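(* Let $w$ be a doubling weight, $r\in\mathbb{N}$, $1<p<\infty$ and $f\in L_p[-1,1]$. Then, for $0<\alpha<r-1/p$, we have $$E_n(f)_{p,w_n}=O(n^{-\alpha})\iff\omega_\varphi^r(f,n^{-1})_{p,w_n}=O(n^{-\alpha})\qquad(n\to\infty).$$
   Context: A doubling weight is a nonnegative $w\in L_1[-1,1]$, extended by $0$ outside $[-1,1]$, for which there is a constant $L$ (the doubling constant of $w$) with $\int_{2I}w\le L\int_I w$ for all intervals $I\subset[-1,1]$, where $2I$ is the interval with the same center as $I$ and twice its length. Let $\varphi(x)=\sqrt{1-x^2}$, $\rho_n(x)=n^{-1}\sqrt{1-x^2}+n^{-2}$, and $w_n(x)=\frac{1}{\rho_n(x)}\int_{x-\rho_n(x)}^{x+\rho_n(x)}w(u)\,du$. For a weight $v$ on $[-1,1]$: $\|g\|_{p,v}=\left(\int_{-1}^1|g|^p v\right)^{1/p}$. $\Pi_n$ is the set of algebraic polynomials of degree $\le n-1$ and $E_n(f)_{p,v}=\inf_{P\in\Pi_n}\|f-P\|_{p,v}$. Symmetric difference: $\Delta_h^r(f,x)=\sum_{i=0}^r\binom ri(-1)^{r-i}f(x-rh/2+ih)$ if $x\pm rh/2\in[-1,1]$, and $0$ otherwise. Modulus: $\omega_\varphi^r(f,t)_{p,v}=\sup_{0<h\le t}\|\Delta_{h\varphi(\cdot)}^r(f,\cdot)\|_{p,v}$. *)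

theory Defs
  imports "HOL-Analysis.Analysis" "HOL-Computational_Algebra.Polynomial"
begin

definition zero_ext :: "(real \<Rightarrow> real) \<Rightarrow> real \<Rightarrow> real" where
  "zero_ext w x = (if x \<in> {-1..1} then w x else 0)"

(* The interval with endpoints m - l and m + l has centre m and length 2 * l, so that its double
   has endpoints m - 2 * l and m + 2 * l; the double may stick out of [-1,1]. *)
definition doubling_weight :: "(real \<Rightarrow> real) \<Rightarrow> bool" where
  "doubling_weight w \<longleftrightarrow>
     (\<forall>x\<in>{-1..1}. 0 \<le> w x) \<and>
     set_integrable lebesgue {-1..1} w \<and>
     (\<exists>L. \<forall>m l. 0 < l \<longrightarrow> {m - l..m + l} \<subseteq> {-1..1} \<longrightarrow>
        (LINT u:{m - 2 * l..m + 2 * l}|lebesgue. zero_ext w u)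
          \<le> L * (LINT u:{m - l..m + l}|lebesgue. zero_ext w u))"

definition phi :: "real \<Rightarrow> real" where
  "phi x = sqrt (1 - x\<^sup>2)"

definition rho :: "nat \<Rightarrow> real \<Rightarrow> real" where
  "rho n x = sqrt (1 - x\<^sup>2) / real n + 1 / (real n)\<^sup>2"

definition averaged_weight :: "(real \<Rightarrow> real) \<Rightarrow> nat \<Rightarrow> real \<Rightarrow> real" where
  "averaged_weight w n x =
     1 / rho n x * (LINT u:{x - rho n x..x + rho n x}|lebesgue. zero_ext w u)"

(* Membership of (a representative of) f in the unweighted space L_p[-1,1], for finite p. *)
definition in_Lp :: "real \<Rightarrow> (real \<Rightarrow> real) \<Rightarrow> bool" where
  "in_Lp p f \<longleftrightarrow>
     f \<in> borel_measurable (lebesgue_on {-1..1}) \<and>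
     integrable (lebesgue_on {-1..1}) (\<lambda>x. \<bar>f x\<bar> powr p)"

(* Real powers extended to [0,\<infinity>] by \<infinity> for the base \<infinity>; only positive exponents are used. *)
definition ennpowr :: "ennreal \<Rightarrow> real \<Rightarrow> ennreal" where
  "ennpowr a s = (if a = \<infinity> then \<infinity> else ennreal (enn2real a powr s))"

(* Norms take values in [0,\<infinity>], so that divergent integrals, infima and suprema carry no
   default value. *)
definition wnorm :: "real \<Rightarrow> (real \<Rightarrow> real) \<Rightarrow> (real \<Rightarrow> real) \<Rightarrow> ennreal" where
  "wnorm p v g =
     ennpowr (\<integral>\<^sup>+ x\<in>{-1..1}. ennreal (\<bar>g x\<bar> powr p * v x) \<partial>lebesgue) (1 / p)"

(* For n \<ge> 1, degree P < n says degree at most n - 1 (the zero polynomial has degree 0). *)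
definition best_approx :: "nat \<Rightarrow> (real \<Rightarrow> real) \<Rightarrow> real \<Rightarrow> (real \<Rightarrow> real) \<Rightarrow> ennreal" where
  "best_approx n f p v = (INF P\<in>{P :: real poly. degree P < n}. wnorm p v (\<lambda>x. f x - poly P x))"

definition sym_diff :: "nat \<Rightarrow> real \<Rightarrow> (real \<Rightarrow> real) \<Rightarrow> real \<Rightarrow> real" where
  "sym_diff r h f x =
     (if x - real r * h / 2 \<in> {-1..1} \<and> x + real r * h / 2 \<in> {-1..1}
      then \<Sum>i=0..r. real (r choose i) * (-1) ^ (r - i) * f (x - real r * h / 2 + real i * h)
      else 0)"

definition modulus ::
    "nat \<Rightarrow> (real \<Rightarrow> real) \<Rightarrow> real \<Rightarrow> real \<Rightarrow> (real \<Rightarrow> real) \<Rightarrow> ennreal" where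
  "modulus r f t p v = (SUP h\<in>{0<..t}. wnorm p v (\<lambda>x. sym_diff r (h * phi x) f x))"

(* a n = O(b n) as n tends to infinity, for sequences in [0,\<infinity>]; in particular a n is then
   eventually finite. *)
definition enn_bigo :: "(nat \<Rightarrow> ennreal) \<Rightarrow> (nat \<Rightarrow> real) \<Rightarrow> bool" where
  "enn_bigo a b \<longleftrightarrow> (\<exists>C::real. \<forall>\<^sub>F n in sequentially. a n \<le> ennreal (C * b n))"

end

theory Submission
  imports Defs
begin

text \<open>
  The weight $w_n$ varies slowly in the metric $d_n(x,y) = n\,|\arccos x - \arccos y|$: its values at
  two points differ by a factor polynomial in $1 + d_n$. Two estimates between $w_n$-norms follow.

  Inverse estimate. A polynomial of degree below $m$ is bounded, on complex discs of radius
  $\rho_m(x)/16$, by the integral of its modulus against a kernel with arbitrarily fast polynomial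
  decay in $d_m$; this comes from multiplying with a power of the Fejer kernel and bounding the
  coefficients of the resulting trigonometric polynomial. By Cauchy's estimate, Jensen's inequality and
  Fubini's theorem, the $r$-th difference with $h \le 1/n$ of such a polynomial costs a factor
  $(m/n)^r$. Telescoping over dyadic degrees gives the implication from left to right.

  Direct estimate. On each cell between consecutive Chebyshev nodes of order $N$, Whitney's inequality
  provides a polynomial of degree below $r$ close to $f$ as measured by the averaged differences, and
  these local polynomials are glued by a polynomial partition of unity whose members decay fast in
  $d_N$. The decay beats the polynomial growth of the ratios of the weights of the cells. Whitney's
  inequality itself is obtained by approximating the primitive of $f$ on a fine grid and differentiating;
  this gives an approximation up to half of the norm of $f$, and one iterates.
\<close>

text \<open>The obstacle is that the weight changes with n. For n much larger than m, w_n and w_m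
  need not be comparable at a point, yet the inverse estimate measures a polynomial of degree below
  m in the w_n-norm. The remedy is to pass through the measure mu with density w: a function that is
  nearly constant on sets of bounded d_m-diameter has comparable integrals against w_n, mu and w_m.
  The p-th power of a polynomial is not such a function, but its integral against a decaying kernel
  is, and that integral also dominates the polynomial on complex discs. In the direct part f is an
  arbitrary L_p function, and its differences are controlled only for steps h phi(x) that vary with
  x. Averaging over steps overcomes this: after Fubini the substitution u = h phi(x), for fixed x,
  turns a constant step into a varying one. Therefore Whitney's inequality is proved with an
  averaged right-hand side. There the primitive helps because it is Hoelder continuous with exponent
  1 - 1/p, so that sampling it on a fine grid loses only a small multiple of the norm.\<close>

abbreviation lp_int :: "real \<Rightarrow> real set \<Rightarrow> (real \<Rightarrow> real) \<Rightarrow> ennreal" where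
  "lp_int p S g \<equiv> \<integral>\<^sup>+x. ennreal (\<bar>g x\<bar> powr p) * indicator S x \<partial>lborel"

section \<open>Jensen's inequality and finite differences\<close>

text \<open>The graph of t^p lies above its tangent at b. Young's inequality with the exponents p
  and p/(p - 1) gives this in a form without division by b, so that b = 0 needs no separate
  case.\<close>

lemma young_tangent:
  fixes a b p :: real
  assumes "0 \<le> a" "0 \<le> b" "1 < p"
  shows "p * b powr (p - 1) * a \<le> a powr p + (p - 1) * b powr p"
proof -
  define q where "q = p / (p - 1)"
  have q: "1 < q" "1 / p + 1 / q = 1" "(p - 1) * q = p"
    using assms by (auto simp: q_def field_simps)
  have "a * b powr (p - 1) \<le> a powr p / p + (b powr (p - 1)) powr q / q"
    by (rule Youngs_inequality) (use assms q in auto)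
  also have "(b powr (p - 1)) powr q = b powr p"
    by (simp add: powr_powr q)
  also have "b powr p / q = (p - 1) * b powr p / p"
    using assms by (simp add: q_def)
  finally have "a * b powr (p - 1) \<le> (a powr p + (p - 1) * b powr p) / p"
    by (simp add: add_divide_distrib)
  thus ?thesis using assms by (simp add: field_simps)
qed

text \<open>The tangent of t^p at b = a/K is integrated against k. Only an upper bound K for the
  mass of k and a lower bound a for the integral of k h enter, so the integrals of k h and k h^p may
  be infinite and kernels need not be normalised.\<close>

lemma nn_integral_jensen_powr:
  fixes k h :: "'a \<Rightarrow> real" and p K a :: real
  assumes [measurable]: "k \<in> borel_measurable M" "h \<in> borel_measurable M"
    and nonneg: "\<And>x. x \<in> space M \<Longrightarrow> 0 \<le> k x" "\<And>x. x \<in> space M \<Longrightarrow> 0 \<le> h x"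
    and p: "1 < p" and K: "0 < K" "(\<integral>\<^sup>+x. ennreal (k x) \<partial>M) \<le> ennreal K"
    and a: "0 \<le> a" "ennreal a \<le> (\<integral>\<^sup>+x. ennreal (k x * h x) \<partial>M)"
  shows "ennreal (a powr p) \<le> ennreal (K powr (p - 1)) * (\<integral>\<^sup>+x. ennreal (k x * h x powr p) \<partial>M)"
proof -
  define b where "b = a / K"
  have b: "0 \<le> b" using a K by (simp add: b_def)
  define I where "I = (\<integral>\<^sup>+x. ennreal (k x * h x powr p) \<partial>M)"
  have ab: "a = b * K" using K by (simp add: b_def)
  have bp: "b powr (p - 1) * b = b powr p"
    using b by (cases "b = 0") (auto simp: powr_diff)
  have "ennreal (p * b powr (p - 1) * a) \<le> ennreal (p * b powr (p - 1)) * (\<integral>\<^sup>+x. ennreal (k x * h x) \<partial>M)"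
    using a b p by (subst ennreal_mult) (auto intro!: mult_left_mono)
  also have "\<dots> = (\<integral>\<^sup>+x. ennreal (p * b powr (p - 1)) * ennreal (k x * h x) \<partial>M)"
    by (subst nn_integral_cmult) auto
  also have "\<dots> \<le> (\<integral>\<^sup>+x. ennreal (k x * h x powr p) + ennreal ((p - 1) * b powr p) * ennreal (k x) \<partial>M)"
  proof (rule nn_integral_mono)
    fix x assume x: "x \<in> space M"
    have "p * b powr (p - 1) * h x \<le> h x powr p + (p - 1) * b powr p"
      using young_tangent[OF nonneg(2)[OF x] b p] .
    from mult_left_mono[OF this nonneg(1)[OF x]]
    have "p * b powr (p - 1) * (k x * h x) \<le> k x * h x powr p + (p - 1) * b powr p * k x"
      by (simp add: algebra_simps)
    thus "ennreal (p * b powr (p - 1)) * ennreal (k x * h x)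
        \<le> ennreal (k x * h x powr p) + ennreal ((p - 1) * b powr p) * ennreal (k x)"
      using p b nonneg x by (simp flip: ennreal_mult ennreal_plus)
  qed
  also have "\<dots> = I + ennreal ((p - 1) * b powr p) * (\<integral>\<^sup>+x. ennreal (k x) \<partial>M)"
    unfolding I_def by (subst nn_integral_add) (auto simp: nn_integral_cmult)
  also have "\<dots> \<le> I + ennreal ((p - 1) * b powr p * K)"
    using K p by (subst ennreal_mult) (auto intro!: add_left_mono mult_left_mono)
  finally have *: "ennreal (p * b powr (p - 1) * a) \<le> I + ennreal ((p - 1) * b powr p * K)" .
  \<comment> \<open>As a = b K, the left side contains the finite term (p - 1) b^p K, which cancels
    against the same term on the right.\<close>
  have "p * b powr (p - 1) * a = b powr p * K + (p - 1) * b powr p * K"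
    by (simp add: ab bp[symmetric] algebra_simps)
  hence "ennreal (b powr p * K) + ennreal ((p - 1) * b powr p * K) \<le> I + ennreal ((p - 1) * b powr p * K)"
    using * p K b by (simp flip: ennreal_plus)
  hence **: "ennreal (b powr p * K) \<le> I" by (simp add: ennreal_add_left_cancel_le add.commute)
  have "a powr p = K powr (p - 1) * (b powr p * K)"
    using a K b by (simp add: ab powr_mult powr_diff)
  hence "ennreal (a powr p) = ennreal (K powr (p - 1)) * ennreal (b powr p * K)"
    using K b by (simp add: ennreal_mult)
  also have "\<dots> \<le> ennreal (K powr (p - 1)) * I"
    by (intro mult_left_mono **) auto
  finally show ?thesis unfolding I_def .
qed

lemma sum_jensen_powr:
  fixes k h :: "'a \<Rightarrow> real" and p K :: real
  assumes A: "finite A" and nonneg: "\<And>x. x \<in> A \<Longrightarrow> 0 \<le> k x" "\<And>x. x \<in> A \<Longrightarrow> 0 \<le> h x"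
    and p: "1 < p" and K: "0 < K" "(\<Sum>x\<in>A. k x) \<le> K"
  shows "(\<Sum>x\<in>A. k x * h x) powr p \<le> K powr (p - 1) * (\<Sum>x\<in>A. k x * h x powr p)"
proof -
  define a where "a = (\<Sum>x\<in>A. k x * h x)"
  define b where "b = a / K"
  define I where "I = (\<Sum>x\<in>A. k x * h x powr p)"
  have a: "0 \<le> a" unfolding a_def by (intro sum_nonneg mult_nonneg_nonneg nonneg)
  have b: "0 \<le> b" using a K by (simp add: b_def)
  have ab: "a = b * K" using K by (simp add: b_def)
  have bp: "b powr (p - 1) * b = b powr p"
    using b by (cases "b = 0") (auto simp: powr_diff)
  have "p * b powr (p - 1) * a = (\<Sum>x\<in>A. k x * (p * b powr (p - 1) * h x))"
    by (simp add: a_def sum_distrib_left algebra_simps)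
  also have "\<dots> \<le> (\<Sum>x\<in>A. k x * (h x powr p + (p - 1) * b powr p))"
    by (intro sum_mono mult_left_mono young_tangent nonneg b p)
  also have "\<dots> = I + (\<Sum>x\<in>A. k x) * ((p - 1) * b powr p)"
    by (simp add: I_def sum_distrib_right sum.distrib distrib_left)
  also have "\<dots> \<le> I + K * ((p - 1) * b powr p)"
    by (intro add_left_mono mult_right_mono K) (use p in auto)
  finally have "b powr p * K \<le> I"
    by (simp add: ab bp[symmetric] algebra_simps)
  hence "K powr (p - 1) * (b powr p * K) \<le> K powr (p - 1) * I"
    by (intro mult_left_mono) auto
  moreover have "a powr p = K powr (p - 1) * (b powr p * K)"
    using a K b by (simp add: ab powr_mult powr_diff)
  ultimately show ?thesis by (simp add: a_def I_def)
qed

lemma powr_add_le: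
  fixes a b p :: real
  assumes "0 \<le> a" "0 \<le> b" "0 \<le> p"
  shows "(a + b) powr p \<le> 2 powr p * (a powr p + b powr p)"
proof -
  have "(a + b) powr p \<le> (2 * max a b) powr p"
    using assms by (intro powr_mono2) auto
  also have "\<dots> = 2 powr p * max a b powr p" using assms by (simp add: powr_mult)
  also have "\<dots> \<le> 2 powr p * (a powr p + b powr p)"
    by (intro mult_left_mono) (auto simp: max_def)
  finally show ?thesis .
qed

text \<open>The sign differs from that of the usual forward difference by (-1)^r. It makes the
  coefficient of \<open>g x\<close> equal to 1, which is what isolates \<open>g x\<close> when the
  step is averaged out in \<open>half_pointwise\<close>.\<close>

definition fdiff :: "nat \<Rightarrow> real \<Rightarrow> (real \<Rightarrow> real) \<Rightarrow> real \<Rightarrow> real" where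
  "fdiff r u g x = (\<Sum>i\<le>r. (-1) ^ i * real (r choose i) * g (x + real i * u))"

lemma fdiff_Suc: "fdiff (Suc r) u g x = fdiff r u g x - fdiff r u g (x + u)"
proof -
  have "fdiff (Suc r) u g x = g x + (\<Sum>i\<le>r. (-1) ^ Suc i * real (Suc r choose Suc i) * g (x + real (Suc i) * u))"
    unfolding fdiff_def by (subst sum.atMost_Suc_shift) simp
  also have "\<dots> = (g x + (\<Sum>i\<le>r. (-1) ^ Suc i * real (r choose Suc i) * g (x + real (Suc i) * u)))
     - (\<Sum>i\<le>r. (-1) ^ i * real (r choose i) * g (x + u + real i * u))"
    unfolding add_diff_eq[symmetric] sum_subtractf[symmetric]
    by (intro arg_cong2[of _ _ _ _ "(+)"] sum.cong refl) (simp add: algebra_simps)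
  also have "g x + (\<Sum>i\<le>r. (-1) ^ Suc i * real (r choose Suc i) * g (x + real (Suc i) * u))
     = (\<Sum>i\<le>Suc r. (-1) ^ i * real (r choose i) * g (x + real i * u))"
    by (subst sum.atMost_Suc_shift) simp
  also have "\<dots> = fdiff r u g x" unfolding fdiff_def by simp
  finally show ?thesis by (simp add: fdiff_def)
qed

lemma fdiff_diff: "fdiff r u (\<lambda>x. f x - g x) x = fdiff r u f x - fdiff r u g x"
  by (simp add: fdiff_def sum_subtractf algebra_simps)

lemma fdiff_sum: "fdiff r u (\<lambda>x. \<Sum>i\<in>A. f i x) x = (\<Sum>i\<in>A. fdiff r u (f i) x)"
  unfolding fdiff_def by (subst sum.swap) (simp add: sum_distrib_left)

lemma fdiff_cmult: "fdiff r u (\<lambda>x. c * f x) x = c * fdiff r u f x"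
  by (simp add: fdiff_def sum_distrib_left algebra_simps)

lemma fdiff_cong: "(\<And>i. i \<le> r \<Longrightarrow> f (x + real i * u) = g (x + real i * u)) \<Longrightarrow> fdiff r u f x = fdiff r u g x"
  by (simp add: fdiff_def)

lemma fdiff_shift: "fdiff r u (\<lambda>x. f (x + c)) x = fdiff r u f (x + c)"
  by (simp add: fdiff_def algebra_simps)

lemma fdiff_scale: "fdiff r u (\<lambda>x. f (a + l * x)) x = fdiff r (l * u) f (a + l * x)"
  by (simp add: fdiff_def algebra_simps)

text \<open>In the right half of an interval forward steps may leave the interval, so backward steps
  are used there. The symmetry of the binomial coefficients converts them into forward steps up to
  sign.\<close>

lemma fdiff_reverse: "fdiff r (-u) f (x + real r * u) = (-1) ^ r * fdiff r u f x"
proof -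
  have "fdiff r (-u) f (x + real r * u)
      = (\<Sum>i\<le>r. (-1) ^ (r - i) * real (r choose (r - i)) * f (x + real r * u + real (r - i) * (-u)))"
    unfolding fdiff_def by (subst sum.nat_diff_reindex[symmetric, of _ "Suc r", unfolded lessThan_Suc_atMost]) simp
  also have "\<dots> = (\<Sum>i\<le>r. (-1) ^ r * ((-1) ^ i * real (r choose i) * f (x + real i * u)))"
  proof (intro sum.cong refl)
    fix i assume "i \<in> {..r}"
    hence i: "i \<le> r" by simp
    have "(-1::real) ^ (r - i) = (-1) ^ r * (-1) ^ i"
      using i by (metis even_add even_diff_nat le_add_diff_inverse2 minus_one_power_iff mult_1 mult_minus1
          mult_minus_right power_add)
    thus "(-1) ^ (r - i) * real (r choose (r - i)) * f (x + real r * u + real (r - i) * (-u))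
        = (-1) ^ r * ((-1) ^ i * real (r choose i) * f (x + real i * u))"
      using i by (simp add: binomial_symmetric[symmetric] of_nat_diff algebra_simps)
  qed
  also have "\<dots> = (-1) ^ r * fdiff r u f x" by (simp add: fdiff_def sum_distrib_left)
  finally show ?thesis .
qed

lemma sym_diff_fdiff:
  "x - real r * h / 2 \<in> {-1..1} \<Longrightarrow> x + real r * h / 2 \<in> {-1..1} \<Longrightarrow>
   \<bar>sym_diff r h f x\<bar> = \<bar>fdiff r h f (x - real r * h / 2)\<bar>"
proof -
  assume "x - real r * h / 2 \<in> {-1..1}" "x + real r * h / 2 \<in> {-1..1}"
  hence "sym_diff r h f x = (\<Sum>i=0..r. real (r choose i) * (-1) ^ (r - i) * f (x - real r * h / 2 + real i * h))"
    by (simp add: sym_diff_def)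
  also have "\<dots> = (-1) ^ r * fdiff r h f (x - real r * h / 2)"
    unfolding fdiff_def sum_distrib_left atLeast0AtMost
  proof (intro sum.cong refl)
    fix i assume "i \<in> {..r}"
    hence i: "i \<le> r" by simp
    have "(-1::real) ^ (r - i) = (-1) ^ r * (-1) ^ i"
      using i by (metis even_add even_diff_nat le_add_diff_inverse2 minus_one_power_iff mult_1 mult_minus1
          mult_minus_right power_add)
    thus "real (r choose i) * (-1) ^ (r - i) * f (x - real r * h / 2 + real i * h) =
         (-1) ^ r * ((-1) ^ i * real (r choose i) * f (x - real r * h / 2 + real i * h))" by simp
  qed
  finally show ?thesis by (simp add: abs_mult power_abs)
qed

lemma fdiff_abs_le:
  assumes "\<And>i. i \<le> r \<Longrightarrow> \<bar>g (x + real i * u)\<bar> \<le> B"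
  shows "\<bar>fdiff r u g x\<bar> \<le> 2 ^ r * B"
proof -
  have "\<bar>fdiff r u g x\<bar> \<le> (\<Sum>i\<le>r. \<bar>(-1) ^ i * real (r choose i) * g (x + real i * u)\<bar>)"
    unfolding fdiff_def by (rule sum_abs)
  also have "\<dots> \<le> (\<Sum>i\<le>r. real (r choose i) * B)"
    using assms by (intro sum_mono) (auto simp: abs_mult power_abs intro!: mult_left_mono)
  also have "\<dots> = real (\<Sum>i\<le>r. r choose i) * B" by (simp add: sum_distrib_right)
  also have "\<dots> = 2 ^ r * B" by (subst choose_row_sum) simp
  finally show ?thesis .
qed

lemma fdiff_poly_eq_0:
  fixes q :: "real poly"
  assumes "degree q < r"
  shows "fdiff r u (poly q) x = 0"
  using assms
proof (induction r arbitrary: q)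
  case (Suc r)
  \<comment> \<open>The first difference of q with this sign convention. The leading coefficients
    cancel, so the degree drops.\<close>
  define q' where "q' = q - pcompose q [:u, 1:]"
  have deg: "degree (pcompose q [:u, 1:]) = degree q" by (simp add: degree_pcompose)
  have lc: "coeff (pcompose q [:u, 1:]) (degree q) = coeff q (degree q)"
    using lead_coeff_comp[of "[:u, 1:]" q] by (simp add: deg)
  have eq: "fdiff (Suc r) u (poly q) x = fdiff r u (poly q') x"
    unfolding fdiff_Suc fdiff_shift[of r u "poly q" u x, symmetric] fdiff_diff[symmetric]
    by (rule fdiff_cong) (simp add: q'_def poly_pcompose algebra_simps)
  show ?case
  proof (cases "degree q = 0")
    case True
    then obtain c where "q = [:c:]" by (meson degree_eq_zeroE)
    hence "q' = 0" by (simp add: q'_def pcompose_const)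
    thus ?thesis unfolding eq by (simp add: fdiff_def)
  next
    case False
    have "degree q' \<le> degree q" unfolding q'_def by (rule degree_diff_le) (auto simp: deg)
    moreover have "coeff q' (degree q) = 0" by (simp add: q'_def lc)
    ultimately have "degree q' < degree q"
      using False by (metis eq_zero_or_degree_less degree_0 gr0I)
    thus ?thesis using Suc by (simp add: eq)
  qed
qed simp

text \<open>Lagrange interpolation at r nodes is exact for degree below r, since the difference to
  the interpolant would have r roots. The second bound keeps the quotients of the basis polynomials,
  because \<open>near_polynomial\<close> estimates their increments factor by factor.\<close>

lemma poly_bound_from_nodes:
  fixes q :: "real poly" and z :: "nat \<Rightarrow> real"
  assumes deg: "degree q < r"
    and sep: "\<And>i j. i < r \<Longrightarrow> j < r \<Longrightarrow> i \<noteq> j \<Longrightarrow> d \<le> \<bar>z i - z j\<bar>" and d: "0 < d"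
  shows "\<bar>poly q x\<bar> \<le> (\<Sum>i<r. \<bar>poly q (z i)\<bar> * (\<Prod>j\<in>{..<r} - {i}. \<bar>x - z j\<bar> / d))"
    and "\<bar>poly q x - poly q y\<bar> \<le> (\<Sum>i<r. \<bar>poly q (z i)\<bar> *
          \<bar>(\<Prod>j\<in>{..<r} - {i}. (x - z j) / (z i - z j)) - (\<Prod>j\<in>{..<r} - {i}. (y - z j) / (z i - z j))\<bar>)"
proof -
  define lg where "lg i = (\<Prod>j\<in>{..<r} - {i}. [:- z j / (z i - z j), 1 / (z i - z j):])" for i
  have ne: "z i \<noteq> z j" if "i < r" "j < r" "i \<noteq> j" for i j
    using sep[OF that] d by auto
  have pl: "poly (lg i) x = (\<Prod>j\<in>{..<r} - {i}. (x - z j) / (z i - z j))" for i x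
    unfolding lg_def poly_prod by (intro prod.cong refl) (simp add: diff_divide_distrib)
  have dl: "degree (lg i) < r" if "i < r" for i
  proof -
    have "degree (lg i) \<le> (\<Sum>j\<in>{..<r} - {i}. degree [:- z j / (z i - z j), 1 / (z i - z j):])"
      unfolding lg_def by (rule order.trans[OF degree_prod_sum_le]) (auto simp: o_def)
    also have "\<dots> \<le> (\<Sum>j\<in>{..<r} - {i}. 1)" by (intro sum_mono) auto
    also have "\<dots> = r - 1" using that by simp
    finally show ?thesis using that by linarith
  qed
  define s where "s = (\<Sum>i<r. smult (poly q (z i)) (lg i))"
  have li: "poly (lg i) (z k) = (if i = k then 1 else 0)" if "i < r" "k < r" for i k
  proof (cases "i = k")
    case True
    have "(\<Prod>j\<in>{..<r} - {i}. (z i - z j) / (z i - z j)) = (\<Prod>j\<in>{..<r} - {i}. 1)"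
      by (intro prod.cong refl) (use ne that in auto)
    thus ?thesis using True by (simp add: pl)
  next
    case False
    thus ?thesis using that by (auto simp: pl intro!: bexI[of _ k])
  qed
  have sz: "poly s (z k) = poly q (z k)" if "k < r" for k
  proof -
    have "poly s (z k) = (\<Sum>i<r. if i = k then poly q (z i) else 0)"
      unfolding s_def poly_sum poly_smult by (intro sum.cong refl) (use li that in auto)
    thus ?thesis using that by simp
  qed
  have "q - s = 0"
  proof (rule ccontr)
    assume nz: "q - s \<noteq> 0"
    have "0 < r" using deg by simp
    hence "degree s < r" unfolding s_def
      by (intro degree_sum_less) (use dl in \<open>auto intro: le_less_trans[OF degree_smult_le]\<close>)
    hence "degree (q - s) < r" using deg by (intro degree_diff_less)
    moreover have "card {x. poly (q - s) x = 0} \<le> degree (q - s)" using nz by (rule card_poly_roots_bound)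
    moreover have "r \<le> card {x. poly (q - s) x = 0}"
    proof -
      have "card (z ` {..<r}) = r" using ne by (subst card_image) (auto simp: inj_on_def)
      moreover have "z ` {..<r} \<subseteq> {x. poly (q - s) x = 0}" using sz by auto
      ultimately show ?thesis using poly_roots_finite[OF nz] by (metis card_mono)
    qed
    ultimately show False by linarith
  qed
  hence pq: "poly q x = (\<Sum>i<r. poly q (z i) * poly (lg i) x)" for x
    by (metis (no_types, lifting) eq_iff_diff_eq_0 poly_smult poly_sum s_def sum.cong)
  have "\<bar>poly q x\<bar> \<le> (\<Sum>i<r. \<bar>poly q (z i)\<bar> * \<bar>poly (lg i) x\<bar>)"
    by (subst pq) (rule order.trans[OF sum_abs], simp add: abs_mult)
  also have "\<dots> \<le> (\<Sum>i<r. \<bar>poly q (z i)\<bar> * (\<Prod>j\<in>{..<r} - {i}. \<bar>x - z j\<bar> / d))"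
    unfolding pl abs_prod abs_divide
    by (intro sum_mono mult_left_mono prod_mono) (use sep d in \<open>auto intro!: divide_left_mono mult_pos_pos simp: ne\<close>)
  finally show "\<bar>poly q x\<bar> \<le> (\<Sum>i<r. \<bar>poly q (z i)\<bar> * (\<Prod>j\<in>{..<r} - {i}. \<bar>x - z j\<bar> / d))" .
  have "poly q x - poly q y = (\<Sum>i<r. poly q (z i) * (poly (lg i) x - poly (lg i) y))"
    by (subst (1 2) pq) (simp add: sum_subtractf right_diff_distrib)
  thus "\<bar>poly q x - poly q y\<bar> \<le> (\<Sum>i<r. \<bar>poly q (z i)\<bar> *
          \<bar>(\<Prod>j\<in>{..<r} - {i}. (x - z j) / (z i - z j)) - (\<Prod>j\<in>{..<r} - {i}. (y - z j) / (z i - z j))\<bar>)"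
    unfolding pl by (simp only:) (rule order.trans[OF sum_abs], simp add: abs_mult)
qed

section \<open>The arccosine metric\<close>

text \<open>Jordan's inequality, from the concavity of sine on [0,pi].\<close>

lemma sin_ge_two_div_pi:
  assumes "0 \<le> x" "x \<le> pi / 2"
  shows "2 / pi * x \<le> sin x"
proof -
  have "convex_on {0..pi} (\<lambda>x. - sin x)"
    by (rule f''_ge0_imp_convex[where f' = "\<lambda>x. - cos x" and f'' = "\<lambda>x. sin x"])
       (auto intro!: derivative_eq_intros sin_ge_zero)
  from convex_onD[OF this, of "2 / pi * x" 0 "pi / 2"] show ?thesis
    using assms by (simp add: field_simps)
qed

lemma rho_pos: "1 \<le> n \<Longrightarrow> x \<in> {-1..1} \<Longrightarrow> 0 < rho n x"
  by (auto simp: rho_def intro!: add_nonneg_pos divide_nonneg_nonneg real_sqrt_ge_zero)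
     (metis abs_le_iff abs_square_le_1 minus_le_iff)

lemma rho_le_1: "2 \<le> n \<Longrightarrow> rho n x \<le> 1"
proof -
  assume n: "2 \<le> n"
  have "sqrt (1 - x\<^sup>2) / real n \<le> 1 / 2"
    using n by (intro frac_le) auto
  moreover have "1 / (real n)\<^sup>2 \<le> 1 / 2\<^sup>2"
    using n by (intro frac_le power_mono) auto
  ultimately show ?thesis by (simp add: rho_def)
qed

lemma rho_cos: "0 \<le> t \<Longrightarrow> t \<le> pi \<Longrightarrow> rho n (cos t) = sin t / real n + 1 / (real n)\<^sup>2"
  by (simp add: rho_def sin_squared_eq[symmetric] sin_ge_zero)

lemma rho_borel [measurable]: "rho n \<in> borel_measurable borel"
  unfolding rho_def by measurable

lemma rho_antimono: "1 \<le> m \<Longrightarrow> m \<le> n \<Longrightarrow> x \<in> {-1..1} \<Longrightarrow> rho n x \<le> rho m x"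
proof -
  assume *: "1 \<le> m" "m \<le> n" "x \<in> {-1..1}"
  have "x\<^sup>2 \<le> 1" using * by (auto simp: abs_square_le_1 abs_le_iff)
  thus ?thesis unfolding rho_def
    by (intro add_mono divide_left_mono power_mono mult_pos_pos real_sqrt_ge_zero) (use * in auto)
qed

definition adist :: "nat \<Rightarrow> real \<Rightarrow> real \<Rightarrow> real" where
  "adist n x y = real n * \<bar>arccos x - arccos y\<bar>"

lemma adist_nonneg [simp]: "0 \<le> adist n x y"
  by (simp add: adist_def)

lemma adist_commute: "adist n x y = adist n y x"
  by (simp add: adist_def abs_minus_commute)

lemma adist_mono: "m \<le> n \<Longrightarrow> adist m x y \<le> adist n x y"
  by (auto simp: adist_def intro!: mult_right_mono)

lemma adist_triangle: "adist n x z \<le> adist n x y + adist n y z"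
  unfolding adist_def distrib_left[symmetric] by (intro mult_left_mono) auto

lemma arccos_borel [measurable]: "arccos \<in> borel_measurable borel"
proof -
  \<comment> \<open>No real number has a cosine outside [-1,1], so all those x give the same
    predicate under the definite description. Hence \<open>arccos\<close> has one unspecified
    constant value there, represented by its value at 2.\<close>
  have *: "arccos x = arccos 2" if "x \<notin> {-1..1}" for x :: real
  proof -
    have "(\<lambda>y. 0 \<le> y \<and> y \<le> pi \<and> cos y = x) = (\<lambda>y. 0 \<le> y \<and> y \<le> pi \<and> cos y = 2)"
    proof
      fix y :: real
      have "cos y \<noteq> x" using that cos_le_one[of y] cos_ge_minus_one[of y] by auto
      moreover have "cos y \<noteq> 2" using cos_le_one[of y] by linarith
      ultimately show "(0 \<le> y \<and> y \<le> pi \<and> cos y = x) = (0 \<le> y \<and> y \<le> pi \<and> cos y = 2)" by blast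
    qed
    thus ?thesis by (simp add: arccos_def)
  qed
  have eq: "arccos = (\<lambda>x. if x \<in> {-1..1} then arccos x else arccos 2)"
    by (intro ext) (simp split: if_split, rule impI, rule *, auto)
  show ?thesis
    by (subst eq, intro borel_measurable_continuous_on_if)
       (auto intro!: continuous_on_arccos' continuous_intros)
qed

lemma sin_lipschitz: "\<bar>sin a - sin b\<bar> \<le> \<bar>a - b\<bar>" for a b :: real
proof -
  have "\<bar>sin a - sin b\<bar> = 2 * \<bar>sin ((a - b) / 2)\<bar> * \<bar>cos ((a + b) / 2)\<bar>"
    by (simp add: sin_diff_sin abs_mult)
  also have "\<dots> \<le> 2 * \<bar>(a - b) / 2\<bar> * 1"
    by (intro mult_mono abs_sin_x_le_abs_x order_refl) auto
  finally show ?thesis by simp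
qed

lemma cos_param:
  assumes "x \<in> {-1..1}"
  obtains t where "0 \<le> t" "t \<le> pi" "x = cos t" "arccos x = t"
  using assms by (intro that[of "arccos x"]) (auto simp: arccos_lbound arccos_ubound)

text \<open>In the variable t = arccos x one has rho_n = sin t / n + 1/n^2, and sine is Lipschitz.
  The increment |t - u| / n equals d_n / n^2, which the second summand of rho_n pays for.\<close>

lemma rho_le_adist:
  assumes n: "1 \<le> n" and x: "x \<in> {-1..1}" and y: "y \<in> {-1..1}"
  shows "rho n y \<le> (1 + adist n x y) * rho n x"
proof -
  obtain t where t: "0 \<le> t" "t \<le> pi" "x = cos t" "arccos x = t" using cos_param[OF x] .
  obtain u where u: "0 \<le> u" "u \<le> pi" "y = cos u" "arccos y = u" using cos_param[OF y] .
  have n': "0 < real n" using n by simp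
  have s: "sin u \<le> sin t + \<bar>t - u\<bar>"
  proof -
    have "\<bar>sin u - sin t\<bar> \<le> \<bar>u - t\<bar>"
      by (rule sin_lipschitz)
    thus ?thesis by linarith
  qed
  have "rho n y \<le> (sin t + \<bar>t - u\<bar>) / real n + 1 / (real n)\<^sup>2"
    unfolding u(3) rho_cos[OF u(1,2)] using s n' by (intro add_mono divide_right_mono) auto
  also have "\<dots> = rho n x + real n * \<bar>t - u\<bar> * (1 / (real n)\<^sup>2)"
    unfolding t(3) rho_cos[OF t(1,2)] using n' by (simp add: field_simps power2_eq_square)
  also have "\<dots> \<le> rho n x + real n * \<bar>t - u\<bar> * rho n x"
    unfolding t(3) rho_cos[OF t(1,2)]
    using n' t by (intro add_left_mono mult_left_mono) (auto simp: sin_ge_zero)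
  finally show ?thesis by (simp add: adist_def t(4) u(4) algebra_simps)
qed

text \<open>cos t - cos u = 2 sin((t + u)/2) sin((u - t)/2). The first sine is at most sin t + |t -
  u|; its two parts produce the linear and the quadratic term in d_n, matched with sin t / n and
  1/n^2 respectively.\<close>

lemma dist_le_adist:
  assumes n: "1 \<le> n" and x: "x \<in> {-1..1}" and y: "y \<in> {-1..1}"
  shows "\<bar>x - y\<bar> \<le> (adist n x y + (adist n x y)\<^sup>2) * rho n x"
proof -
  obtain t where t: "0 \<le> t" "t \<le> pi" "x = cos t" "arccos x = t" using cos_param[OF x] .
  obtain u where u: "0 \<le> u" "u \<le> pi" "y = cos u" "arccos y = u" using cos_param[OF y] .
  have n': "0 < real n" using n by simp
  define d where "d = real n * \<bar>t - u\<bar>"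
  have d: "0 \<le> d" "\<bar>t - u\<bar> = d / real n" using n' by (auto simp: d_def)
  have s: "\<bar>sin ((t + u) / 2)\<bar> \<le> sin t + \<bar>t - u\<bar>"
  proof -
    have "\<bar>sin ((t + u) / 2) - sin t\<bar> \<le> \<bar>(t + u) / 2 - t\<bar>"
      by (rule sin_lipschitz)
    moreover have "0 \<le> sin t" using t by (simp add: sin_ge_zero)
    moreover have "\<bar>(t + u) / 2 - t\<bar> \<le> \<bar>t - u\<bar>" by (simp add: abs_if field_simps)
    ultimately show ?thesis by linarith
  qed
  have "\<bar>x - y\<bar> = 2 * \<bar>sin ((t + u) / 2)\<bar> * \<bar>sin ((u - t) / 2)\<bar>"
    by (simp add: t(3) u(3) cos_diff_cos abs_mult)
  also have "\<dots> \<le> 2 * (sin t + \<bar>t - u\<bar>) * (\<bar>t - u\<bar> / 2)"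
  proof (intro mult_mono s order_refl)
    have "\<bar>sin ((u - t) / 2)\<bar> \<le> \<bar>(u - t) / 2\<bar>" by (rule abs_sin_x_le_abs_x)
    thus "\<bar>sin ((u - t) / 2)\<bar> \<le> \<bar>t - u\<bar> / 2" by (simp add: abs_minus_commute)
  qed (use t in \<open>auto simp: sin_ge_zero\<close>)
  also have "\<dots> = d * (sin t / real n) + d\<^sup>2 * (1 / (real n)\<^sup>2)"
    using n' by (simp add: d field_simps power2_eq_square)
  also have "\<dots> \<le> d * rho n x + d\<^sup>2 * rho n x"
    unfolding t(3) rho_cos[OF t(1,2)] using n' t d by (intro add_mono mult_left_mono) (auto simp: sin_ge_zero)
  finally show ?thesis by (simp add: adist_def t(4) u(4) algebra_simps d_def)
qed

text \<open>The common core of \<open>adist_le_of_dist\<close> and its complex analogue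
  \<open>arccos_preimage_near\<close>. There \<delta> and e are the moduli of the sines of half the
  difference and half the sum of the angles, and s is sin t. If s is at least 1/n, the term s/n
  dominates in rho_n and s cancels; otherwise 1/n^2 dominates and \<delta> <= e yields the square
  root.\<close>

lemma sine_factor_bound:
  fixes \<delta> e s c :: real
  assumes n: "1 \<le> n" and "0 \<le> \<delta>" "\<delta> \<le> e" "0 \<le> s" "s \<le> 2 * e" "0 \<le> c"
    and le: "2 * \<delta> * e \<le> c * (s / real n + 1 / (real n)\<^sup>2)"
  shows "real n * \<delta> \<le> max (2 * c) (sqrt c)"
proof -
  have n': "0 < real n" using n by simp
  show ?thesis
  proof (cases "1 / real n \<le> s")
    case True
    hence s: "0 < s" using n' by (auto intro: less_le_trans[of _ "1 / real n"])
    have "\<delta> * s \<le> 2 * \<delta> * e" using mult_left_mono[of s "2 * e" \<delta>] assms by simp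
    also have "\<dots> \<le> c * (s / real n + s / real n)"
    proof (rule order.trans[OF le], intro mult_left_mono add_left_mono)
      have "1 / (real n)\<^sup>2 = (1 / real n) / real n" by (simp add: power2_eq_square)
      also have "\<dots> \<le> s / real n" using True n' by (intro divide_right_mono) auto
      finally show "1 / (real n)\<^sup>2 \<le> s / real n" .
    qed (use assms in auto)
    also have "\<dots> = (2 * c / real n) * s" by simp
    finally have "\<delta> \<le> 2 * c / real n" using s by (rule mult_right_le_imp_le)
    thus ?thesis using n' by (simp add: field_simps max_def)
  next
    case False
    have "2 * \<delta>\<^sup>2 \<le> 2 * \<delta> * e" using assms by (simp add: power2_eq_square mult_left_mono)
    also have "\<dots> \<le> c * (1 / (real n)\<^sup>2 + 1 / (real n)\<^sup>2)"
    proof (rule order.trans[OF le], intro mult_left_mono add_right_mono)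
      have "s / real n \<le> (1 / real n) / real n" using False n' by (intro divide_right_mono) auto
      thus "s / real n \<le> 1 / (real n)\<^sup>2" by (simp add: power2_eq_square)
    qed (use assms in auto)
    finally have "(real n * \<delta>)\<^sup>2 \<le> c" using n' by (simp add: field_simps power_mult_distrib)
    hence "real n * \<delta> \<le> sqrt c" by (rule real_le_rsqrt)
    thus ?thesis by simp
  qed
qed

text \<open>With a and b the half sum and half difference, sin^2 a - sin^2 b = sin t sin u, which is
  nonnegative for angles in [0,pi]. This gives the first bound and, with the addition theorem, the
  second; the third is Jordan's inequality.\<close>

lemma sin_half_sum_bounds:
  assumes "0 \<le> t" "t \<le> pi" "0 \<le> u" "u \<le> pi"
  shows "\<bar>sin ((t - u) / 2)\<bar> \<le> sin ((t + u) / 2)"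
    and "sin t \<le> 2 * sin ((t + u) / 2)"
    and "\<bar>t - u\<bar> \<le> pi * \<bar>sin ((t - u) / 2)\<bar>"
proof -
  define a where "a = (t + u) / 2"
  define b where "b = (t - u) / 2"
  have tu: "t = a + b" "u = a - b" by (auto simp: a_def b_def field_simps)
  have e: "0 \<le> sin a" using assms by (intro sin_ge_zero) (auto simp: a_def)
  have "(sin a)\<^sup>2 - (sin b)\<^sup>2 = sin t * sin u"
  proof -
    have c: "(cos a)\<^sup>2 = 1 - (sin a)\<^sup>2" "(cos b)\<^sup>2 = 1 - (sin b)\<^sup>2" by (simp_all add: cos_squared_eq)
    have "sin t * sin u = (sin a)\<^sup>2 * (cos b)\<^sup>2 - (cos a)\<^sup>2 * (sin b)\<^sup>2"
      unfolding tu sin_add sin_diff by (simp add: algebra_simps power2_eq_square)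
    thus ?thesis unfolding c by (simp add: algebra_simps)
  qed
  moreover have "0 \<le> sin t * sin u" using assms by (simp add: sin_ge_zero)
  ultimately have "\<bar>sin b\<bar> \<le> \<bar>sin a\<bar>" by (simp add: abs_le_square_iff)
  thus de: "\<bar>sin ((t - u) / 2)\<bar> \<le> sin ((t + u) / 2)" using e by (simp add: a_def b_def)
  have "sin t \<le> \<bar>sin a\<bar> * \<bar>cos b\<bar> + \<bar>cos a\<bar> * \<bar>sin b\<bar>"
    unfolding tu(1) sin_add abs_mult[symmetric] by linarith
  also have "\<dots> \<le> sin a * 1 + 1 * sin a"
    using e de by (intro add_mono mult_mono) (auto simp: a_def b_def)
  finally show "sin t \<le> 2 * sin ((t + u) / 2)" by (simp add: a_def)
  have "2 / pi * \<bar>b\<bar> \<le> sin \<bar>b\<bar>" using assms by (intro sin_ge_two_div_pi) (auto simp: b_def)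
  also have "\<dots> \<le> \<bar>sin b\<bar>" by (simp add: abs_if)
  finally show "\<bar>t - u\<bar> \<le> pi * \<bar>sin ((t - u) / 2)\<bar>" by (simp add: b_def field_simps)
qed

lemma adist_le_of_dist:
  assumes n: "1 \<le> n" and x: "x \<in> {-1..1}" and y: "y \<in> {-1..1}" and c: "0 \<le> c"
    and le: "\<bar>x - y\<bar> \<le> c * rho n x"
  shows "adist n x y \<le> pi * max (2 * c) (sqrt c)"
proof -
  obtain t where t: "0 \<le> t" "t \<le> pi" "x = cos t" "arccos x = t" using cos_param[OF x] .
  obtain u where u: "0 \<le> u" "u \<le> pi" "y = cos u" "arccos y = u" using cos_param[OF y] .
  define a where "a = (t + u) / 2"
  define b where "b = (t - u) / 2"
  note sb = sin_half_sum_bounds[OF t(1,2) u(1,2), folded a_def b_def]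
  have e: "0 \<le> sin a" using sb(1) by linarith
  have "x - y = 2 * sin a * sin (- b)"
  proof -
    have "(u - t) / 2 = - b" by (simp add: b_def field_simps)
    thus ?thesis unfolding t(3) u(3) cos_diff_cos by (simp add: a_def)
  qed
  hence "\<bar>x - y\<bar> = 2 * \<bar>sin b\<bar> * sin a" using e by (simp add: abs_mult)
  hence "2 * \<bar>sin b\<bar> * sin a \<le> c * (sin t / real n + 1 / (real n)\<^sup>2)"
    using le unfolding t(3) rho_cos[OF t(1,2)] by simp
  from sine_factor_bound[OF n _ sb(1) _ sb(2) c this] t
  have *: "real n * \<bar>sin b\<bar> \<le> max (2 * c) (sqrt c)" by (simp add: sin_ge_zero)
  have "real n * \<bar>t - u\<bar> \<le> real n * (pi * \<bar>sin b\<bar>)" by (intro mult_left_mono sb(3)) auto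
  also have "\<dots> \<le> pi * max (2 * c) (sqrt c)" using mult_left_mono[OF *, of pi] by (simp add: algebra_simps)
  finally show ?thesis by (simp add: adist_def t(4) u(4))
qed

section \<open>Integration in the angle, and the decaying kernel\<close>

lemma nn_integral_cos_substitution:
  fixes F :: "real \<Rightarrow> ennreal"
  assumes [measurable]: "F \<in> borel_measurable borel"
  shows "(\<integral>\<^sup>+y. F y * indicator {-1..1} y \<partial>lborel)
       = (\<integral>\<^sup>+t. F (cos t) * ennreal (sin t) * indicator {0..pi} t \<partial>lborel)"
proof -
  \<comment> \<open>The substitution rule is for increasing maps, so y is reflected and - cos takes
    the place of cos.\<close>
  have "(\<integral>\<^sup>+y. F y * indicator {-1..1} y \<partial>lborel) = (\<integral>\<^sup>+y. F (-y) * indicator {-1..1} (-y) \<partial>lborel)"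
    by (subst nn_integral_real_affine[where c = "-1" and t = 0]) auto
  also have "\<dots> = (\<integral>\<^sup>+y. F (-y) * indicator {- cos 0..- cos pi} y \<partial>lborel)"
    by (intro nn_integral_cong) (auto simp: indicator_def)
  also have "\<dots> = (\<integral>\<^sup>+t. F (- (- cos t)) * ennreal (sin t) * indicator {0..pi} t \<partial>lborel)"
    by (rule nn_integral_substitution_aux[where g = "\<lambda>t. - cos t"])
       (auto intro!: derivative_eq_intros continuous_intros sin_ge_zero)
  finally show ?thesis by simp
qed

definition akernel :: "nat \<Rightarrow> nat \<Rightarrow> real \<Rightarrow> real \<Rightarrow> real" where
  "akernel B m x y = 1 / (1 + adist m x y) ^ B"

lemma akernel_pos: "0 < akernel B m x y"
  by (auto simp: akernel_def add_pos_nonneg)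

lemma akernel_commute: "akernel B m x y = akernel B m y x"
  by (simp add: akernel_def adist_commute)

lemma akernel_borel [measurable]: "akernel B m x \<in> borel_measurable borel"
  unfolding akernel_def adist_def by measurable

section \<open>Averages of doubling measures\<close>

text \<open>Each step doubles the inner interval and clips the result to {c..d}. Unless the clipped
  interval is all of {c..d}, it is extended by the full half-length on at least one side, so its
  length grows by 3/2; this is the origin of that base in place of 2.\<close>

lemma interval_growth:
  fixes M :: "real measure"
  assumes fin: "\<And>a b. emeasure M {a..b} < \<infinity>" and sets: "sets M = sets borel"
    and L: "1 \<le> L" "\<And>m l. 0 < l \<Longrightarrow> {m - l..m + l} \<subseteq> {-1..1} \<Longrightarrow>
        measure M {m - 2 * l..m + 2 * l} \<le> L * measure M {m - l..m + l}"
    and ab: "a < b" "{a..b} \<subseteq> {c..d}" "{c..d} \<subseteq> {-1..1}" and k: "d - c \<le> (3 / 2) ^ k * (b - a)"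
  shows "measure M {c..d} \<le> L ^ k * measure M {a..b}"
  using ab k
proof (induction k arbitrary: a b)
  case 0
  hence "a = c" "b = d" by auto
  thus ?case by simp
next
  case (Suc k)
  have sub: "c \<le> a" "b \<le> d" "-1 \<le> c" "d \<le> 1" using Suc.prems by auto
  define l where "l = (b - a) / 2"
  have l: "0 < l" "b = a + 2 * l" using Suc.prems(1) by (auto simp: l_def field_simps)
  define a' where "a' = max c (a - l)"
  define b' where "b' = min d (b + l)"
  have a'b': "a' \<le> a" "b \<le> b'" "c \<le> a'" "b' \<le> d" using sub l by (auto simp: a'_def b'_def)
  have ab': "a' < b'" "{a'..b'} \<subseteq> {c..d}" using Suc.prems(1) a'b' by auto
  define m where "m = (a + b) / 2"
  have ml: "m - l = a" "m + l = b" "m - 2 * l = a - l" "m + 2 * l = b + l"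
    by (auto simp: m_def l_def field_simps)
  have "measure M {a - l..b + l} \<le> L * measure M {a..b}"
    using L(2)[of l m] sub Suc.prems(1) l(1) unfolding ml by auto
  moreover have "measure M {a'..b'} \<le> measure M {a - l..b + l}"
    using fin[of "a - l" "b + l"]
    by (auto simp: measure_def sets a'_def b'_def top.not_eq_extremum intro!: enn2real_mono emeasure_mono)
  ultimately have step: "measure M {a'..b'} \<le> L * measure M {a..b}" by simp
  have "measure M {c..d} \<le> L ^ k * measure M {a'..b'}"
  proof (cases "a' = c \<and> b' = d")
    case True
    have "1 * measure M {c..d} \<le> L ^ k * measure M {c..d}"
      using L(1) by (intro mult_right_mono one_le_power) auto
    thus ?thesis using True by simp
  next
    case False
    hence "a' = a - l \<or> b' = b + l" by (auto simp: a'_def b'_def max_def min_def)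
    hence "3 / 2 * (b - a) \<le> b' - a'" using a'b' l by auto
    hence "(3 / 2) ^ k * (3 / 2 * (b - a)) \<le> (3 / 2) ^ k * (b' - a')" by (intro mult_left_mono) auto
    moreover have "d - c \<le> (3 / 2) ^ k * (3 / 2 * (b - a))" using Suc.prems(4) by (simp only: power_Suc2 mult.assoc)
    ultimately have "d - c \<le> (3 / 2) ^ k * (b' - a')" by linarith
    with ab' Suc.prems(3) show ?thesis by (intro Suc.IH)
  qed
  also have "\<dots> \<le> L ^ k * (L * measure M {a..b})" using L(1) by (intro mult_left_mono step) auto
  finally show ?case by (simp add: algebra_simps)
qed

text \<open>The exponential constant L^k becomes a power of the ratio of lengths: s bounds the
  logarithm of L to the base 3/2, and choosing k minimal makes (3/2)^k at most 3/2 times the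
  ratio.\<close>

lemma interval_growth_power:
  fixes M :: "real measure"
  assumes fin: "\<And>a b. emeasure M {a..b} < \<infinity>" and sets: "sets M = sets borel"
    and L: "1 \<le> L" "\<And>m l. 0 < l \<Longrightarrow> {m - l..m + l} \<subseteq> {-1..1} \<Longrightarrow>
        measure M {m - 2 * l..m + 2 * l} \<le> L * measure M {m - l..m + l}"
    and s: "L \<le> (3 / 2) ^ s"
    and ab: "a < b" "{a..b} \<subseteq> {c..d}" "{c..d} \<subseteq> {-1..1}"
  shows "measure M {c..d} \<le> (3 / 2 * (d - c) / (b - a)) ^ s * measure M {a..b}"
proof -
  define q where "q = (d - c) / (b - a)"
  have q: "1 \<le> q" using ab by (auto simp: q_def)
  define k where "k = (LEAST k. q \<le> (3 / 2) ^ k)"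
  have ex: "\<exists>k. q \<le> (3 / 2) ^ k" using real_arch_pow[of "3 / 2" q] by (auto intro: less_imp_le)
  have k: "q \<le> (3 / 2) ^ k" unfolding k_def using ex by (rule LeastI_ex)
  have k': "(3 / 2) ^ k \<le> 3 / 2 * q"
  proof (cases k)
    case 0
    thus ?thesis using q by simp
  next
    case (Suc j)
    hence "\<not> q \<le> (3 / 2) ^ j" unfolding k_def by (metis lessI not_less_Least)
    thus ?thesis using Suc by simp
  qed
  have "measure M {c..d} \<le> L ^ k * measure M {a..b}"
    by (rule interval_growth[OF fin sets L ab]) (use k ab in \<open>auto simp: q_def field_simps\<close>)
  also have "\<dots> \<le> ((3 / 2) ^ s) ^ k * measure M {a..b}"
    using L(1) s by (intro mult_right_mono power_mono) auto
  also have "((3 / 2 :: real) ^ s) ^ k = ((3 / 2) ^ k) ^ s" by (simp add: power_mult[symmetric] mult.commute)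
  also have "\<dots> * measure M {a..b} \<le> (3 / 2 * q) ^ s * measure M {a..b}"
    using k' by (intro mult_right_mono power_mono) auto
  finally show ?thesis by (simp add: q_def)
qed

text \<open>The weight enters the estimates only through its measure, and the doubling condition
  only through polynomial growth in the ratio of lengths. Growth is available inside [-1,1] only, so
  windows that stick out are clipped first (\<open>measure_clip\<close>).\<close>

locale doubling_measure =
  fixes \<mu> :: "real measure" and s :: nat
  assumes sets_mu [measurable_cong]: "sets \<mu> = sets borel"
    and finite: "finite_measure \<mu>"
    and support: "emeasure \<mu> (- {-1..1}) = 0"
    and growth: "\<And>a b c d. a < b \<Longrightarrow> {a..b} \<subseteq> {c..d} \<Longrightarrow> {c..d} \<subseteq> {-1..1} \<Longrightarrow>
        measure \<mu> {c..d} \<le> (3 / 2 * (d - c) / (b - a)) ^ s * measure \<mu> {a..b}"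
begin

sublocale finite_measure \<mu> by (rule finite)

definition aw :: "nat \<Rightarrow> real \<Rightarrow> real" where
  "aw n x = measure \<mu> {x - rho n x..x + rho n x} / rho n x"

lemma aw_nonneg: "1 \<le> n \<Longrightarrow> x \<in> {-1..1} \<Longrightarrow> 0 \<le> aw n x"
  using rho_pos[of n x] by (auto simp: aw_def)

lemma aw_borel [measurable]: "aw n \<in> borel_measurable borel"
proof -
  \<comment> \<open>As the integral of an indicator that is jointly measurable in x and u, the mass
    of the moving window is measurable in x.\<close>
  have eq: "(\<lambda>x. measure \<mu> {x - rho n x..x + rho n x}) = (\<lambda>x. enn2real (\<integral>\<^sup>+u. indicator {x - rho n x..x
      + rho n x} u \<partial>\<mu>))"
    by (simp add: measure_def sets_mu)
  have "(\<lambda>x. enn2real (\<integral>\<^sup>+u. indicator {x - rho n x..x + rho n x} u \<partial>\<mu>)) \<in> borel_measurable borel"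
    unfolding indicator_def atLeastAtMost_iff by measurable
  hence [measurable]: "(\<lambda>x. measure \<mu> {x - rho n x..x + rho n x}) \<in> borel_measurable borel"
    unfolding eq .
  show ?thesis unfolding aw_def by measurable
qed

lemma measure_clip: "measure \<mu> {a..b} = measure \<mu> {max (-1) a..min 1 b}"
proof (rule measure_eq_AE)
  have "AE u in \<mu>. u \<in> {-1..1}"
    using support by (intro AE_I[where N = "- {-1..1}"]) (auto simp: sets_mu)
  thus "AE u in \<mu>. u \<in> {a..b} \<longleftrightarrow> u \<in> {max (-1) a..min 1 b}" by eventually_elim auto
qed (auto simp: sets_mu)

text \<open>The product is the mass of the window. Both windows lie in a hull of length at most 2 (1
  + d_n)^2 rho_n(x). For n >= 2 the radius is at most 1, so the clipped window at x still has length
  at least rho_n(x), and growth applies to the pair.\<close>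

lemma aw_rho_le:
  assumes n: "2 \<le> n" and x: "x \<in> {-1..1}" and y: "y \<in> {-1..1}"
  shows "aw n y * rho n y \<le> (3 * (1 + adist n x y)\<^sup>2) ^ s * (aw n x * rho n x)"
proof -
  have rx: "0 < rho n x" "rho n x \<le> 1" and ry: "0 < rho n y" "rho n y \<le> 1"
    using n x y by (auto intro: rho_pos rho_le_1)
  define d where "d = adist n x y"
  have d: "0 \<le> d" by (simp add: d_def)
  define a where "a = max (-1) (x - rho n x)"
  define b where "b = min 1 (x + rho n x)"
  define a' where "a' = max (-1) (y - rho n y)"
  define b' where "b' = min 1 (y + rho n y)"
  have ab: "rho n x \<le> b - a" using rx x by (auto simp: a_def b_def)
  have "\<bar>x - y\<bar> \<le> (d + d\<^sup>2) * rho n x" unfolding d_def using n x y by (intro dist_le_adist) auto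
  moreover have ry': "rho n y \<le> (1 + d) * rho n x" unfolding d_def using n x y by (intro rho_le_adist) auto
  moreover have "max b b' - min a a' \<le> \<bar>x - y\<bar> + 2 * ((1 + d) * rho n x)"
  proof -
    have "0 \<le> d * rho n x" using d rx by simp
    hence rx': "rho n x \<le> (1 + d) * rho n x" by (simp add: distrib_right)
    have "b \<le> x + rho n x" "b' \<le> y + rho n y" "x - rho n x \<le> a" "y - rho n y \<le> a'"
      by (auto simp: a_def b_def a'_def b'_def)
    thus ?thesis using rx' ry' by (auto simp: max_def min_def abs_if)
  qed
  ultimately have "max b b' - min a a' \<le> (2 + 3 * d + d\<^sup>2) * rho n x"
    by (simp add: algebra_simps)
  also have "\<dots> \<le> 2 * (1 + d)\<^sup>2 * rho n x"
    using d rx by (intro mult_right_mono) (auto simp: power2_eq_square algebra_simps)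
  finally have len: "max b b' - min a a' \<le> 2 * (1 + d)\<^sup>2 * rho n x" .
  have "aw n y * rho n y = measure \<mu> {a'..b'}"
    using ry by (simp add: aw_def a'_def b'_def measure_clip[of "y - rho n y"])
  also have "\<dots> \<le> measure \<mu> {min a a'..max b b'}"
    by (intro finite_measure_mono) (auto simp: sets_mu)
  also have "\<dots> \<le> (3 / 2 * (max b b' - min a a') / (b - a)) ^ s * measure \<mu> {a..b}"
    by (rule growth) (use rx ab x y ry in \<open>auto simp: a_def b_def a'_def b'_def\<close>)
  also have "\<dots> \<le> (3 * (1 + d)\<^sup>2) ^ s * measure \<mu> {a..b}"
  proof (intro mult_right_mono power_mono)
    have "3 / 2 * (max b b' - min a a') / (b - a) \<le> 3 / 2 * (2 * (1 + d)\<^sup>2 * rho n x) / rho n x"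
      using len ab rx d by (intro frac_le mult_left_mono) auto
    thus "3 / 2 * (max b b' - min a a') / (b - a) \<le> 3 * (1 + d)\<^sup>2" using rx by simp
    show "0 \<le> 3 / 2 * (max b b' - min a a') / (b - a)" using ab rx by (intro divide_nonneg_nonneg) auto
  qed auto
  also have "measure \<mu> {a..b} = aw n x * rho n x"
    using rx by (simp add: aw_def a_def b_def measure_clip[of "x - rho n x"])
  finally show ?thesis by (simp add: d_def)
qed

text \<open>Passing from masses to averages divides by rho_n, which costs one further factor 1 +
  d_n.\<close>

lemma aw_le:
  assumes n: "2 \<le> n" and x: "x \<in> {-1..1}" and y: "y \<in> {-1..1}"
  shows "aw n y \<le> 3 ^ s * (1 + adist n x y) ^ (2 * s + 1) * aw n x"
proof -
  have ry: "0 < rho n y" using n y by (auto intro: rho_pos)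
  have "aw n y * rho n y \<le> (3 * (1 + adist n x y)\<^sup>2) ^ s * (aw n x * rho n x)"
    by (rule aw_rho_le[OF assms])
  also have "\<dots> \<le> (3 * (1 + adist n x y)\<^sup>2) ^ s * (aw n x * ((1 + adist n x y) * rho n y))"
    using rho_le_adist[of n y x] n x y by (intro mult_left_mono aw_nonneg) (auto simp: adist_commute)
  also have "\<dots> = (3 ^ s * (1 + adist n x y) ^ (2 * s + 1) * aw n x) * rho n y"
    by (simp add: power_mult_distrib power_mult[symmetric] power_add algebra_simps)
  finally show ?thesis using ry by (rule mult_right_le_imp_le)
qed

text \<open>The narrower window has the smaller mass, and its radius is shorter by at most the
  factor A^2, the square coming from the summand 1/n^2 of rho_n.\<close>

lemma aw_scale:
  assumes "1 \<le> m" "m \<le> n" "real n \<le> A * real m" and x: "x \<in> {-1..1}" and A: "1 \<le> A"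
  shows "aw n x \<le> A\<^sup>2 * aw m x"
proof -
  have r: "0 < rho n x" "0 < rho m x" "rho n x \<le> rho m x"
    using assms by (auto intro!: rho_pos rho_antimono)
  have "rho m x \<le> A\<^sup>2 * rho n x"
  proof -
    have n0: "0 < real n" "0 < real m" using assms by auto
    have "x\<^sup>2 \<le> 1" using x by (auto simp: abs_square_le_1 abs_le_iff)
    hence 1: "sqrt (1 - x\<^sup>2) / real m \<le> A * sqrt (1 - x\<^sup>2) / real n"
      using n0 assms mult_right_mono[OF assms(3), of "sqrt (1 - x\<^sup>2)"] by (simp add: field_simps)
    have "A * sqrt (1 - x\<^sup>2) / real n \<le> A\<^sup>2 * (sqrt (1 - x\<^sup>2) / real n)"
    proof -
      have "A \<le> A\<^sup>2" using A by (simp add: power2_eq_square)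
      from mult_right_mono[OF this, of "sqrt (1 - x\<^sup>2) / real n"] show ?thesis
        using \<open>x\<^sup>2 \<le> 1\<close> by simp
    qed
    moreover have "1 / (real m)\<^sup>2 \<le> A\<^sup>2 * (1 / (real n)\<^sup>2)"
      using n0 power_mono[OF assms(3), of 2] by (simp add: field_simps power_mult_distrib)
    ultimately show ?thesis using 1 unfolding rho_def by (simp add: distrib_left)
  qed
  hence "1 / rho n x \<le> A\<^sup>2 / rho m x" using r by (simp add: field_simps)
  moreover have "measure \<mu> {x - rho n x..x + rho n x} \<le> measure \<mu> {x - rho m x..x + rho m x}"
    using r by (intro finite_measure_mono) (auto simp: sets_mu)
  ultimately have "measure \<mu> {x - rho n x..x + rho n x} * (1 / rho n x)
     \<le> measure \<mu> {x - rho m x..x + rho m x} * (A\<^sup>2 / rho m x)"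
    using r by (intro mult_mono) auto
  thus ?thesis by (simp add: aw_def algebra_simps)
qed

text \<open>For large n/m the weights w_n and w_m need not be comparable pointwise; this lemma and
  \<open>nn_integral_le_aw\<close> compare them as integrators of slowly varying functions, with mu
  in between. w_n is unfolded into an integral over mu and the order is swapped: a fixed u then sees
  only points x whose window contains u, and these are within d_n <= 2 pi of u.\<close>

lemma nn_integral_aw_le:
  fixes g :: "real \<Rightarrow> ennreal"
  assumes mn: "2 \<le> m" "m \<le> n" and [measurable]: "g \<in> borel_measurable borel"
    and g: "\<And>x u. x \<in> {-1..1} \<Longrightarrow> u \<in> {-1..1} \<Longrightarrow> adist m x u \<le> 2 * pi \<Longrightarrow> g x \<le> ennreal K * g u"
    and K: "0 \<le> K"
  shows "(\<integral>\<^sup>+x. ennreal (aw n x) * g x * indicator {-1..1} x \<partial>lborel) \<le> ennreal (162 * K) * (\<integral>\<^sup>+u. g u \<partial>\<mu>)"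
proof -
  interpret P: pair_sigma_finite lborel \<mu> ..
  define k :: "real \<Rightarrow> real \<Rightarrow> ennreal" where
    "k x u = ennreal (1 / rho n x) * indicator {-1..1} x * (if x - rho n x \<le> u \<and> u
        \<le> x + rho n x then 1 else 0)" for x u
  have [measurable]: "case_prod k \<in> borel_measurable (lborel \<Otimes>\<^sub>M \<mu>)"
    unfolding k_def case_prod_beta' by measurable
  have "(\<integral>\<^sup>+x. ennreal (aw n x) * g x * indicator {-1..1} x \<partial>lborel)
      = (\<integral>\<^sup>+x. (\<integral>\<^sup>+u. k x u * g x \<partial>\<mu>) \<partial>lborel)"
  proof (rule nn_integral_cong)
    fix x :: real
    show "ennreal (aw n x) * g x * indicator {-1..1} x = (\<integral>\<^sup>+u. k x u * g x \<partial>\<mu>)"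
    proof (cases "x \<in> {-1..1}")
      case True
      hence r: "0 < rho n x" using mn by (intro rho_pos) auto
      have "(\<integral>\<^sup>+u. k x u * g x \<partial>\<mu>) = (\<integral>\<^sup>+u. ennreal (1 / rho n x) * g x * indicator {x - rho n x..x + rho n x} u \<partial>\<mu>)"
        using True by (intro nn_integral_cong) (auto simp: k_def indicator_def)
      also have "\<dots> = ennreal (1 / rho n x) * g x * emeasure \<mu> {x - rho n x..x + rho n x}"
        by (intro nn_integral_cmult_indicator) (auto simp: sets_mu)
      also have "\<dots> = ennreal (1 / rho n x * measure \<mu> {x - rho n x..x + rho n x}) * g x"
        unfolding emeasure_eq_measure using r by (subst ennreal_mult) (auto simp: ac_simps)
      finally show ?thesis using True by (simp add: aw_def)
    qed (simp add: k_def)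
  qed
  also have "\<dots> = (\<integral>\<^sup>+u. (\<integral>\<^sup>+x. k x u * g x \<partial>lborel) \<partial>\<mu>)"
    by (rule P.Fubini'[symmetric]) measurable
  also have "\<dots> \<le> (\<integral>\<^sup>+u. ennreal (162 * K) * g u \<partial>\<mu>)"
  proof (rule nn_integral_mono_AE)
    have "AE u in \<mu>. u \<in> {-1..1}"
      using support by (intro AE_I[where N = "- {-1..1}"]) (auto simp: sets_mu)
    thus "AE u in \<mu>. (\<integral>\<^sup>+x. k x u * g x \<partial>lborel) \<le> ennreal (162 * K) * g u"
    proof eventually_elim
      fix u :: real assume u: "u \<in> {-1..1}"
      have ru: "0 < rho n u" using u mn by (intro rho_pos) auto
      \<comment> \<open>1 + 2 pi is below 9, so the radii at x and u differ by at most the factor 9.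
        The points x lie in an interval of length 18 rho_n(u) and carry density at most 9 /
        rho_n(u), hence 162.\<close>
      define R where "R = 9 * rho n u"
      have "(\<integral>\<^sup>+x. k x u * g x \<partial>lborel) \<le> (\<integral>\<^sup>+x. ennreal (9 / rho n u) * (ennreal K * g u) * indicator {u - R..u
          + R} x \<partial>lborel)"
      proof (rule nn_integral_mono)
        fix x :: real
        show "k x u * g x \<le> ennreal (9 / rho n u) * (ennreal K * g u) * indicator {u - R..u + R} x"
        proof (cases "x \<in> {-1..1} \<and> x - rho n x \<le> u \<and> u \<le> x + rho n x")
          case True
          hence x: "x \<in> {-1..1}" and xu: "\<bar>x - u\<bar> \<le> 1 * rho n x" by auto
          have rx: "0 < rho n x" using x mn by (intro rho_pos) auto
          have "adist n x u \<le> pi * max (2 * 1) (sqrt 1)"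
            by (rule adist_le_of_dist) (use x u xu mn in auto)
          hence ad: "adist n x u \<le> 2 * pi" by simp
          hence "adist n x u \<le> 8" using pi_less_4 by linarith
          hence "(1 + adist n x u) * rho n x \<le> 9 * rho n x" "(1 + adist n u x) * rho n u \<le> 9 * rho n u"
            using rx ru by (auto intro!: mult_right_mono simp: adist_commute)
          with rho_le_adist[OF _ x u, of n] rho_le_adist[OF _ u x, of n] mn
          have rr: "rho n u \<le> 9 * rho n x" "rho n x \<le> 9 * rho n u" by auto
          have "k x u * g x = ennreal (1 / rho n x) * g x" using True by (simp add: k_def)
          also have "\<dots> \<le> ennreal (9 / rho n u) * (ennreal K * g u)"
          proof (intro mult_mono g x u)
            show "ennreal (1 / rho n x) \<le> ennreal (9 / rho n u)"
              using rr rx ru by (intro ennreal_leI) (simp add: field_simps)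
            show "adist m x u \<le> 2 * pi" using adist_mono[OF mn(2), of x u] ad by simp
          qed auto
          finally show ?thesis using rr xu by (simp add: R_def indicator_def abs_le_iff)
        qed (auto simp: k_def)
      qed
      also have "\<dots> = ennreal (9 / rho n u) * (ennreal K * g u) * ennreal (2 * R)"
        using ru by (subst nn_integral_cmult_indicator) (auto simp: R_def)
      also have "\<dots> = (ennreal (9 / rho n u) * ennreal K * ennreal (2 * R)) * g u"
        by (simp only: ac_simps)
      also have "ennreal (9 / rho n u) * ennreal K * ennreal (2 * R) = ennreal (9 / rho n u * K * (2 * R))"
        using ru K by (subst ennreal_mult; (subst ennreal_mult)?) (auto simp: R_def)
      also have "9 / rho n u * K * (2 * R) = 162 * K" using ru by (simp add: R_def)
      finally show "(\<integral>\<^sup>+x. k x u * g x \<partial>lborel) \<le> ennreal (162 * K) * g u" .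
    qed
  qed
  also have "\<dots> = ennreal (162 * K) * (\<integral>\<^sup>+u. g u \<partial>\<mu>)"
    by (rule nn_integral_cmult) measurable
  finally show ?thesis .
qed

text \<open>The same exchange of integrals from below: every u in [-1,1] must be contained in the
  windows of enough points x of [-1,1].\<close>

lemma nn_integral_le_aw:
  fixes g :: "real \<Rightarrow> ennreal"
  assumes m: "2 \<le> m" and [measurable]: "g \<in> borel_measurable borel"
    and g: "\<And>x u. x \<in> {-1..1} \<Longrightarrow> u \<in> {-1..1} \<Longrightarrow> adist m x u \<le> 2 * pi \<Longrightarrow> g x \<le> ennreal K * g u"
    and K: "0 \<le> K"
  shows "(\<integral>\<^sup>+u. g u \<partial>\<mu>) \<le> ennreal (24 * K) * (\<integral>\<^sup>+x. ennreal (aw m x) * g x * indicator {-1..1} x \<partial>lborel)"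
proof -
  interpret P: pair_sigma_finite lborel \<mu> ..
  define k :: "real \<Rightarrow> real \<Rightarrow> ennreal" where
    "k x u = ennreal (1 / rho m x) * indicator {-1..1} x * (if x - rho m x \<le> u \<and> u
        \<le> x + rho m x then 1 else 0)" for x u
  have [measurable]: "case_prod k \<in> borel_measurable (lborel \<Otimes>\<^sub>M \<mu>)"
    unfolding k_def case_prod_beta' by measurable
  have "(\<integral>\<^sup>+u. g u \<partial>\<mu>) \<le> (\<integral>\<^sup>+u. ennreal (24 * K) * (\<integral>\<^sup>+x. k x u * g x \<partial>lborel) \<partial>\<mu>)"
  proof (rule nn_integral_mono_AE)
    have "AE u in \<mu>. u \<in> {-1..1}"
      using support by (intro AE_I[where N = "- {-1..1}"]) (auto simp: sets_mu)
    thus "AE u in \<mu>. g u \<le> ennreal (24 * K) * (\<integral>\<^sup>+x. k x u * g x \<partial>lborel)"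
    proof eventually_elim
      fix u :: real assume u: "u \<in> {-1..1}"
      have ru: "0 < rho m u" "rho m u \<le> 1" using u m by (auto intro: rho_pos rho_le_1)
      define R where "R = rho m u / 8"
      \<comment> \<open>A one-sided interval from u towards 0, so that it stays in [-1,1]. On it d_m
        is at most 2, so the radii are at least rho_m(u)/3 and the windows contain u. Density at
        least 1/(3 rho_m(u)) on length rho_m(u)/8 gives the factor 24.\<close>
      obtain a where a: "{a..a + R} \<subseteq> {-1..1}" "{a..a + R} \<subseteq> {u - R..u + R}"
      proof (cases "u \<le> 0")
        case True
        show ?thesis by (rule that[of u]) (use True u ru in \<open>auto simp: R_def\<close>)
      next
        case False
        show ?thesis by (rule that[of "u - R"]) (use False u ru in \<open>auto simp: R_def\<close>)
      qed
      have "(\<integral>\<^sup>+x. g u * ennreal (1 / (3 * rho m u)) * indicator {a..a + R} x \<partial>lborel)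
          \<le> (\<integral>\<^sup>+x. ennreal K * (k x u * g x) \<partial>lborel)"
      proof (rule nn_integral_mono)
        fix x :: real
        show "g u * ennreal (1 / (3 * rho m u)) * indicator {a..a + R} x \<le> ennreal K * (k x u * g x)"
        proof (cases "x \<in> {a..a + R}")
          case True
          hence x: "x \<in> {-1..1}" and "x \<in> {u - R..u + R}" using a by blast+
          hence xu: "\<bar>u - x\<bar> \<le> 1 / 8 * rho m u" by (auto simp: R_def abs_if)
          have rx: "0 < rho m x" using x m by (intro rho_pos) auto
          have "adist m u x \<le> pi * max (2 * (1 / 8)) (sqrt (1 / 8))"
            by (rule adist_le_of_dist) (use x u xu m in auto)
          also have "\<dots> \<le> 4 * (1 / 2)"
          proof (intro mult_mono)
            have "sqrt (1 / 8) \<le> sqrt (1 / 4)" by simp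
            also have "\<dots> = 1 / 2" by (simp add: real_sqrt_divide)
            finally show "max (2 * (1 / 8)) (sqrt (1 / 8)) \<le> 1 / 2" by simp
          qed (use pi_less_4 in auto)
          finally have ad: "adist m u x \<le> 2" by simp
          hence "(1 + adist m x u) * rho m x \<le> 3 * rho m x" "(1 + adist m u x) * rho m u \<le> 3 * rho m u"
            using rx ru by (auto intro!: mult_right_mono simp: adist_commute)
          with rho_le_adist[OF _ x u, of m] rho_le_adist[OF _ u x, of m] m
          have rr: "rho m u \<le> 3 * rho m x" "rho m x \<le> 3 * rho m u" by auto
          have "g u * ennreal (1 / (3 * rho m u)) \<le> (ennreal K * g x) * ennreal (1 / rho m x)"
          proof (intro mult_mono g x u)
            show "ennreal (1 / (3 * rho m u)) \<le> ennreal (1 / rho m x)"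
              using rr rx ru by (intro ennreal_leI) (simp add: field_simps)
            show "adist m u x \<le> 2 * pi" using ad pi_ge_two by simp
          qed auto
          also have "\<dots> = ennreal K * (k x u * g x)"
            using x xu rr ru by (auto simp: k_def ac_simps abs_le_iff)
          finally show ?thesis using True by simp
        qed auto
      qed
      also have "(\<integral>\<^sup>+x. g u * ennreal (1 / (3 * rho m u)) * indicator {a..a + R} x \<partial>lborel)
         = g u * ennreal (1 / (3 * rho m u)) * ennreal R"
        using ru by (subst nn_integral_cmult_indicator) (auto simp: R_def)
      also have "\<dots> = ennreal (1 / 24) * g u"
        using ru by (subst mult.assoc, subst ennreal_mult[symmetric]) (auto simp: R_def mult.commute)
      also have "(\<integral>\<^sup>+x. ennreal K * (k x u * g x) \<partial>lborel) = ennreal K * (\<integral>\<^sup>+x. k x u * g x \<partial>lborel)"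
        by (rule nn_integral_cmult) (use u in \<open>simp add: k_def\<close>)
      finally have *: "ennreal (1 / 24) * g u \<le> ennreal K * (\<integral>\<^sup>+x. k x u * g x \<partial>lborel)" .
      have "g u = ennreal 24 * (ennreal (1 / 24) * g u)"
        by (subst mult.assoc[symmetric], subst ennreal_mult[symmetric]) auto
      also have "\<dots> \<le> ennreal 24 * (ennreal K * (\<integral>\<^sup>+x. k x u * g x \<partial>lborel))"
        by (intro mult_left_mono *) auto
      also have "\<dots> = ennreal (24 * K) * (\<integral>\<^sup>+x. k x u * g x \<partial>lborel)"
        using K by (simp add: ennreal_mult mult.assoc)
      finally show "g u \<le> ennreal (24 * K) * (\<integral>\<^sup>+x. k x u * g x \<partial>lborel)" .
    qed
  qed
  also have "\<dots> = ennreal (24 * K) * (\<integral>\<^sup>+u. (\<integral>\<^sup>+x. k x u * g x \<partial>lborel) \<partial>\<mu>)"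
    by (rule nn_integral_cmult) measurable
  also have "(\<integral>\<^sup>+u. (\<integral>\<^sup>+x. k x u * g x \<partial>lborel) \<partial>\<mu>) = (\<integral>\<^sup>+x. (\<integral>\<^sup>+u. k x u * g x \<partial>\<mu>) \<partial>lborel)"
    by (rule P.Fubini') measurable
  also have "\<dots> = (\<integral>\<^sup>+x. ennreal (aw m x) * g x * indicator {-1..1} x \<partial>lborel)"
  proof (rule nn_integral_cong)
    fix x :: real
    show "(\<integral>\<^sup>+u. k x u * g x \<partial>\<mu>) = ennreal (aw m x) * g x * indicator {-1..1} x"
    proof (cases "x \<in> {-1..1}")
      case True
      hence r: "0 < rho m x" using m by (intro rho_pos) auto
      have "(\<integral>\<^sup>+u. k x u * g x \<partial>\<mu>) = (\<integral>\<^sup>+u. ennreal (1 / rho m x) * g x * indicator {x - rho m x..x + rho m x} u \<partial>\<mu>)"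
        using True by (intro nn_integral_cong) (auto simp: k_def indicator_def)
      also have "\<dots> = ennreal (1 / rho m x) * g x * emeasure \<mu> {x - rho m x..x + rho m x}"
        by (intro nn_integral_cmult_indicator) (auto simp: sets_mu)
      also have "\<dots> = ennreal (1 / rho m x * measure \<mu> {x - rho m x..x + rho m x}) * g x"
        unfolding emeasure_eq_measure using r by (subst ennreal_mult) (auto simp: ac_simps)
      finally show ?thesis using True by (simp add: aw_def)
    qed (simp add: k_def)
  qed
  finally show ?thesis .
qed

end

section \<open>Kernels and symmetric differences in averaged weights\<close>

lemma akernel_mono: "B \<le> B' \<Longrightarrow> akernel B' m x y \<le> akernel B m x y"
  unfolding akernel_def by (intro divide_left_mono power_increasing mult_pos_pos zero_less_power) (auto simp:
      add_pos_nonneg)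

lemma akernel_mult_power: "k \<le> B \<Longrightarrow> akernel B m x y * (1 + adist m x y) ^ k = akernel (B - k) m x y"
proof -
  assume "k \<le> B"
  have "1 + adist m x y \<noteq> 0" using adist_nonneg[of m x y] by linarith
  thus ?thesis using \<open>k \<le> B\<close> by (simp add: akernel_def power_diff)
qed

text \<open>The triangle inequality gives 1 + e <= (1 + D)(1 + d). So the kernel varies slowly at
  scale m, as demanded of g in \<open>nn_integral_aw_le\<close> and
  \<open>nn_integral_le_aw\<close>.\<close>

lemma akernel_shift:
  assumes "adist m x u \<le> D" "0 \<le> D"
  shows "akernel B m x y \<le> (1 + D) ^ B * akernel B m u y"
proof -
  define d where "d = adist m x y"
  define e where "e = adist m u y"
  have de: "0 \<le> d" "0 \<le> e" by (auto simp: d_def e_def)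
  have "e \<le> D + d" unfolding d_def e_def using adist_triangle[of m u y x] assms by (simp add: adist_commute)
  moreover have "0 \<le> D * d" using assms de by simp
  ultimately have "1 + e \<le> (1 + D) * (1 + d)" by (simp add: algebra_simps)
  hence "(1 + e) ^ B \<le> (1 + D) ^ B * (1 + d) ^ B" using de by (subst power_mult_distrib[symmetric]) (intro
      power_mono, auto)
  moreover have "0 < (1 + e) ^ B" "0 < (1 + d) ^ B" using de by (auto intro: zero_less_power)
  ultimately show ?thesis by (simp add: akernel_def d_def[symmetric] e_def[symmetric] field_simps)
qed

text \<open>In the angle, dy / rho_m(y) becomes sin t / rho_m(cos t) dt, which is at most m dt. Two
  powers of decay are dominated by m / (1 + (m (t - \<tau>))^2), whose primitive is an arctangent;
  the total is below pi.\<close>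

lemma nn_integral_akernel_div_rho:
  assumes m: "1 \<le> m" and x: "x \<in> {-1..1}" and B: "2 \<le> B"
  shows "(\<integral>\<^sup>+y. ennreal (akernel B m x y / rho m y) * indicator {-1..1} y \<partial>lborel) \<le> 4"
proof -
  obtain \<tau> where \<tau>: "0 \<le> \<tau>" "\<tau> \<le> pi" "x = cos \<tau>" "arccos x = \<tau>" using cos_param[OF x] .
  have m0: "0 < real m" using m by simp
  have "(\<integral>\<^sup>+y. ennreal (akernel B m x y / rho m y) * indicator {-1..1} y \<partial>lborel)
     = (\<integral>\<^sup>+t. ennreal (akernel B m x (cos t) / rho m (cos t)) * ennreal (sin t) * indicator {0..pi} t \<partial>lborel)"
    by (rule nn_integral_cos_substitution) measurable
  also have "\<dots> \<le> (\<integral>\<^sup>+t. ennreal (real m / (1 + (real m * (t - \<tau>))\<^sup>2)) * indicator {0..pi} t \<partial>lborel)"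
  proof (intro nn_integral_mono)
    fix t :: real
    show "ennreal (akernel B m x (cos t) / rho m (cos t)) * ennreal (sin t) * indicator {0..pi} t
       \<le> ennreal (real m / (1 + (real m * (t - \<tau>))\<^sup>2)) * indicator {0..pi} t"
    proof (cases "t \<in> {0..pi}")
      case True
      hence st: "0 \<le> sin t" by (simp add: sin_ge_zero)
      have r: "0 < rho m (cos t)" using m by (intro rho_pos) auto
      have "akernel B m x (cos t) \<le> akernel 2 m x (cos t)" by (rule akernel_mono[OF B])
      also have "\<dots> = 1 / (1 + real m * \<bar>t - \<tau>\<bar>)\<^sup>2"
        using True by (simp add: akernel_def adist_def \<tau>(4) arccos_cos abs_minus_commute)
      also have "\<dots> \<le> 1 / (1 + (real m * (t - \<tau>))\<^sup>2)"
      proof (intro divide_left_mono mult_pos_pos)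
        have "(real m * (t - \<tau>))\<^sup>2 = (real m * \<bar>t - \<tau>\<bar>)\<^sup>2" by (simp add: power_mult_distrib)
        thus "1 + (real m * (t - \<tau>))\<^sup>2 \<le> (1 + real m * \<bar>t - \<tau>\<bar>)\<^sup>2" by (simp add: power2_sum)
        have "0 < 1 + real m * \<bar>t - \<tau>\<bar>" by (intro add_pos_nonneg) auto
        thus "0 < (1 + real m * \<bar>t - \<tau>\<bar>)\<^sup>2" by (rule zero_less_power)
      qed (auto simp: add_pos_nonneg)
      finally have 1: "akernel B m x (cos t) \<le> 1 / (1 + (real m * (t - \<tau>))\<^sup>2)" .
      have 2: "sin t / rho m (cos t) \<le> real m"
      proof -
        have "sin t \<le> real m * rho m (cos t)"
          using True m0 by (simp add: rho_cos distrib_left)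
        thus ?thesis using r by (simp add: field_simps)
      qed
      have "akernel B m x (cos t) / rho m (cos t) * sin t = akernel B m x (cos t) * (sin t / rho m (cos t))" by simp
      also have "\<dots> \<le> 1 / (1 + (real m * (t - \<tau>))\<^sup>2) * real m"
        by (intro mult_mono 1 2) (use st r in \<open>auto simp: add_nonneg_nonneg\<close>)
      finally show ?thesis using True st r akernel_pos[of B m x "cos t"]
        by (subst ennreal_mult[symmetric]) (auto intro!: ennreal_leI)
    qed auto
  qed
  also have "\<dots> = ennreal (arctan (real m * (pi - \<tau>)) - arctan (real m * (0 - \<tau>)))"
  proof (rule nn_integral_FTC_Icc)
    fix t :: real
    show "((\<lambda>t. arctan (real m * (t - \<tau>))) has_real_derivative real m / (1 + (real m * (t - \<tau>))\<^sup>2)) (at t)"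
      by (auto intro!: derivative_eq_intros simp: field_simps)
  qed (auto intro!: divide_nonneg_nonneg add_nonneg_nonneg)
  also have "\<dots> \<le> ennreal 4"
  proof (rule ennreal_leI)
    show "arctan (real m * (pi - \<tau>)) - arctan (real m * (0 - \<tau>)) \<le> 4"
      using arctan_ubound[of "real m * (pi - \<tau>)"] arctan_lbound[of "real m * (0 - \<tau>)"] pi_less_4 by linarith
  qed
  finally show ?thesis by simp
qed

text \<open>One power of decay replaces rho_m(x) by rho_m(y); the rest is integrated against dx /
  rho_m(x).\<close>

lemma nn_integral_akernel:
  assumes m: "1 \<le> m" and y: "y \<in> {-1..1}" and B: "3 \<le> B"
  shows "(\<integral>\<^sup>+x. ennreal (akernel B m x y) * indicator {-1..1} x \<partial>lborel) \<le> ennreal (4 * rho m y)"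
proof -
  have ry: "0 < rho m y" using m y by (intro rho_pos) auto
  have "(\<integral>\<^sup>+x. ennreal (akernel B m x y) * indicator {-1..1} x \<partial>lborel)
     \<le> (\<integral>\<^sup>+x. ennreal (rho m y) * (ennreal (akernel (B - 1) m y x / rho m x) * indicator {-1..1} x) \<partial>lborel)"
  proof (intro nn_integral_mono)
    fix x :: real
    show "ennreal (akernel B m x y) * indicator {-1..1} x
       \<le> ennreal (rho m y) * (ennreal (akernel (B - 1) m y x / rho m x) * indicator {-1..1} x)"
    proof (cases "x \<in> {-1..1}")
      case True
      have rx: "0 < rho m x" using m True by (intro rho_pos) auto
      have "akernel B m x y * rho m x \<le> akernel B m x y * ((1 + adist m x y) ^ 1 * rho m y)"
        using rho_le_adist[OF m y True] akernel_pos[of B m x y]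
        by (intro mult_left_mono) (auto simp: adist_commute)
      also have "\<dots> = rho m y * akernel (B - 1) m y x"
        using akernel_mult_power[of 1 B m x y] B by (simp add: akernel_commute ac_simps)
      finally show ?thesis using True rx ry akernel_pos[of "B - 1" m y x]
        by (auto simp: ennreal_mult[symmetric] field_simps intro!: ennreal_leI)
    qed auto
  qed
  also have "\<dots> = ennreal (rho m y) * (\<integral>\<^sup>+x. ennreal (akernel (B - 1) m y x / rho m x) * indicator {-1..1} x \<partial>lborel)"
    by (rule nn_integral_cmult) measurable
  also have "\<dots> \<le> ennreal (rho m y) * 4"
    using B by (intro mult_left_mono nn_integral_akernel_div_rho m y) auto
  finally show ?thesis using ry by (simp add: ennreal_mult mult.commute)
qed

text \<open>The kernel is slowly varying at scale m, so w_n may be replaced by mu and mu by w_m;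
  each exchange costs 8^B, since 2 pi < 7. Replacing w_m(x) by w_m(y) uses 2 s + 1 powers of decay
  and leaves the three that \<open>nn_integral_akernel\<close> needs. 15552 is 162 * 24 * 4.\<close>

lemma (in doubling_measure) nn_integral_aw_akernel:
  assumes mn: "2 \<le> m" "m \<le> n" and y: "y \<in> {-1..1}" and B: "2 * s + 4 \<le> B"
  shows "(\<integral>\<^sup>+x. ennreal (aw n x * akernel B m x y) * indicator {-1..1} x \<partial>lborel)
    \<le> ennreal (15552 * 64 ^ B * 3 ^ s * (rho m y * aw m y))"
proof -
  define g where "g x = ennreal (akernel B m x y)" for x
  have akB: "(\<lambda>x. akernel B m x y) \<in> borel_measurable borel" for B
    unfolding akernel_commute[of B m _ y] by measurable
  note akB [measurable]
  have gm: "g \<in> borel_measurable borel" unfolding g_def using akB by measurable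
  have ry: "0 < rho m y" using mn y by (intro rho_pos) auto
  have ay: "0 \<le> aw m y" using mn y by (intro aw_nonneg) auto
  have slow: "g x \<le> ennreal (8 ^ B) * g u" if "adist m x u \<le> 2 * pi" for x u
  proof -
    have "adist m x u \<le> 7" using that pi_less_4 pi_approx by simp
    from akernel_shift[OF this, of B y] show ?thesis
      unfolding g_def using akernel_pos[of B m u y] by (subst ennreal_mult[symmetric]) (auto intro!: ennreal_leI)
  qed
  have "(\<integral>\<^sup>+x. ennreal (aw n x * akernel B m x y) * indicator {-1..1} x \<partial>lborel)
     = (\<integral>\<^sup>+x. ennreal (aw n x) * g x * indicator {-1..1} x \<partial>lborel)"
    unfolding g_def using mn
    by (intro nn_integral_cong) (auto simp: indicator_def ennreal_mult aw_nonneg akernel_pos less_imp_le)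
  also have "\<dots> \<le> ennreal (162 * 8 ^ B) * (\<integral>\<^sup>+u. g u \<partial>\<mu>)"
    by (rule nn_integral_aw_le[OF mn gm slow]) auto
  also have "\<dots> \<le> ennreal (162 * 8 ^ B) * (ennreal (24 * 8 ^ B) * (\<integral>\<^sup>+x.
      ennreal (aw m x) * g x * indicator {-1..1} x \<partial>lborel))"
    by (intro mult_left_mono nn_integral_le_aw[OF mn(1) gm slow]) auto
  also have "(\<integral>\<^sup>+x. ennreal (aw m x) * g x * indicator {-1..1} x \<partial>lborel)
     \<le> (\<integral>\<^sup>+x. ennreal (3 ^ s * aw m y) * (ennreal (akernel (B - (2 * s + 1)) m x y) * indicator {-1..1} x) \<partial>lborel)"
  proof (intro nn_integral_mono)
    fix x :: real
    show "ennreal (aw m x) * g x * indicator {-1..1} x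
      \<le> ennreal (3 ^ s * aw m y) * (ennreal (akernel (B - (2 * s + 1)) m x y) * indicator {-1..1} x)"
    proof (cases "x \<in> {-1..1}")
      case True
      have "aw m x * akernel B m x y \<le> 3 ^ s * (1 + adist m y x) ^ (2 * s + 1) * aw m y * akernel B m x y"
        using aw_le[OF mn(1) y True] akernel_pos[of B m x y] by (intro mult_right_mono) auto
      also have "\<dots> = 3 ^ s * aw m y * (akernel B m x y * (1 + adist m x y) ^ (2 * s + 1))"
        by (simp only: adist_commute ac_simps)
      also have "\<dots> = 3 ^ s * aw m y * akernel (B - (2 * s + 1)) m x y"
        using B by (subst akernel_mult_power) auto
      finally show ?thesis using True mn ay akernel_pos[of B m x y] akernel_pos[of "B - (2 * s + 1)" m x y]
        unfolding g_def by (simp add: ennreal_mult[symmetric] aw_nonneg ennreal_leI)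
    qed auto
  qed
  also have "\<dots> = ennreal (3 ^ s * aw m y) * (\<integral>\<^sup>+x. (ennreal (akernel (B - (2 * s
      + 1)) m x y) * indicator {-1..1} x) \<partial>lborel)"
    by (rule nn_integral_cmult) measurable
  also have "\<dots> \<le> ennreal (3 ^ s * aw m y) * ennreal (4 * rho m y)"
    using B mn y by (intro mult_left_mono nn_integral_akernel) auto
  also have "ennreal (162 * 8 ^ B) * (ennreal (24 * 8 ^ B) * (ennreal (3 ^ s * aw m y) * ennreal (4 * rho m y)))
     = ennreal ((162 * 8 ^ B) * ((24 * 8 ^ B) * ((3 ^ s * aw m y) * (4 * rho m y))))"
    using ay ry by (simp add: ennreal_mult[symmetric] del: ennreal_numeral)
  also have "(162 * 8 ^ B) * ((24 * 8 ^ B) * ((3 ^ s * aw m y) * (4 * rho m y)))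
      = 15552 * 64 ^ B * 3 ^ s * (rho m y * aw m y)"
    by (simp add: power_mult_distrib[symmetric] flip: mult.assoc)
  finally show ?thesis by (simp add: mult_left_mono)
qed

section \<open>Symmetric differences with step h phi(x)\<close>

lemma phi_pos: "\<bar>x\<bar> < 1 \<Longrightarrow> 0 < phi x"
  by (simp add: phi_def abs_square_less_1)

lemma phi_nonneg: "x \<in> {-1..1} \<Longrightarrow> 0 \<le> phi x"
  by (simp add: phi_def abs_square_le_1 abs_le_iff)

lemma phi_borel [measurable]: "phi \<in> borel_measurable borel"
  unfolding phi_def by measurable

lemma phi_le_rho: "1 \<le> n \<Longrightarrow> phi x / real n \<le> rho n x"
  by (simp add: phi_def rho_def)

text \<open>On the side nearer to the boundary a phi(x) <= 1 - |x|; squaring and cancelling one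
  factor 1 - |x| leaves a linear inequality. The cancellation requires |x| < 1: at the endpoints phi
  vanishes and every shift is admissible.\<close>

lemma shift_domain:
  assumes "\<bar>x\<bar> < 1" "0 \<le> a" "x - a * phi x \<in> {-1..1}" "x + a * phi x \<in> {-1..1}"
  shows "\<bar>x\<bar> \<le> (1 - a\<^sup>2) / (1 + a\<^sup>2)"
proof -
  have *: "z \<le> (1 - a\<^sup>2) / (1 + a\<^sup>2)" if "\<bar>z\<bar> < 1" "a * phi z \<le> 1 - z" for z
  proof -
    have z2: "z\<^sup>2 \<le> 1" using that(1) by (simp add: abs_square_le_1)
    have "(a * phi z)\<^sup>2 \<le> (1 - z)\<^sup>2" using that assms by (intro power_mono) (auto simp: phi_def z2)
    hence "a\<^sup>2 * ((1 - z) * (1 + z)) \<le> (1 - z) * (1 - z)"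
      using z2 by (simp add: phi_def power_mult_distrib) (simp add: power2_eq_square algebra_simps)
    hence "(1 - z) * (a\<^sup>2 * (1 + z)) \<le> (1 - z) * (1 - z)" by (simp add: algebra_simps)
    hence "a\<^sup>2 * (1 + z) \<le> 1 - z" using that(1) by (simp add: abs_less_iff)
    hence "z * (1 + a\<^sup>2) \<le> 1 - a\<^sup>2" by (simp add: algebra_simps)
    thus ?thesis by (subst pos_le_divide_eq) (auto simp: add_pos_nonneg)
  qed
  have "phi (- x) = phi x" by (simp add: phi_def)
  with *[of x] *[of "-x"] assms show ?thesis by (auto simp: abs_le_iff)
qed

text \<open>X solves X + a phi(X) = 1, and phi(X) = 2 a / (1 + a^2). The quotient |x| / phi(x) is
  largest at the ends of {-X..X}, so the derivative 1 - c x / phi(x) is at least 1 - (1 - a^2)/2,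
  hence at least 1/2. This is the factor 2.\<close>

lemma nn_integral_shift_phi:
  fixes F :: "real \<Rightarrow> ennreal"
  assumes [measurable]: "F \<in> borel_measurable borel" and a: "0 < a" "\<bar>c\<bar> \<le> a"
  defines "X \<equiv> (1 - a\<^sup>2) / (1 + a\<^sup>2)"
  shows "(\<integral>\<^sup>+x. F (x + c * phi x) * indicator {-X..X} x \<partial>lborel) \<le> 2 * (\<integral>\<^sup>+y. F y * indicator {-1..1} y \<partial>lborel)"
proof (cases "0 < X")
  case False
  \<comment> \<open>In this case the range of integration is empty or the single point 0.\<close>
  have "AE x in lborel. x \<noteq> (0::real)" by (rule AE_lborel_singleton)
  hence "(\<integral>\<^sup>+x. F (x + c * phi x) * indicator {-X..X} x \<partial>lborel) = (\<integral>\<^sup>+(x::real). 0 \<partial>lborel)"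
    using False by (intro nn_integral_cong_AE) (auto simp: indicator_def)
  thus ?thesis by simp
next
  case True
  have a2: "0 < 1 + a\<^sup>2" by (auto simp: add_pos_nonneg)
  have phiX: "phi X = 2 * a / (1 + a\<^sup>2)"
  proof -
    have "1 - X\<^sup>2 = (2 * a / (1 + a\<^sup>2))\<^sup>2"
      using a2 unfolding X_def by (simp add: power_divide divide_simps) (simp add: algebra_simps power2_eq_square)
    thus ?thesis using a a2 by (simp add: phi_def)
  qed
  define \<psi> where "\<psi> x = x + c * phi x" for x
  define \<psi>' where "\<psi>' x = 1 - c * x / phi x" for x
  have ph: "phi X \<le> phi x" "0 < phi x" if "x \<in> {-X..X}" for x
  proof -
    have "\<bar>x\<bar> \<le> \<bar>X\<bar>" using that True by auto
    hence "x\<^sup>2 \<le> X\<^sup>2" by (simp add: abs_le_square_iff)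
    thus le: "phi X \<le> phi x" by (simp add: phi_def)
    have "0 < phi X" unfolding phiX using a a2 by simp
    thus "0 < phi x" using le by linarith
  qed
  have half: "1 / 2 \<le> \<psi>' x" if "x \<in> {-X..X}" for x
  proof -
    have "c * x / phi x \<le> \<bar>c\<bar> * \<bar>x\<bar> / phi x" using ph[OF that]
      by (intro divide_right_mono) (auto simp: abs_mult[symmetric])
    also have "\<dots> \<le> a * X / phi X"
      using a that ph[OF that] True phiX a2 by (intro frac_le mult_mono) auto
    also have "\<dots> = (1 - a\<^sup>2) / 2" using a a2 by (simp only: phiX) (simp add: X_def divide_simps)
    also have "\<dots> \<le> 1 / 2" by simp
    finally show ?thesis by (simp add: \<psi>'_def)
  qed
  have deriv: "(\<psi> has_real_derivative \<psi>' x) (at x)" if "x \<in> {-X..X}" for x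
  proof -
    have "0 < 1 - x\<^sup>2" using ph(2)[OF that] by (simp add: phi_def)
    thus ?thesis unfolding \<psi>_def \<psi>'_def phi_def
      by (auto intro!: derivative_eq_intros simp: field_simps)
  qed
  have "(\<integral>\<^sup>+x. F (x + c * phi x) * indicator {-X..X} x \<partial>lborel)
      \<le> (\<integral>\<^sup>+x. 2 * (F (\<psi> x) * ennreal (\<psi>' x) * indicator {-X..X} x) \<partial>lborel)"
  proof (intro nn_integral_mono)
    fix x :: real
    show "F (x + c * phi x) * indicator {-X..X} x \<le> 2 * (F (\<psi> x) * ennreal (\<psi>' x) * indicator {-X..X} x)"
    proof (cases "x \<in> {-X..X}")
      case True
      have "1 \<le> ennreal (2 * \<psi>' x)" using half[OF True] by (simp add: ennreal_ge_1)
      hence "1 * F (\<psi> x) \<le> ennreal (2 * \<psi>' x) * F (\<psi> x)" by (intro mult_right_mono) auto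
      also have "\<dots> = 2 * (F (\<psi> x) * ennreal (\<psi>' x))" using half[OF True] by (simp add: ennreal_mult ac_simps)
      finally show ?thesis using True by (simp add: \<psi>_def)
    qed auto
  qed
  also have "\<dots> = 2 * (\<integral>\<^sup>+x. F (\<psi> x) * ennreal (\<psi>' x) * indicator {-X..X} x \<partial>lborel)"
    unfolding \<psi>_def \<psi>'_def by (rule nn_integral_cmult) measurable
  also have "(\<integral>\<^sup>+x. F (\<psi> x) * ennreal (\<psi>' x) * indicator {-X..X} x \<partial>lborel)
      = (\<integral>\<^sup>+y. F y * indicator {\<psi> (-X)..\<psi> X} y \<partial>lborel)"
  proof (rule nn_integral_substitution_aux[symmetric])
    show "continuous_on {-X..X} \<psi>'" unfolding \<psi>'_def
    proof (intro continuous_intros)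
      show "continuous_on {- X..X} phi" unfolding phi_def by (intro continuous_intros)
    qed (use ph in force)
    show "0 \<le> \<psi>' x" if "x \<in> {-X..X}" for x using half[OF that] by linarith
  qed (use True deriv in auto)
  also have "\<dots> \<le> (\<integral>\<^sup>+y. F y * indicator {-1..1} y \<partial>lborel)"
  proof -
    have "\<bar>c * phi X\<bar> \<le> a * phi X" using a a2 by (simp add: abs_mult phiX divide_right_mono mult_right_mono)
    moreover have "X + a * phi X = 1"
      using a2 by (simp only: phiX) (simp add: X_def divide_simps, simp add: power2_eq_square)
    moreover have "phi (- X) = phi X" by (simp add: phi_def)
    ultimately have "{\<psi> (-X)..\<psi> X} \<subseteq> {-1..1}" unfolding \<psi>_def by (auto simp: abs_le_iff)
    thus ?thesis by (intro nn_integral_mono mult_left_mono) (auto simp: indicator_def)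
  qed
  finally show ?thesis by (simp add: mult_left_mono)
qed

text \<open>The binomial coefficients sum to 2^r, and the largest term is bounded by the l_p-sum of
  all. The indicator keeps x in the range where the substitution of
  \<open>nn_integral_shift_phi\<close> is available, which \<open>shift_domain\<close> permits
  because the difference is 0 elsewhere.\<close>

lemma sym_diff_bound:
  assumes x: "\<bar>x\<bar> < 1" and h: "0 < h" and r: "1 \<le> r" and p: "0 < p"
  defines "X \<equiv> (1 - (real r * h / 2)\<^sup>2) / (1 + (real r * h / 2)\<^sup>2)"
  shows "\<bar>sym_diff r (h * phi x) g x\<bar> powr p
     \<le> (\<Sum>i\<le>r. 2 powr (real r * p) * \<bar>g (x + (real i - real r / 2) * h * phi x)\<bar> powr p * indicator {-X..X} x)"
proof (cases "x - real r * (h * phi x) / 2 \<in> {-1..1} \<and> x + real r * (h * phi x) / 2 \<in> {-1..1}")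
  case False
  hence "sym_diff r (h * phi x) g x = 0" by (auto simp: sym_diff_def)
  moreover have "0 \<le> (\<Sum>i\<le>r. 2 powr (real r * p) * \<bar>g (x + (real i - real r / 2) * h * phi x)\<bar> powr p
      * indicator {-X..X} x)"
    by (intro sum_nonneg mult_nonneg_nonneg) auto
  ultimately show ?thesis using p by simp
next
  case True
  define G where "G i = \<bar>g (x + (real i - real r / 2) * h * phi x)\<bar>" for i
  have G0: "0 \<le> G i" for i by (simp add: G_def)
  have "\<bar>x\<bar> \<le> X" unfolding X_def
    by (rule shift_domain) (use True x h r in \<open>auto simp: algebra_simps\<close>)
  hence ind: "x \<in> {-X..X}" by auto
  define B where "B = (\<Sum>i\<le>r. G i powr p) powr (1 / p)"
  have "\<bar>sym_diff r (h * phi x) g x\<bar> = \<bar>fdiff r (h * phi x) g (x - real r * (h * phi x) / 2)\<bar>"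
    using True by (intro sym_diff_fdiff) auto
  also have "\<dots> \<le> 2 ^ r * B"
  proof (rule fdiff_abs_le)
    fix i assume i: "i \<le> r"
    have "G i = (G i powr p) powr (1 / p)" using p G0[of i] by (simp add: powr_powr)
    also have "\<dots> \<le> B" unfolding B_def using i p
      by (intro powr_mono2 member_le_sum) auto
    finally show "\<bar>g (x - real r * (h * phi x) / 2 + real i * (h * phi x))\<bar> \<le> B"
      by (simp add: G_def algebra_simps)
  qed
  finally have "\<bar>sym_diff r (h * phi x) g x\<bar> powr p \<le> (2 ^ r * B) powr p"
    using p by (intro powr_mono2) auto
  also have "\<dots> = 2 powr (real r * p) * (\<Sum>i\<le>r. G i powr p)"
    using p by (simp add: B_def powr_mult powr_powr powr_realpow[symmetric] sum_nonneg)
  finally show ?thesis using ind by (simp add: G_def sum_distrib_left)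
qed

text \<open>On the domain of the difference the maps $x \mapsto x + c\varphi(x)$ are injective with derivative
  bounded below, hence they pull null sets back to null sets.\<close>

lemma AE_sym_diff_eq:
  assumes N: "N \<in> null_sets lborel" and eq: "\<And>x. x \<in> {-1..1} \<Longrightarrow> x \<notin> N \<Longrightarrow> f x = f' x"
    and h: "0 < h" and r: "1 \<le> r"
  shows "AE x in lborel. x \<in> {-1..1} \<longrightarrow> sym_diff r (h * phi x) f x = sym_diff r (h * phi x) f' x"
proof -
  define a where "a = real r * h / 2"
  define X where "X = (1 - a\<^sup>2) / (1 + a\<^sup>2)"
  have a: "0 < a" using h r by (simp add: a_def)
  have N': "N \<in> sets borel" "emeasure lborel N = 0" using N by (auto simp: null_sets_def)
  have AEi: "AE x in lborel. x \<in> {-X..X} \<longrightarrow> x + (real i - real r / 2) * h * phi x \<notin> N" if i: "i \<le> r" for i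
  proof -
    define c where "c = (real i - real r / 2) * h"
    have "\<bar>real i - real r / 2\<bar> \<le> real r / 2" using i by (auto simp: abs_if)
    hence c: "\<bar>c\<bar> \<le> a" using h by (simp add: c_def a_def abs_mult)
    have [measurable]: "indicator N \<in> borel_measurable borel" using N' by simp
    have "(\<integral>\<^sup>+x. indicator N (x + c * phi x) * indicator {-X..X} x \<partial>lborel)
        \<le> 2 * (\<integral>\<^sup>+y. indicator N y * indicator {-1..1} y \<partial>lborel)"
      unfolding X_def using a c by (intro nn_integral_shift_phi) (use N' in auto)
    also have "(\<integral>\<^sup>+y. indicator N y * indicator {-1..1} y \<partial>lborel) \<le> (\<integral>\<^sup>+y. indicator N y \<partial>lborel)"
      by (intro nn_integral_mono) (auto simp: indicator_def)
    also have "\<dots> = 0" using N' by simp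
    finally have "(\<integral>\<^sup>+x. indicator N (x + c * phi x) * indicator {-X..X} x \<partial>lborel) = 0"
      by (simp add: mult_left_mono)
    hence "AE x in lborel. (indicator N (x + c * phi x) * indicator {-X..X} x :: ennreal) = 0"
      by (subst (asm) nn_integral_0_iff_AE) (use N' in measurable)
    thus ?thesis unfolding c_def by eventually_elim (auto simp: indicator_def split: if_splits)
  qed
  have "AE x in lborel. \<forall>i\<in>{..r}. x \<in> {-X..X} \<longrightarrow> x + (real i - real r / 2) * h * phi x \<notin> N"
    using AEi by (intro AE_finite_allI) auto
  moreover have "AE x in lborel. x \<noteq> (1::real)" "AE x in lborel. x \<noteq> (-1::real)"
    by (rule AE_lborel_singleton)+
  ultimately show ?thesis
  proof eventually_elim
    fix x :: real
    assume *: "\<forall>i\<in>{..r}. x \<in> {-X..X} \<longrightarrow> x + (real i - real r / 2) * h * phi x \<notin> N" and "x \<noteq> 1" "x \<noteq> -1"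
    show "x \<in> {-1..1} \<longrightarrow> sym_diff r (h * phi x) f x = sym_diff r (h * phi x) f' x"
    proof
      assume x1: "x \<in> {-1..1}"
      show "sym_diff r (h * phi x) f x = sym_diff r (h * phi x) f' x"
    proof (cases "x - real r * (h * phi x) / 2 \<in> {-1..1} \<and> x + real r * (h * phi x) / 2 \<in> {-1..1}")
      case True
      have x: "\<bar>x\<bar> < 1" using x1 \<open>x \<noteq> 1\<close> \<open>x \<noteq> -1\<close> by auto
      have "\<bar>x\<bar> \<le> X" unfolding X_def
        by (rule shift_domain) (use True x a in \<open>auto simp: a_def algebra_simps\<close>)
      hence xX: "x \<in> {-X..X}" by auto
      have ph: "0 \<le> h * phi x" using h phi_pos[OF x] by simp
      have "f (x - real r * (h * phi x) / 2 + real i * (h * phi x))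
          = f' (x - real r * (h * phi x) / 2 + real i * (h * phi x))"
        if i: "i \<le> r" for i
      proof (rule eq)
        have e: "x - real r * (h * phi x) / 2 + real i * (h * phi x) = x + (real i - real r / 2) * h * phi x"
          by (simp add: algebra_simps)
        show "x - real r * (h * phi x) / 2 + real i * (h * phi x) \<notin> N"
          unfolding e using * xX i by auto
        have "0 \<le> real i * (h * phi x)" "real i * (h * phi x) \<le> real r * (h * phi x)"
          using ph i by (auto intro!: mult_right_mono mult_nonneg_nonneg)
        thus "x - real r * (h * phi x) / 2 + real i * (h * phi x) \<in> {-1..1}" using True by auto
      qed
      thus ?thesis unfolding sym_diff_def by (auto intro!: sum.cong)
    qed (auto simp: sym_diff_def)
    qed
  qed
qed

lemma sym_diff_borel:
  assumes [measurable]: "f \<in> borel_measurable borel"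
  shows "(\<lambda>x. sym_diff r (h * phi x) f x) \<in> borel_measurable borel"
  unfolding sym_diff_def by measurable

text \<open>For h <= 1/n all nodes of the difference are within (r/2) rho_n(x) of x, so w_n changes
  between x and a node by a bounded factor only. With the weight moved to the node, every term is a
  substitution instance of the right side.\<close>

lemma (in doubling_measure) nn_integral_sym_diff_le:
  assumes n: "2 \<le> n" and h: "0 < h" "h \<le> 1 / real n" and r: "1 \<le> r" and p: "0 < p"
    and [measurable]: "g \<in> borel_measurable borel"
  shows "(\<integral>\<^sup>+x. ennreal (\<bar>sym_diff r (h * phi x) g x\<bar> powr p * aw n x) * indicator {-1..1} x \<partial>lborel)
    \<le> ennreal (real (Suc r) * 2 powr (real r * p) * 3 ^ s * (1 + 4 * real r) ^ (2 * s + 1) * 2)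
       * (\<integral>\<^sup>+x. ennreal (\<bar>g x\<bar> powr p * aw n x) * indicator {-1..1} x \<partial>lborel)"
proof -
  define a where "a = real r * h / 2"
  define X where "X = (1 - a\<^sup>2) / (1 + a\<^sup>2)"
  define c where "c i = (real i - real r / 2) * h" for i
  define D where "D = 3 ^ s * (1 + 4 * real r) ^ (2 * s + 1)"
  define E where "E = (2::real) powr (real r * p)"
  define F where "F x = ennreal (\<bar>g x\<bar> powr p * aw n x)" for x
  have [measurable]: "F \<in> borel_measurable borel" unfolding F_def by measurable
  have a: "0 < a" using h r by (simp add: a_def)
  have c: "\<bar>c i\<bar> \<le> a" if "i \<le> r" for i
  proof -
    have "\<bar>real i - real r / 2\<bar> \<le> real r / 2" using that by (auto simp: abs_if)
    thus ?thesis using h by (simp add: c_def a_def abs_mult)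
  qed
  have D: "0 \<le> D" "0 \<le> E" by (auto simp: D_def E_def)
  have "(\<integral>\<^sup>+x. ennreal (\<bar>sym_diff r (h * phi x) g x\<bar> powr p * aw n x) * indicator {-1..1} x \<partial>lborel)
    \<le> (\<integral>\<^sup>+x. (\<Sum>i\<le>r. ennreal (E * D) * (F (x + c i * phi x) * indicator {-X..X} x)) \<partial>lborel)"
  proof (rule nn_integral_mono_AE)
    have "AE x in lborel. x \<noteq> (1::real)" "AE x in lborel. x \<noteq> (-1::real)"
      by (rule AE_lborel_singleton)+
    thus "AE x in lborel. ennreal (\<bar>sym_diff r (h * phi x) g x\<bar> powr p * aw n x) * indicator {-1..1} x
       \<le> (\<Sum>i\<le>r. ennreal (E * D) * (F (x + c i * phi x) * indicator {-X..X} x))"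
    proof eventually_elim
      fix x :: real assume ne: "x \<noteq> 1" "x \<noteq> -1"
      show "ennreal (\<bar>sym_diff r (h * phi x) g x\<bar> powr p * aw n x) * indicator {-1..1} x
       \<le> (\<Sum>i\<le>r. ennreal (E * D) * (F (x + c i * phi x) * indicator {-X..X} x))"
      proof (cases "x \<in> {-1..1}")
        case True
        hence x: "\<bar>x\<bar> < 1" using ne by auto
        have ax: "0 \<le> aw n x" using True n by (intro aw_nonneg) auto
        have "\<bar>sym_diff r (h * phi x) g x\<bar> powr p * aw n x
           \<le> (\<Sum>i\<le>r. E * \<bar>g (x + c i * phi x)\<bar> powr p * indicator {-X..X} x) * aw n x"
          unfolding E_def X_def a_def c_def by (intro mult_right_mono sym_diff_bound x h r p ax)
        also have "\<dots> = (\<Sum>i\<le>r. E * \<bar>g (x + c i * phi x)\<bar> powr p * indicator {-X..X} x * aw n x)"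
          by (rule sum_distrib_right)
        also have "ennreal \<dots> = (\<Sum>i\<le>r. ennreal (E * \<bar>g (x + c i * phi x)\<bar> powr p * indicator {-X..X} x * aw n x))"
          using D ax by (intro sum_ennreal[symmetric]) auto
        also have "\<dots> \<le> (\<Sum>i\<le>r. ennreal (E * D) * (F (x + c i * phi x) * indicator {-X..X} x))"
        proof (intro sum_mono)
          fix i assume "i \<in> {..r}"
          hence ci: "\<bar>c i\<bar> \<le> a" using c by auto
          show "ennreal (E * \<bar>g (x + c i * phi x)\<bar> powr p * indicator {-X..X} x * aw n x)
             \<le> ennreal (E * D) * (F (x + c i * phi x) * indicator {-X..X} x)"
          proof (cases "x \<in> {-X..X}")
            case xX: True
            define y where "y = x + c i * phi x"
            \<comment> \<open>The converse of \<open>shift_domain\<close>: |x| <= X implies a phi(x)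
              <= 1 - |x|.\<close>
            have y: "y \<in> {-1..1}"
            proof -
              have "\<bar>c i * phi x\<bar> \<le> a * phi x" using ci phi_pos[OF x] by (simp add: abs_mult)
              moreover have "a * phi x \<le> 1 - \<bar>x\<bar>"
              proof -
                have "a\<^sup>2 * (1 + \<bar>x\<bar>) \<le> 1 - \<bar>x\<bar>"
                proof -
                  have "\<bar>x\<bar> \<le> (1 - a\<^sup>2) / (1 + a\<^sup>2)" using xX by (simp add: X_def abs_le_iff)
                  hence "\<bar>x\<bar> * (1 + a\<^sup>2) \<le> 1 - a\<^sup>2" by (subst (asm) pos_le_divide_eq) (auto simp: add_pos_nonneg)
                  thus ?thesis by (simp add: algebra_simps)
                qed
                hence "(1 - \<bar>x\<bar>) * (a\<^sup>2 * (1 + \<bar>x\<bar>)) \<le> (1 - \<bar>x\<bar>) * (1 - \<bar>x\<bar>)"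
                  using x by (intro mult_left_mono) auto
                moreover have "(phi x)\<^sup>2 = (1 - \<bar>x\<bar>) * (1 + \<bar>x\<bar>)"
                  using x abs_square_less_1[of x] by (simp add: phi_def algebra_simps power2_eq_square)
                ultimately have "(a * phi x)\<^sup>2 \<le> (1 - \<bar>x\<bar>)\<^sup>2"
                  by (simp add: power_mult_distrib) (simp add: power2_eq_square algebra_simps)
                thus ?thesis by (rule power2_le_imp_le) (use x in auto)
              qed
              ultimately show ?thesis using x unfolding y_def by (auto simp: abs_le_iff)
            qed
            have "\<bar>x - y\<bar> \<le> real r / 2 * rho n x"
            proof -
              have "\<bar>x - y\<bar> = \<bar>c i\<bar> * phi x" using phi_pos[OF x] by (simp add: y_def abs_mult)
              also have "\<dots> \<le> (real r / 2 * (1 / real n)) * phi x"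
                using ci h r phi_pos[OF x] mult_left_mono[OF h(2), of "real r / 2"]
                by (intro mult_right_mono) (auto simp: a_def)
              also have "\<dots> \<le> real r / 2 * rho n x"
                using mult_left_mono[OF phi_le_rho[of n x], of "real r / 2"] n by simp
              finally show ?thesis .
            qed
            hence "adist n x y \<le> pi * max (2 * (real r / 2)) (sqrt (real r / 2))"
              using n by (intro adist_le_of_dist True y) auto
            also have "\<dots> \<le> 4 * real r"
            proof (intro mult_mono)
              have "sqrt (real r / 2) \<le> sqrt ((real r)\<^sup>2)"
                using r by (intro real_sqrt_le_mono) (auto simp: power2_eq_square)
              thus "max (2 * (real r / 2)) (sqrt (real r / 2)) \<le> real r" by simp
            qed (use pi_less_4 in auto)
            finally have "(1 + adist n y x) ^ (2 * s + 1) \<le> (1 + 4 * real r) ^ (2 * s + 1)"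
              by (intro power_mono) (auto simp: adist_commute)
            hence "3 ^ s * (1 + adist n y x) ^ (2 * s + 1) * aw n y \<le> D * aw n y"
              unfolding D_def using y n by (intro mult_right_mono mult_left_mono aw_nonneg) auto
            hence "aw n x \<le> D * aw n y" using aw_le[OF n y True] by linarith
            hence "(E * \<bar>g y\<bar> powr p) * aw n x \<le> (E * \<bar>g y\<bar> powr p) * (D * aw n y)"
              using D by (intro mult_left_mono) auto
            also have "\<dots> = (E * D) * (\<bar>g y\<bar> powr p * aw n y)" by simp
            finally have "ennreal ((E * \<bar>g y\<bar> powr p) * aw n x) \<le> ennreal (E * D) * F y"
              unfolding F_def using D by (subst ennreal_mult'[symmetric]) (auto intro!: ennreal_leI)
            thus ?thesis using xX by (simp add: y_def)
          qed auto
        qed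
        finally show ?thesis using True by (simp add: ennreal_leI)
      qed auto
    qed
  qed
  also have "\<dots> = (\<Sum>i\<le>r. ennreal (E * D) * (\<integral>\<^sup>+x. F (x + c i * phi x) * indicator {-X..X} x \<partial>lborel))"
    by (subst nn_integral_sum) (auto intro!: sum.cong nn_integral_cmult)
  also have "\<dots> \<le> (\<Sum>i\<le>r. ennreal (E * D) * (2 * (\<integral>\<^sup>+y. F y * indicator {-1..1} y \<partial>lborel)))"
    unfolding X_def using a c by (intro sum_mono mult_left_mono nn_integral_shift_phi) auto
  also have "\<dots> = ennreal (real (Suc r) * E * D * 2) * (\<integral>\<^sup>+y. F y * indicator {-1..1} y \<partial>lborel)"
  proof -
    have "ennreal (real (Suc r) * E * D * 2) = of_nat (Suc r) * ennreal (E * D) * 2"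
      using D by (simp add: ennreal_mult ennreal_of_nat_eq_real_of_nat ac_simps)
    thus ?thesis by (simp add: ac_simps)
  qed
  finally show ?thesis unfolding F_def E_def D_def by (simp only: ac_simps)
qed

section \<open>Trigonometric polynomials near the real axis\<close>

text \<open>Trigonometric polynomials of degree at most $N$ on the complex plane, multiplied by $e^{iNz}$
  so that only non-negative powers of $e^{iz}$ occur.\<close>

definition trigp :: "nat \<Rightarrow> (complex \<Rightarrow> complex) \<Rightarrow> bool" where
  "trigp N U \<longleftrightarrow> (\<exists>Q. degree Q \<le> 2 * N \<and> (\<forall>z. U z * exp (\<i> * z) ^ N = poly Q (exp (\<i> * z))))"

lemma trigp_mult:
  assumes "trigp N U" "trigp M V"
  shows "trigp (N + M) (\<lambda>z. U z * V z)"
proof -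
  obtain Q R where Q: "degree Q \<le> 2 * N" "\<And>z. U z * exp (\<i> * z) ^ N = poly Q (exp (\<i> * z))"
    and R: "degree R \<le> 2 * M" "\<And>z. V z * exp (\<i> * z) ^ M = poly R (exp (\<i> * z))"
    using assms by (auto simp: trigp_def)
  have "degree (Q * R) \<le> 2 * (N + M)" using degree_mult_le[of Q R] Q R by simp
  moreover have "U z * V z * exp (\<i> * z) ^ (N + M) = poly (Q * R) (exp (\<i> * z))" for z
    unfolding poly_mult Q(2)[symmetric] R(2)[symmetric] power_add by (simp only: mult_ac)
  ultimately show ?thesis unfolding trigp_def by blast
qed

lemma trigp_const: "trigp N (\<lambda>_. c)"
  unfolding trigp_def by (rule exI[of _ "monom c N"]) (auto simp: poly_monom intro: order.trans[OF degree_monom_le])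

lemma trigp_add:
  assumes "trigp N U" "trigp N V"
  shows "trigp N (\<lambda>z. U z + V z)"
proof -
  obtain Q R where Q: "degree Q \<le> 2 * N" "\<And>z. U z * exp (\<i> * z) ^ N = poly Q (exp (\<i> * z))"
    and R: "degree R \<le> 2 * N" "\<And>z. V z * exp (\<i> * z) ^ N = poly R (exp (\<i> * z))"
    using assms by (auto simp: trigp_def)
  have "degree (Q + R) \<le> 2 * N" using Q R by (intro degree_add_le)
  moreover have "(U z + V z) * exp (\<i> * z) ^ N = poly (Q + R) (exp (\<i> * z))" for z
    by (simp add: distrib_right Q R)
  ultimately show ?thesis unfolding trigp_def by blast
qed

lemma trigp_power: "trigp N U \<Longrightarrow> trigp (M * N) (\<lambda>z. U z ^ M)"
proof (induction M)
  case 0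
  show ?case using trigp_const[of 0 1] by simp
next
  case (Suc M)
  thus ?case using trigp_mult[of N U "M * N" "\<lambda>z. U z ^ M"] by simp
qed

lemma trigp_cos: "trigp 1 cos"
  unfolding trigp_def
proof (intro exI[of _ "[:1/2, 0, 1/2:]"] conjI allI)
  fix z :: complex
  show "cos z * exp (\<i> * z) ^ 1 = poly [:1/2, 0, 1/2:] (exp (\<i> * z))"
    by (simp add: cos_exp_eq distrib_right exp_minus field_simps)
qed auto

lemma trigp_poly_cos: "degree p \<le> N \<Longrightarrow> trigp N (\<lambda>z. poly p (cos z))"
proof (induction p arbitrary: N)
  case 0
  show ?case using trigp_const[of N 0] by simp
next
  case (pCons a p)
  show ?case
  proof (cases "p = 0")
    case True
    thus ?thesis using trigp_const[of N a] by simp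
  next
    case False
    then obtain K where N: "N = Suc K" "degree p \<le> K" using pCons.prems by (cases N) auto
    have "trigp (1 + K) (\<lambda>z. cos z * poly p (cos z))"
      by (rule trigp_mult[OF trigp_cos pCons.IH[OF N(2)]])
    from trigp_add[OF trigp_const[of N a], of "\<lambda>z. cos z * poly p (cos z)"] this N(1)
    show ?thesis by simp
  qed
qed

lemma exp_has_integral_full_period:
  fixes j :: int
  shows "((\<lambda>s::real. exp (\<i> * of_int j * of_real s)) has_integral (if j = 0 then of_real (2 * pi) else 0)) {-pi..pi}"
proof (cases "j = 0")
  case True
  have "((\<lambda>s::real. 1::complex) has_integral (pi - (-pi)) *\<^sub>R 1) {-pi..pi}"
    using has_integral_const_real[of "1::complex" "-pi" pi] by simp
  thus ?thesis using True by (simp add: scaleR_conv_of_real)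
next
  case False
  define F where "F s = exp (\<i> * of_int j * of_real s) / (\<i> * of_int j)" for s :: real
  have "((\<lambda>s::real. exp (\<i> * of_int j * of_real s)) has_integral F pi - F (-pi)) {-pi..pi}"
  proof (rule fundamental_theorem_of_calculus)
    fix x :: real
    have "((\<lambda>z::complex. exp (\<i> * of_int j * z) / (\<i> * of_int j)) has_field_derivative exp (\<i> * of_int j
        * of_real x)) (at (of_real x))"
      using False by (auto intro!: derivative_eq_intros)
    from has_vector_derivative_real_field[OF this, of "{-pi..pi}"]
    show "(F has_vector_derivative exp (\<i> * of_int j * of_real x)) (at x within {-pi..pi})"
      unfolding F_def .
  qed simp
  moreover have "exp (\<i> * of_int j * of_real pi) = exp (\<i> * of_int j * of_real (-pi))"
  proof -
    show ?thesis unfolding exp_eq by (rule exI[of _ j]) (simp add: algebra_simps)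
  qed
  ultimately show ?thesis using False by (simp add: F_def)
qed

text \<open>By orthogonality of the exponentials the coefficients are Fourier coefficients on the
  unit circle.\<close>

lemma coeff_norm_le_integral:
  fixes Q :: "complex poly"
  shows "2 * pi * norm (coeff Q k) \<le> integral {-pi..pi} (\<lambda>s. norm (poly Q (exp (\<i> * of_real s))))"
proof -
  define e where "e j s = exp (\<i> * of_int j * of_real s)" for j :: int and s :: real
  have "((\<lambda>s. \<Sum>j\<le>degree Q. coeff Q j * e (int j - int k) s) has_integral
          (\<Sum>j\<le>degree Q. coeff Q j * (if int j - int k = 0 then of_real (2 * pi) else 0))) {-pi..pi}"
    unfolding e_def by (intro has_integral_sum has_integral_mult_right exp_has_integral_full_period) auto
  moreover have "(\<Sum>j\<le>degree Q. coeff Q j * (if int j - int k = 0 then of_real (2 * pi) else 0))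
      = of_real (2 * pi) * coeff Q k"
  proof -
    have "(\<Sum>j\<le>degree Q. coeff Q j * (if int j - int k = 0 then of_real (2 * pi) else 0))
       = (\<Sum>j\<le>degree Q. if j = k then coeff Q j * of_real (2 * pi) else 0)"
      by (intro sum.cong) auto
    also have "\<dots> = of_real (2 * pi) * coeff Q k" by (auto simp: coeff_eq_0 not_le)
    finally show ?thesis .
  qed
  moreover have "(\<Sum>j\<le>degree Q. coeff Q j * e (int j - int k) s) = poly Q (exp (\<i> * of_real s)) * e (- int k) s" for s
  proof -
    have "e (int j - int k) s = exp (\<i> * of_real s) ^ j * e (- int k) s" for j
      unfolding e_def exp_of_nat_mult[symmetric] exp_add[symmetric] by (simp add: algebra_simps)
    thus ?thesis by (simp add: poly_altdef sum_distrib_right mult.assoc)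
  qed
  ultimately have I: "((\<lambda>s. poly Q (exp (\<i> * of_real s)) * e (- int k) s) has_integral of_real (2 * pi)
      * coeff Q k) {-pi..pi}"
    by simp
  have "norm (of_real (2 * pi) * coeff Q k) \<le> integral {-pi..pi} (\<lambda>s. norm (poly Q (exp (\<i> * of_real s))))"
  proof (subst integral_unique[OF I, symmetric], rule integral_norm_bound_integral)
    show "(\<lambda>s. poly Q (exp (\<i> * of_real s)) * e (- int k) s) integrable_on {-pi..pi}" using I by blast
    show "(\<lambda>s. norm (poly Q (exp (\<i> * of_real s)))) integrable_on {-pi..pi}"
      by (intro integrable_continuous_interval continuous_intros)
    show "norm (poly Q (exp (\<i> * of_real s)) * e (- int k) s) \<le> norm (poly Q (exp (\<i> * of_real s)))" for s
      by (simp add: norm_mult e_def)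
  qed
  thus ?thesis by (simp add: norm_mult)
qed

text \<open>Cauchy's estimate for Taylor coefficients at a: an affine map carries the circle to the
  unit circle, where coefficients are bounded by the mean of the modulus.\<close>

lemma coeff_norm_le_circle:
  fixes Q :: "complex poly"
  assumes R: "0 < R" and B: "\<And>z. norm (z - a) = R \<Longrightarrow> norm (poly Q z) \<le> B"
  shows "norm (coeff (pcompose Q [:a, 1:]) k) * R ^ k \<le> B"
proof -
  define P where "P = pcompose Q [:a, of_real R:]"
  have P: "P = pcompose (pcompose Q [:a, 1:]) [:0, of_real R:]"
    unfolding P_def pcompose_assoc[symmetric] by (simp add: pcompose_pCons)
  have "coeff P k = of_real R ^ k * coeff (pcompose Q [:a, 1:]) k"
    unfolding P by (rule coeff_pcompose_linear)
  moreover have "2 * pi * norm (coeff P k) \<le> 2 * pi * B"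
  proof -
    have "2 * pi * norm (coeff P k) \<le> integral {-pi..pi} (\<lambda>s. norm (poly P (exp (\<i> * of_real s))))"
      by (rule coeff_norm_le_integral)
    also have "\<dots> \<le> integral {-pi..pi} (\<lambda>s::real. B)"
    proof (rule integral_le)
      fix s :: real
      have "poly P (exp (\<i> * of_real s)) = poly Q (a + of_real R * exp (\<i> * of_real s))"
        by (simp add: P_def poly_pcompose mult.commute)
      also have "norm \<dots> \<le> B" using R by (intro B) (simp add: norm_mult)
      finally show "norm (poly P (exp (\<i> * of_real s))) \<le> B" .
    qed (auto intro!: integrable_continuous_interval continuous_intros)
    also have "\<dots> = 2 * pi * B" by simp
    finally show ?thesis .
  qed
  ultimately show ?thesis using R by (simp add: norm_mult norm_power mult.commute)
qed

lemma trigp_continuous: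
  assumes "trigp N U"
  shows "continuous_on UNIV U"
proof -
  obtain Q where Q: "\<And>z. U z * exp (\<i> * z) ^ N = poly Q (exp (\<i> * z))"
    using assms by (auto simp: trigp_def)
  have "U = (\<lambda>z. poly Q (exp (\<i> * z)) / exp (\<i> * z) ^ N)"
    unfolding Q[symmetric] by auto
  moreover have "continuous_on UNIV (\<lambda>z. poly Q (exp (\<i> * z)) / exp (\<i> * z) ^ N)"
    by (intro continuous_intros) auto
  ultimately show ?thesis by simp
qed

text \<open>There are 2 N + 1 coefficients, each at most the integral divided by 2 pi. After
  division by exp(i N z) only frequencies between -N and N remain, and each grows at most like exp(N
  |Im z|).\<close>

lemma trigp_norm_le:
  assumes U: "trigp N U" and N: "1 \<le> N"
  shows "norm (U z) \<le> real N * exp (real N * \<bar>Im z\<bar>) * integral {-pi..pi} (\<lambda>s. norm (U (of_real s)))"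
proof -
  obtain Q where Q: "degree Q \<le> 2 * N" "\<And>z. U z * exp (\<i> * z) ^ N = poly Q (exp (\<i> * z))"
    using assms by (auto simp: trigp_def)
  define I where "I = integral {-pi..pi} (\<lambda>s. norm (U (of_real s)))"
  define E where "E = exp (real N * \<bar>Im z\<bar>)"
  have ne: "norm (U (of_real s)) = norm (poly Q (exp (\<i> * of_real s)))" for s :: real
    unfolding Q(2)[symmetric] by (simp add: norm_mult norm_power)
  have c: "2 * pi * norm (coeff Q k) \<le> I" for k
    unfolding I_def ne by (rule coeff_norm_le_integral)
  have I0: "0 \<le> I" using c[of 0] by (meson mult_nonneg_nonneg norm_ge_zero order.trans pi_ge_zero zero_le_numeral)
  have "norm (U z) * norm (exp (\<i> * z)) ^ N = norm (poly Q (exp (\<i> * z)))"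
    unfolding Q(2)[symmetric] by (simp add: norm_mult norm_power)
  also have "\<dots> \<le> (\<Sum>k\<le>2 * N. norm (coeff Q k) * norm (exp (\<i> * z)) ^ k)"
  proof -
    have "poly Q (exp (\<i> * z)) = (\<Sum>k\<le>2 * N. coeff Q k * exp (\<i> * z) ^ k)"
      unfolding poly_altdef by (rule sum.mono_neutral_left) (use Q in \<open>auto simp: coeff_eq_0 not_le\<close>)
    thus ?thesis by (simp only:) (rule order.trans[OF norm_sum], simp add: norm_mult norm_power)
  qed
  also have "\<dots> \<le> (\<Sum>k\<le>2 * N. I / (2 * pi) * (E * norm (exp (\<i> * z)) ^ N))"
  proof (intro sum_mono mult_mono)
    fix k assume "k \<in> {..2 * N}"
    hence k: "\<bar>real N - real k\<bar> \<le> real N" by (auto simp: abs_le_iff)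
    show "norm (coeff Q k) \<le> I / (2 * pi)" using c[of k] by (simp add: field_simps)
    have "- Im z * real k + Im z * real N \<le> \<bar>Im z * (real N - real k)\<bar>" by (simp add: algebra_simps)
    also have "\<dots> \<le> \<bar>Im z\<bar> * real N" unfolding abs_mult using k by (intro mult_left_mono) auto
    finally have "- Im z * real k \<le> real N * \<bar>Im z\<bar> + (- Im z) * real N" by (simp add: algebra_simps)
    hence "exp (real k * (- Im z)) \<le> exp (real N * \<bar>Im z\<bar> + real N * (- Im z))" by (simp add: algebra_simps)
    thus "norm (exp (\<i> * z)) ^ k \<le> E * norm (exp (\<i> * z)) ^ N"
      unfolding E_def exp_add exp_of_nat_mult by simp
  qed (use I0 in auto)
  also have "\<dots> = (real (2 * N + 1) / (2 * pi) * I * E) * norm (exp (\<i> * z)) ^ N"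
    by simp
  finally have "norm (U z) \<le> real (2 * N + 1) / (2 * pi) * I * E"
    by (rule mult_right_le_imp_le) simp
  also have "\<dots> \<le> real N * I * E"
  proof (intro mult_right_mono I0)
    have "real (2 * N + 1) \<le> 3 * real N" using N by simp
    also have "\<dots> \<le> (2 * pi) * real N" using pi_ge_two by (intro mult_right_mono) auto
    finally show "real (2 * N + 1) / (2 * pi) \<le> real N" by (simp add: field_simps)
  qed (simp add: E_def)
  finally show ?thesis by (simp add: I_def E_def mult_ac)
qed

text \<open>Near 0 and pi the Jacobian sin s is too small to convert an integral ds into one against
  dy / rho_m(y). Neighbourhoods of length comparable to 1/N are therefore cut away here, at the cost
  of a factor 2. The negative half of the period is folded onto the positive one.\<close>

lemma trigp_norm_le_trimmed:
  assumes U: "trigp N U" and N: "1 \<le> N"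
  shows "norm (U z) \<le> 2 * real N * exp (real N * \<bar>Im z\<bar>) *
    integral {1 / (8 * real N)..pi - 1 / (8 * real N)} (\<lambda>s. norm (U (of_real s)) + norm (U (- of_real s)))"
proof -
  define \<delta> where "\<delta> = 1 / (8 * real N)"
  have \<delta>: "0 < \<delta>" "\<delta> \<le> 1 / 8" using N by (auto simp: \<delta>_def field_simps)
  have d2: "\<delta> \<le> pi - \<delta>" using \<delta> pi_ge_two by linarith
  define V where "V s = norm (U (of_real s)) + norm (U (- of_real s))" for s :: real
  define J where "J = integral {\<delta>..pi - \<delta>} V"
  have contU: "continuous_on A (\<lambda>s. norm (U (f s)))" if "continuous_on A f" for A f
    by (intro continuous_on_norm continuous_on_compose2[OF trigp_continuous[OF U] that]) auto
  have cU: "continuous_on A (\<lambda>s. norm (U (of_real s)))" for A :: "real set" by (intro contU continuous_intros)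
  have cU': "continuous_on A (\<lambda>s. norm (U (- of_real s)))" for A :: "real set" by (intro contU continuous_intros)
  have contV: "continuous_on A V" for A unfolding V_def by (intro continuous_on_add cU cU')
  obtain t where t: "t \<in> {-pi..pi}" "\<And>s. s \<in> {-pi..pi} \<Longrightarrow> norm (U (of_real s)) \<le> norm (U (of_real t))"
    using continuous_attains_sup[OF compact_Icc _ cU, of "-pi" pi] by auto
  define S where "S = norm (U (of_real t))"
  have V: "V s \<le> 2 * S" if "s \<in> {0..pi}" for s
    using t(2)[of s] t(2)[of "-s"] that by (auto simp: V_def S_def)
  have "integral {-pi..pi} (\<lambda>s. norm (U (of_real s)))
      = integral {-pi..0} (\<lambda>s. norm (U (of_real s))) + integral {0..pi} (\<lambda>s. norm (U (of_real s)))"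
    by (intro Henstock_Kurzweil_Integration.integral_combine[symmetric] integrable_continuous_interval cU) auto
  also have "integral {-pi..0} (\<lambda>s. norm (U (of_real s))) = integral {0..pi} (\<lambda>s. norm (U (- of_real s)))"
    using Henstock_Kurzweil_Integration.integral_reflect_real[of pi 0 "\<lambda>s. norm (U (- of_real s))"] by simp
  also have "\<dots> + integral {0..pi} (\<lambda>s. norm (U (of_real s))) = integral {0..pi} V"
    unfolding V_def by (subst Henstock_Kurzweil_Integration.integral_add) (auto intro!:
        integrable_continuous_interval cU cU')
  also have "\<dots> = integral {0..\<delta>} V + (integral {\<delta>..pi - \<delta>} V + integral {pi - \<delta>..pi} V)"
    using \<delta> d2 by (subst Henstock_Kurzweil_Integration.integral_combine, (auto intro!:
        integrable_continuous_interval contV)[3],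
        subst Henstock_Kurzweil_Integration.integral_combine) (auto intro!: integrable_continuous_interval contV)
  also have "integral {0..\<delta>} V \<le> integral {0..\<delta>} (\<lambda>_. 2 * S)"
    using \<delta> d2 by (intro integral_le integrable_continuous_interval contV V) auto
  also have "\<dots> = 2 * \<delta> * S" using \<delta> by simp
  also have "integral {pi - \<delta>..pi} V \<le> integral {pi - \<delta>..pi} (\<lambda>_. 2 * S)"
    using \<delta> d2 by (intro integral_le integrable_continuous_interval contV V) auto
  also have "\<dots> = 2 * \<delta> * S" using \<delta> by simp
  finally have I: "integral {-pi..pi} (\<lambda>s. norm (U (of_real s))) \<le> 4 * \<delta> * S + J"
    by (simp add: J_def algebra_simps)
  \<comment> \<open>At the point where the modulus is maximal on the real axis, the pieces cut away
    contribute at most 4 N \<delta> S = S/2 and are absorbed. This determines \<delta> = 1/(8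
    N).\<close>
  have "S \<le> real N * integral {-pi..pi} (\<lambda>s. norm (U (of_real s)))"
    using trigp_norm_le[OF U N, of "of_real t"] by (simp add: S_def)
  also have "\<dots> \<le> real N * (4 * \<delta> * S + J)" using I by (intro mult_left_mono) auto
  also have "\<dots> = S / 2 + real N * J" using N by (simp add: \<delta>_def field_simps)
  finally have S: "S \<le> 2 * real N * J" by simp
  have "4 * \<delta> * S \<le> 4 * \<delta> * (2 * real N * J)" using S \<delta> by (intro mult_left_mono) auto
  also have "\<dots> = J" using N by (simp add: \<delta>_def)
  finally have "integral {-pi..pi} (\<lambda>s. norm (U (of_real s))) \<le> 2 * J" using I by simp
  hence "real N * exp (real N * \<bar>Im z\<bar>) * integral {-pi..pi} (\<lambda>s. norm (U (of_real s)))
     \<le> real N * exp (real N * \<bar>Im z\<bar>) * (2 * J)" by (intro mult_left_mono) auto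
  with trigp_norm_le[OF U N, of z] show ?thesis by (simp add: J_def V_def[abs_def] \<delta>_def mult_ac)
qed

text \<open>The Fejer kernel divided by its value at 0, continued to complex arguments: for real z
  the second sum is the conjugate of the first.\<close>

definition fejer :: "nat \<Rightarrow> complex \<Rightarrow> complex" where
  "fejer m z = (\<Sum>k<m. exp (\<i> * z) ^ k) * (\<Sum>k<m. exp (- (\<i> * z)) ^ k) / (of_nat m)\<^sup>2"

lemma trigp_fejer_shift: "trigp m (\<lambda>z. fejer m (z - a))"
proof -
  define Q1 where "Q1 = (\<Sum>k<m. monom (exp (- (\<i> * a)) ^ k) k)"
  define Q2 where "Q2 = (\<Sum>k<m. monom (exp (\<i> * a) ^ k) (m - k))"
  define Q where "Q = smult (1 / (of_nat m)\<^sup>2) (Q1 * Q2)"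
  have "degree Q1 \<le> m" "degree Q2 \<le> m"
    unfolding Q1_def Q2_def by (intro degree_sum_le; auto intro: order.trans[OF degree_monom_le])+
  hence "degree Q \<le> 2 * m"
    unfolding Q_def using degree_mult_le[of Q1 Q2] by (intro order.trans[OF degree_smult_le]) simp
  moreover have "fejer m (z - a) * exp (\<i> * z) ^ m = poly Q (exp (\<i> * z))" for z
  proof -
    have 1: "(\<Sum>k<m. exp (\<i> * (z - a)) ^ k) = poly Q1 (exp (\<i> * z))"
      unfolding Q1_def poly_sum poly_monom
    proof (intro sum.cong refl)
      fix k
      have "exp (\<i> * (z - a)) = exp (- (\<i> * a)) * exp (\<i> * z)"
        by (simp add: exp_add[symmetric] algebra_simps)
      thus "exp (\<i> * (z - a)) ^ k = exp (- (\<i> * a)) ^ k * exp (\<i> * z) ^ k"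
        by (simp only: power_mult_distrib)
    qed
    have 2: "(\<Sum>k<m. exp (- (\<i> * (z - a))) ^ k) * exp (\<i> * z) ^ m = poly Q2 (exp (\<i> * z))"
      unfolding Q2_def poly_sum poly_monom sum_distrib_right
    proof (intro sum.cong refl)
      fix k assume "k \<in> {..<m}"
      hence "exp (\<i> * z) ^ m = exp (\<i> * z) ^ k * exp (\<i> * z) ^ (m - k)"
        by (simp add: power_add[symmetric])
      moreover have "exp (- (\<i> * (z - a))) * exp (\<i> * z) = exp (\<i> * a)"
        by (simp add: exp_add[symmetric] algebra_simps)
      ultimately show "exp (- (\<i> * (z - a))) ^ k * exp (\<i> * z) ^ m = exp (\<i> * a) ^ k * exp (\<i> * z) ^ (m - k)"
        by (metis mult.assoc power_mult_distrib)
    qed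
    have "fejer m (z - a) * exp (\<i> * z) ^ m = (\<Sum>k<m. exp (\<i> * (z - a)) ^ k) *
        ((\<Sum>k<m. exp (- (\<i> * (z - a))) ^ k) * exp (\<i> * z) ^ m) / (of_nat m)\<^sup>2"
      by (simp add: fejer_def)
    thus ?thesis unfolding 1 2 by (simp add: Q_def)
  qed
  ultimately show ?thesis unfolding trigp_def by blast
qed

text \<open>The product of the two sums is a double sum of exp((l - k) \<tau>). In 1 + x <= exp x
  the linear terms cancel by antisymmetry, leaving m^2. So a kernel centred at the real part of a
  point does not decrease the modulus at that point.\<close>

lemma fejer_imaginary_ge_1:
  assumes "1 \<le> m"
  shows "1 \<le> norm (fejer m (\<i> * of_real \<tau>))"
proof -
  define A where "A = (\<Sum>k<m. exp (- \<tau>) ^ k)"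
  define B where "B = (\<Sum>k<m. exp \<tau> ^ k)"
  have "exp (\<i> * (\<i> * of_real \<tau>)) = complex_of_real (exp (- \<tau>))"
    by (simp add: exp_of_real[symmetric] mult.assoc[symmetric])
  moreover have "exp (- (\<i> * (\<i> * of_real \<tau>))) = complex_of_real (exp \<tau>)"
    by (simp add: exp_of_real[symmetric] mult.assoc[symmetric])
  ultimately have F: "fejer m (\<i> * of_real \<tau>) = complex_of_real (A * B / (real m)\<^sup>2)"
    unfolding fejer_def A_def B_def by simp
  have "(\<Sum>k<m. \<Sum>l<m. 1 + (real l - real k) * \<tau>) = (real m)\<^sup>2"
    by (simp add: sum.distrib sum_distrib_right[symmetric] sum_subtractf sum_distrib_left[symmetric]
        power2_eq_square algebra_simps)
  moreover have "(\<Sum>k<m. \<Sum>l<m. 1 + (real l - real k) * \<tau>) \<le> (\<Sum>k<m. \<Sum>l<m. exp ((real l - real k) * \<tau>))"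
    by (intro sum_mono exp_ge_add_one_self)
  moreover have "(\<Sum>k<m. \<Sum>l<m. exp ((real l - real k) * \<tau>)) = A * B"
    unfolding A_def B_def sum_product
    by (intro sum.cong refl) (simp add: exp_of_nat_mult[symmetric] exp_add[symmetric] algebra_simps)
  ultimately have "(real m)\<^sup>2 \<le> A * B" by simp
  hence "1 \<le> A * B / (real m)\<^sup>2" using assms by (simp add: field_simps)
  thus ?thesis unfolding F norm_of_real by linarith
qed

lemma fejer_real_bounds:
  assumes m: "1 \<le> m"
  shows "norm (fejer m (of_real x)) \<le> 1"
    and "norm (fejer m (of_real x)) * (real m * sin (x / 2))\<^sup>2 \<le> 1"
proof -
  have s1: "norm (\<Sum>k<m. exp (\<i> * of_real y) ^ k) \<le> real m" for y :: real
    by (rule order.trans[OF norm_sum]) (simp add: norm_power)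
  have s2: "norm (\<Sum>k<m. exp (\<i> * of_real y) ^ k) * \<bar>sin (y / 2)\<bar> \<le> 1" for y :: real
  proof -
    define w where "w = exp (\<i> * complex_of_real y)"
    have "norm (1 - w) = 2 * \<bar>sin (y / 2)\<bar>"
      unfolding w_def by (metis dist_exp_i_1 norm_minus_commute)
    moreover have "norm ((1 - w) * (\<Sum>k<m. w ^ k)) \<le> 2"
    proof -
      have "(1 - w) * (\<Sum>k<m. w ^ k) = 1 - w ^ m" by (rule one_diff_power_eq[symmetric])
      also have "norm \<dots> \<le> norm (1::complex) + norm (w ^ m)" by (rule norm_triangle_ineq4)
      also have "\<dots> = 2" by (simp add: w_def norm_power)
      finally show ?thesis .
    qed
    ultimately show ?thesis by (simp add: norm_mult w_def mult.commute)
  qed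
  define a where "a = norm (\<Sum>k<m. exp (\<i> * of_real x) ^ k)"
  define b where "b = norm (\<Sum>k<m. exp (\<i> * of_real (- x)) ^ k)"
  have F: "norm (fejer m (of_real x)) = a * b / (real m)\<^sup>2"
    by (simp add: fejer_def norm_mult norm_divide norm_power a_def b_def)
  have m0: "0 < real m" using m by simp
  have ab: "0 \<le> a" "0 \<le> b" "a \<le> real m" "b \<le> real m" "a * \<bar>sin (x / 2)\<bar> \<le> 1" "b * \<bar>sin (x / 2)\<bar> \<le> 1"
    using s1[of x] s1[of "-x"] s2[of x] s2[of "-x"] by (auto simp: a_def b_def)
  have "a * b \<le> real m * real m" using ab by (intro mult_mono) auto
  thus "norm (fejer m (of_real x)) \<le> 1" unfolding F using m0 by (simp add: power2_eq_square)
  have "(a * \<bar>sin (x / 2)\<bar>) * (b * \<bar>sin (x / 2)\<bar>) \<le> 1 * 1" using ab by (intro mult_mono) auto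
  moreover have "(a * \<bar>sin (x / 2)\<bar>) * (b * \<bar>sin (x / 2)\<bar>) = a * b * (sin (x / 2))\<^sup>2"
    by (simp add: power2_eq_square mult_ac flip: abs_mult)
  ultimately show "norm (fejer m (of_real x)) * (real m * sin (x / 2))\<^sup>2 \<le> 1"
    unfolding F using m0 by (simp add: power_mult_distrib)
qed

lemma fejer_decay:
  assumes m: "1 \<le> m" and st: "0 \<le> s" "s \<le> pi" "0 \<le> t" "t \<le> pi"
    and x: "\<bar>sin ((s - t) / 2)\<bar> \<le> \<bar>sin (x / 2)\<bar>"
  shows "norm (fejer m (of_real x)) \<le> 25 / (1 + real m * \<bar>s - t\<bar>)\<^sup>2"
proof -
  define d where "d = real m * \<bar>s - t\<bar>"
  have d: "0 \<le> d" by (simp add: d_def)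
  have "\<bar>s - t\<bar> \<le> pi * \<bar>sin ((s - t) / 2)\<bar>" by (rule sin_half_sum_bounds(3)[OF st])
  also have "\<dots> \<le> 4 * \<bar>sin (x / 2)\<bar>" using x pi_less_4 by (intro mult_mono) auto
  finally have "d \<le> real m * (4 * \<bar>sin (x / 2)\<bar>)" unfolding d_def by (rule mult_left_mono) simp
  hence "d\<^sup>2 \<le> (real m * (4 * \<bar>sin (x / 2)\<bar>))\<^sup>2" using d by (intro power_mono) auto
  also have "\<dots> = 16 * (real m * sin (x / 2))\<^sup>2" by (simp add: power_mult_distrib)
  finally have "norm (fejer m (of_real x)) * d\<^sup>2 \<le> norm (fejer m (of_real x)) * (16 * (real m * sin (x / 2))\<^sup>2)"
    by (intro mult_left_mono) auto
  also have "\<dots> \<le> 16" using fejer_real_bounds(2)[OF m, of x] by simp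
  finally have *: "norm (fejer m (of_real x)) * d\<^sup>2 \<le> 16" .
  \<comment> \<open>The coefficients combine the two bounds 1 and 16/d^2 for the kernel: 5 + (5/4) *
    16 = 25.\<close>
  have "(1 + d)\<^sup>2 \<le> 5 + 5 / 4 * d\<^sup>2"
  proof -
    have "0 \<le> (d / 2 - 2)\<^sup>2" by simp
    thus ?thesis by (simp add: power2_eq_square algebra_simps)
  qed
  hence "norm (fejer m (of_real x)) * (1 + d)\<^sup>2 \<le> norm (fejer m (of_real x)) * (5 + 5 / 4 * d\<^sup>2)"
    by (intro mult_left_mono) auto
  also have "\<dots> \<le> 25" using * fejer_real_bounds(1)[OF m, of x] by (simp add: algebra_simps)
  finally show ?thesis using d by (simp add: d_def[symmetric] field_simps add_pos_nonneg)
qed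

text \<open>The complex version of \<open>adist_le_of_dist\<close>: z - cos t is again a product of
  sines of half sum and half difference, now with a complex angle, and
  \<open>sine_factor_bound\<close> bounds the smaller one.\<close>

lemma arccos_preimage_near:
  assumes m: "1 \<le> m" and t: "0 \<le> t" "t \<le> pi" and z: "norm (z - of_real (cos t)) \<le> rho m (cos t) / 16"
  obtains \<zeta> where "cos \<zeta> = z" "0 \<le> Re \<zeta>" "Re \<zeta> \<le> pi" "real m * \<bar>Re \<zeta> - t\<bar> \<le> 1" "real m * \<bar>Im \<zeta>\<bar> \<le> 1"
proof -
  \<comment> \<open>Cosine is even, so the sign is chosen to make the real part nonnegative.\<close>
  define \<zeta> where "\<zeta> = (if 0 \<le> Re (Arccos z) then Arccos z else - Arccos z)"
  have c: "cos \<zeta> = z" by (simp add: \<zeta>_def)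
  have re: "0 \<le> Re \<zeta>" "Re \<zeta> \<le> pi" using Re_Arccos_bound[of z] by (auto simp: \<zeta>_def abs_le_iff)
  define \<delta> where "\<delta> = norm (sin ((\<zeta> - of_real t) / 2))"
  define e where "e = norm (sin ((\<zeta> + of_real t) / 2))"
  define b where "b = Im \<zeta> / 2"
  \<comment> \<open>This is the square of the hyperbolic sine of b. The squared modulus of a complex
    sine is the squared sine of the real part plus this term, which both \<delta> and e contain;
    hence their comparison reduces to real angles.\<close>
  define E where "E = (exp (2 * b) + inverse (exp (2 * b)) - 2) / 4"
  have cos2: "1 - cos x = 2 * (sin (x / 2))\<^sup>2" for x :: real
    using cos_double_sin[of "x / 2"] by simp
  have half: "2 * Re ((\<zeta> - of_real t) / 2) = Re \<zeta> - t" "2 * Re ((\<zeta> + of_real t) / 2) = Re \<zeta> + t"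
    "2 * Im ((\<zeta> - of_real t) / 2) = 2 * b" "2 * Im ((\<zeta> + of_real t) / 2) = 2 * b"
    by (simp_all add: b_def)
  have quarter: "(x + y - 2 * c) / 4 = (x + y - 2) / 4 + q" if "1 - c = 2 * q" for c q x y :: real
  proof -
    have c: "c = 1 - 2 * q" using that by linarith
    show ?thesis unfolding c by (simp add: field_simps)
  qed
  have d2: "\<delta>\<^sup>2 = E + (sin ((Re \<zeta> - t) / 2))\<^sup>2"
    unfolding \<delta>_def norm_sin_squared half E_def
    by (rule quarter, rule cos2)
  have e2: "e\<^sup>2 = E + (sin ((Re \<zeta> + t) / 2))\<^sup>2"
    unfolding e_def norm_sin_squared half E_def
    by (rule quarter, rule cos2)
  have Eb: "b\<^sup>2 \<le> E"
  proof -
    have "\<bar>b\<bar> \<le> \<bar>(exp b - inverse (exp b)) / 2\<bar>" by (rule real_le_abs_sinh)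
    hence "b\<^sup>2 \<le> ((exp b - inverse (exp b)) / 2)\<^sup>2" by (rule abs_le_square_iff[THEN iffD1])
    also have "\<dots> = E" unfolding E_def exp_double
      by (simp add: power2_eq_square field_simps)
    finally show ?thesis .
  qed
  hence E0: "0 \<le> E" using zero_le_power2[of b] by linarith
  note sb = sin_half_sum_bounds[OF t re] sin_half_sum_bounds[OF re t]
  have de: "\<delta> \<le> e"
  proof (rule power2_le_imp_le)
    show "\<delta>\<^sup>2 \<le> e\<^sup>2" unfolding d2 e2 using sb(4) by (simp add: abs_le_square_iff[symmetric])
  qed (simp add: e_def)
  have "sin ((Re \<zeta> + t) / 2) \<le> e"
    by (rule power2_le_imp_le) (use e2 E0 in \<open>auto simp: e_def\<close>)
  hence st: "sin t \<le> 2 * e" using sb(2) by (simp add: add.commute)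
  have "z - of_real (cos t) = cos \<zeta> - cos (of_real t)" using c by (simp add: cos_of_real)
  also have "\<dots> = 2 * sin ((\<zeta> + of_real t) / 2) * sin ((of_real t - \<zeta>) / 2)" by (rule cos_diff_cos)
  also have "norm \<dots> = 2 * \<delta> * e"
  proof -
    have "(of_real t - \<zeta>) / 2 = - ((\<zeta> - of_real t) / 2)" by (simp add: field_simps)
    hence "norm (sin ((of_real t - \<zeta>) / 2)) = \<delta>" by (simp only: sin_minus norm_minus_cancel \<delta>_def)
    thus ?thesis unfolding e_def by (simp add: norm_mult)
  qed
  finally have "2 * \<delta> * e \<le> 1 / 16 * (sin t / real m + 1 / (real m)\<^sup>2)"
    using z unfolding rho_cos[OF t] by simp
  \<comment> \<open>The radius rho_m/16 gives max(1/8, 1/4) = 1/4, small enough that pi times it is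
    still below 1.\<close>
  from sine_factor_bound[OF m _ de _ st _ this] have md: "real m * \<delta> \<le> 1 / 4"
    using t by (simp add: \<delta>_def sin_ge_zero real_sqrt_divide)
  have "\<bar>sin ((Re \<zeta> - t) / 2)\<bar> \<le> \<delta>"
    by (rule abs_le_square_iff[THEN iffD2, of _ \<delta>, simplified abs_norm_cancel \<delta>_def[symmetric], THEN order.trans])
       (use d2 E0 in \<open>auto simp: \<delta>_def\<close>)
  hence "\<bar>Re \<zeta> - t\<bar> \<le> pi * \<delta>" using sb(6) by (meson mult_left_mono order.trans pi_ge_zero)
  hence "real m * \<bar>Re \<zeta> - t\<bar> \<le> real m * (pi * \<delta>)" by (intro mult_left_mono) auto
  also have "\<dots> \<le> pi * (1 / 4)" using mult_left_mono[OF md, of pi] by (simp add: mult_ac)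
  also have "\<dots> \<le> 1" using pi_less_4 by simp
  finally have 1: "real m * \<bar>Re \<zeta> - t\<bar> \<le> 1" .
  have "b\<^sup>2 \<le> \<delta>\<^sup>2" using d2 Eb zero_le_power2[of "sin ((Re \<zeta> - t) / 2)"] by linarith
  hence "\<bar>b\<bar> \<le> \<delta>" by (simp add: abs_le_square_iff[symmetric] \<delta>_def)
  hence "real m * \<bar>b\<bar> \<le> real m * \<delta>" by (intro mult_left_mono) auto
  hence "real m * \<bar>Im \<zeta>\<bar> \<le> 1" using md by (simp add: b_def)
  with c re 1 show ?thesis by (intro that[of \<zeta>])
qed

lemma poly_of_real_cos: "norm (poly (map_poly of_real p) (cos (of_real s)) :: complex) = \<bar>poly p (cos s)\<bar>"
proof -
  have "poly (map_poly of_real p) (of_real x :: complex) = of_real (poly p x)" for x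
    by (induction p) (auto simp: map_poly_pCons)
  thus ?thesis by (simp add: cos_of_real)
qed

lemma poly_borel [measurable]: "poly p \<in> borel_measurable borel" for p :: "real poly"
  by (intro borel_measurable_continuous_onI continuous_intros)

text \<open>The kernel is centred at the real part of a preimage \<zeta> of z, where its modulus is
  at least 1, while on the real axis its M-th power supplies 2 M powers of decay. Since the
  imaginary part of \<zeta> is at most 1/m and the degree is (M + 1) m, the growth off the axis is
  at most exp(M + 1).\<close>

lemma poly_norm_le_kernel_integral:
  fixes p :: "real poly" and M :: nat and z :: complex
  defines "C \<equiv> 4 * exp ((real M + 1)) * 100 ^ M * (real M + 1) * (17 + 16 * real M)"
  assumes m: "1 \<le> m" and deg: "degree p < m" and x: "x \<in> {-1..1}" and z: "norm (z - of_real x) \<le> rho m x / 16"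
  shows "ennreal (norm (poly (map_poly of_real p) z)) \<le>
     ennreal C * (\<integral>\<^sup>+y. ennreal (\<bar>poly p y\<bar> * (akernel (2 * M) m x y / rho m y)) * indicator {-1..1} y \<partial>lborel)"
proof -
  obtain t where t: "0 \<le> t" "t \<le> pi" "x = cos t" "arccos x = t" using cos_param[OF x] .
  obtain \<zeta> where \<zeta>: "cos \<zeta> = z" "0 \<le> Re \<zeta>" "Re \<zeta> \<le> pi" "real m * \<bar>Re \<zeta> - t\<bar> \<le> 1" "real m * \<bar>Im \<zeta>\<bar> \<le> 1"
    using arccos_preimage_near[OF m t(1,2)] z unfolding t(3) by blast
  define N where "N = m + M * m"
  have N: "1 \<le> N" "real N = (real M + 1) * real m" using m by (auto simp: N_def algebra_simps)
  have m0: "0 < real m" using m by simp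
  define P where "P = (map_poly of_real p :: complex poly)"
  define U where "U w = poly P (cos w) * fejer m (w - of_real (Re \<zeta>)) ^ M" for w
  have U: "trigp N U" unfolding U_def N_def
    by (intro trigp_mult trigp_poly_cos trigp_power trigp_fejer_shift) (use deg in \<open>auto simp: P_def degree_map_poly\<close>)
  define \<delta> where "\<delta> = 1 / (8 * real N)"
  have \<delta>: "0 < \<delta>" "\<delta> \<le> 1 / 8" using N(1) by (auto simp: \<delta>_def field_simps)
  define V where "V s = norm (U (of_real s)) + norm (U (- of_real s))" for s :: real
  define W where "W s = \<bar>poly p (cos s)\<bar> * (akernel (2 * M) m x (cos s) / rho m (cos s))" for s :: real
  have Uz: "norm (poly P z) \<le> norm (U \<zeta>)"
  proof -
    have "\<zeta> - of_real (Re \<zeta>) = \<i> * of_real (Im \<zeta>)" by (simp add: complex_eq_iff)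
    hence "1 \<le> norm (fejer m (\<zeta> - of_real (Re \<zeta>)))" using fejer_imaginary_ge_1[OF m] by simp
    hence "norm (poly P z) * 1 \<le> norm (poly P z) * norm (fejer m (\<zeta> - of_real (Re \<zeta>))) ^ M"
      by (intro mult_left_mono one_le_power) auto
    thus ?thesis by (simp add: U_def \<zeta>(1) norm_mult norm_power)
  qed
  have Uz2: "norm (U \<zeta>) \<le> 2 * real N * exp (real M + 1) * integral {\<delta>..pi - \<delta>} V"
  proof -
    have J0: "0 \<le> integral {\<delta>..pi - \<delta>} V"
      by (cases "V integrable_on {\<delta>..pi - \<delta>}") (auto intro!: Henstock_Kurzweil_Integration.integral_nonneg simp:
          V_def not_integrable_integral)
    have "norm (U \<zeta>) \<le> 2 * real N * exp (real N * \<bar>Im \<zeta>\<bar>) * integral {\<delta>..pi - \<delta>} V"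
      using trigp_norm_le_trimmed[OF U N(1), of \<zeta>] unfolding \<delta>_def V_def .
    also have "\<dots> \<le> 2 * real N * exp (real M + 1) * integral {\<delta>..pi - \<delta>} V"
    proof (intro mult_right_mono mult_left_mono J0)
      have "real N * \<bar>Im \<zeta>\<bar> \<le> (real M + 1) * 1"
        unfolding N(2) mult.assoc by (intro mult_left_mono \<zeta>) auto
      thus "exp (real N * \<bar>Im \<zeta>\<bar>) \<le> exp (real M + 1)" by simp
    qed auto
    finally show ?thesis .
  qed
  have contV: "continuous_on A V" for A
  proof -
    have "continuous_on A (\<lambda>s. norm (U (f s)))" if "continuous_on A f" for f
      by (intro continuous_on_norm continuous_on_compose2[OF trigp_continuous[OF U] that]) auto
    note c = this
    show ?thesis unfolding V_def by (intro continuous_on_add c continuous_intros)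
  qed
  have V0: "0 \<le> V s" for s by (simp add: V_def)
  \<comment> \<open>On the trimmed range sin s is at least of order 1/m, so N ds is at most a
    constant times sin s / rho_m(cos s) ds, which is dy / rho_m(y) in the variable y = cos
    s.\<close>
  have Vle: "real N * V s \<le> 2 * 100 ^ M * ((real M + 1) * (17 + 16 * real M)) * (W s
      * sin s)" if s: "s \<in> {\<delta>..pi - \<delta>}" for s
  proof -
    have s': "0 \<le> s" "s \<le> pi" using s \<delta> by auto
    define d where "d = real m * \<bar>s - t\<bar>"
    have d: "0 \<le> d" by (simp add: d_def)
    \<comment> \<open>Moving the centre from the real part of \<zeta> to t changes the scaled
      distance by at most 1, so 1 + d <= 2 (1 + d'). Hence 100 = 4 * 25.\<close>
    have fe: "norm (fejer m (of_real y)) \<le> 100 / (1 + d)\<^sup>2" if "\<bar>sin ((s - Re \<zeta>) / 2)\<bar> \<le> \<bar>sin (y / 2)\<bar>" for y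
    proof -
      define d' where "d' = real m * \<bar>s - Re \<zeta>\<bar>"
      have d': "0 \<le> d'" by (simp add: d'_def)
      have "d \<le> d' + real m * \<bar>Re \<zeta> - t\<bar>"
        unfolding d_def d'_def distrib_left[symmetric] by (intro mult_left_mono) auto
      also have "\<dots> \<le> d' + 1" using \<zeta>(4) by (rule add_left_mono)
      finally have "1 + d \<le> 2 * (1 + d')" using d' by simp
      hence "(1 + d)\<^sup>2 \<le> (2 * (1 + d'))\<^sup>2" using d by (intro power_mono) auto
      hence le: "(1 + d)\<^sup>2 \<le> 4 * (1 + d')\<^sup>2" by (simp only: power_mult_distrib) simp
      have "norm (fejer m (of_real y)) \<le> 25 / (1 + d')\<^sup>2"
        unfolding d'_def by (rule fejer_decay[OF m s' \<zeta>(2,3) that])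
      also have "\<dots> = 100 / (4 * (1 + d')\<^sup>2)" by simp
      also have "\<dots> \<le> 100 / (1 + d)\<^sup>2"
        using le d d' by (intro divide_left_mono mult_pos_pos zero_less_power) auto
      finally show ?thesis .
    qed
    have ak: "akernel (2 * M) m x (cos s) = (1 / (1 + d)\<^sup>2) ^ M"
      using s' by (simp add: akernel_def adist_def t(4) arccos_cos d_def abs_minus_commute power_mult power_divide)
    have U1: "norm (U (of_real y)) \<le> \<bar>poly p (cos s)\<bar> * (100 ^ M * akernel (2 * M) m x (cos s))"
      if "cos y = cos s" "\<bar>sin ((s - Re \<zeta>) / 2)\<bar> \<le> \<bar>sin ((y - Re \<zeta>) / 2)\<bar>" for y
    proof -
      have "norm (U (of_real y)) = \<bar>poly p (cos s)\<bar> * norm (fejer m (of_real (y - Re \<zeta>))) ^ M"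
        unfolding U_def P_def norm_mult norm_power poly_of_real_cos that(1) by simp
      also have "\<dots> \<le> \<bar>poly p (cos s)\<bar> * (100 / (1 + d)\<^sup>2) ^ M"
        by (intro mult_left_mono power_mono fe that) auto
      also have "(100 / (1 + d)\<^sup>2) ^ M = 100 ^ M * akernel (2 * M) m x (cos s)"
        by (simp add: ak power_divide)
      finally show ?thesis .
    qed
    have "norm (U (of_real s)) \<le> \<bar>poly p (cos s)\<bar> * (100 ^ M * akernel (2 * M) m x (cos s))"
      by (rule U1) auto
    \<comment> \<open>At -s the angle to the centre is the sum s + Re \<zeta>, and half of it has a
      sine at least that of half the difference in modulus. So the folded half decays at least as
      well.\<close>
    moreover have "norm (U (of_real (- s))) \<le> \<bar>poly p (cos s)\<bar> * (100 ^ M * akernel (2 * M) m x (cos s))"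
    proof (rule U1)
      have "(- s - Re \<zeta>) / 2 = - ((s + Re \<zeta>) / 2)" by (simp add: field_simps)
      hence "\<bar>sin ((- s - Re \<zeta>) / 2)\<bar> = \<bar>sin ((s + Re \<zeta>) / 2)\<bar>" by (simp only: sin_minus abs_minus)
      thus "\<bar>sin ((s - Re \<zeta>) / 2)\<bar> \<le> \<bar>sin ((- s - Re \<zeta>) / 2)\<bar>"
        using sin_half_sum_bounds(1)[OF s' \<zeta>(2,3)] by linarith
    qed simp
    ultimately have "V s \<le> 2 * 100 ^ M * (\<bar>poly p (cos s)\<bar> * akernel (2 * M) m x (cos s))"
      by (simp add: V_def algebra_simps)
    hence "real N * V s \<le> real N * (2 * 100 ^ M * (\<bar>poly p (cos s)\<bar> * akernel (2 * M) m x (cos s)))"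
      by (intro mult_left_mono) auto
    also have "\<dots> = 2 * 100 ^ M * (\<bar>poly p (cos s)\<bar> * akernel (2 * M) m x (cos s)) * real N" by simp
    also have "\<dots> \<le> 2 * 100 ^ M * (\<bar>poly p (cos s)\<bar> * akernel (2 * M) m x (cos s)) * ((real M + 1) * (17
        + 16 * real M) * (sin s / rho m (cos s)))"
    proof (intro mult_left_mono)
      \<comment> \<open>b/m is \<delta>/2, a lower bound for sin s by Jordan's inequality and pi <
        4. The quotient (b + 1)/b is 17 + 16 M.\<close>
      define b where "b = 1 / (16 * (real M + 1))"
      have b: "0 < b" by (simp add: b_def)
      have "2 / pi * \<delta> \<le> sin s"
      proof (cases "s \<le> pi / 2")
        case True
        have "2 / pi * \<delta> \<le> 2 / pi * s" using s by (intro mult_left_mono) auto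
        thus ?thesis using sin_ge_two_div_pi[of s] s' True by linarith
      next
        case False
        have "2 / pi * \<delta> \<le> 2 / pi * (pi - s)" using s by (intro mult_left_mono) auto
        thus ?thesis using sin_ge_two_div_pi[of "pi - s"] s' False by simp
      qed
      moreover have "1 / 2 * \<delta> \<le> 2 / pi * \<delta>" using \<delta> pi_less_4 by (intro mult_right_mono) (auto simp: field_simps)
      moreover have "1 / 2 * \<delta> = b / real m" by (simp add: \<delta>_def b_def N(2) mult_ac)
      ultimately have "b / real m \<le> sin s" by linarith
      hence "b \<le> sin s * real m" using m0 by (simp add: field_simps)
      hence "real m * b * (sin s * real m + 1) \<le> real m * (sin s * real m) * (b + 1)"
        using mult_left_mono[of b "sin s * real m" "real m"] m0 by (simp add: algebra_simps)
      moreover have sp: "0 < sin s * real m + 1" using s' by (intro add_nonneg_pos mult_nonneg_nonneg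
          sin_ge_zero) auto
      ultimately have "real m * b \<le> real m * (sin s * real m) * (b + 1) / (sin s * real m + 1)"
        by (simp add: pos_le_divide_eq)
      also have "real m * (sin s * real m) * (b + 1) / (sin s * real m + 1) = (b + 1) * (sin s / rho m (cos s))"
        using sp m0 unfolding rho_cos[OF s'] by (simp add: field_simps power2_eq_square)
      finally have "real m \<le> (b + 1) * (sin s / rho m (cos s)) / b" using b by (simp only: pos_le_divide_eq)
      also have "\<dots> = (17 + 16 * real M) * (sin s / rho m (cos s))"
      proof -
        have "(b + 1) / b = 17 + 16 * real M" by (simp add: b_def field_simps)
        thus ?thesis by (metis times_divide_eq_left)
      qed
      finally have "(real M + 1) * real m \<le> (real M + 1) * ((17 + 16 * real M) * (sin s / rho m (cos s)))"
        by (intro mult_left_mono) auto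
      thus "real N \<le> (real M + 1) * (17 + 16 * real M) * (sin s / rho m (cos s))"
        by (simp add: N(2) mult.assoc)
    qed (auto intro!: mult_nonneg_nonneg less_imp_le[OF akernel_pos])
    also have "\<dots> = 2 * 100 ^ M * ((real M + 1) * (17 + 16 * real M)) * (W s * sin s)"
      by (simp add: W_def)
    finally show ?thesis .
  qed
  define D where "D = 2 * 100 ^ M * ((real M + 1) * (17 + 16 * real M))"
  have D0: "0 \<le> D" by (simp add: D_def)
  have "ennreal (real N * integral {\<delta>..pi - \<delta>} V) = (\<integral>\<^sup>+s. ennreal (real N * V s) * indicator {\<delta>..pi - \<delta>} s \<partial>lborel)"
    by (rule nn_integral_has_integral_lebesgue'[symmetric])
       (auto intro!: has_integral_mult_right integrable_integral integrable_continuous_interval contV V0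
           mult_nonneg_nonneg)
  also have "\<dots> \<le> (\<integral>\<^sup>+s. ennreal D * (ennreal (W s) * ennreal (sin s) * indicator {0..pi} s) \<partial>lborel)"
  proof (rule nn_integral_mono)
    fix s :: real
    show "ennreal (real N * V s) * indicator {\<delta>..pi - \<delta>} s \<le> ennreal D * (ennreal (W s) * ennreal (sin s)
        * indicator {0..pi} s)"
    proof (cases "s \<in> {\<delta>..pi - \<delta>}")
      case True
      hence s': "s \<in> {0..pi}" using \<delta> by auto
      have W0: "0 \<le> W s" unfolding W_def using m
        by (intro mult_nonneg_nonneg divide_nonneg_nonneg less_imp_le[OF akernel_pos] less_imp_le[OF rho_pos]) auto
      have "real N * V s \<le> D * (W s * sin s)" using Vle[OF True] by (simp add: D_def)
      thus ?thesis using True s' W0 D0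
        by (simp add: ennreal_mult[symmetric] sin_ge_zero ennreal_leI)
    qed simp
  qed
  also have "\<dots> = ennreal D * (\<integral>\<^sup>+s. ennreal (W s) * ennreal (sin s) * indicator {0..pi} s \<partial>lborel)"
    unfolding W_def by (rule nn_integral_cmult) measurable
  also have "(\<integral>\<^sup>+s. ennreal (W s) * ennreal (sin s) * indicator {0..pi} s \<partial>lborel) =
    (\<integral>\<^sup>+y. ennreal (\<bar>poly p y\<bar> * (akernel (2 * M) m x y / rho m y)) * indicator {-1..1} y \<partial>lborel)"
    unfolding W_def by (rule nn_integral_cos_substitution[symmetric]) measurable
  finally have *: "ennreal (real N * integral {\<delta>..pi - \<delta>} V) \<le> ennreal D *
    (\<integral>\<^sup>+y. ennreal (\<bar>poly p y\<bar> * (akernel (2 * M) m x y / rho m y)) * indicator {-1..1} y \<partial>lborel)" .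
  have "ennreal (norm (poly P z)) \<le> ennreal (2 * exp (real M + 1)) * ennreal (real N * integral {\<delta>..pi - \<delta>} V)"
    using Uz Uz2 by (subst ennreal_mult'[symmetric]) (auto intro!: ennreal_leI simp: mult_ac)
  also have "\<dots> \<le> ennreal (2 * exp (real M + 1)) * (ennreal D *
    (\<integral>\<^sup>+y. ennreal (\<bar>poly p y\<bar> * (akernel (2 * M) m x y / rho m y)) * indicator {-1..1} y \<partial>lborel))"
    by (intro mult_left_mono *) auto
  also have "\<dots> = ennreal (2 * exp (real M + 1) * D) *
    (\<integral>\<^sup>+y. ennreal (\<bar>poly p y\<bar> * (akernel (2 * M) m x y / rho m y)) * indicator {-1..1} y \<partial>lborel)"
    using D0 by (simp add: ennreal_mult mult.assoc)
  also have "2 * exp (real M + 1) * D = C" by (simp add: D_def C_def mult_ac)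
  finally show ?thesis by (simp add: P_def)
qed

section \<open>The inverse estimate\<close>

lemma poly_map_of_real: "poly (map_poly of_real p) (of_real x :: complex) = of_real (poly p x)"
  by (induction p) (auto simp: map_poly_pCons)

text \<open>Taylor expansion at the centre x of the difference: powers below r are annihilated, and
  Cauchy's estimate makes the remaining terms a geometric series that starts at the power r.\<close>

lemma fdiff_poly_bound:
  fixes p :: "real poly"
  assumes R: "0 < R" and B: "\<And>z::complex. norm (z - of_real x) = R \<Longrightarrow> norm (poly (map_poly of_real p) z) \<le> B"
    and u: "0 \<le> u" "real r * u \<le> R"
  shows "\<bar>fdiff r u (poly p) (x - real r * u / 2)\<bar> \<le> 2 * B * (real r * u / R) ^ r"
proof -
  define q where "q = pcompose p [:x, 1:]"
  \<comment> \<open>The nodes are within r u / 2 of x, so this is the ratio of the geometric series.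
    It is at most 1/2, so the tail from r on is at most twice its first term.\<close>
  define \<theta> where "\<theta> = real r * u / (2 * R)"
  have \<theta>: "0 \<le> \<theta>" "\<theta> \<le> 1 / 2" using R u by (auto simp: \<theta>_def field_simps)
  have "pcompose (map_poly of_real p) [:of_real x, 1:] = (map_poly of_real q :: complex poly)"
  proof -
    have add: "map_poly of_real (a + b) = (map_poly of_real a + map_poly of_real b :: complex poly)" for a b ::
        "real poly"
      by (intro poly_eqI) (simp add: coeff_map_poly)
    have mult: "map_poly of_real (a * b) = (map_poly of_real a
        * map_poly of_real b :: complex poly)" for a b :: "real poly"
      by (intro poly_eqI) (simp add: coeff_map_poly coeff_mult)
    show ?thesis unfolding q_def
      by (induction p) (simp_all add: map_poly_pCons pcompose_pCons add mult del: mult_pCons_left)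
  qed
  hence cf: "\<bar>coeff q k\<bar> * R ^ k \<le> B" for k
    using coeff_norm_le_circle[OF R, of "of_real x" "map_poly of_real p" B k] B by (simp add: coeff_map_poly)
  have B0: "0 \<le> B" using cf[of 0] by simp
  have "fdiff r u (poly p) (x - real r * u / 2) = fdiff r u (\<lambda>y. poly q (y - x)) (x - real r * u / 2)"
    by (rule fdiff_cong) (simp add: q_def poly_pcompose algebra_simps)
  also have "\<dots> = fdiff r u (poly q) (- (real r * u / 2))"
    using fdiff_shift[of r u "poly q" "-x"] by simp
  also have "\<dots> = fdiff r u (\<lambda>y. \<Sum>k\<le>degree q. coeff q k * y ^ k) (- (real r * u / 2))"
    by (intro fdiff_cong) (simp add: poly_altdef)
  also have "\<dots> = (\<Sum>k\<le>degree q. coeff q k * fdiff r u (\<lambda>y. y ^ k) (- (real r * u / 2)))"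
    by (simp add: fdiff_sum fdiff_cmult)
  also have "\<bar>\<dots>\<bar> \<le> (\<Sum>k\<le>degree q. \<bar>coeff q k\<bar> * \<bar>fdiff r u (\<lambda>y. y ^ k) (- (real r * u / 2))\<bar>)"
    by (rule order.trans[OF sum_abs]) (simp add: abs_mult)
  also have "\<dots> \<le> (\<Sum>k\<le>degree q. if r \<le> k then 2 ^ r * B * \<theta> ^ k else 0)"
  proof (rule sum_mono)
    fix k assume "k \<in> {..degree q}"
    show "\<bar>coeff q k\<bar> * \<bar>fdiff r u (\<lambda>y. y ^ k) (- (real r * u / 2))\<bar> \<le> (if r \<le> k then 2 ^ r * B * \<theta> ^ k else 0)"
    proof (cases "r \<le> k")
      case False
      have "fdiff r u (poly (monom 1 k)) (- (real r * u / 2)) = 0"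
        using False by (intro fdiff_poly_eq_0) (simp add: degree_monom_eq)
      moreover have "poly (monom (1::real) k) = (\<lambda>y. y ^ k)" by (auto simp: poly_monom)
      ultimately show ?thesis using False by simp
    next
      case True
      have "\<bar>fdiff r u (\<lambda>y. y ^ k) (- (real r * u / 2))\<bar> \<le> 2 ^ r * (real r * u / 2) ^ k"
      proof (rule fdiff_abs_le)
        fix i assume "i \<le> r"
        hence "real i * u \<le> real r * u" "0 \<le> real i * u" using u by (auto intro: mult_right_mono)
        hence "\<bar>- (real r * u / 2) + real i * u\<bar> \<le> real r * u / 2" by (intro abs_leI) linarith+
        thus "\<bar>(- (real r * u / 2) + real i * u) ^ k\<bar> \<le> (real r * u / 2) ^ k"
          unfolding power_abs by (intro power_mono) auto
      qed
      hence "\<bar>coeff q k\<bar> * \<bar>fdiff r u (\<lambda>y. y ^ k) (- (real r * u / 2))\<bar>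
          \<le> \<bar>coeff q k\<bar> * (2 ^ r * (real r * u / 2) ^ k)"
        by (intro mult_left_mono) auto
      also have "\<dots> = 2 ^ r * (\<bar>coeff q k\<bar> * R ^ k) * \<theta> ^ k"
      proof -
        have "real r * u / 2 = \<theta> * R" using R by (simp add: \<theta>_def)
        thus ?thesis by (simp add: power_mult_distrib)
      qed
      also have "\<dots> \<le> 2 ^ r * B * \<theta> ^ k"
        using cf \<theta> by (intro mult_right_mono mult_left_mono) auto
      finally show ?thesis using True by simp
    qed
  qed
  also have "\<dots> = 2 ^ r * B * (\<Sum>k\<in>{..degree q} \<inter> {r..}. \<theta> ^ k)"
    by (simp add: sum.If_cases sum_distrib_left Collect_mono_iff atLeast_def)
  also have "\<dots> \<le> 2 ^ r * B * (2 * \<theta> ^ r)"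
  proof (intro mult_left_mono)
    have "(\<Sum>k\<in>{..degree q} \<inter> {r..}. \<theta> ^ k) \<le> (\<Sum>k\<in>{r..r + degree q}. \<theta> ^ k)"
      by (intro sum_mono2) (use \<theta> in auto)
    also have "\<dots> = \<theta> ^ r * (\<Sum>k\<le>degree q. \<theta> ^ k)"
    proof -
      have "(\<Sum>k\<in>{r..r + degree q}. \<theta> ^ k) = (\<Sum>k\<in>{0..degree q}. \<theta> ^ (k + r))"
        using sum.shift_bounds_cl_nat_ivl[of "\<lambda>k. \<theta> ^ k" 0 r "degree q"] by (simp add: add.commute)
      thus ?thesis by (simp add: power_add sum_distrib_left atLeast0AtMost mult.commute)
    qed
    also have "\<dots> \<le> \<theta> ^ r * 2"
    proof (intro mult_left_mono)
      have "(\<Sum>k\<le>degree q. \<theta> ^ k) \<le> (\<Sum>k\<le>degree q. (1 / 2) ^ k)"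
        using \<theta> by (intro sum_mono power_mono) auto
      also have "\<dots> \<le> 2" by (subst sum_gp0) (simp add: field_simps)
      finally show "(\<Sum>k\<le>degree q. \<theta> ^ k) \<le> 2" .
    qed (use \<theta> in auto)
    finally show "(\<Sum>k\<in>{..degree q} \<inter> {r..}. \<theta> ^ k) \<le> 2 * \<theta> ^ r" by simp
  qed (use B0 in auto)
  also have "\<dots> = 2 * B * (2 * \<theta>) ^ r" by (simp add: power_mult_distrib)
  also have "2 * \<theta> = real r * u / R" by (simp add: \<theta>_def)
  finally show ?thesis .
qed

context doubling_measure
begin

text \<open>The p-th power of the constant of \<open>poly_norm_le_kernel_integral\<close> for M = s
  + 2, times the Jensen constant of a kernel of mass 4. The choice of M yields 2 s + 4 powers of
  decay, the number needed in \<open>nn_integral_aw_akernel\<close>.\<close>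

definition sup_const :: "real \<Rightarrow> real" where
  "sup_const p = (4 * exp (real (s + 2) + 1) * 100 ^ (s + 2) * (real (s + 2) + 1) * (17 + 16 * real (s
      + 2))) powr p * 4 powr (p - 1)"

text \<open>Dominates the p-th power of the modulus of P on the disc of radius rho_m(x)/16 about x
  (\<open>poly_powr_le_majorant\<close>) and, unlike that power itself, varies slowly in x at scale
  m.\<close>

definition majorant :: "real \<Rightarrow> nat \<Rightarrow> real poly \<Rightarrow> real \<Rightarrow> ennreal" where
  "majorant p m P x = ennreal (sup_const p) *
     (\<integral>\<^sup>+y. ennreal (akernel (2 * (s + 2)) m x y / rho m y * \<bar>poly P y\<bar> powr p) * indicator {-1..1} y \<partial>lborel)"

lemma poly_powr_le_majorant:
  fixes z :: complex
  assumes p: "1 < p" and m: "1 \<le> m" and deg: "degree P < m" and x: "x \<in> {-1..1}" and z: "norm (z - of_real x)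
      \<le> rho m x / 16"
  shows "ennreal (norm (poly (map_poly of_real P) z) powr p) \<le> majorant p m P x"
proof -
  define C where "C = 4 * exp (real (s + 2) + 1) * 100 ^ (s + 2) * (real (s + 2) + 1) * (17 + 16 * real (s + 2))"
  define B where "B = 2 * (s + 2)"
  define k where "k y = akernel B m x y / rho m y * indicator {-1..1} y" for y
  have k0: "0 \<le> k y" for y
    using rho_pos[OF m, of y] akernel_pos[of B m x y] by (auto simp: k_def indicator_def)
  have C: "0 < C" by (auto simp: C_def intro!: mult_pos_pos add_pos_nonneg)
  define a where "a = norm (poly (map_poly of_real P) z) / C"
  have eq1: "(\<integral>\<^sup>+y. ennreal (\<bar>poly P y\<bar> * (akernel B m x y / rho m y)) * indicator {-1..1} y \<partial>lborel)
      = (\<integral>\<^sup>+y. ennreal (k y * \<bar>poly P y\<bar>) \<partial>lborel)"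
    by (intro nn_integral_cong) (auto simp: k_def indicator_def mult.commute)
  have eq2: "(\<integral>\<^sup>+y. ennreal (akernel B m x y / rho m y * \<bar>poly P y\<bar> powr p) * indicator {-1..1} y \<partial>lborel)
      = (\<integral>\<^sup>+y. ennreal (k y * \<bar>poly P y\<bar> powr p) \<partial>lborel)"
    by (intro nn_integral_cong) (auto simp: k_def indicator_def mult.commute)
  have "ennreal (C * a) \<le> ennreal C * (\<integral>\<^sup>+y. ennreal (k y * \<bar>poly P y\<bar>) \<partial>lborel)"
    using poly_norm_le_kernel_integral[OF m deg x z, of "s + 2"] C
    unfolding C_def[symmetric] B_def[symmetric] eq1 by (simp add: a_def)
  hence "ennreal (1 / C) * ennreal (C * a) \<le> ennreal (1 / C) * (ennreal C * (\<integral>\<^sup>+y.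
      ennreal (k y * \<bar>poly P y\<bar>) \<partial>lborel))"
    by (intro mult_left_mono) auto
  hence a: "ennreal a \<le> (\<integral>\<^sup>+y. ennreal (k y * \<bar>poly P y\<bar>) \<partial>lborel)"
    using C by (simp add: mult.assoc[symmetric] ennreal_mult'[symmetric] ennreal_mult[symmetric] a_def)
  have "ennreal (a powr p) \<le> ennreal (4 powr (p - 1)) * (\<integral>\<^sup>+y. ennreal (k y * \<bar>poly P y\<bar> powr p) \<partial>lborel)"
  proof (rule nn_integral_jensen_powr[OF _ _ _ _ p])
    have "(\<integral>\<^sup>+y. ennreal (k y) \<partial>lborel) = (\<integral>\<^sup>+y. ennreal (akernel B m x y / rho m y) * indicator {-1..1} y \<partial>lborel)"
      by (intro nn_integral_cong) (auto simp: k_def indicator_def)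
    also have "\<dots> \<le> 4" by (rule nn_integral_akernel_div_rho[OF m x]) (simp add: B_def)
    finally show "(\<integral>\<^sup>+y. ennreal (k y) \<partial>lborel) \<le> ennreal 4" by simp
  qed (use k0 a C in \<open>auto simp: a_def k_def\<close>)
  hence "ennreal (C powr p) * ennreal (a powr p) \<le> ennreal (C powr p) * (ennreal (4 powr (p - 1)) * (\<integral>\<^sup>+y.
      ennreal (k y * \<bar>poly P y\<bar> powr p) \<partial>lborel))"
    by (intro mult_left_mono) auto
  moreover have "C powr p * a powr p = norm (poly (map_poly of_real P) z) powr p"
    using C by (simp add: powr_mult[symmetric] a_def)
  ultimately show ?thesis
    unfolding majorant_def sup_const_def C_def[symmetric] B_def[symmetric] eq2
    by (simp add: ennreal_mult[symmetric] ennreal_mult'[symmetric] mult.assoc[symmetric])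
qed

lemma majorant_borel [measurable]: "majorant p m P \<in> borel_measurable borel"
  unfolding majorant_def akernel_def adist_def by measurable

text \<open>After Fubini the kernel is integrated over x against w_n for fixed y. The result, of
  order rho_m(y) w_m(y), cancels the division by rho_m(y).\<close>

lemma nn_integral_majorant_le:
  assumes p: "1 < p" and mn: "2 \<le> m" "m \<le> n"
  shows "(\<integral>\<^sup>+x. majorant p m P x * ennreal (aw n x) * indicator {-1..1} x \<partial>lborel)
    \<le> ennreal (sup_const p * (15552 * 64 ^ (2 * (s + 2)) * 3 ^ s)) *
      (\<integral>\<^sup>+y. ennreal (\<bar>poly P y\<bar> powr p * aw m y) * indicator {-1..1} y \<partial>lborel)"
proof -
  define B where "B = 2 * (s + 2)"
  define D where "D = 15552 * 64 ^ B * (3::real) ^ s"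
  define F where "F x y = ennreal (sup_const p) * (ennreal (akernel B m x y / rho m y * \<bar>poly P y\<bar> powr p)
      * indicator {-1..1} y) * (ennreal (aw n x) * indicator {-1..1} x)" for x y
  have [measurable]: "case_prod F \<in> borel_measurable (lborel \<Otimes>\<^sub>M lborel)"
    unfolding F_def case_prod_beta' akernel_def adist_def by measurable
  have sc: "0 \<le> sup_const p" by (simp add: sup_const_def)
  have "(\<integral>\<^sup>+x. majorant p m P x * ennreal (aw n x) * indicator {-1..1} x \<partial>lborel)
      = (\<integral>\<^sup>+x. (\<integral>\<^sup>+y. F x y \<partial>lborel) \<partial>lborel)"
  proof (rule nn_integral_cong)
    fix x :: real
    have "(\<integral>\<^sup>+y. F x y \<partial>lborel) = (\<integral>\<^sup>+y. ennreal (sup_const p) * (ennreal (akernel B m x y / rho m y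
        * \<bar>poly P y\<bar> powr p) * indicator {-1..1} y) \<partial>lborel)
        * (ennreal (aw n x) * indicator {-1..1} x)"
      unfolding F_def by (rule nn_integral_multc) measurable
    also have "(\<integral>\<^sup>+y. ennreal (sup_const p) * (ennreal (akernel B m x y / rho m y * \<bar>poly P y\<bar> powr p)
        * indicator {-1..1} y) \<partial>lborel) = majorant p m P x"
      unfolding majorant_def B_def by (rule nn_integral_cmult) measurable
    finally show "majorant p m P x * ennreal (aw n x) * indicator {-1..1} x = (\<integral>\<^sup>+y. F x y \<partial>lborel)"
      by (simp add: mult.assoc)
  qed
  also have "\<dots> = (\<integral>\<^sup>+y. (\<integral>\<^sup>+x. F x y \<partial>lborel) \<partial>lborel)" by (rule lborel_pair.Fubini'[symmetric]) measurable
  also have "\<dots> \<le> (\<integral>\<^sup>+y. ennreal (sup_const p * D) * (ennreal (\<bar>poly P y\<bar> powr p * aw m y)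
      * indicator {-1..1} y) \<partial>lborel)"
  proof (rule nn_integral_mono)
    fix y :: real
    show "(\<integral>\<^sup>+x. F x y \<partial>lborel) \<le> ennreal (sup_const p * D) * (ennreal (\<bar>poly P y\<bar> powr p * aw m y)
        * indicator {-1..1} y)"
    proof (cases "y \<in> {-1..1}")
      case True
      have r: "0 < rho m y" using True mn by (intro rho_pos) auto
      have aw: "0 \<le> aw m y" using True mn by (intro aw_nonneg) auto
      define c where "c = sup_const p * (\<bar>poly P y\<bar> powr p / rho m y)"
      have c: "0 \<le> c" using sc r by (simp add: c_def)
      have "(\<integral>\<^sup>+x. F x y \<partial>lborel) = (\<integral>\<^sup>+x. ennreal c * (ennreal (aw n x * akernel B m x y)
          * indicator {-1..1} x) \<partial>lborel)"
      proof (rule nn_integral_cong)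
        fix x :: real
        show "F x y = ennreal c * (ennreal (aw n x * akernel B m x y) * indicator {-1..1} x)"
        proof (cases "x \<in> {-1..1}")
          case x: True
          have "0 \<le> aw n x" using x mn by (intro aw_nonneg) auto
          hence "F x y = ennreal (sup_const p * (akernel B m x y / rho m y * \<bar>poly P y\<bar> powr p) * aw n x)"
            using x True sc r akernel_pos[of B m x y] by (simp add: F_def ennreal_mult'[symmetric]
                ennreal_mult''[symmetric])
          also have "sup_const p * (akernel B m x y / rho m y * \<bar>poly P y\<bar> powr p) * aw n x
              = c * (aw n x * akernel B m x y)"
            by (simp add: c_def)
          also have "ennreal \<dots> = ennreal c * (ennreal (aw n x * akernel B m x y) * indicator {-1..1} x)"
            using x c by (simp add: ennreal_mult')
          finally show ?thesis .
        qed (simp add: F_def)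
      qed
      also have "\<dots> = ennreal c * (\<integral>\<^sup>+x. ennreal (aw n x * akernel B m x y) * indicator {-1..1} x \<partial>lborel)"
        by (rule nn_integral_cmult) (simp add: akernel_commute[of B m _ y])
      also have "\<dots> \<le> ennreal c * ennreal (D * (rho m y * aw m y))"
        unfolding D_def using nn_integral_aw_akernel[OF mn True, of B]
            by (intro mult_left_mono) (auto simp: B_def mult.assoc)
      also have "\<dots> = ennreal (sup_const p * D) * (ennreal (\<bar>poly P y\<bar> powr p * aw m y) * indicator {-1..1} y)"
        using True r c sc aw by (simp add: ennreal_mult'[symmetric] ennreal_mult[symmetric] D_def c_def)
      finally show ?thesis .
    qed (simp add: F_def)
  qed
  also have "\<dots> = ennreal (sup_const p * D) * (\<integral>\<^sup>+y. ennreal (\<bar>poly P y\<bar> powr p * aw m y)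
      * indicator {-1..1} y \<partial>lborel)"
    by (rule nn_integral_cmult) measurable
  finally show ?thesis by (simp add: D_def B_def)
qed

text \<open>If n >= 16 r m, the nodes of the difference fit into the disc of radius rho_m(x)/16 and
  \<open>fdiff_poly_bound\<close> gains the power r. For smaller n the factor (16 r m / n)^(r p) is
  at least 1, so boundedness of the difference operator suffices.\<close>

lemma nn_integral_sym_diff_poly_le:
  assumes p: "1 < p" and r: "1 \<le> r"
  shows "\<exists>C\<ge>0. \<forall>m n P h. 2 \<le> m \<longrightarrow> m \<le> n \<longrightarrow> degree P < m \<longrightarrow> 0 < h \<longrightarrow> h \<le> 1 / real n \<longrightarrow>
    (\<integral>\<^sup>+x. ennreal (\<bar>sym_diff r (h * phi x) (poly P) x\<bar> powr p * aw n x) * indicator {-1..1} x \<partial>lborel)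
     \<le> ennreal (C * (real m / real n) powr (real r * p)) *
        (\<integral>\<^sup>+x. ennreal (\<bar>poly P x\<bar> powr p * aw m x) * indicator {-1..1} x \<partial>lborel)"
proof -
  define E where "E = sup_const p * (15552 * 64 ^ (2 * (s + 2)) * 3 ^ s)"
  define D where "D = real (Suc r) * 2 powr (real r * p) * 3 ^ s * (1 + 4 * real r) ^ (2 * s + 1) * 2"
  define H where "H = (16 * real r) powr (real r * p)"
  have E: "0 \<le> E" "0 \<le> D" "0 \<le> H" by (auto simp: E_def D_def H_def sup_const_def)
  have "(\<integral>\<^sup>+x. ennreal (\<bar>sym_diff r (h * phi x) (poly P) x\<bar> powr p * aw n x) * indicator {-1..1} x \<partial>lborel)
     \<le> ennreal ((D * E * H + 2 powr p * H * E) * (real m / real n) powr (real r * p)) *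
        (\<integral>\<^sup>+x. ennreal (\<bar>poly P x\<bar> powr p * aw m x) * indicator {-1..1} x \<partial>lborel)" (is "?L \<le> _ * ?R")
    if mn: "2 \<le> m" "m \<le> n" and deg: "degree P < m" and h: "0 < h" "h \<le> 1 / real n" for m n P h
  proof -
    define q where "q = (real m / real n) powr (real r * p)"
    have q: "0 \<le> q" by (simp add: q_def)
    have n0: "0 < real n" "0 < real m" using mn by auto
    have m1: "1 \<le> m" using mn by simp
    have M: "(\<integral>\<^sup>+x. majorant p m P x * ennreal (aw n x) * indicator {-1..1} x \<partial>lborel) \<le> ennreal E * ?R"
      unfolding E_def by (rule nn_integral_majorant_le[OF p mn])
    show ?thesis
    proof (cases "16 * r * m \<le> n")
      case False
      hence "real n \<le> 16 * real r * real m" by (metis nat_le_linear of_nat_le_iff of_nat_mult of_nat_numeral)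
      hence "1 / (16 * real r) \<le> real m / real n" using n0 r by (simp add: field_simps)
      hence "1 \<le> (16 * real r) * (real m / real n)" using r by (simp add: field_simps)
      hence "1 \<le> ((16 * real r) * (real m / real n)) powr (real r * p)" using p by (intro ge_one_powr_ge_zero) auto
      also have "((16 * real r) * (real m / real n)) powr (real r * p) = H * q"
        unfolding H_def q_def by (subst powr_mult) (use r n0 in auto)
      finally have Hq: "1 \<le> H * q" .
      have "?L \<le> ennreal D * (\<integral>\<^sup>+x. ennreal (\<bar>poly P x\<bar> powr p * aw n x) * indicator {-1..1} x \<partial>lborel)"
        unfolding D_def using mn p by (intro nn_integral_sym_diff_le h r) auto
      also have "\<dots> \<le> ennreal D * (\<integral>\<^sup>+x. majorant p m P x * ennreal (aw n x) * indicator {-1..1} x \<partial>lborel)"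
      proof (intro mult_left_mono nn_integral_mono)
        fix x :: real
        show "ennreal (\<bar>poly P x\<bar> powr p * aw n x) * indicator {-1..1} x
            \<le> majorant p m P x * ennreal (aw n x) * indicator {-1..1} x"
        proof (cases "x \<in> {-1..1}")
          case True
          have "ennreal (\<bar>poly P x\<bar> powr p) \<le> majorant p m P x"
            using poly_powr_le_majorant[OF p m1 deg True, of "of_real x"] rho_pos[OF m1 True]
            by (simp add: poly_map_of_real)
          thus ?thesis using True by (simp add: ennreal_mult' mult_right_mono)
        qed auto
      qed auto
      also have "\<dots> \<le> ennreal D * (ennreal E * ?R)" by (intro mult_left_mono M) auto
      also have "\<dots> = ennreal (D * E) * ?R" using E by (simp add: ennreal_mult mult.assoc)
      also have "\<dots> \<le> ennreal ((D * E * H + 2 powr p * H * E) * q) * ?R"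
      proof (intro mult_right_mono ennreal_leI)
        have "D * E * 1 \<le> D * E * (H * q)" using E Hq by (intro mult_left_mono) auto
        moreover have "0 \<le> 2 powr p * H * E * q" using E q by simp
        ultimately show "D * E \<le> (D * E * H + 2 powr p * H * E) * q" by (simp add: distrib_right mult.assoc)
      qed auto
      finally show ?thesis by (simp add: q_def)
    next
      case True
      hence small: "16 * real r * real m \<le> real n" by (metis of_nat_le_iff of_nat_mult of_nat_numeral)
      have "?L \<le> (\<integral>\<^sup>+x. ennreal (2 powr p * H * q) * (majorant p m P x * ennreal (aw n x)
          * indicator {-1..1} x) \<partial>lborel)"
      proof (rule nn_integral_mono)
        fix x :: real
        show "ennreal (\<bar>sym_diff r (h * phi x) (poly P) x\<bar> powr p * aw n x) * indicator {-1..1} x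
           \<le> ennreal (2 powr p * H * q) * (majorant p m P x * ennreal (aw n x) * indicator {-1..1} x)"
        proof (cases "x \<in> {-1..1}")
          case x: True
          have aw: "0 \<le> aw n x" using x mn by (intro aw_nonneg) auto
          have rx: "0 < rho m x" using x m1 by (intro rho_pos) auto
          have "ennreal (\<bar>sym_diff r (h * phi x) (poly P) x\<bar> powr p) \<le> ennreal (2 powr p * H * q) * majorant p m P x"
          \<comment> \<open>An infinite majorant is separated first, because the real root B below
            would otherwise be formed from the default value of \<open>enn2real\<close>. The factors
            H and q are nonzero, so the right side is then infinite.\<close>
          proof (cases "majorant p m P x = \<infinity> \<or> \<not> (x - real r * (h * phi x) / 2 \<in> {-1..1}
              \<and> x + real r * (h * phi x) / 2 \<in> {-1..1})")
            case True
            thus ?thesis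
            proof
              assume "majorant p m P x = \<infinity>"
              moreover have "H \<noteq> 0" "q \<noteq> 0" using r n0 by (auto simp: H_def q_def)
              ultimately show ?thesis using E q by (simp add: ennreal_mult_top ennreal_mult')
            next
              assume "\<not> (x - real r * (h * phi x) / 2 \<in> {-1..1} \<and> x + real r * (h * phi x) / 2 \<in> {-1..1})"
              hence "sym_diff r (h * phi x) (poly P) x = 0" by (auto simp: sym_diff_def)
              thus ?thesis using p by simp
            qed
          next
            case False
            define B where "B = enn2real (majorant p m P x) powr (1 / p)"
            have mj: "majorant p m P x = ennreal (B powr p)"
              using False p by (simp add: B_def powr_powr less_top[symmetric])
            define R where "R = rho m x / 16"
            have R: "0 < R" using rx by (simp add: R_def)
            have ph: "0 \<le> phi x" using x by (rule phi_nonneg)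
            have uR: "real r * (h * phi x) \<le> 16 * real r * (real m / real n) * R"
            proof -
              have "h * phi x \<le> 1 / real n * phi x" using h ph by (intro mult_right_mono) auto
              also have "\<dots> = real m / real n * (phi x / real m)" using n0 by simp
              also have "\<dots> \<le> real m / real n * rho m x" using n0 m1 by (intro mult_left_mono phi_le_rho) auto
              also have "\<dots> = 16 * (real m / real n) * R" by (simp add: R_def)
              finally show ?thesis using mult_left_mono[of _ _ "real r"] by (fastforce simp: mult_ac)
            qed
            also have "\<dots> \<le> 1 * R" using small n0 R by (intro mult_right_mono) (auto simp: field_simps)
            finally have uR1: "real r * (h * phi x) \<le> R" by simp
            have "\<bar>sym_diff r (h * phi x) (poly P) x\<bar> = \<bar>fdiff r (h * phi x) (poly P) (x - real r * (h * phi x) / 2)\<bar>"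
              using False by (intro sym_diff_fdiff) auto
            also have "\<dots> \<le> 2 * B * (real r * (h * phi x) / R) ^ r"
            proof (rule fdiff_poly_bound[OF R])
              fix z :: complex assume "norm (z - of_real x) = R"
              hence "ennreal (norm (poly (map_poly of_real P) z) powr p) \<le> ennreal (B powr p)"
                unfolding mj[symmetric] by (intro poly_powr_le_majorant[OF p m1 deg x]) (simp add: R_def)
              hence "norm (poly (map_poly of_real P) z) powr p \<le> B powr p" by (simp add: ennreal_le_iff)
              thus "norm (poly (map_poly of_real P) z) \<le> B"
                using p powr_less_mono2[of p B "norm (poly (map_poly of_real P) z)"] by (force simp: B_def)
            qed (use h ph uR1 in auto)
            also have "\<dots> \<le> 2 * B * (16 * real r * (real m / real n)) ^ r"
              using uR R h ph by (intro mult_left_mono power_mono) (auto simp: B_def field_simps)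
            finally have "\<bar>sym_diff r (h * phi x) (poly P) x\<bar> powr p
                \<le> (2 * B * (16 * real r * (real m / real n)) ^ r) powr p"
              using p by (intro powr_mono2) auto
            also have "\<dots> = 2 powr p * B powr p * ((16 * real r * (real m / real n)) ^ r) powr p"
              using r n0 by (simp add: powr_mult B_def)
            also have "((16 * real r * (real m / real n)) ^ r) powr p = H * q"
            proof -
              have "((16 * real r * (real m / real n)) ^ r) powr p
                  = ((16 * real r) * (real m / real n)) powr (real r * p)"
                using r n0 by (simp add: powr_realpow[symmetric] powr_powr)
              also have "\<dots> = H * q" unfolding H_def q_def by (subst powr_mult) (use r n0 in auto)
              finally show ?thesis .
            qed
            finally have "ennreal (\<bar>sym_diff r (h * phi x) (poly P) x\<bar> powr p)
                \<le> ennreal (2 powr p * H * q * B powr p)"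
              by (intro ennreal_leI) (simp add: mult_ac)
            also have "\<dots> = ennreal (2 powr p * H * q) * majorant p m P x"
              unfolding mj using E q by (intro ennreal_mult) auto
            finally show ?thesis .
          qed
          hence "ennreal (\<bar>sym_diff r (h * phi x) (poly P) x\<bar> powr p) * ennreal (aw n x)
              \<le> (ennreal (2 powr p * H * q) * majorant p m P x) * ennreal (aw n x)"
            by (intro mult_right_mono) auto
          thus ?thesis using x aw by (simp add: ennreal_mult mult.assoc)
        qed auto
      qed
      also have "\<dots> = ennreal (2 powr p * H * q) * (\<integral>\<^sup>+x. majorant p m P x * ennreal (aw n x)
          * indicator {-1..1} x \<partial>lborel)"
        by (rule nn_integral_cmult) measurable
      also have "\<dots> \<le> ennreal (2 powr p * H * q) * (ennreal E * ?R)" by (intro mult_left_mono M) auto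
      also have "\<dots> = ennreal (2 powr p * H * q * E) * ?R" using E q by (simp add: ennreal_mult mult.assoc)
      also have "\<dots> \<le> ennreal ((D * E * H + 2 powr p * H * E) * q) * ?R"
        using E q by (intro mult_right_mono ennreal_leI) (auto simp: algebra_simps)
      finally show ?thesis by (simp add: q_def)
    qed
  qed
  moreover have "0 \<le> D * E * H + 2 powr p * H * E" using E by simp
  ultimately show ?thesis by blast
qed

end

section \<open>Telescoping over dyadic degrees\<close>

lemma sym_diff_add: "sym_diff r h (\<lambda>x. f x + g x) x = sym_diff r h f x + sym_diff r h g x"
  by (simp add: sym_diff_def sum.distrib distrib_left)

lemma sym_diff_sum: "finite A \<Longrightarrow> sym_diff r h (\<lambda>x. \<Sum>a\<in>A. f a x) x = (\<Sum>a\<in>A. sym_diff r h (f a) x)"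
proof (induction A rule: finite_induct)
  case empty
  show ?case by (simp add: sym_diff_def)
qed (auto simp: sym_diff_add)

context doubling_measure
begin

text \<open>Kept as a p-th power in [0,infinity], so that Jensen and Fubini apply directly; roots
  are taken only in the final theorem.\<close>

definition wint :: "real \<Rightarrow> nat \<Rightarrow> (real \<Rightarrow> real) \<Rightarrow> ennreal" where
  "wint p n g = (\<integral>\<^sup>+x. ennreal (\<bar>g x\<bar> powr p * aw n x) * indicator {-1..1} x \<partial>lborel)"

abbreviation smooth_bound :: "real \<Rightarrow> nat \<Rightarrow> nat \<Rightarrow> (real \<Rightarrow> real) \<Rightarrow> real \<Rightarrow> bool" where
  "smooth_bound p r N f \<Omega> \<equiv> \<forall>h. 0 < h \<longrightarrow> h \<le> 1 / real N \<longrightarrow> wint p N (\<lambda>x. sym_diff r (h * phi x) f x) \<le> ennreal \<Omega>"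

lemma wint_add_le:
  assumes n: "1 \<le> n" and p: "0 \<le> p" and [measurable]: "f \<in> borel_measurable borel" "g \<in> borel_measurable borel"
  shows "wint p n (\<lambda>x. f x + g x) \<le> ennreal (2 powr p) * (wint p n f + wint p n g)"
proof -
  have "wint p n (\<lambda>x. f x + g x) \<le> (\<integral>\<^sup>+x. ennreal (2 powr p) * (ennreal (\<bar>f x\<bar> powr p * aw n x)
      * indicator {-1..1} x + ennreal (\<bar>g x\<bar> powr p * aw n x) * indicator {-1..1} x) \<partial>lborel)"
    unfolding wint_def
  proof (rule nn_integral_mono)
    fix x :: real
    show "ennreal (\<bar>f x + g x\<bar> powr p * aw n x) * indicator {-1..1} x
      \<le> ennreal (2 powr p) * (ennreal (\<bar>f x\<bar> powr p * aw n x) * indicator {-1..1} x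
          + ennreal (\<bar>g x\<bar> powr p * aw n x) * indicator {-1..1} x)"
    proof (cases "x \<in> {-1..1}")
      case True
      hence aw: "0 \<le> aw n x" using n by (intro aw_nonneg)
      have "\<bar>f x + g x\<bar> powr p \<le> (\<bar>f x\<bar> + \<bar>g x\<bar>) powr p" using p by (intro powr_mono2) auto
      also have "\<dots> \<le> 2 powr p * (\<bar>f x\<bar> powr p + \<bar>g x\<bar> powr p)" by (rule powr_add_le) (use p in auto)
      finally have "\<bar>f x + g x\<bar> powr p * aw n x \<le> 2 powr p * (\<bar>f x\<bar> powr p + \<bar>g x\<bar> powr p) * aw n x"
        using aw by (intro mult_right_mono)
      also have "\<dots> = 2 powr p * (\<bar>f x\<bar> powr p * aw n x + \<bar>g x\<bar> powr p * aw n x)" by (simp add: algebra_simps)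
      finally have "ennreal (\<bar>f x + g x\<bar> powr p * aw n x) \<le> ennreal (2 powr p * (\<bar>f x\<bar> powr p * aw n x
          + \<bar>g x\<bar> powr p * aw n x))"
        by (rule ennreal_leI)
      thus ?thesis using True aw by (simp add: ennreal_mult)
    qed auto
  qed
  also have "\<dots> = ennreal (2 powr p) * (wint p n f + wint p n g)"
    unfolding wint_def by (subst nn_integral_cmult) (auto simp: nn_integral_add)
  finally show ?thesis .
qed

lemma wint_scale:
  assumes "1 \<le> m" "m \<le> n" "real n \<le> A * real m" "1 \<le> A"
    and [measurable]: "f \<in> borel_measurable borel"
  shows "wint p n f \<le> ennreal (A\<^sup>2) * wint p m f"
proof -
  have "wint p n f \<le> (\<integral>\<^sup>+x. ennreal (A\<^sup>2) * (ennreal (\<bar>f x\<bar> powr p * aw m x) * indicator {-1..1} x) \<partial>lborel)"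
    unfolding wint_def
  proof (rule nn_integral_mono)
    fix x :: real
    show "ennreal (\<bar>f x\<bar> powr p * aw n x) * indicator {-1..1} x
        \<le> ennreal (A\<^sup>2) * (ennreal (\<bar>f x\<bar> powr p * aw m x) * indicator {-1..1} x)"
    proof (cases "x \<in> {-1..1}")
      case True
      have "\<bar>f x\<bar> powr p * aw n x \<le> \<bar>f x\<bar> powr p * (A\<^sup>2 * aw m x)"
        using assms True by (intro mult_left_mono aw_scale) auto
      hence "ennreal (\<bar>f x\<bar> powr p * aw n x) \<le> ennreal (A\<^sup>2 * (\<bar>f x\<bar> powr p * aw m x))"
        by (intro ennreal_leI) (simp add: mult_ac)
      thus ?thesis using True by (simp add: ennreal_mult')
    qed auto
  qed
  also have "\<dots> = ennreal (A\<^sup>2) * wint p m f"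
    unfolding wint_def by (rule nn_integral_cmult) measurable
  finally show ?thesis .
qed

text \<open>The crude bound of w_n by n^2 times the total mass suffices. It supplies a constant for
  the first dyadic block, which is not a difference of two approximants.\<close>

lemma wint_poly_finite:
  assumes "1 \<le> n" "0 \<le> p"
  shows "wint p n (poly P) < \<infinity>"
proof -
  have "bounded (poly P ` {-1..1})"
    by (intro compact_imp_bounded compact_continuous_image continuous_intros) auto
  then obtain B where B: "\<And>x. x \<in> {-1..1} \<Longrightarrow> \<bar>poly P x\<bar> \<le> B"
    unfolding bounded_iff ball_simps by (metis image_eqI real_norm_def)
  have "wint p n (poly P) \<le> (\<integral>\<^sup>+(x::real). ennreal (B powr p * (measure \<mu> UNIV * (real n)\<^sup>2))
      * indicator {-1..1} x \<partial>lborel)"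
    unfolding wint_def
  proof (rule nn_integral_mono)
    fix x :: real
    show "ennreal (\<bar>poly P x\<bar> powr p * aw n x) * indicator {-1..1} x
        \<le> ennreal (B powr p * (measure \<mu> UNIV * (real n)\<^sup>2)) * indicator {-1..1} x"
    proof (cases "x \<in> {-1..1}")
      case True
      hence r: "0 < rho n x" using assms by (intro rho_pos)
      have "x\<^sup>2 \<le> 1" using True by (simp add: abs_square_le_1 abs_le_iff)
      hence "1 / (real n)\<^sup>2 \<le> rho n x" by (simp add: rho_def)
      hence i: "1 / rho n x \<le> (real n)\<^sup>2" using r assms by (simp add: field_simps)
      have "aw n x = measure \<mu> {x - rho n x..x + rho n x} * (1 / rho n x)" by (simp add: aw_def)
      also have "\<dots> \<le> measure \<mu> UNIV * (real n)\<^sup>2"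
        using r i by (intro mult_mono finite_measure_mono) (auto simp: sets_mu)
      finally have "\<bar>poly P x\<bar> powr p * aw n x \<le> B powr p * (measure \<mu> UNIV * (real n)\<^sup>2)"
        using B[OF True] assms True by (intro mult_mono powr_mono2 aw_nonneg) auto
      thus ?thesis using True by (simp add: ennreal_leI)
    qed auto
  qed
  also have "\<dots> < \<infinity>" by (subst nn_integral_cmult_indicator) (auto simp: ennreal_mult_less_top)
  finally show ?thesis .
qed

text \<open>The block of degree below 2^j has size 2^(-j \<alpha>) and its difference gains
  (2^j/n)^r. With n of order 2^J the contributions decay like 2^(-(J - j)(r - \<alpha>)) relative to
  2^(-J \<alpha>), so they are summable because \<alpha> < r. Blocks are summed by Jensen with
  geometric weights.\<close>

theorem inverse_estimate:
  assumes p: "1 < p" and r: "1 \<le> r" and \<alpha>: "0 < \<alpha>" "\<alpha> < real r"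
    and f[measurable]: "f \<in> borel_measurable borel"
    and C1: "0 \<le> C1" and approx: "\<And>m. n0 \<le> m \<Longrightarrow> \<exists>P. degree P < m \<and> wint p m (\<lambda>x. f x - poly P x)
        \<le> ennreal (C1 * real m powr (- (\<alpha> * p)))"
  shows "\<exists>C\<ge>0. \<exists>n1. \<forall>n\<ge>n1. \<forall>h. 0 < h \<longrightarrow> h \<le> 1 / real n \<longrightarrow>
     wint p n (\<lambda>x. sym_diff r (h * phi x) f x) \<le> ennreal (C * real n powr (- (\<alpha> * p)))"
proof -
  \<comment> \<open>Starting at 1 or later keeps 2^j >= 2, the range in which windows have radius at
    most 1.\<close>
  define j0 where "j0 = max n0 1"
  have pow: "n0 \<le> 2 ^ j" "2 \<le> (2::nat) ^ j" if "j0 \<le> j" for j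
  proof -
    have "j < 2 ^ j" by (rule less_exp)
    thus "n0 \<le> 2 ^ j" using that unfolding j0_def by linarith
    have "(2::nat) ^ 1 \<le> 2 ^ j" using that by (intro power_increasing) (auto simp: j0_def)
    thus "2 \<le> (2::nat) ^ j" by simp
  qed
  obtain P where P: "degree (P j) < 2 ^ j" "wint p (2 ^ j) (\<lambda>x. f x - poly (P j) x)
      \<le> ennreal (C1 * real (2 ^ j) powr (- (\<alpha> * p)))"
    if "j0 \<le> j" for j
    using approx[OF pow(1)] by metis
  define w where "w j = (2::real) powr (- (real j * (\<alpha> * p)))" for j :: nat
  have w: "real (2 ^ j) powr (- (\<alpha> * p)) = w j" for j
    by (simp add: w_def powr_realpow[symmetric] powr_powr)
  have w0: "0 < w j" for j by (simp add: w_def)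
  define b where "b j = (if j = j0 then P j0 else P j - P (j - 1))" for j
  have degb: "degree (b j) < 2 ^ j" if j: "j0 \<le> j" for j
  proof (cases "j = j0")
    case False
    hence j': "j0 \<le> j - 1" using j by simp
    have "(2::nat) ^ (j - 1) \<le> 2 ^ j" by (intro power_increasing) auto
    hence "degree (P (j - 1)) < 2 ^ j" using P(1)[OF j'] by linarith
    thus ?thesis using False P(1)[OF j] by (simp add: b_def degree_diff_less)
  qed (use P(1)[OF j] in \<open>simp add: b_def\<close>)
  define T0 where "T0 = enn2real (wint p (2 ^ j0) (poly (P j0)))"
  \<comment> \<open>The first summand makes the uniform bound C2 w_j true for the initial block; the
    factor 4 in the second is the cost of passing from w at 2^(j-1) to w at 2^j.\<close>
  define C2 where "C2 = T0 / w j0 + 2 powr p * C1 * (1 + 4 * 2 powr (\<alpha> * p))"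
  have C2: "0 \<le> C2" using C1 w0[of j0] by (auto simp: C2_def T0_def intro!: add_nonneg_nonneg mult_nonneg_nonneg)
  have wb: "wint p (2 ^ j) (poly (b j)) \<le> ennreal (C2 * w j)" if j: "j0 \<le> j" for j
  proof (cases "j = j0")
    case True
    have "wint p (2 ^ j) (poly (b j)) = ennreal T0"
      using wint_poly_finite[of "2 ^ j0" p "P j0"] p True by (simp add: T0_def b_def)
    also have "T0 = T0 / w j0 * w j" using w0[of j0] True by simp
    also have "\<dots> \<le> C2 * w j" using C1 w0[of j] by (intro mult_right_mono) (auto simp: C2_def)
    finally show ?thesis by (simp add: ennreal_leI)
  next
    case False
    hence j': "j0 \<le> j - 1" "j = Suc (j - 1)" using j by auto
    have wj: "w (j - 1) = 2 powr (\<alpha> * p) * w j"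
    proof -
      have "real (j - 1) = real j - 1" using j' by simp
      thus ?thesis by (simp add: w_def powr_add[symmetric] algebra_simps)
    qed
    have "wint p (2 ^ j) (poly (b j)) = wint p (2 ^ j) (\<lambda>x. (f x - poly (P (j - 1)) x) + (poly (P j) x - f x))"
      using False by (simp add: b_def wint_def)
    also have "\<dots> \<le> ennreal (2 powr p) * (wint p (2 ^ j) (\<lambda>x. f x - poly (P (j - 1)) x)
        + wint p (2 ^ j) (\<lambda>x. poly (P j) x - f x))"
      using p by (intro wint_add_le) auto
    also have "wint p (2 ^ j) (\<lambda>x. poly (P j) x - f x) = wint p (2 ^ j) (\<lambda>x. f x - poly (P j) x)"
      by (simp add: wint_def abs_minus_commute)
    also have "\<dots> \<le> ennreal (C1 * w j)" using P(2)[OF j] by (simp only: w)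
    also have "wint p (2 ^ j) (\<lambda>x. f x - poly (P (j - 1)) x) \<le> ennreal (2\<^sup>2) * wint p (2 ^ (j - 1)) (\<lambda>x.
        f x - poly (P (j - 1)) x)"
    proof (rule wint_scale)
      have "(2::nat) ^ j = 2 * 2 ^ (j - 1)" by (subst j'(2)) simp
      thus "2 ^ (j - 1) \<le> (2::nat) ^ j" "real (2 ^ j) \<le> 2 * real (2 ^ (j - 1))" by simp_all
    qed auto
    also have "wint p (2 ^ (j - 1)) (\<lambda>x. f x - poly (P (j - 1)) x) \<le> ennreal (C1 * w (j - 1))"
      using P(2)[OF j'(1)] by (simp only: w)
    finally have "wint p (2 ^ j) (poly (b j)) \<le> ennreal (2 powr p) * (ennreal (2\<^sup>2) * ennreal (C1 * w (j - 1))
        + ennreal (C1 * w j))"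
      by (simp add: mult_left_mono add_mono)
    also have "\<dots> = ennreal (2 powr p * (2\<^sup>2 * (C1 * w (j - 1)) + C1 * w j))"
    proof -
      have "ennreal (2\<^sup>2) * ennreal (C1 * w (j - 1)) + ennreal (C1 * w j)
          = ennreal (2\<^sup>2 * (C1 * w (j - 1)) + C1 * w j)"
        using C1 w0[of j] w0[of "j - 1"] by (subst ennreal_mult[symmetric], auto)
      thus ?thesis using C1 w0[of j] w0[of "j - 1"] by (simp only: ennreal_mult'[symmetric] powr_ge_zero)
    qed
    also have "2 powr p * (2\<^sup>2 * (C1 * w (j - 1)) + C1 * w j) = 2 powr p * C1 * (1 + 4 * 2 powr (\<alpha> * p)) * w j"
      unfolding wj by (simp add: algebra_simps)
    also have "\<dots> \<le> C2 * w j"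
      using w0[of j] w0[of j0] by (intro mult_right_mono) (auto simp: C2_def T0_def)
    finally show ?thesis by (simp add: ennreal_leI)
  qed
  have sumb: "(\<Sum>j=j0..J. b j) = P J" if "j0 \<le> J" for J
    using that by (induction J rule: dec_induct) (auto simp: b_def)
  obtain C3 where C3: "0 \<le> C3" and C3': "\<And>m n Q h. 2 \<le> m \<Longrightarrow> m \<le> n \<Longrightarrow> degree Q < m \<Longrightarrow> 0 < h \<Longrightarrow> h \<le> 1 / real n \<Longrightarrow>
      wint p n (\<lambda>x. sym_diff r (h * phi x) (poly Q) x) \<le> ennreal (C3 * (real m / real n) powr (real r * p))
          * wint p m (poly Q)"
    using nn_integral_sym_diff_poly_le[OF p r] unfolding wint_def by blast
  define D where "D = real (Suc r) * 2 powr (real r * p) * 3 ^ s * (1 + 4 * real r) ^ (2 * s + 1) * 2"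
  have D: "0 \<le> D" by (simp add: D_def)
  define \<epsilon> where "\<epsilon> = real r - \<alpha>"
  define \<theta> where "\<theta> = (2::real) powr (- \<epsilon>)"
  have \<theta>: "0 < \<theta>" "\<theta> < 1" using \<alpha> by (auto simp: \<theta>_def \<epsilon>_def powr_less_one)
  define K where "K = 1 / (1 - \<theta>)"
  have K: "0 < K" using \<theta> by (simp add: K_def)
  define C where "C = 2 powr p * (4 * D * C1 + K powr (p - 1) * (C3 * C2 * K)) * 2 powr (\<alpha> * p)"
  have C: "0 \<le> C" using D C1 C2 C3 K by (simp add: C_def)
  have main: "wint p n (\<lambda>x. sym_diff r (h * phi x) f x) \<le> ennreal (C * real n powr (- (\<alpha> * p)))"
    if n: "2 ^ j0 \<le> n" and h: "0 < h" "h \<le> 1 / real n" for n h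
  proof -
    have n1: "1 \<le> n" using n by (meson one_le_numeral one_le_power order.trans)
    obtain J where J: "2 ^ J \<le> n" "n < 2 ^ Suc J"
      using ex_power_ivl1[of 2 n] n1 by auto
    have "(2::nat) ^ j0 < 2 ^ Suc J" using n J by linarith
    hence jJ: "j0 \<le> J" by (subst (asm) power_strict_increasing_iff) auto
    have n0: "0 < real n" using n1 by simp
    have Jr: "real (2 ^ J) \<le> real n" "real n \<le> 2 * real (2 ^ J)" using J by (simp_all flip: of_nat_power of_nat_mult)
    have two: "2 \<le> n" using pow(2)[OF jJ] J by linarith
    have wJ: "w J \<le> 2 powr (\<alpha> * p) * real n powr (- (\<alpha> * p))"
    proof -
      have "w J = 2 powr (\<alpha> * p) * (2 * real (2 ^ J)) powr (- (\<alpha> * p))"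
        unfolding w[symmetric] by (simp add: powr_mult powr_add[symmetric] flip: mult.assoc)
      also have "\<dots> \<le> 2 powr (\<alpha> * p) * real n powr (- (\<alpha> * p))"
        using Jr n0 \<alpha> p by (intro mult_left_mono powr_mono2') auto
      finally show ?thesis .
    qed
    define A where "A x = sym_diff r (h * phi x) (\<lambda>x. f x - poly (P J) x) x" for x
    define Bj where "Bj j x = sym_diff r (h * phi x) (poly (b j)) x" for j x
    have [measurable]: "A \<in> borel_measurable borel" "Bj j \<in> borel_measurable borel" for j
      unfolding A_def Bj_def by (intro sym_diff_borel; measurable)+
    have split: "sym_diff r (h * phi x) f x = A x + (\<Sum>j=j0..J. Bj j x)" for x
    proof -
      have "f = (\<lambda>x. (f x - poly (P J) x) + (\<Sum>j=j0..J. poly (b j) x))"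
        by (simp add: sumb[OF jJ, symmetric] poly_sum)
      hence "sym_diff r (h * phi x) f x = sym_diff r (h * phi x) (\<lambda>x. (f x - poly (P J) x)
          + (\<Sum>j=j0..J. poly (b j) x)) x"
        by simp
      also have "\<dots> = A x + (\<Sum>j=j0..J. Bj j x)"
        unfolding A_def Bj_def by (simp add: sym_diff_add sym_diff_sum)
      finally show ?thesis .
    qed
    have "wint p n A \<le> ennreal D * wint p n (\<lambda>x. f x - poly (P J) x)"
      unfolding A_def wint_def D_def using p by (intro nn_integral_sym_diff_le two h r) auto
    also have "\<dots> \<le> ennreal D * (ennreal (2\<^sup>2) * wint p (2 ^ J) (\<lambda>x. f x - poly (P J) x))"
      using J Jr by (intro mult_left_mono wint_scale) auto
    also have "\<dots> \<le> ennreal D * (ennreal (2\<^sup>2) * ennreal (C1 * w J))"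
      using P(2)[OF jJ] by (intro mult_left_mono) (auto simp only: w zero_le)
    also have "\<dots> = ennreal (D * (2\<^sup>2 * (C1 * w J)))"
      using D C1 w0[of J] by (simp only: ennreal_mult'[symmetric] zero_le_power2)
    finally have wA: "wint p n A \<le> ennreal (4 * D * C1 * w J)" by (simp add: mult_ac)
    \<comment> \<open>Jensen weights with half-open room on neither side: their sum is at most K,
      and dividing a block by its weight costs the power p - 1 of the weight, out of the power p by
      which the block decays.\<close>
    define lam where "lam j = \<theta> ^ (J - j)" for j
    have lam0: "0 < lam j" for j using \<theta> by (simp add: lam_def)
    have lamsum: "(\<Sum>j=j0..J. lam j) \<le> K"
    proof -
      have "(\<Sum>j=j0..J. lam j) \<le> (\<Sum>j\<le>J. lam j)" using lam0 by (intro sum_mono2) (auto intro: less_imp_le)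
      also have "\<dots> = (\<Sum>j\<le>J. \<theta> ^ j)"
        unfolding lam_def by (rule sum.nat_diff_reindex[of "\<lambda>j.
            \<theta> ^ j" "Suc J", simplified lessThan_Suc_atMost diff_Suc_Suc, simplified])
      also have "\<dots> \<le> K" using \<theta> by (subst sum_gp0) (auto simp: K_def intro!: divide_right_mono)
      finally show ?thesis .
    qed
    have "wint p n (\<lambda>x. \<Sum>j=j0..J. Bj j x) \<le> (\<integral>\<^sup>+x. (\<Sum>j=j0..J. ennreal (K powr (p - 1) * lam j powr (1 - p))
        * (ennreal (\<bar>Bj j x\<bar> powr p * aw n x) * indicator {-1..1} x)) \<partial>lborel)"
      unfolding wint_def
    proof (rule nn_integral_mono)
      fix x :: real
      show "ennreal (\<bar>\<Sum>j=j0..J. Bj j x\<bar> powr p * aw n x) * indicator {-1..1} x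
        \<le> (\<Sum>j=j0..J. ennreal (K powr (p - 1) * lam j powr (1 - p)) * (ennreal (\<bar>Bj j x\<bar> powr p * aw n x)
            * indicator {-1..1} x))"
      proof (cases "x \<in> {-1..1}")
        case True
        hence aw: "0 \<le> aw n x" using n1 by (intro aw_nonneg)
        have "\<bar>\<Sum>j=j0..J. Bj j x\<bar> \<le> (\<Sum>j=j0..J. lam j * (\<bar>Bj j x\<bar> / lam j))"
          using lam0 by (intro order.trans[OF sum_abs] sum_mono) (simp add: less_imp_neq[symmetric])
        hence "\<bar>\<Sum>j=j0..J. Bj j x\<bar> powr p \<le> (\<Sum>j=j0..J. lam j * (\<bar>Bj j x\<bar> / lam j)) powr p"
          using p by (intro powr_mono2) auto
        also have "\<dots> \<le> K powr (p - 1) * (\<Sum>j=j0..J. lam j * (\<bar>Bj j x\<bar> / lam j) powr p)"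
          using lam0 by (intro sum_jensen_powr p K lamsum) (auto intro: less_imp_le divide_nonneg_pos)
        also have "(\<Sum>j=j0..J. lam j * (\<bar>Bj j x\<bar> / lam j) powr p) = (\<Sum>j=j0..J. lam j powr (1 - p) * \<bar>Bj j x\<bar> powr p)"
          using lam0 by (intro sum.cong refl) (simp add: powr_divide powr_diff less_imp_le)
        finally have "\<bar>\<Sum>j=j0..J. Bj j x\<bar> powr p * aw n x \<le> K powr (p - 1) * (\<Sum>j=j0..J.
            lam j powr (1 - p) * \<bar>Bj j x\<bar> powr p) * aw n x"
          using aw by (intro mult_right_mono)
        also have "\<dots> = (\<Sum>j=j0..J. (K powr (p - 1) * lam j powr (1 - p)) * (\<bar>Bj j x\<bar> powr p * aw n x))"
          by (simp add: sum_distrib_left sum_distrib_right mult_ac)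
        finally have "ennreal (\<bar>\<Sum>j=j0..J. Bj j x\<bar> powr p * aw n x)
            \<le> ennreal (\<Sum>j=j0..J. (K powr (p - 1) * lam j powr (1 - p)) * (\<bar>Bj j x\<bar> powr p * aw n x))"
          by (rule ennreal_leI)
        also have "\<dots> = (\<Sum>j=j0..J. ennreal (K powr (p - 1) * lam j powr (1 - p)) * ennreal (\<bar>Bj j x\<bar> powr p * aw n x))"
          using aw by (subst sum_ennreal[symmetric]) (auto simp: ennreal_mult)
        finally show ?thesis using True by simp
      qed auto
    qed
    also have "\<dots> = (\<Sum>j=j0..J. ennreal (K powr (p - 1) * lam j powr (1 - p)) * wint p n (Bj j))"
      unfolding wint_def by (subst nn_integral_sum) (auto intro!: sum.cong nn_integral_cmult)
    also have "\<dots> \<le> (\<Sum>j=j0..J. ennreal (K powr (p - 1) * (C3 * C2) * w J * lam j))"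
    proof (rule sum_mono)
      fix j assume j: "j \<in> {j0..J}"
      have jn: "2 ^ j \<le> n" using j J(1) by (metis atLeastAtMost_iff order.trans one_le_numeral power_increasing)
      define y where "y = real (2 ^ j) / real n"
      have "wint p n (Bj j) \<le> ennreal (C3 * y powr (real r * p)) * wint p (2 ^ j) (poly (b j))"
        unfolding Bj_def y_def using j by (intro C3' pow(2) jn degb h) auto
      also have "\<dots> \<le> ennreal (C3 * y powr (real r * p)) * ennreal (C2 * w j)"
        using j by (intro mult_left_mono wb) auto
      also have "\<dots> = ennreal (C3 * y powr (real r * p) * (C2 * w j))"
        using C3 C2 w0[of j] by (simp add: ennreal_mult)
      finally have "ennreal (K powr (p - 1) * lam j powr (1 - p)) * wint p n (Bj j) \<le>
         ennreal (K powr (p - 1) * lam j powr (1 - p)) * ennreal (C3 * y powr (real r * p) * (C2 * w j))"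
        by (intro mult_left_mono) auto
      also have "\<dots> = ennreal (K powr (p - 1) * (C3 * C2) * (lam j powr (1 - p) * (y powr (real r * p) * w j)))"
        using C3 C2 w0[of j] by (subst ennreal_mult[symmetric]) (auto simp: mult_ac)
      \<comment> \<open>With \<epsilon> = r - \<alpha> the exponents of 2 add up to -J \<alpha> p -
        \<epsilon> (J - j), so exactly one weight is left for the summation.\<close>
      also have "lam j powr (1 - p) * (y powr (real r * p) * w j) \<le> w J * lam j"
      proof -
        have jr: "real (J - j) = real J - real j" using j by (simp add: of_nat_diff)
        have lamj: "lam j = 2 powr (- \<epsilon> * (real J - real j))"
          by (simp add: lam_def \<theta>_def powr_realpow[symmetric] powr_powr jr)
        have "y \<le> real (2 ^ j) / real (2 ^ J)"
          unfolding y_def using Jr n0 by (intro divide_left_mono) auto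
        also have "\<dots> = 2 powr (real j - real J)" by (simp add: powr_diff powr_realpow)
        finally have "y powr (real r * p) \<le> (2 powr (real j - real J)) powr (real r * p)"
          using p by (intro powr_mono2) (auto simp: y_def)
        hence "lam j powr (1 - p) * (y powr (real r * p) * w j)
            \<le> lam j powr (1 - p) * ((2 powr (real j - real J)) powr (real r * p) * w j)"
          using w0[of j] by (intro mult_left_mono mult_right_mono) auto
        also have "\<dots> = 2 powr ((- \<epsilon> * (real J - real j)) * (1 - p) + ((real j - real J) * (real r * p)
            + - (real j * (\<alpha> * p))))"
          unfolding lamj w_def powr_powr powr_add ..
        also have "(- \<epsilon> * (real J - real j)) * (1 - p) + ((real j - real J) * (real r * p)
            + - (real j * (\<alpha> * p))) = - (real J * (\<alpha> * p)) + - \<epsilon> * (real J - real j)"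
          by (simp add: \<epsilon>_def algebra_simps)
        also have "2 powr \<dots> = w J * lam j" unfolding lamj w_def powr_add ..
        finally show ?thesis .
      qed
      finally show "ennreal (K powr (p - 1) * lam j powr (1 - p)) * wint p n (Bj j)
          \<le> ennreal (K powr (p - 1) * (C3 * C2) * w J * lam j)"
        using C3 C2 by (simp add: mult_left_mono ennreal_leI mult.assoc)
    qed
    also have "\<dots> = ennreal (\<Sum>j=j0..J. K powr (p - 1) * (C3 * C2) * w J * lam j)"
      by (intro sum_ennreal mult_nonneg_nonneg less_imp_le[OF lam0] less_imp_le[OF w0] C2 C3) auto
    also have "\<dots> \<le> ennreal (K powr (p - 1) * (C3 * C2) * w J * K)"
      unfolding sum_distrib_left[symmetric] using C2 C3 w0[of J]
      by (intro ennreal_leI mult_left_mono lamsum) (auto intro!: mult_nonneg_nonneg less_imp_le)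
    finally have wB: "wint p n (\<lambda>x. \<Sum>j=j0..J. Bj j x) \<le> ennreal (K powr (p - 1) * (C3 * C2 * K) * w J)"
      by (simp add: mult_ac)
    have "wint p n (\<lambda>x. sym_diff r (h * phi x) f x) \<le> ennreal (2 powr p) * (wint p n A
        + wint p n (\<lambda>x. \<Sum>j=j0..J. Bj j x))"
      unfolding split using p n1 by (intro wint_add_le) auto
    also have "\<dots> \<le> ennreal (2 powr p) * (ennreal (4 * D * C1 * w J) + ennreal (K powr (p - 1) * (C3 * C2 * K) * w J))"
      by (intro mult_left_mono add_mono wA wB) auto
    also have "\<dots> = ennreal (2 powr p * (4 * D * C1 + K powr (p - 1) * (C3 * C2 * K)) * w J)"
      using D C1 C2 C3 K w0[of J] by (simp add: ennreal_mult'[symmetric] ennreal_plus[symmetric] distrib_right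
          mult.assoc del: ennreal_plus)
    also have "\<dots> \<le> ennreal (2 powr p * (4 * D * C1 + K powr (p - 1) * (C3 * C2 * K)) * (2 powr (\<alpha> * p)
        * real n powr (- (\<alpha> * p))))"
      using D C1 C2 C3 K by (intro ennreal_leI mult_left_mono wJ) auto
    finally show ?thesis by (simp add: C_def mult.assoc)
  qed
  show ?thesis using C main by blast
qed

end

section \<open>Whitney's inequality on an interval\<close>

text \<open>A discrete Taylor estimate. Differences of order i vanish at 0 and are sums of at most K
  differences of order i + 1, so descending from order r + 1 to 0 costs a factor K each
  time.\<close>

lemma seq_near_polynomial:
  fixes a :: "nat \<Rightarrow> real"
  defines "D \<equiv> \<lambda>i k. \<Sum>j\<le>i. (-1) ^ j * real (i choose j) * a (k + j)"
  assumes \<delta>: "0 \<le> \<delta>" and D0: "\<And>i. i \<le> r \<Longrightarrow> D i 0 = 0"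
    and Dr: "\<And>k. k + Suc r \<le> K \<Longrightarrow> \<bar>D (Suc r) k\<bar> \<le> \<delta>" and K: "1 \<le> K" and k: "k \<le> K"
  shows "\<bar>a k\<bar> \<le> real K ^ Suc r * \<delta>"
proof -
  have DS: "D (Suc i) k = D i k - D i (Suc k)" for i k
  proof -
    \<comment> \<open>The sequence is read as a step function so that the recursion for
      \<open>fdiff\<close> can be reused.\<close>
    have "D i k = fdiff i 1 (\<lambda>x. a (nat \<lfloor>x\<rfloor>)) (real k)" for i k
      unfolding D_def fdiff_def by (intro sum.cong refl) (simp flip: of_nat_add)
    thus ?thesis using fdiff_Suc[of i 1 "\<lambda>x. a (nat \<lfloor>x\<rfloor>)" "real k"] by (simp add: add.commute)
  qed
  have "i \<le> Suc r \<Longrightarrow> k + i \<le> K \<Longrightarrow> \<bar>D i k\<bar> \<le> real K ^ (Suc r - i) * \<delta>" for i k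
  proof (induction "Suc r - i" arbitrary: i k)
    case 0
    hence "i = Suc r" by simp
    thus ?case using Dr 0 by simp
  next
    case (Suc m)
    hence i: "i \<le> r" by simp
    have "l \<le> k \<Longrightarrow> \<bar>D i l\<bar> \<le> real l * (real K ^ m * \<delta>)" for l
    proof (induction l)
      case 0
      thus ?case using D0[OF i] by simp
    next
      case (Suc l)
      have "\<bar>D (Suc i) l\<bar> \<le> real K ^ (Suc r - Suc i) * \<delta>"
        using \<open>Suc m = Suc r - i\<close> \<open>k + i \<le> K\<close> i \<open>Suc l \<le> k\<close> by (intro \<open>\<And>i k. m = Suc r - i \<Longrightarrow> i \<le> Suc r
            \<Longrightarrow> k + i \<le> K \<Longrightarrow> \<bar>D i k\<bar> \<le> real K ^ (Suc r - i) * \<delta>\<close>) auto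
      also have "Suc r - Suc i = m" using \<open>Suc m = Suc r - i\<close> by simp
      finally have "\<bar>D i (Suc l)\<bar> \<le> \<bar>D i l\<bar> + real K ^ m * \<delta>" using DS[of i l] by linarith
      also have "\<bar>D i l\<bar> \<le> real l * (real K ^ m * \<delta>)" using Suc by simp
      finally show ?case by (simp add: algebra_simps)
    qed
    from this[of k] have "\<bar>D i k\<bar> \<le> real k * (real K ^ m * \<delta>)" by simp
    also have "\<dots> \<le> real K * (real K ^ m * \<delta>)" using Suc.prems \<delta> by (intro mult_right_mono) auto
    also have "\<dots> = real K ^ (Suc r - i) * \<delta>" using \<open>Suc m = Suc r - i\<close>[symmetric] by simp
    finally show ?case .
  qed
  from this[of 0 k] show ?thesis using k by (simp add: D_def)
qed

lemma polynomial_interpolation_exists: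
  fixes b :: "nat \<Rightarrow> real"
  shows "\<exists>q :: real poly. degree q \<le> r \<and> (\<forall>k\<le>r. poly q (real k) = b k)"
proof (induction r)
  case 0
  show ?case by (rule exI[of _ "[:b 0:]"]) auto
next
  case (Suc r)
  then obtain q where q: "degree q \<le> r" "\<And>k. k \<le> r \<Longrightarrow> poly q (real k) = b k" by blast
  define w where "w = (\<Prod>j\<le>r. [:- real j, 1:])"
  have w0: "poly w (real k) = 0" if "k \<le> r" for k
    unfolding w_def poly_prod using that by (intro prod_zero bexI[of _ k]) auto
  have w1: "poly w (real (Suc r)) \<noteq> 0"
    unfolding w_def poly_prod by (auto simp: prod_zero_iff)
  have dw: "degree w \<le> Suc r"
    unfolding w_def by (rule order.trans[OF degree_prod_sum_le]) (auto simp: o_def)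
  define c where "c = (b (Suc r) - poly q (real (Suc r))) / poly w (real (Suc r))"
  show ?case
  proof (intro exI[of _ "q + smult c w"] conjI allI impI)
    show "degree (q + smult c w) \<le> Suc r"
      using q dw degree_smult_le[of c w] by (intro degree_add_le) linarith+
    show "poly (q + smult c w) (real k) = b k" if "k \<le> Suc r" for k
    proof (cases "k = Suc r")
      case True
      thus ?thesis using w1 by (simp add: c_def)
    next
      case False
      thus ?thesis using that q w0 by simp
    qed
  qed
qed

text \<open>G interpolates F at the first r + 1 grid points of spacing v, so the differences of F -
  G of order up to r vanish at 0 and those of order r + 1 are those of F. This controls F - G on the
  grid. Between grid points F is controlled by \<tau> and G by a Lipschitz constant, read off from
  its values at nodes spread over the whole interval.\<close>

lemma near_polynomial:
  fixes F :: "real \<Rightarrow> real"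
  assumes r: "1 \<le> r" and N: "4 * real r \<le> N" and v: "1 / (2 * N) \<le> v" "v \<le> 1 / N"
    and \<delta>: "0 \<le> \<delta>" and diff: "\<And>j. real (j + Suc r) * v \<le> 1 \<Longrightarrow> \<bar>fdiff (Suc r) v F (real j * v)\<bar> \<le> \<delta>"
    and \<tau>: "\<And>x y. x \<in> {0..1} \<Longrightarrow> y \<in> {0..1} \<Longrightarrow> \<bar>x - y\<bar> \<le> 1 / N \<Longrightarrow> \<bar>F x - F y\<bar> \<le> \<tau>"
    and A: "\<And>x. x \<in> {0..1} \<Longrightarrow> \<bar>F x\<bar> \<le> A"
  shows "\<exists>G. degree G \<le> r \<and> (\<forall>y\<in>{0..1}. \<bar>F y - poly G y\<bar> \<le>
     \<tau> + (2 * N) ^ Suc r * \<delta> + (A + (2 * N) ^ Suc r * \<delta>) * (real (Suc r) * (real r * (4 * real r) ^ r)) / N)"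
proof -
  have N0: "4 \<le> N" using r N by auto
  have v0: "0 < v" using v N0 by (auto intro: less_le_trans[of _ "1 / (2 * N)"])
  have "1 / N \<le> 1 / 4" using N0 by (intro divide_left_mono) auto
  hence v4: "v \<le> 1 / 4" using v by linarith
  define K where "K = nat \<lfloor>1 / v\<rfloor>"
  have K: "real K \<le> 1 / v" "1 / v < real K + 1"
    using v0 by (auto simp: K_def)
  have Kv: "real K * v \<le> 1" "1 < real K * v + v" using K v0 by (auto simp: field_simps)
  have K2N: "real K \<le> 2 * N"
  proof -
    have "1 / v \<le> 2 * N" using v(1) v0 N0 by (simp add: field_simps)
    thus ?thesis using K by linarith
  qed
  have KN: "N - 1 < real K"
  proof -
    have "N \<le> 1 / v" using v(2) v0 N0 by (simp add: field_simps)
    thus ?thesis using K by linarith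
  qed
  have Kr: "r \<le> K" "1 \<le> K" using KN N N0 r by linarith+
  define \<delta>' where "\<delta>' = (2 * N) ^ Suc r * \<delta>"
  have \<delta>': "0 \<le> \<delta>'" using N0 \<delta> by (simp add: \<delta>'_def)
  obtain q where q: "degree q \<le> r" "\<And>k. k \<le> r \<Longrightarrow> poly q (real k) = F (real k * v)"
    using polynomial_interpolation_exists[of r "\<lambda>k. F (real k * v)"] by blast
  define G where "G = pcompose q [:0, 1 / v:]"
  have degG: "degree G \<le> r" using q by (simp add: G_def degree_pcompose v0 less_imp_neq[OF v0, symmetric])
  have Gk: "poly G (real k * v) = poly q (real k)" for k
    using v0 by (simp add: G_def poly_pcompose)
  define a where "a k = F (real k * v) - poly G (real k * v)" for k
  have Da: "(\<Sum>j\<le>i. (-1) ^ j * real (i choose j) * a (k + j)) = fdiff i v (\<lambda>x. F x - poly G x) (real k * v)" for i k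
    unfolding fdiff_def a_def by (simp add: algebra_simps)
  have near: "\<bar>a k\<bar> \<le> \<delta>'" if k: "k \<le> K" for k
  proof -
    have "\<bar>a k\<bar> \<le> real K ^ Suc r * \<delta>"
    proof (rule seq_near_polynomial[OF \<delta> _ _ Kr(2) k])
      fix i assume i: "i \<le> r"
      have "a j = 0" if "j \<le> i" for j using q(2)[of j] Gk[of j] that i by (simp add: a_def)
      thus "(\<Sum>j\<le>i. (-1) ^ j * real (i choose j) * a (0 + j)) = 0" by simp
    next
      fix k assume "k + Suc r \<le> K"
      hence "real (k + Suc r) * v \<le> real K * v" using v0 by (intro mult_right_mono) auto
      hence "real (k + Suc r) * v \<le> 1" using Kv by linarith
      moreover have "fdiff (Suc r) v (poly G) (real k * v) = 0"
        using degG by (intro fdiff_poly_eq_0) simp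
      ultimately show "\<bar>\<Sum>j\<le>Suc r. (-1) ^ j * real (Suc r choose j) * a (k + j)\<bar> \<le> \<delta>"
        unfolding Da fdiff_diff using diff by simp
    qed
    also have "\<dots> \<le> \<delta>'" unfolding \<delta>'_def using K2N \<delta> by (intro mult_right_mono power_mono) auto
    finally show ?thesis .
  qed
  \<comment> \<open>Every M-th grid point is taken as a node: i M <= K for i <= r, and the spacing d
    = M v is at least 1/(4 r), independently of the fineness of the grid.\<close>
  define M where "M = K div r"
  have M: "r * M \<le> K" "K < r * (M + 1)" using r
    by (auto simp: M_def dividend_less_times_div)
  have M1: "1 \<le> M" using Kr r by (simp add: M_def Suc_le_eq div_greater_zero_iff)
  define d where "d = real M * v"
  have d: "1 / (4 * real r) \<le> d"
  proof -
    have "real K \<le> real (r * (M + 1))" using M by linarith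
    also have "\<dots> \<le> real r * (2 * real M)"
      unfolding of_nat_mult using M1 by (intro mult_left_mono) auto
    finally have "real K * v \<le> real r * (2 * real M) * v" using v0 by (intro mult_right_mono) auto
    moreover have "1 / 2 \<le> real K * v" using Kv v4 by linarith
    ultimately have "1 / 2 \<le> 2 * real r * d" by (simp add: d_def mult_ac)
    thus ?thesis using r by (simp add: field_simps)
  qed
  have d0: "0 < d" using M1 v0 by (simp add: d_def)
  define z where "z i = real i * d" for i :: nat
  have z: "z i \<in> {0..1}" if "i \<le> r" for i
  proof -
    have "z i \<le> real (r * M) * v" unfolding z_def d_def using that v0
        by (simp add: mult.assoc[symmetric] mult_right_mono)
    also have "\<dots> \<le> real K * v" using M v0 by (intro mult_right_mono of_nat_mono) auto
    finally show ?thesis using Kv d0 by (simp add: z_def)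
  qed
  have Gz: "\<bar>poly G (z i)\<bar> \<le> A + \<delta>'" if "i \<le> r" for i
  proof -
    have "z i = real (i * M) * v" by (simp add: z_def d_def)
    moreover have "i * M \<le> K" using M(1) mult_right_mono[of i r M] that by linarith
    ultimately show ?thesis using near[of "i * M"] A[OF z[OF that]] by (simp add: a_def abs_if split: if_splits)
  qed
  have A0: "0 \<le> A" using A[of 0] by auto
  have lip: "\<bar>poly G x - poly G y\<bar> \<le> (A + \<delta>') * (real (Suc r) * (real r * (4 * real r) ^ r)) * \<bar>x - y\<bar>"
    if x: "x \<in> {0..1}" and y: "y \<in> {0..1}" for x y
  proof -
    have sep: "d \<le> \<bar>z i - z j\<bar>" if "i \<noteq> j" for i j
    proof -
      have "1 \<le> \<bar>real i - real j\<bar>" using that by linarith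
      hence "1 * d \<le> \<bar>real i - real j\<bar> * d" using d0 by (intro mult_right_mono) auto
      thus ?thesis using d0 by (simp add: z_def abs_mult left_diff_distrib[symmetric])
    qed
    have pd: "\<bar>(\<Prod>j\<in>{..<Suc r} - {i}. (x - z j) / (z i - z j)) - (\<Prod>j\<in>{..<Suc r} - {i}. (y - z j) / (z i - z j))\<bar>
       \<le> (real r * (4 * real r) ^ r) * \<bar>x - y\<bar>" if i: "i < Suc r" for i
    proof -
      \<comment> \<open>Division by L, which is at least 1/d, brings all factors into the unit ball,
        where the difference of two products is at most the sum of the differences of the
        factors.\<close>
      define L where "L = 4 * real r"
      have L: "0 < L" using r by (simp add: L_def)
      define S where "S = {..<Suc r} - {i}"
      have cS: "card S = r" using i by (simp add: S_def)
      have bd: "norm (((t - z j) / (z i - z j)) / L) \<le> 1" if "t \<in> {0..1}" "j \<in> S" for t j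
      proof -
        have "\<bar>t - z j\<bar> \<le> 1" using that z[of j] by (auto simp: S_def abs_le_iff)
        moreover have dz: "d \<le> \<bar>z i - z j\<bar>" using that by (intro sep) (auto simp: S_def)
        ultimately have "\<bar>t - z j\<bar> / \<bar>z i - z j\<bar> \<le> 1 / d" using d0 by (intro frac_le) auto
        also have "\<dots> \<le> L" using d d0 r by (simp add: L_def field_simps)
        finally show ?thesis by (simp only: real_norm_def abs_divide abs_of_pos[OF L] pos_divide_le_eq[OF L] mult_1)
      qed
      have "norm ((\<Prod>j\<in>S. ((x - z j) / (z i - z j)) / L) - (\<Prod>j\<in>S. ((y - z j) / (z i - z j)) / L))
        \<le> (\<Sum>j\<in>S. norm (((x - z j) / (z i - z j)) / L - ((y - z j) / (z i - z j)) / L))"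
        by (rule norm_prod_diff) (use bd x y in auto)
      also have "\<dots> \<le> (\<Sum>j\<in>S. \<bar>x - y\<bar>)"
      proof (rule sum_mono)
        fix j assume "j \<in> S"
        hence dz: "d \<le> \<bar>z i - z j\<bar>" by (intro sep) (auto simp: S_def)
        have "((x - z j) / (z i - z j)) / L - ((y - z j) / (z i - z j)) / L = (x - y) / ((z i - z j) * L)"
          by (simp add: diff_divide_distrib)
        hence "norm (((x - z j) / (z i - z j)) / L - ((y - z j) / (z i - z j)) / L) = \<bar>x - y\<bar> / (\<bar>z i - z j\<bar> * L)"
          using L by (simp add: abs_mult)
        also have "\<dots> \<le> \<bar>x - y\<bar> / 1"
        proof (rule divide_left_mono)
          have "1 \<le> d * L" using d r by (simp add: L_def field_simps)
          also have "\<dots> \<le> \<bar>z i - z j\<bar> * L" using dz L by (intro mult_right_mono) auto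
          finally show "1 \<le> \<bar>z i - z j\<bar> * L" .
          thus "0 < \<bar>z i - z j\<bar> * L * 1" by linarith
        qed auto
        finally show "norm (((x - z j) / (z i - z j)) / L - ((y - z j) / (z i - z j)) / L) \<le> \<bar>x - y\<bar>" by simp
      qed
      also have "\<dots> = real r * \<bar>x - y\<bar>" by (simp add: cS)
      finally have pn: "norm ((\<Prod>j\<in>S. ((x - z j) / (z i - z j)) / L) - (\<Prod>j\<in>S. ((y - z j) / (z i - z j)) / L))
          \<le> real r * \<bar>x - y\<bar>" .
      have "\<bar>(\<Prod>j\<in>S. (x - z j) / (z i - z j)) - (\<Prod>j\<in>S. (y - z j) / (z i - z j))\<bar> / L ^ r \<le> real r * \<bar>x - y\<bar>"
      proof -
        have e: "(\<Prod>j\<in>S. f j / L) = (\<Prod>j\<in>S. f j) / L ^ r" for f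
          by (simp add: prod_dividef cS)
        show ?thesis using pn
          unfolding e diff_divide_distrib[symmetric] by (simp only: real_norm_def abs_divide abs_of_pos[OF
              zero_less_power[OF L]])
      qed
      thus ?thesis using L unfolding S_def[symmetric] L_def[symmetric] by (simp add: pos_divide_le_eq mult_ac)
    qed
    have "\<bar>poly G x - poly G y\<bar> \<le> (\<Sum>i<Suc r. \<bar>poly G (z i)\<bar> *
          \<bar>(\<Prod>j\<in>{..<Suc r} - {i}. (x - z j) / (z i - z j)) - (\<Prod>j\<in>{..<Suc r} - {i}. (y - z j) / (z i - z j))\<bar>)"
      by (rule poly_bound_from_nodes(2)[where d = d]) (use degG sep d0 in auto)
    also have "\<dots> \<le> (\<Sum>i<Suc r. (A + \<delta>') * ((real r * (4 * real r) ^ r) * \<bar>x - y\<bar>))"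
      using Gz pd A0 \<delta>' by (intro sum_mono mult_mono) auto
    finally show ?thesis by (simp add: mult_ac)
  qed
  have "\<bar>F y - poly G y\<bar> \<le> \<tau> + \<delta>' + (A + \<delta>') * (real (Suc r) * (real r * (4
      * real r) ^ r)) / N" if y: "y \<in> {0..1}" for y
  proof -
    define k where "k = nat \<lfloor>y / v\<rfloor>"
    have "0 \<le> y / v" using y v0 by simp
    hence k: "real k \<le> y / v" "y / v < real k + 1" by (auto simp: k_def)
    have kv: "real k * v \<le> y" "y - real k * v \<le> v" using k v0 by (auto simp: field_simps)
    have "real k * v \<le> 1" using kv y by auto
    hence "real k \<le> 1 / v" using v0 by (simp add: field_simps)
    hence kK: "k \<le> K" by (simp add: K_def le_nat_floor)
    have x: "real k * v \<in> {0..1}" using kv y v0 by auto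
    have dist: "\<bar>y - real k * v\<bar> \<le> 1 / N" using kv v by auto
    have "\<bar>F y - F (real k * v)\<bar> \<le> \<tau>" by (rule \<tau>[OF y x dist])
    moreover have "\<bar>F (real k * v) - poly G (real k * v)\<bar> \<le> \<delta>'" using near[OF kK] by (simp add: a_def)
    moreover have "\<bar>poly G (real k * v) - poly G y\<bar> \<le> (A + \<delta>') * (real (Suc r) * (real r * (4 * real r) ^ r))
        * (1 / N)"
      by (rule order.trans[OF lip[OF x y]], rule mult_left_mono)
         (use dist A0 \<delta>' in \<open>auto simp: abs_minus_commute intro!: mult_nonneg_nonneg\<close>)
    ultimately show ?thesis by simp
  qed
  thus ?thesis using degG unfolding \<delta>'_def by blast
qed

text \<open>Integration from minus infinity avoids signed integrals. For a function that vanishes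
  off [0,1] the primitive still starts from the value 0 at 0.\<close>

definition primitive :: "(real \<Rightarrow> real) \<Rightarrow> real \<Rightarrow> real" where
  "primitive g y = (LINT t|lborel. indicator {..y} t * g t)"

lemma primitive_diff:
  assumes g: "integrable lborel g" and xy: "x \<le> y"
  shows "primitive g y - primitive g x = (LINT t|lborel. indicator {x<..y} t * g t)"
proof -
  have I: "integrable lborel (\<lambda>t. indicator {..y} t * g t)" for y
    using integrable_mult_indicator[of "{..y}" lborel g] g by simp
  have "primitive g y - primitive g x = (LINT t|lborel. indicator {..y} t * g t - indicator {..x} t * g t)"
    unfolding primitive_def using I by (subst Bochner_Integration.integral_diff) auto
  also have "\<dots> = (LINT t|lborel. indicator {x<..y} t * g t)"
    using xy by (intro Bochner_Integration.integral_cong refl) (auto simp: indicator_def)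
  finally show ?thesis .
qed

lemma primitive_affine:
  assumes g: "integrable lborel g" and ab: "a \<le> b" and c: "c \<noteq> 0"
  shows "integrable lborel (\<lambda>u. indicator {a..b} u * g (x + c * u))"
    and "(LINT u|lborel. indicator {a..b} u * g (x + c * u)) = (primitive g (x + c * b) - primitive g (x
        + c * a)) / c"
proof -
  have "integrable lborel (\<lambda>u. g (x + c * u))"
    using g c by (rule lborel_integrable_real_affine)
  thus "integrable lborel (\<lambda>u. indicator {a..b} u * g (x + c * u))"
    using integrable_mult_indicator[of "{a..b}" lborel "\<lambda>u. g (x + c * u)"] by simp
  have [measurable]: "g \<in> borel_measurable borel" using g by simp
  define lo where "lo = min (x + c * a) (x + c * b)"
  define hi where "hi = max (x + c * a) (x + c * b)"
  have "primitive g hi - primitive g lo = (LINT t|lborel. indicator {lo<..hi} t * g t)"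
    by (rule primitive_diff[OF g]) (auto simp: lo_def hi_def)
  also have "\<dots> = \<bar>c\<bar> *\<^sub>R (LINT u|lborel. indicator {lo<..hi} (x + c * u) * g (x + c * u))"
    by (rule lborel_integral_real_affine[OF c])
  also have "(LINT u|lborel. indicator {lo<..hi} (x + c * u) * g (x + c * u))
      = (LINT u|lborel. indicator {a..b} u * g (x + c * u))"
  proof (rule integral_cong_AE)
    have "AE u in lborel. u \<noteq> a" "AE u in lborel. u \<noteq> b" by (rule AE_lborel_singleton)+
    thus "AE u in lborel. indicator {lo<..hi} (x + c * u) * g (x + c * u) = indicator {a..b} u * g (x + c * u)"
    proof eventually_elim
      fix u assume u: "u \<noteq> a" "u \<noteq> b"
      have "x + c * u \<in> {lo<..hi} \<longleftrightarrow> u \<in> {a..b}"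
      proof (cases "0 < c")
        case True
        hence "lo = x + c * a" "hi = x + c * b" using ab by (auto simp: lo_def hi_def)
        thus ?thesis using True u by auto
      next
        case False
        hence c': "c < 0" using c by simp
        hence "lo = x + c * b" "hi = x + c * a" using ab by (auto simp: lo_def hi_def)
        thus ?thesis using c' u by auto
      qed
      thus "indicator {lo<..hi} (x + c * u) * g (x + c * u) = indicator {a..b} u * g (x + c * u)"
        by (simp add: indicator_def)
    qed
  qed measurable
  finally have *: "primitive g hi - primitive g lo = \<bar>c\<bar> * (LINT u|lborel. indicator {a..b} u * g (x + c * u))"
      by simp
  show "(LINT u|lborel. indicator {a..b} u * g (x + c * u)) = (primitive g (x + c * b) - primitive g (x + c * a)) / c"
  proof (cases "0 < c")
    case True
    hence "lo = x + c * a" "hi = x + c * b" using ab by (auto simp: lo_def hi_def)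
    thus ?thesis using * True by (simp add: field_simps)
  next
    case False
    hence c': "c < 0" using c by simp
    hence "lo = x + c * b" "hi = x + c * a" using ab by (auto simp: lo_def hi_def)
    thus ?thesis using * c' by (simp add: field_simps)
  qed
qed

lemma poly_affine_integral:
  fixes G :: "real poly"
  assumes ab: "a \<le> b" and c: "c \<noteq> 0"
  shows "integrable lborel (\<lambda>u. indicator {a..b} u * poly (pderiv G) (x + c * u))"
    and "(LINT u|lborel. indicator {a..b} u * poly (pderiv G) (x + c * u))
        = (poly G (x + c * b) - poly G (x + c * a)) / c"
proof -
  have "has_bochner_integral lborel (\<lambda>u. poly (pderiv G) (x + c * u) * indicator {a..b} u)
     (poly G (x + c * b) / c - poly G (x + c * a) / c)"
  proof (rule has_bochner_integral_FTC_Icc_real[OF ab])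
    fix u
    show "((\<lambda>u. poly G (x + c * u) / c) has_real_derivative poly (pderiv G) (x + c * u)) (at u)"
      using c by (auto intro!: derivative_eq_intros)
    show "isCont (\<lambda>u. poly (pderiv G) (x + c * u)) u" by (intro continuous_intros)
  qed
  thus "integrable lborel (\<lambda>u. indicator {a..b} u * poly (pderiv G) (x + c * u))"
    and "(LINT u|lborel. indicator {a..b} u * poly (pderiv G) (x + c * u))
        = (poly G (x + c * b) - poly G (x + c * a)) / c"
    by (simp_all add: has_bochner_integral_iff mult.commute diff_divide_distrib)
qed

text \<open>As $G'$ has degree below $r$, it is annihilated by the $r$-th difference. Averaging the difference
  over its step turns all its terms but the first into increments of the primitive of $g - G'$, each
  at most $2\eta$.\<close>

lemma half_pointwise:
  fixes G :: "real poly"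
  assumes g: "integrable lborel g" and p: "1 < p" and \<sigma>: "0 < \<sigma>" and c: "c = 1 \<or> c = -1" and r: "1 \<le> r"
    and G: "degree G \<le> r" and \<eta>: "\<And>y. y \<in> {0..1} \<Longrightarrow> \<bar>primitive g y - poly G y\<bar> \<le> \<eta>"
    and x: "x \<in> {0..1}" "x + c * (real r * \<sigma>) \<in> {0..1}"
  shows "ennreal (\<bar>g x - poly (pderiv G) x\<bar> powr p) \<le> ennreal (2 powr p) *
    ((\<integral>\<^sup>+u. ennreal (2 / \<sigma> * indicator {\<sigma>/2..\<sigma>} u * \<bar>fdiff r (c * u) g x\<bar> powr p) \<partial>lborel)
        + ennreal ((2 ^ r * 4 * \<eta> / \<sigma>) powr p))"
proof -
  have [measurable]: "g \<in> borel_measurable borel" using g by simp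
  define I where "I = {\<sigma>/2..\<sigma>}"
  define k where "k y = g y - poly (pderiv G) y" for y
  have c0: "c \<noteq> 0" "\<bar>c\<bar> = 1" using c by auto
  have \<eta>0: "0 \<le> \<eta>" using \<eta>[of 0] by simp
  \<comment> \<open>The integral over the step of the i-th term of the difference of k = g - G'. For
    i = 0 the argument does not move, so this is the length of the step range times the value to be
    estimated.\<close>
  define E where "E i = (if i = 0 then \<sigma> / 2 * k x else ((primitive g (x + c * real i * \<sigma>) - poly G (x
      + c * real i * \<sigma>)) -
       (primitive g (x + c * real i * (\<sigma>/2)) - poly G (x + c * real i * (\<sigma>/2)))) / (c * real i))" for i
  have E: "integrable lborel (\<lambda>u. indicator I u * k (x + real i * (c * u)))"
     "(LINT u|lborel. indicator I u * k (x + real i * (c * u))) = E i" for i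
  proof -
    have "integrable lborel (\<lambda>u. indicator I u * k (x + real i * (c * u))) \<and>
       (LINT u|lborel. indicator I u * k (x + real i * (c * u))) = E i"
    proof (cases "i = 0")
      case True
      have "has_bochner_integral lborel (\<lambda>u. indicator I u *\<^sub>R k x) (measure lborel I *\<^sub>R k x)"
        by (rule has_bochner_integral_indicator) (use \<sigma> in \<open>auto simp: I_def\<close>)
      thus ?thesis using True \<sigma> by (simp add: has_bochner_integral_iff E_def I_def)
    next
      case False
      have ci: "c * real i \<noteq> 0" using False c0 by simp
      have le: "\<sigma> / 2 \<le> \<sigma>" using \<sigma> by simp
      have eq: "(\<lambda>u. indicator I u * k (x + real i * (c * u)))
          = (\<lambda>u. indicator I u * g (x + (c * real i) * u) - indicator I u * poly (pderiv G) (x + (c * real i) * u))"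
        by (intro ext) (simp add: k_def algebra_simps)
      show ?thesis unfolding eq unfolding I_def
        using primitive_affine[OF g le ci, of x] poly_affine_integral[OF le ci, of G x] False
        by (simp add: E_def diff_divide_distrib)
    qed
    thus "integrable lborel (\<lambda>u. indicator I u * k (x + real i * (c * u)))"
     "(LINT u|lborel. indicator I u * k (x + real i * (c * u))) = E i" by auto
  qed
  have fk: "fdiff r (c * u) g x = (\<Sum>i\<le>r. (-1) ^ i * real (r choose i) * k (x + real i * (c * u)))" for u
  proof -
    have "degree (pderiv G) < r" using G r by (simp add: degree_pderiv)
    hence "fdiff r (c * u) (poly (pderiv G)) x = 0" by (rule fdiff_poly_eq_0)
    hence "fdiff r (c * u) g x = fdiff r (c * u) k x"
      unfolding k_def by (simp add: fdiff_diff)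
    thus ?thesis by (simp add: fdiff_def)
  qed
  have int: "integrable lborel (\<lambda>u. indicator I u * fdiff r (c * u) g x)"
  proof -
    have "integrable lborel (\<lambda>u. \<Sum>i\<le>r. (-1) ^ i * real (r choose i) * (indicator I u * k (x + real i * (c * u))))"
      by (intro Bochner_Integration.integrable_sum integrable_mult_right E)
    thus ?thesis unfolding fk by (simp add: sum_distrib_left mult_ac)
  qed
  have val: "(LINT u|lborel. indicator I u * fdiff r (c * u) g x) = (\<Sum>i\<le>r. (-1) ^ i * real (r choose i) * E i)"
  proof -
    have "(LINT u|lborel. indicator I u * fdiff r (c * u) g x)
        = (LINT u|lborel. (\<Sum>i\<le>r. (-1) ^ i * real (r choose i) * (indicator I u * k (x + real i * (c * u)))))"
      unfolding fk by (simp add: sum_distrib_left mult_ac)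
    also have "\<dots> = (\<Sum>i\<le>r. (-1) ^ i * real (r choose i) * E i)"
      by (subst Bochner_Integration.integral_sum) (auto intro!: integrable_mult_right E simp: E)
    finally show ?thesis .
  qed
  have Ei: "\<bar>E i\<bar> \<le> 2 * \<eta>" if i: "i \<in> {1..r}" for i
  proof -
    have in01: "x + c * real i * t \<in> {0..1}" if t: "0 \<le> t" "t \<le> \<sigma>" for t
    proof -
      have "0 \<le> real i * t" using t by simp
      moreover have "real i * t \<le> real r * \<sigma>" using i t by (intro mult_mono) auto
      ultimately show ?thesis using x c by auto
    qed
    have "\<bar>E i\<bar> = \<bar>(primitive g (x + c * real i * \<sigma>) - poly G (x + c * real i * \<sigma>)) -
       (primitive g (x + c * real i * (\<sigma>/2)) - poly G (x + c * real i * (\<sigma>/2)))\<bar> / real i"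
      using i c0 by (simp add: E_def abs_mult)
    also have "\<dots> \<le> (2 * \<eta>) / 1"
    proof (rule frac_le)
      show "\<bar>(primitive g (x + c * real i * \<sigma>) - poly G (x + c * real i * \<sigma>)) -
       (primitive g (x + c * real i * (\<sigma>/2)) - poly G (x + c * real i * (\<sigma>/2)))\<bar> \<le> 2 * \<eta>"
        using \<eta>[OF in01[of \<sigma>]] \<eta>[OF in01[of "\<sigma>/2"]] \<sigma> by auto
    qed (use i \<eta>0 in auto)
    finally show ?thesis by simp
  qed
  define a where "a = (LINT u|lborel. 2 / \<sigma> * indicator I u * \<bar>fdiff r (c * u) g x\<bar>)"
  have inta: "integrable lborel (\<lambda>u. 2 / \<sigma> * indicator I u * \<bar>fdiff r (c * u) g x\<bar>)"
    using integrable_mult_right[OF integrable_abs[OF int], of "2 / \<sigma>"] by (simp add: abs_mult mult.assoc)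
  have a0: "0 \<le> a" unfolding a_def using \<sigma> by (intro Bochner_Integration.integral_nonneg) auto
  have "\<bar>k x\<bar> \<le> a + 2 ^ r * 4 * \<eta> / \<sigma>"
  proof -
    have "(\<Sum>i\<le>r. (-1) ^ i * real (r choose i) * E i) = \<sigma> / 2 * k x + (\<Sum>i\<in>{1..r}. (-1) ^ i * real (r choose i) * E i)"
    proof -
      have "{..r} = insert 0 {1..r}" by auto
      thus ?thesis by (simp add: E_def)
    qed
    hence "\<sigma> / 2 * k x = (LINT u|lborel. indicator I u * fdiff r (c * u) g x) - (\<Sum>i\<in>{1..r}.
        (-1) ^ i * real (r choose i) * E i)"
      using val by simp
    hence "\<bar>\<sigma> / 2 * k x\<bar> \<le> \<bar>LINT u|lborel. indicator I u * fdiff r (c * u) g x\<bar>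
        + \<bar>\<Sum>i\<in>{1..r}. (-1) ^ i * real (r choose i) * E i\<bar>"
      by linarith
    also have "\<bar>LINT u|lborel. indicator I u * fdiff r (c * u) g x\<bar>
        \<le> (LINT u|lborel. \<bar>indicator I u * fdiff r (c * u) g x\<bar>)"
      by (rule integral_abs_bound)
    also have "\<dots> = \<sigma> / 2 * a"
    proof -
      have "\<sigma> / 2 * a = (LINT u|lborel. \<sigma> / 2 * (2 / \<sigma> * indicator I u * \<bar>fdiff r (c * u) g x\<bar>))"
        unfolding a_def by (rule Bochner_Integration.integral_mult_right[symmetric]) (use inta in simp)
      thus ?thesis using \<sigma> by (simp add: abs_mult mult.assoc[symmetric])
    qed
    also have "\<bar>\<Sum>i\<in>{1..r}. (-1) ^ i * real (r choose i) * E i\<bar> \<le> (\<Sum>i\<in>{1..r}. real (r choose i) * (2 * \<eta>))"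
      using Ei by (intro order.trans[OF sum_abs] sum_mono) (simp add: abs_mult power_abs mult_left_mono)
    also have "\<dots> \<le> (\<Sum>i\<le>r. real (r choose i) * (2 * \<eta>))"
      using \<eta>0 by (intro sum_mono2) auto
    also have "\<dots> = real (\<Sum>i\<le>r. r choose i) * (2 * \<eta>)" by (simp add: sum_distrib_right)
    also have "\<dots> = 2 ^ r * (2 * \<eta>)" by (subst choose_row_sum) simp
    finally have "\<sigma> / 2 * \<bar>k x\<bar> \<le> \<sigma> / 2 * (a + 2 ^ r * 4 * \<eta> / \<sigma>)"
      using \<sigma> by (simp add: abs_mult distrib_left mult_ac)
    thus ?thesis by (rule mult_left_le_imp_le) (use \<sigma> in simp)
  qed
  hence "\<bar>k x\<bar> powr p \<le> (a + 2 ^ r * 4 * \<eta> / \<sigma>) powr p" using p by (intro powr_mono2) auto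
  also have "\<dots> \<le> 2 powr p * (a powr p + (2 ^ r * 4 * \<eta> / \<sigma>) powr p)"
    by (rule powr_add_le) (use a0 \<eta>0 \<sigma> p in auto)
  finally have "ennreal (\<bar>k x\<bar> powr p) \<le> ennreal (2 powr p) * (ennreal (a powr p)
      + ennreal ((2 ^ r * 4 * \<eta> / \<sigma>) powr p))"
    by (simp add: ennreal_mult'[symmetric] ennreal_plus[symmetric] ennreal_leI del: ennreal_plus)
  also have "ennreal (a powr p) \<le> ennreal (1 powr (p - 1)) * (\<integral>\<^sup>+u.
      ennreal (2 / \<sigma> * indicator I u * \<bar>fdiff r (c * u) g x\<bar> powr p) \<partial>lborel)"
  proof (rule nn_integral_jensen_powr[OF _ _ _ _ p])
    show "(\<lambda>u. \<bar>fdiff r (c * u) g x\<bar>) \<in> borel_measurable lborel" unfolding fdiff_def by measurable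
    have "(\<integral>\<^sup>+u. ennreal (2 / \<sigma> * indicator I u) \<partial>lborel) = (\<integral>\<^sup>+u. ennreal (2 / \<sigma>) * indicator I u \<partial>lborel)"
      by (intro nn_integral_cong) (auto simp: indicator_def)
    also have "\<dots> = ennreal (2 / \<sigma>) * ennreal (\<sigma> / 2)"
      by (subst nn_integral_cmult_indicator) (use \<sigma> in \<open>auto simp: I_def\<close>)
    also have "\<dots> = ennreal 1" using \<sigma> by (subst ennreal_mult[symmetric]) auto
    finally show "(\<integral>\<^sup>+u. ennreal (2 / \<sigma> * indicator I u) \<partial>lborel) \<le> ennreal 1" by simp
    show "ennreal a \<le> (\<integral>\<^sup>+u. ennreal (2 / \<sigma> * indicator I u * \<bar>fdiff r (c * u) g x\<bar>) \<partial>lborel)"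
      unfolding a_def by (subst nn_integral_eq_integral[OF inta]) (use \<sigma> in auto)
  qed (use \<sigma> a0 in \<open>auto simp: I_def\<close>)
  finally show ?thesis by (simp add: k_def I_def mult_left_mono add_mono)
qed

section \<open>Averaged oscillation and Whitney's inequality on the unit interval\<close>

definition unit_int :: "real \<Rightarrow> (real \<Rightarrow> real) \<Rightarrow> ennreal" where
  "unit_int p g = lp_int p {0..1} g"

text \<open>An averaged modulus of smoothness: an integral over the step, without normalisation,
  instead of a supremum. Only this form can be obtained from differences with the varying step h
  phi(x), by exchanging integrals.\<close>

definition unit_osc :: "real \<Rightarrow> nat \<Rightarrow> real \<Rightarrow> (real \<Rightarrow> real) \<Rightarrow> ennreal" where
  "unit_osc p r \<sigma> g = (\<integral>\<^sup>+u. lp_int p {0..1 - real r * u} (fdiff r u g)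
      * indicator {0<..<\<sigma>} u \<partial>lborel)"

lemma indicator_Icc_borel [measurable]:
  fixes f1 f2 f3 :: "'a \<Rightarrow> real"
  assumes [measurable]: "f1 \<in> borel_measurable M" "f2 \<in> borel_measurable M" "f3 \<in> borel_measurable M"
  shows "(\<lambda>x. indicator {f1 x..f2 x} (f3 x) :: ennreal) \<in> borel_measurable M"
  unfolding indicator_def atLeastAtMost_iff by measurable

lemma fdiff_borel [measurable]:
  assumes [measurable]: "g \<in> borel_measurable borel" "f1 \<in> borel_measurable M" "f2 \<in> borel_measurable M"
  shows "(\<lambda>x. fdiff r (f1 x) g (f2 x)) \<in> borel_measurable M"
  unfolding fdiff_def by measurable

lemma half_integral_le:
  fixes g :: "real \<Rightarrow> real"
  assumes [measurable]: "g \<in> borel_measurable borel" and \<sigma>: "0 < \<sigma>1" "\<sigma>1 < \<sigma>" "real r * \<sigma>1 \<le> 1 / 2"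
    and c: "c = 1 \<and> H = {0..1/2} \<or> c = -1 \<and> H = {1/2..1::real}"
  shows "(\<integral>\<^sup>+x. (\<integral>\<^sup>+u. ennreal (2 / \<sigma>1 * indicator {\<sigma>1/2..\<sigma>1} u * \<bar>fdiff r (c * u) g x\<bar> powr p) \<partial>lborel)
      * indicator H x \<partial>lborel)
     \<le> ennreal (2 / \<sigma>1) * unit_osc p r \<sigma> g"
proof -
  have [measurable]: "H \<in> sets borel" using c by auto
  define f where "f x u = ennreal (2 / \<sigma>1 * indicator {\<sigma>1/2..\<sigma>1} u * \<bar>fdiff r (c * u) g x\<bar> powr p)
      * indicator H x" for x u
  have [measurable]: "case_prod f \<in> borel_measurable (lborel \<Otimes>\<^sub>M lborel)"
    unfolding f_def case_prod_beta' by measurable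
  have "(\<integral>\<^sup>+x. (\<integral>\<^sup>+u. ennreal (2 / \<sigma>1 * indicator {\<sigma>1/2..\<sigma>1} u * \<bar>fdiff r (c * u) g x\<bar> powr p) \<partial>lborel)
      * indicator H x \<partial>lborel)
     = (\<integral>\<^sup>+x. (\<integral>\<^sup>+u. f x u \<partial>lborel) \<partial>lborel)"
    unfolding f_def by (intro nn_integral_cong nn_integral_multc[symmetric]) measurable
  also have "\<dots> = (\<integral>\<^sup>+u. (\<integral>\<^sup>+x. f x u \<partial>lborel) \<partial>lborel)"
    by (rule lborel_pair.Fubini'[symmetric]) measurable
  also have "\<dots> \<le> (\<integral>\<^sup>+u. ennreal (2 / \<sigma>1) * (lp_int p {0..1 - real r * u} (fdiff r u g)
      * indicator {0<..<\<sigma>} u) \<partial>lborel)"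
  proof (rule nn_integral_mono)
    fix u :: real
    show "(\<integral>\<^sup>+x. f x u \<partial>lborel) \<le> ennreal (2 / \<sigma>1) * (lp_int p {0..1 - real r * u} (fdiff r u g)
      * indicator {0<..<\<sigma>} u)"
    proof (cases "u \<in> {\<sigma>1/2..\<sigma>1}")
      case False
      hence "f x u = 0" for x by (simp add: f_def)
      thus ?thesis by simp
    next
      case True
      have "real r * u \<le> real r * \<sigma>1" using True by (intro mult_left_mono) auto
      hence ru: "0 \<le> real r * u" "real r * u \<le> 1 / 2" using True \<sigma> by auto
      have us: "u \<in> {0<..<\<sigma>}" using True \<sigma> by auto
      have "(\<integral>\<^sup>+x. f x u \<partial>lborel) = (\<integral>\<^sup>+x. ennreal (2 / \<sigma>1) * (ennreal (\<bar>fdiff r (c * u) g x\<bar> powr p)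
          * indicator H x) \<partial>lborel)"
      proof (rule nn_integral_cong)
        fix x :: real
        have "ennreal (2 / \<sigma>1 * indicator {\<sigma>1/2..\<sigma>1} u * \<bar>fdiff r (c * u) g x\<bar> powr p)
            = ennreal (2 / \<sigma>1) * ennreal (\<bar>fdiff r (c * u) g x\<bar> powr p)"
          using True \<sigma> by (subst ennreal_mult[symmetric]) auto
        thus "f x u = ennreal (2 / \<sigma>1) * (ennreal (\<bar>fdiff r (c * u) g x\<bar> powr p) * indicator H x)"
          by (simp only: f_def mult.assoc)
      qed
      also have "\<dots> = ennreal (2 / \<sigma>1) * lp_int p H (fdiff r (c * u) g)"
        by (rule nn_integral_cmult) measurable
      also have "lp_int p H (fdiff r (c * u) g)
        \<le> lp_int p {0..1 - real r * u} (fdiff r u g)"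
        using c
      proof
        assume "c = 1 \<and> H = {0..1/2}"
        thus ?thesis using ru by (intro nn_integral_mono) (auto simp: indicator_def)
      next
        assume cH: "c = -1 \<and> H = {1/2..1}"
        \<comment> \<open>Translation by r u turns the backward difference at the right end into the
          forward difference at the left end.\<close>
        have "lp_int p H (fdiff r (c * u) g)
          = ennreal \<bar>1\<bar> * (\<integral>\<^sup>+x. ennreal (\<bar>fdiff r (c * u) g (real r * u
              + 1 * x)\<bar> powr p) * indicator H (real r * u + 1 * x) \<partial>lborel)"
          by (subst nn_integral_real_affine[where c = 1 and t = "real r * u"]) auto
        also have "\<dots> = (\<integral>\<^sup>+x. ennreal (\<bar>fdiff r u g x\<bar> powr p) * indicator H (real r * u + x) \<partial>lborel)"
        proof -
          have "\<bar>fdiff r (c * u) g (real r * u + x)\<bar> = \<bar>fdiff r u g x\<bar>" for x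
            using fdiff_reverse[of r u g x] cH by (simp add: abs_mult power_abs add.commute)
          thus ?thesis by simp
        qed
        also have "\<dots> \<le> lp_int p {0..1 - real r * u} (fdiff r u g)"
          using cH ru by (intro nn_integral_mono) (auto simp: indicator_def)
        finally show ?thesis .
      qed
      finally show ?thesis using us by (simp add: mult_left_mono)
    qed
  qed
  also have "\<dots> = ennreal (2 / \<sigma>1) * unit_osc p r \<sigma> g"
    unfolding unit_osc_def by (rule nn_integral_cmult) measurable
  finally show ?thesis .
qed

text \<open>As r \<sigma>1 <= 1/2, forward steps stay in [0,1] when started in the left half and
  backward steps when started in the right half. The pointwise estimate is integrated over each
  half.\<close>

lemma unit_int_pderiv_le:
  fixes G :: "real poly"
  assumes g: "integrable lborel g" and p: "1 < p" and \<sigma>: "0 < \<sigma>1" "\<sigma>1 < \<sigma>" "real r * \<sigma>1 \<le> 1 / 2" and r: "1 \<le> r"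
    and G: "degree G \<le> r" and \<eta>: "\<And>y. y \<in> {0..1} \<Longrightarrow> \<bar>primitive g y - poly G y\<bar> \<le> \<eta>"
  shows "unit_int p (\<lambda>x. g x - poly (pderiv G) x) \<le> ennreal (2 powr p) *
     (ennreal (4 / \<sigma>1) * unit_osc p r \<sigma> g + ennreal (2 * (2 ^ r * 4 * \<eta> / \<sigma>1) powr p))"
proof -
  have [measurable]: "g \<in> borel_measurable borel" using g by simp
  have [measurable]: "poly (pderiv G) \<in> borel_measurable borel"
    by (intro borel_measurable_continuous_onI continuous_intros)
  define e where "e = (2 ^ r * 4 * \<eta> / \<sigma>1) powr p"
  define k where "k x = ennreal (\<bar>g x - poly (pderiv G) x\<bar> powr p)" for x
  have half: "(\<integral>\<^sup>+x. k x * indicator H x \<partial>lborel) \<le> ennreal (2 powr p) * (ennreal (2 / \<sigma>1) * unit_osc p r \<sigma> g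
      + ennreal e)"
    if c: "c = 1 \<and> H = {0..1/2} \<or> c = -1 \<and> H = {1/2..1::real}" for c :: real and H
  proof -
    have [measurable]: "H \<in> sets borel" using c by auto
    define A where "A x = (\<integral>\<^sup>+u. ennreal (2 / \<sigma>1 * indicator {\<sigma>1/2..\<sigma>1} u * \<bar>fdiff r (c
        * u) g x\<bar> powr p) \<partial>lborel)" for x
    have [measurable]: "A \<in> borel_measurable borel" unfolding A_def by measurable
    have "(\<integral>\<^sup>+x. k x * indicator H x \<partial>lborel) \<le> (\<integral>\<^sup>+x. ennreal (2 powr p) * (A x * indicator H x
        + ennreal e * indicator H x) \<partial>lborel)"
    proof (rule nn_integral_mono)
      fix x :: real
      show "k x * indicator H x \<le> ennreal (2 powr p) * (A x * indicator H x + ennreal e * indicator H x)"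
      proof (cases "x \<in> H")
        case True
        define z where "z = real r * \<sigma>1"
        have "0 \<le> z" "z \<le> 1 / 2" using \<sigma> by (simp_all add: z_def)
        hence "x \<in> {0..1}" "x + c * z \<in> {0..1}" using True c by auto
        note this[unfolded z_def]
        with c have "k x \<le> ennreal (2 powr p) * (A x + ennreal e)"
          unfolding k_def A_def e_def by (intro half_pointwise g p \<sigma> r G \<eta>) auto
        thus ?thesis using True by simp
      qed auto
    qed
    also have "\<dots> = ennreal (2 powr p) * ((\<integral>\<^sup>+x. A x * indicator H x \<partial>lborel) + ennreal e * emeasure lborel H)"
      by (subst nn_integral_cmult) (auto simp: nn_integral_add nn_integral_cmult_indicator)
    also have "\<dots> \<le> ennreal (2 powr p) * (ennreal (2 / \<sigma>1) * unit_osc p r \<sigma> g + ennreal e * 1)"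
    proof (intro mult_left_mono add_mono)
      show "(\<integral>\<^sup>+x. A x * indicator H x \<partial>lborel) \<le> ennreal (2 / \<sigma>1) * unit_osc p r \<sigma> g"
        unfolding A_def by (rule half_integral_le[OF _ \<sigma> c]) measurable
      have "emeasure lborel H \<le> emeasure lborel {0..1::real}" using c by (intro emeasure_mono) auto
      thus "emeasure lborel H \<le> 1" by simp
    qed auto
    finally show ?thesis by simp
  qed
  have "unit_int p (\<lambda>x. g x - poly (pderiv G) x) \<le> (\<integral>\<^sup>+x. k x * indicator {0..1/2} x
      + k x * indicator {1/2..1} x \<partial>lborel)"
    unfolding unit_int_def k_def by (intro nn_integral_mono) (auto simp: indicator_def)
  also have "\<dots> = (\<integral>\<^sup>+x. k x * indicator {0..1/2} x \<partial>lborel) + (\<integral>\<^sup>+x. k x * indicator {1/2..1} x \<partial>lborel)"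
    unfolding k_def by (rule nn_integral_add) measurable
  also have "\<dots> \<le> ennreal (2 powr p) * (ennreal (2 / \<sigma>1) * unit_osc p r \<sigma> g + ennreal e)
      + ennreal (2 powr p) * (ennreal (2 / \<sigma>1) * unit_osc p r \<sigma> g + ennreal e)"
    by (intro add_mono half[of 1] half[of "-1"]) auto
  also have "\<dots> = ennreal (2 powr p) * ((ennreal (2 / \<sigma>1) + ennreal (2 / \<sigma>1)) * unit_osc p r \<sigma> g + (ennreal e
      + ennreal e))"
    by (simp add: distrib_left distrib_right add_ac)
  also have "ennreal (2 / \<sigma>1) + ennreal (2 / \<sigma>1) = ennreal (4 / \<sigma>1)"
    using \<sigma> by (subst ennreal_plus[symmetric]) auto
  also have "ennreal e + ennreal e = ennreal (2 * e)"
    by (subst ennreal_plus[symmetric]) (auto simp: e_def)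
  finally show ?thesis by (simp add: e_def)
qed

text \<open>Jensen on the interval between x and y gives the Hoelder exponent 1 - 1/p. It is
  positive for p > 1, which makes the error of sampling the primitive on a grid of mesh 1/N tend to
  0.\<close>

lemma primitive_holder:
  assumes [measurable]: "g \<in> borel_measurable borel" and g: "integrable lborel g" and p: "1 < p"
    and X: "unit_int p g \<le> ennreal X" "0 \<le> X" and xy: "x \<in> {0..1}" "y \<in> {0..1}" "\<bar>x - y\<bar> \<le> t" and t: "0 < t"
  shows "\<bar>primitive g x - primitive g y\<bar> \<le> (t powr (p - 1) * X) powr (1 / p)"
proof -
  have *: "\<bar>primitive g y - primitive g x\<bar> \<le> (t powr (p - 1) * X) powr (1 / p)"
    if xy: "x \<in> {0..1}" "y \<in> {0..1}" "y - x \<le> t" "x \<le> y" for x y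
  proof -
    define a where "a = (LINT s|lborel. indicator {x<..y} s * \<bar>g s\<bar>)"
    have int: "integrable lborel (\<lambda>s. indicator {x<..y} s * \<bar>g s\<bar>)"
      using integrable_mult_indicator[of "{x<..y}" lborel "\<lambda>s. \<bar>g s\<bar>"] g by simp
    have "primitive g y - primitive g x = (LINT s|lborel. indicator {x<..y} s * g s)"
      by (rule primitive_diff[OF g xy(4)])
    also have "\<bar>\<dots>\<bar> \<le> (LINT s|lborel. \<bar>indicator {x<..y} s * g s\<bar>)" by (rule integral_abs_bound)
    also have "\<dots> = a" by (simp add: a_def abs_mult)
    finally have 1: "\<bar>primitive g y - primitive g x\<bar> \<le> a" .
    have a0: "0 \<le> a" unfolding a_def by (intro Bochner_Integration.integral_nonneg) auto
    have "ennreal (a powr p) \<le> ennreal (t powr (p - 1)) * (\<integral>\<^sup>+s.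
        ennreal (indicator {x<..y} s * \<bar>g s\<bar> powr p) \<partial>lborel)"
    proof (rule nn_integral_jensen_powr[OF _ _ _ _ p t])
      have "(\<integral>\<^sup>+s. ennreal (indicator {x<..y} s) \<partial>lborel) = emeasure lborel {x<..y}"
        by (simp add: ennreal_indicator)
      also have "\<dots> \<le> ennreal t" using xy by (simp add: ennreal_leI)
      finally show "(\<integral>\<^sup>+s. ennreal (indicator {x<..y} s) \<partial>lborel) \<le> ennreal t" .
      show "ennreal a \<le> (\<integral>\<^sup>+s. ennreal (indicator {x<..y} s * \<bar>g s\<bar>) \<partial>lborel)"
        unfolding a_def by (subst nn_integral_eq_integral[OF int]) auto
    qed (use a0 in auto)
    also have "(\<integral>\<^sup>+s. ennreal (indicator {x<..y} s * \<bar>g s\<bar> powr p) \<partial>lborel) \<le> unit_int p g"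
      unfolding unit_int_def using xy by (intro nn_integral_mono) (auto simp: indicator_def)
    also have "\<dots> \<le> ennreal X" by (rule X)
    finally have "ennreal (a powr p) \<le> ennreal (t powr (p - 1) * X)"
      using X by (simp add: ennreal_mult mult_left_mono)
    hence "a powr p \<le> t powr (p - 1) * X" using X by (subst (asm) ennreal_le_iff) auto
    hence "(a powr p) powr (1 / p) \<le> (t powr (p - 1) * X) powr (1 / p)" using p by (intro powr_mono2) auto
    hence "a \<le> (t powr (p - 1) * X) powr (1 / p)" using p a0 by (simp add: powr_powr)
    thus ?thesis using 1 by linarith
  qed
  show ?thesis
  proof (cases "x \<le> y")
    case True
    thus ?thesis using *[of x y] xy by (simp add: abs_minus_commute)
  next
    case False
    thus ?thesis using *[of y x] xy by (simp add: abs_minus_commute)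
  qed
qed

text \<open>Up to sign, the difference of order r + 1 of the primitive is the integral of the
  difference of order r of g over an interval of length v.\<close>

lemma primitive_fdiff_le:
  assumes [measurable]: "g \<in> borel_measurable borel" and g: "integrable lborel g" and p: "1 < p"
    and v: "0 < v" "v \<le> 1" and W: "lp_int p {0..1 - real r * v} (fdiff r v g) \<le> ennreal W" "0 \<le> W"
    and j: "real (j + Suc r) * v \<le> 1"
  shows "\<bar>fdiff (Suc r) v (primitive g) (real j * v)\<bar> \<le> W powr (1 / p)"
proof -
  define y where "y = real j * v"
  define I where "I = {0..v}"
  have one: "(1::real) \<noteq> 0" by simp
  note PA = primitive_affine[OF g less_imp_le[OF v(1)] one, folded I_def]
  have int: "integrable lborel (\<lambda>u. indicator I u * fdiff r v g (y + u))"
  proof -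
    have "integrable lborel (\<lambda>u. \<Sum>i\<le>r. (-1) ^ i * real (r choose i) * (indicator I u * g ((y + real i * v) + 1 * u)))"
      by (intro Bochner_Integration.integrable_sum integrable_mult_right PA)
    thus ?thesis unfolding fdiff_def by (simp add: sum_distrib_left mult_ac add_ac)
  qed
  have val: "(LINT u|lborel. indicator I u * fdiff r v g (y + u)) = - fdiff (Suc r) v (primitive g) y"
  proof -
    have "(LINT u|lborel. indicator I u * fdiff r v g (y + u))
        = (LINT u|lborel. (\<Sum>i\<le>r. (-1) ^ i * real (r choose i) * (indicator I u * g ((y + real i * v) + 1 * u))))"
      unfolding fdiff_def by (simp add: sum_distrib_left mult_ac add_ac)
    also have "\<dots> = (\<Sum>i\<le>r. (-1) ^ i * real (r choose i) * (primitive g (y + real i * v + v) - primitive g (y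
        + real i * v)))"
      using PA(2)[of "y + real _ * v"] by (subst Bochner_Integration.integral_sum) (auto intro!:
          integrable_mult_right PA(1)[simplified])
    also have "\<dots> = fdiff r v (primitive g) (y + v) - fdiff r v (primitive g) y"
      unfolding fdiff_def by (simp add: right_diff_distrib sum_subtractf add_ac)
    finally show ?thesis by (simp add: fdiff_Suc)
  qed
  define a where "a = (LINT u|lborel. indicator I u * \<bar>fdiff r v g (y + u)\<bar>)"
  have inta: "integrable lborel (\<lambda>u. indicator I u * \<bar>fdiff r v g (y + u)\<bar>)"
    using integrable_abs[OF int] by (simp add: abs_mult)
  have a0: "0 \<le> a" unfolding a_def by (intro Bochner_Integration.integral_nonneg) auto
  have "\<bar>fdiff (Suc r) v (primitive g) y\<bar> = \<bar>LINT u|lborel. indicator I u * fdiff r v g (y + u)\<bar>" using val by simp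
  also have "\<dots> \<le> (LINT u|lborel. \<bar>indicator I u * fdiff r v g (y + u)\<bar>)" by (rule integral_abs_bound)
  also have "\<dots> = a" by (simp add: a_def abs_mult)
  finally have 1: "\<bar>fdiff (Suc r) v (primitive g) y\<bar> \<le> a" .
  have "ennreal (a powr p) \<le> ennreal (1 powr (p - 1)) * (\<integral>\<^sup>+u. ennreal (indicator I u * \<bar>fdiff r v g (y
      + u)\<bar> powr p) \<partial>lborel)"
  proof (rule nn_integral_jensen_powr[OF _ _ _ _ p])
    show "(\<integral>\<^sup>+u. ennreal (indicator I u) \<partial>lborel) \<le> ennreal 1"
      using v by (simp add: ennreal_indicator I_def)
    show "ennreal a \<le> (\<integral>\<^sup>+u. ennreal (indicator I u * \<bar>fdiff r v g (y + u)\<bar>) \<partial>lborel)"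
      unfolding a_def by (subst nn_integral_eq_integral[OF inta]) auto
  qed (use a0 in \<open>auto simp: I_def\<close>)
  also have "(\<integral>\<^sup>+u. ennreal (indicator I u * \<bar>fdiff r v g (y + u)\<bar> powr p) \<partial>lborel)
     \<le> (\<integral>\<^sup>+u. ennreal (\<bar>fdiff r v g (y + 1 * u)\<bar> powr p) * indicator {0..1 - real r * v} (y + 1 * u) \<partial>lborel)"
  proof (rule nn_integral_mono)
    fix u :: real
    have "y + v + real r * v \<le> 1" using j by (simp add: y_def algebra_simps)
    moreover have "0 \<le> y" using v by (simp add: y_def)
    ultimately show "ennreal (indicator I u * \<bar>fdiff r v g (y + u)\<bar> powr p)
        \<le> ennreal (\<bar>fdiff r v g (y + 1 * u)\<bar> powr p) * indicator {0..1 - real r * v} (y + 1 * u)"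
      by (auto simp: indicator_def I_def)
  qed
  also have "\<dots> = lp_int p {0..1 - real r * v} (fdiff r v g)"
    by (subst (2) nn_integral_real_affine[where c = 1 and t = y]) auto
  also have "\<dots> \<le> ennreal W" by (rule W)
  finally have "a powr p \<le> W" using W by (simp add: mult_left_mono)
  hence "(a powr p) powr (1 / p) \<le> W powr (1 / p)" using p by (intro powr_mono2) auto
  hence "a \<le> W powr (1 / p)" using p a0 by (simp add: powr_powr)
  thus ?thesis using 1 by (simp add: y_def)
qed

lemma unit_int_integrable:
  assumes [measurable]: "g \<in> borel_measurable borel" and p: "1 < p" and zero: "\<And>x. x \<notin> {0..1} \<Longrightarrow> g x = 0"
    and X: "unit_int p g < \<infinity>"
  shows "integrable lborel g"
proof (rule integrableI_bounded)
  have "(\<integral>\<^sup>+x. ennreal (norm (g x)) \<partial>lborel) \<le> (\<integral>\<^sup>+x. indicator {0..1} x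
      + ennreal (\<bar>g x\<bar> powr p) * indicator {0..1} x \<partial>lborel)"
  proof (rule nn_integral_mono)
    fix x :: real
    show "ennreal (norm (g x)) \<le> indicator {0..1} x + ennreal (\<bar>g x\<bar> powr p) * indicator {0..1} x"
    proof (cases "x \<in> {0..1}")
      case True
      have "\<bar>g x\<bar> \<le> 1 + \<bar>g x\<bar> powr p"
      proof (cases "\<bar>g x\<bar> \<le> 1")
        case False
        hence "\<bar>g x\<bar> powr 1 \<le> \<bar>g x\<bar> powr p" using p by (intro powr_mono) auto
        thus ?thesis using False by simp
      qed (simp add: add_increasing2)
      hence "ennreal \<bar>g x\<bar> \<le> ennreal (1 + \<bar>g x\<bar> powr p)" by (rule ennreal_leI)
      thus ?thesis using True by simp
    qed (simp add: zero)
  qed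
  also have "\<dots> = 1 + unit_int p g"
    unfolding unit_int_def by (subst nn_integral_add) auto
  also have "\<dots> < \<infinity>" using X by (simp add: less_top)
  finally show "(\<integral>\<^sup>+x. ennreal (norm (g x)) \<partial>lborel) < \<infinity>" .
qed measurable

text \<open>The hypothesis controls an average over steps, whereas the grid needs a single one. If
  all steps of the range were bad, that range of length 1/(2 N) would already contribute 2
  \<Omega>.\<close>

lemma exists_good_step:
  assumes [measurable]: "g \<in> borel_measurable borel" and osc: "unit_osc p r \<sigma> g \<le> ennreal \<Omega>" and \<Omega>: "0 < \<Omega>"
    and N: "0 < N" "1 / N < \<sigma>"
  shows "\<exists>v\<in>{1 / (2 * N)..1 / N}. lp_int p {0..1 - real r * v} (fdiff r v g) \<le> ennreal (4 * N * \<Omega>)"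
proof (rule ccontr)
  define Z where "Z v = lp_int p {0..1 - real r * v} (fdiff r v g)" for v
  assume "\<not> ?thesis"
  hence big: "ennreal (4 * N * \<Omega>) \<le> Z v" if "v \<in> {1 / (2 * N)..1 / N}" for v
    using that by (auto simp: Z_def not_le less_imp_le)
  have "ennreal (2 * \<Omega>) = ennreal (4 * N * \<Omega> * (1 / N - 1 / (2 * N)))"
    using N by (simp add: field_simps)
  also have "\<dots> = ennreal (4 * N * \<Omega>) * emeasure lborel {1 / (2 * N)..1 / N}"
    using N \<Omega> by (subst ennreal_mult) (auto simp: field_simps)
  also have "\<dots> = (\<integral>\<^sup>+v. ennreal (4 * N * \<Omega>) * indicator {1 / (2 * N)..1 / N} v \<partial>lborel)"
    by (subst nn_integral_cmult_indicator) auto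
  also have "\<dots> \<le> (\<integral>\<^sup>+v. Z v * indicator {0<..<\<sigma>} v \<partial>lborel)"
  proof (rule nn_integral_mono)
    fix v :: real
    show "ennreal (4 * N * \<Omega>) * indicator {1 / (2 * N)..1 / N} v \<le> Z v * indicator {0<..<\<sigma>} v"
    proof (cases "v \<in> {1 / (2 * N)..1 / N}")
      case True
      have "0 < 1 / (2 * N)" using N by simp
      hence "v \<in> {0<..<\<sigma>}" using True N unfolding atLeastAtMost_iff greaterThanLessThan_iff by linarith
      thus ?thesis using big[OF True] by (simp only: indicator_simps True mult_1_right)
    qed simp
  qed
  also have "\<dots> \<le> ennreal \<Omega>" using osc by (simp add: unit_osc_def Z_def)
  finally show False using \<Omega> by simp
qed

text \<open>The part of the error that is proportional to the norm of g comes from the mesh size and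
  carries the factor N^(-(p - 1)). Taking N large makes it at most 1/2; N then depends on r, p and
  \<sigma> only.\<close>

lemma whitney_step:
  assumes r: "1 \<le> r" and p: "1 < p" and \<sigma>: "0 < \<sigma>"
  shows "\<exists>C\<ge>0. \<forall>g \<Omega>. g \<in> borel_measurable borel \<longrightarrow> (\<forall>x. x \<notin> {0..1} \<longrightarrow> g x = 0) \<longrightarrow> unit_int p g < \<infinity> \<longrightarrow>
    0 < \<Omega> \<longrightarrow> unit_osc p r \<sigma> g \<le> ennreal \<Omega> \<longrightarrow>
    (\<exists>q. degree q < r \<and> unit_int p (\<lambda>x. g x - poly q x) \<le> ennreal (C * \<Omega>) + ennreal (1 / 2) * unit_int p g)"
proof -
  define \<sigma>1 where "\<sigma>1 = min (\<sigma> / 2) (1 / (2 * real r))"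
  have s1: "0 < \<sigma>1" "\<sigma>1 < \<sigma>" "real r * \<sigma>1 \<le> 1 / 2"
  proof -
    show "0 < \<sigma>1" "\<sigma>1 < \<sigma>" using \<sigma> r by (auto simp: \<sigma>1_def)
    have "real r * \<sigma>1 \<le> real r * (1 / (2 * real r))" by (intro mult_left_mono) (auto simp: \<sigma>1_def)
    thus "real r * \<sigma>1 \<le> 1 / 2" using r by simp
  qed
  define cr where "cr = real (Suc r) * (real r * (4 * real r) ^ r)"
  have cr: "0 \<le> cr" by (simp add: cr_def)
  define L where "L = 2 powr p * (2 * (2 ^ r * 4 / \<sigma>1) powr p)"
  have L: "0 \<le> L" by (simp add: L_def)
  define Y where "Y = 2 * L * 2 powr p * (1 + cr) powr p"
  have Y: "0 \<le> Y" using L by (simp add: Y_def)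
  \<comment> \<open>The three bounds serve \<open>near_polynomial\<close>, the inequality 1/N <
    \<sigma> needed for a good step, and the contraction factor 1/2, in this order.\<close>
  define N where "N = max (4 * real r) (max (2 / \<sigma>) (Y powr (1 / (p - 1))))"
  have N: "4 * real r \<le> N" "2 / \<sigma> \<le> N" "Y powr (1 / (p - 1)) \<le> N" by (auto simp: N_def)
  have N1: "1 \<le> N" using N(1) r by (auto intro: order.trans[of _ "4 * real r"])
  have N\<sigma>: "1 / N < \<sigma>"
  proof -
    have "2 \<le> N * \<sigma>" using N(2) \<sigma> by (simp add: field_simps)
    thus ?thesis using N1 by (simp add: field_simps)
  qed
  have NY: "Y \<le> N powr (p - 1)"
  proof -
    have "Y = (Y powr (1 / (p - 1))) powr (p - 1)" using p Y by (simp add: powr_powr)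
    also have "\<dots> \<le> N powr (p - 1)" using N(3) p by (intro powr_mono2) auto
    finally show ?thesis .
  qed
  \<comment> \<open>aN and bN are the coefficients of the p-th roots of the norm of g and of
    \<Omega> in the uniform error of the primitive.\<close>
  define aN where "aN = N powr (- ((p - 1) / p)) + cr / N"
  define bN where "bN = (1 + cr / N) * ((2 * N) ^ Suc r * (4 * N) powr (1 / p))"
  have aN0: "0 \<le> aN" and bN0: "0 \<le> bN" using cr N1 by (auto simp: aN_def bN_def intro!: add_nonneg_nonneg
      mult_nonneg_nonneg)
  have aNp: "L * 2 powr p * aN powr p \<le> 1 / 2"
  proof -
    have "N powr (- 1) \<le> N powr (- ((p - 1) / p))" using N1 p by (intro powr_mono) (auto simp: field_simps)
    hence "1 / N \<le> N powr (- ((p - 1) / p))" using N1 by (simp add: powr_minus_divide)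
    hence "cr * (1 / N) \<le> cr * N powr (- ((p - 1) / p))" by (rule mult_left_mono[OF _ cr])
    hence "aN \<le> (1 + cr) * N powr (- ((p - 1) / p))" by (simp add: aN_def algebra_simps)
    hence "aN powr p \<le> ((1 + cr) * N powr (- ((p - 1) / p))) powr p" using p aN0 by (intro powr_mono2) auto
    also have "\<dots> = (1 + cr) powr p * (N powr (- ((p - 1) / p))) powr p" by (rule powr_mult)
    also have "(N powr (- ((p - 1) / p))) powr p = N powr (- (p - 1))" using p by (simp add: powr_powr)
    finally have "L * 2 powr p * aN powr p \<le> L * 2 powr p * ((1 + cr) powr p * N powr (- (p - 1)))"
      using L by (intro mult_left_mono) auto
    also have "N powr (- (p - 1)) = 1 / N powr (p - 1)" by (rule powr_minus_divide)
    also have "L * 2 powr p * ((1 + cr) powr p * (1 / N powr (p - 1))) = Y / 2 / N powr (p - 1)" by (simp add: Y_def)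
    also have "\<dots> \<le> 1 / 2" using NY N1 by (simp add: field_simps)
    finally show ?thesis .
  qed
  define C where "C = 2 powr p * (4 / \<sigma>1) + L * 2 powr p * bN powr p"
  have C: "0 \<le> C" using s1 L by (simp add: C_def)
  show ?thesis
  proof (intro exI[of _ C] conjI C allI impI)
    fix g :: "real \<Rightarrow> real" and \<Omega> :: real
    assume g[measurable]: "g \<in> borel_measurable borel" and zero: "\<forall>x. x \<notin> {0..1}
        \<longrightarrow> g x = 0" and fin: "unit_int p g < \<infinity>"
      and \<Omega>: "0 < \<Omega>" and osc: "unit_osc p r \<sigma> g \<le> ennreal \<Omega>"
    have int: "integrable lborel g" by (rule unit_int_integrable[OF g p _ fin]) (use zero in auto)
    define X where "X = enn2real (unit_int p g)"
    have X: "unit_int p g = ennreal X" "0 \<le> X" using fin by (auto simp: X_def less_top[symmetric])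
    define F where "F = primitive g"
    define Xp where "Xp = X powr (1 / p)"
    define Op where "Op = \<Omega> powr (1 / p)"
    obtain v where v: "v \<in> {1 / (2 * N)..1 / N}"
      and vW: "lp_int p {0..1 - real r * v} (fdiff r v g) \<le> ennreal (4 * N * \<Omega>)"
      using exists_good_step[OF g osc \<Omega> _ N\<sigma>] N1 by auto
    have v0: "0 < v" "v \<le> 1"
    proof -
      have "0 < 1 / (2 * N)" "1 / N \<le> 1" using N1 by auto
      thus "0 < v" "v \<le> 1" using v unfolding atLeastAtMost_iff by linarith+
    qed
    define \<delta> where "\<delta> = (4 * N * \<Omega>) powr (1 / p)"
    have d: "\<bar>fdiff (Suc r) v F (real j * v)\<bar> \<le> \<delta>" if "real (j + Suc r) * v \<le> 1" for j
      unfolding F_def \<delta>_def using N1 \<Omega> by (intro primitive_fdiff_le[OF g int p v0 vW _ that]) auto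
    have hold: "\<bar>F x - F y\<bar> \<le> N powr (- ((p - 1) / p)) * Xp" if "x \<in> {0..1}" "y \<in> {0..1}" "\<bar>x - y\<bar> \<le> 1 / N" for x y
    proof -
      have "\<bar>F x - F y\<bar> \<le> ((1 / N) powr (p - 1) * X) powr (1 / p)"
        unfolding F_def by (rule primitive_holder[OF g int p _ X(2) that]) (use X N1 in auto)
      also have "\<dots> = ((1 / N) powr (p - 1)) powr (1 / p) * Xp" unfolding Xp_def by (rule powr_mult)
      also have "((1 / N) powr (p - 1)) powr (1 / p) = N powr (- ((p - 1) / p))"
        using N1 by (simp add: powr_powr powr_divide powr_minus_divide)
      finally show ?thesis .
    qed
    have F0: "F 0 = 0"
    proof -
      have "F 0 = (LINT (t::real)|lborel. 0)" unfolding F_def primitive_def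
      proof (rule integral_cong_AE)
        have "AE t in lborel. t \<noteq> (0::real)" by (rule AE_lborel_singleton)
        thus "AE t in lborel. indicator {..0} t * g t = 0" by eventually_elim (use zero in \<open>auto simp: indicator_def\<close>)
      qed measurable
      thus ?thesis by simp
    qed
    have A: "\<bar>F x\<bar> \<le> Xp" if "x \<in> {0..1}" for x
    proof -
      have "\<bar>F x - F 0\<bar> \<le> (1 powr (p - 1) * X) powr (1 / p)"
        unfolding F_def by (rule primitive_holder[OF g int p _ X(2)]) (use X that in auto)
      thus ?thesis by (simp add: F0 Xp_def)
    qed
    have \<delta>0: "0 \<le> \<delta>" by (simp add: \<delta>_def)
    have \<delta>Op: "\<delta> = (4 * N) powr (1 / p) * Op"
      unfolding \<delta>_def Op_def by (rule powr_mult)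
    have v': "1 / (2 * N) \<le> v" "v \<le> 1 / N" using v by auto
    obtain G where G: "degree G \<le> r" and Gn: "\<forall>y\<in>{0..1}. \<bar>F y - poly G y\<bar> \<le>
       N powr (- ((p - 1) / p)) * Xp + (2 * N) ^ Suc r * \<delta> + (Xp + (2 * N) ^ Suc r * \<delta>) * cr / N"
      using near_polynomial[OF r N(1) v' \<delta>0 d hold A] unfolding cr_def by blast
    define \<eta> where "\<eta> = aN * Xp + bN * Op"
    have e0: "0 \<le> \<eta>" using aN0 bN0 by (simp add: \<eta>_def Xp_def Op_def)
    have "N powr (- ((p - 1) / p)) * Xp + (2 * N) ^ Suc r * \<delta> + (Xp + (2 * N) ^ Suc r * \<delta>) * cr / N = \<eta>"
      unfolding \<eta>_def aN_def bN_def \<delta>Op by (simp add: algebra_simps add_divide_distrib)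
    hence \<eta>: "\<bar>primitive g y - poly G y\<bar> \<le> \<eta>" if "y \<in> {0..1}" for y using Gn that by (simp add: F_def)
    have "unit_int p (\<lambda>x. g x - poly (pderiv G) x) \<le> ennreal (2 powr p) *
      (ennreal (4 / \<sigma>1) * unit_osc p r \<sigma> g + ennreal (2 * (2 ^ r * 4 * \<eta> / \<sigma>1) powr p))"
      by (rule unit_int_pderiv_le[OF int p s1 r G \<eta>])
    also have "\<dots> \<le> ennreal (2 powr p) * (ennreal (4 / \<sigma>1) * ennreal \<Omega> + ennreal (2 * (2 ^ r * 4 * \<eta> / \<sigma>1) powr p))"
      by (intro mult_left_mono add_right_mono osc) auto
    also have "\<dots> = ennreal (2 powr p * (4 / \<sigma>1 * \<Omega> + 2 * (2 ^ r * 4 * \<eta> / \<sigma>1) powr p))"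
      using s1 \<Omega> by (simp add: ennreal_mult'[symmetric] ennreal_plus[symmetric] del: ennreal_plus)
    also have "\<dots> \<le> ennreal (C * \<Omega> + 1 / 2 * X)"
    proof (rule ennreal_leI)
      have "(2 ^ r * 4 * \<eta> / \<sigma>1) powr p = (2 ^ r * 4 / \<sigma>1) powr p * \<eta> powr p"
        using e0 s1 by (subst powr_mult[symmetric]) auto
      hence eq: "2 powr p * (4 / \<sigma>1 * \<Omega> + 2 * (2 ^ r * 4 * \<eta> / \<sigma>1) powr p) = 2 powr p * (4 / \<sigma>1) * \<Omega> + L * \<eta> powr p"
        by (simp add: L_def algebra_simps)
      have "\<eta> powr p \<le> 2 powr p * (aN powr p * X + bN powr p * \<Omega>)"
      proof -
        have "\<eta> powr p \<le> 2 powr p * ((aN * Xp) powr p + (bN * Op) powr p)"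
          unfolding \<eta>_def by (rule powr_add_le) (use aN0 bN0 p in \<open>auto simp: Xp_def Op_def\<close>)
        also have "(aN * Xp) powr p = aN powr p * X"
          using aN0 X p by (simp add: powr_mult Xp_def powr_powr)
        also have "(bN * Op) powr p = bN powr p * \<Omega>"
          using bN0 \<Omega> p by (simp add: powr_mult Op_def powr_powr)
        finally show ?thesis .
      qed
      hence "L * \<eta> powr p \<le> L * (2 powr p * (aN powr p * X + bN powr p * \<Omega>))" using L by (intro mult_left_mono)
      also have "\<dots> = (L * 2 powr p * aN powr p) * X + L * 2 powr p * bN powr p * \<Omega>" by (simp add: algebra_simps)
      also have "(L * 2 powr p * aN powr p) * X \<le> 1 / 2 * X" using aNp X by (intro mult_right_mono) auto
      finally show "2 powr p * (4 / \<sigma>1 * \<Omega> + 2 * (2 ^ r * 4 * \<eta> / \<sigma>1) powr p) \<le> C * \<Omega> + 1 / 2 * X"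
        unfolding eq by (simp add: C_def algebra_simps)
    qed
    also have "\<dots> = ennreal (C * \<Omega>) + ennreal (1 / 2) * unit_int p g"
    proof -
      have "ennreal (1 / 2 * X) = ennreal (1 / 2) * ennreal X" by (rule ennreal_mult) (use X in auto)
      thus ?thesis unfolding X(1) using C \<Omega> X by (subst ennreal_plus) auto
    qed
    finally have "unit_int p (\<lambda>x. g x - poly (pderiv G) x) \<le> ennreal (C * \<Omega>) + ennreal (1 / 2) * unit_int p g" .
    moreover have "degree (pderiv G) < r" using G r by (simp add: degree_pderiv)
    ultimately show "\<exists>q. degree q < r \<and> unit_int p (\<lambda>x. g x - poly q x)
        \<le> ennreal (C * \<Omega>) + ennreal (1 / 2) * unit_int p g"
      by blast
  qed
qed

lemma unit_int_cong: "(\<And>x. x \<in> {0..1} \<Longrightarrow> f x = g x) \<Longrightarrow> unit_int p f = unit_int p g"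
  unfolding unit_int_def by (intro nn_integral_cong) (auto simp: indicator_def)

lemma unit_osc_cong:
  assumes "\<And>x. x \<in> {0..1} \<Longrightarrow> f x = g x"
  shows "unit_osc p r \<sigma> f = unit_osc p r \<sigma> g"
  unfolding unit_osc_def
proof (intro nn_integral_cong)
  fix u :: real
  have "fdiff r u f x = fdiff r u g x" if "0 < u" "x \<in> {0..1 - real r * u}" for x
  proof (rule fdiff_cong, rule assms)
    fix i assume "i \<le> r"
    hence "0 \<le> real i * u" "real i * u \<le> real r * u" using that by (auto intro!: mult_right_mono)
    thus "x + real i * u \<in> {0..1}" using that(2) unfolding atLeastAtMost_iff by linarith
  qed
  hence "lp_int p {0..1 - real r * u} (fdiff r u f) =
    lp_int p {0..1 - real r * u} (fdiff r u g)" if "0 < u"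
    using that by (intro nn_integral_cong) (auto simp: indicator_def)
  thus "lp_int p {0..1 - real r * u} (fdiff r u f) * indicator {0<..<\<sigma>} u =
    lp_int p {0..1 - real r * u} (fdiff r u g) * indicator {0<..<\<sigma>} u"
    by (auto simp: indicator_def)
qed

text \<open>Under iteration the bound x is replaced by C \<Omega> + x/2, so it stays below 2 C
  \<Omega> + 2^(-k) X. As \<Omega> > 0, finitely many steps bring the last term below \<Omega>;
  hence 2 C + 1, and no limit of polynomials is taken.\<close>

lemma whitney_unit:
  assumes r: "1 \<le> r" and p: "1 < p" and \<sigma>: "0 < \<sigma>"
  shows "\<exists>C\<ge>0. \<forall>g \<Omega>. g \<in> borel_measurable borel \<longrightarrow> unit_int p g < \<infinity> \<longrightarrow>
    0 < \<Omega> \<longrightarrow> unit_osc p r \<sigma> g \<le> ennreal \<Omega> \<longrightarrow>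
    (\<exists>q. degree q < r \<and> unit_int p (\<lambda>x. g x - poly q x) \<le> ennreal (C * \<Omega>))"
proof -
  obtain C where C: "0 \<le> C" and step: "\<And>g \<Omega>. g \<in> borel_measurable borel \<Longrightarrow> (\<And>x. x \<notin> {0..1} \<Longrightarrow> g x = 0)
      \<Longrightarrow> unit_int p g < \<infinity> \<Longrightarrow>
    0 < \<Omega> \<Longrightarrow> unit_osc p r \<sigma> g \<le> ennreal \<Omega> \<Longrightarrow>
    (\<exists>q. degree q < r \<and> unit_int p (\<lambda>x. g x - poly q x) \<le> ennreal (C * \<Omega>) + ennreal (1 / 2) * unit_int p g)"
    using whitney_step[OF assms] by blast
  show ?thesis
  proof (intro exI[of _ "2 * C + 1"] conjI allI impI)
    fix g :: "real \<Rightarrow> real" and \<Omega> :: real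
    assume g[measurable]: "g \<in> borel_measurable borel" and fin: "unit_int p g < \<infinity>"
      and \<Omega>: "0 < \<Omega>" and osc: "unit_osc p r \<sigma> g \<le> ennreal \<Omega>"
    define X where "X = enn2real (unit_int p g)"
    have X: "unit_int p g = ennreal X" "0 \<le> X" using fin by (auto simp: X_def less_top[symmetric])
    have iter: "\<exists>q. degree q < r \<and> unit_int p (\<lambda>x. g x - poly q x) \<le> ennreal (2 * C * \<Omega> + (1 / 2) ^ k * X)" for k
    proof (induction k)
      case 0
      show ?case using r X C \<Omega> by (intro exI[of _ 0]) (auto intro!: ennreal_leI)
    next
      case (Suc k)
      then obtain q where q: "degree q < r" "unit_int p (\<lambda>x. g x - poly q x)
          \<le> ennreal (2 * C * \<Omega> + (1 / 2) ^ k * X)" by blast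
      \<comment> \<open>The remainder is cut off outside [0,1] to meet the hypothesis of the step.
        Differences within [0,1] do not see the cut, and q is annihilated by them.\<close>
      define h where "h x = (g x - poly q x) * indicator {0..1} x" for x
      have [measurable]: "poly q \<in> borel_measurable borel"
        by (intro borel_measurable_continuous_onI continuous_intros)
      have h: "unit_int p h = unit_int p (\<lambda>x. g x - poly q x)" by (rule unit_int_cong) (simp add: h_def)
      have "unit_osc p r \<sigma> h = unit_osc p r \<sigma> (\<lambda>x. g x - poly q x)" by (rule unit_osc_cong) (simp add: h_def)
      also have "\<dots> = unit_osc p r \<sigma> g"
        unfolding unit_osc_def fdiff_diff using fdiff_poly_eq_0[OF q(1)] by simp
      finally have osc': "unit_osc p r \<sigma> h \<le> ennreal \<Omega>" using osc by simp
      have "\<exists>q'. degree q' < r \<and> unit_int p (\<lambda>x. h x - poly q' x) \<le> ennreal (C * \<Omega>) + ennreal (1 / 2) * unit_int p h"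
      proof (rule step[OF _ _ _ \<Omega> osc'])
        show "h \<in> borel_measurable borel" unfolding h_def by measurable
        show "unit_int p h < \<infinity>" using q(2) unfolding h by (auto simp: order.strict_trans1[OF _ ennreal_less_top])
      qed (simp add: h_def)
      then obtain q' where q': "degree q' < r" "unit_int p (\<lambda>x. h x - poly q' x)
          \<le> ennreal (C * \<Omega>) + ennreal (1 / 2) * unit_int p h" by blast
      have "unit_int p (\<lambda>x. g x - poly (q + q') x) = unit_int p (\<lambda>x. h x - poly q' x)"
        by (rule unit_int_cong) (simp add: h_def)
      also have "\<dots> \<le> ennreal (C * \<Omega>) + ennreal (1 / 2) * unit_int p h" by (rule q')
      also have "\<dots> \<le> ennreal (C * \<Omega>) + ennreal (1 / 2) * ennreal (2 * C * \<Omega> + (1 / 2) ^ k * X)"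
        unfolding h by (intro add_left_mono mult_left_mono q) auto
      also have "\<dots> = ennreal (2 * C * \<Omega> + (1 / 2) ^ Suc k * X)"
        using C \<Omega> X by (subst ennreal_mult[symmetric], simp, simp, subst ennreal_plus[symmetric]) (auto simp:
            algebra_simps)
      finally show ?case using q q' by (intro exI[of _ "q + q'"]) (auto intro: degree_add_less)
    qed
    obtain k where k: "(1 / 2) ^ k * X \<le> \<Omega>"
    proof -
      have "\<exists>k. (1 / 2) ^ k < \<Omega> / (X + 1)" using X \<Omega> by (intro real_arch_pow_inv) auto
      then obtain k where "(1 / 2) ^ k < \<Omega> / (X + 1)" by blast
      hence "(1 / 2) ^ k * (X + 1) < \<Omega>" using X by (simp add: field_simps)
      moreover have "0 \<le> (1 / 2 :: real) ^ k" by simp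
      ultimately have "(1 / 2) ^ k * X \<le> \<Omega>" unfolding distrib_left mult_1_right by linarith
      thus ?thesis by (rule that)
    qed
    obtain q where q: "degree q < r" "unit_int p (\<lambda>x. g x - poly q x) \<le> ennreal (2 * C * \<Omega> + (1 / 2) ^ k * X)"
        using iter by blast
    have "ennreal (2 * C * \<Omega> + (1 / 2) ^ k * X) \<le> ennreal ((2 * C + 1) * \<Omega>)"
      using k by (intro ennreal_leI) (simp add: distrib_right)
    thus "\<exists>q. degree q < r \<and> unit_int p (\<lambda>x. g x - poly q x) \<le> ennreal ((2 * C + 1) * \<Omega>)"
      using q by (meson order.trans)
  qed (use C in auto)
qed

text \<open>Both the point and the step are scaled by l, so the averaged oscillation scales with l^2
  and the norm with l. The normalisation l \<Omega> in the hypothesis therefore leaves a constant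
  free of l.\<close>

lemma whitney_interval:
  assumes r: "1 \<le> r" and p: "1 < p" and \<sigma>: "0 < \<sigma>"
  shows "\<exists>C\<ge>0. \<forall>f a l \<Omega>. f \<in> borel_measurable borel \<longrightarrow> 0 < l \<longrightarrow>
    lp_int p {a..a + l} f < \<infinity> \<longrightarrow> 0 < \<Omega> \<longrightarrow>
    (\<integral>\<^sup>+u. lp_int p {a..a + l - real r * u} (fdiff r u f) * indicator {0<..<\<sigma> * l} u \<partial>lborel)
      \<le> ennreal (l * \<Omega>) \<longrightarrow>
    (\<exists>q. degree q < r \<and> lp_int p {a..a + l} (\<lambda>x. f x - poly q x) \<le> ennreal (C * \<Omega>))"
proof -
  obtain C where C: "0 \<le> C" and unit: "\<And>g \<Omega>. g \<in> borel_measurable borel \<Longrightarrow> unit_int p g < \<infinity> \<Longrightarrow>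
    0 < \<Omega> \<Longrightarrow> unit_osc p r \<sigma> g \<le> ennreal \<Omega> \<Longrightarrow>
    (\<exists>q. degree q < r \<and> unit_int p (\<lambda>x. g x - poly q x) \<le> ennreal (C * \<Omega>))"
    using whitney_unit[OF assms] by blast
  show ?thesis
  proof (intro exI[of _ C] conjI C allI impI)
    fix f :: "real \<Rightarrow> real" and a l \<Omega> :: real
    assume f[measurable]: "f \<in> borel_measurable borel" and l: "0 < l"
      and fin: "lp_int p {a..a + l} f < \<infinity>" and \<Omega>: "0 < \<Omega>"
      and osc: "(\<integral>\<^sup>+u. lp_int p {a..a + l - real r * u} (fdiff r u f) * indicator {0<..<\<sigma> * l} u \<partial>lborel)
      \<le> ennreal (l * \<Omega>)"
    define g where "g y = f (a + l * y)" for y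
    have [measurable]: "g \<in> borel_measurable borel" unfolding g_def by measurable
    have scale: "(\<integral>\<^sup>+x. k x \<partial>lborel) = ennreal l * (\<integral>\<^sup>+y. k (a
        + l * y) \<partial>lborel)" if "k \<in> borel_measurable borel" for k :: "real \<Rightarrow> ennreal" and a
      using nn_integral_real_affine[OF that, of l a] l by simp
    have scale_int: "lp_int p {a..a + l} (\<lambda>x. f x - h x) = ennreal l * unit_int p (\<lambda>y. g y - h (a + l * y))"
      if [measurable]: "h \<in> borel_measurable borel" for h
      unfolding unit_int_def g_def using l
      by (subst scale, measurable) (auto intro!: arg_cong2[of _ _ _ _ "(*)"] nn_integral_cong simp:
          indicator_def zero_le_mult_iff)
    have "unit_int p g < \<infinity>"
      using scale_int[of "\<lambda>_. 0"] fin l by (auto simp: ennreal_mult_less_top)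
    moreover have "unit_osc p r \<sigma> g \<le> ennreal (\<Omega> / l)"
    proof -
      define Z where "Z u = lp_int p {a..a + l - real r * u} (fdiff r u f)" for u
      have [measurable]: "Z \<in> borel_measurable borel" unfolding Z_def by measurable
      have Zl: "Z (l * u) = ennreal l * (\<integral>\<^sup>+y. ennreal (\<bar>fdiff r u g y\<bar> powr p) * indicator {0..1 - real r
          * u} y \<partial>lborel)" for u
      proof -
        have ind: "indicator {a..a + l - real r * (l * u)} (a + l * y)
            = (indicator {0..1 - real r * u} y :: ennreal)" for y
        proof -
          have "a + l * y \<le> a + l - real r * (l * u) \<longleftrightarrow> l * y \<le> l * (1 - real r * u)" by (simp add: algebra_simps)
          thus ?thesis using l by (auto simp: zero_le_mult_iff indicator_def)
        qed
        have "Z (l * u) = ennreal l * (\<integral>\<^sup>+y. ennreal (\<bar>fdiff r (l * u) f (a + l * y)\<bar> powr p) * indicator {a..a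
            + l - real r * (l * u)} (a + l * y) \<partial>lborel)"
          unfolding Z_def by (rule scale) measurable
        thus ?thesis unfolding g_def fdiff_scale ind .
      qed
      have "(\<integral>\<^sup>+u. Z u * indicator {0<..<\<sigma> * l} u \<partial>lborel) = ennreal l * (\<integral>\<^sup>+u. Z (0
          + l * u) * indicator {0<..<\<sigma> * l} (0 + l * u) \<partial>lborel)"
        by (rule scale) measurable
      also have "(\<integral>\<^sup>+u. Z (0 + l * u) * indicator {0<..<\<sigma> * l} (0 + l * u) \<partial>lborel) = (\<integral>\<^sup>+u. ennreal l *
          ((\<integral>\<^sup>+y. ennreal (\<bar>fdiff r u g y\<bar> powr p) * indicator {0..1 - real r * u} y \<partial>lborel)
              * indicator {0<..<\<sigma>} u) \<partial>lborel)"
      proof (intro nn_integral_cong)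
        fix u :: real
        have "indicator {0<..<\<sigma> * l} (0 + l * u) = (indicator {0<..<\<sigma>} u :: ennreal)"
          using l by (auto simp: indicator_def zero_less_mult_iff mult.commute[of l])
        thus "Z (0 + l * u) * indicator {0<..<\<sigma> * l} (0 + l * u) = ennreal l *
          ((\<integral>\<^sup>+y. ennreal (\<bar>fdiff r u g y\<bar> powr p) * indicator {0..1 - real r * u} y \<partial>lborel) * indicator {0<..<\<sigma>} u)"
          by (simp only: add_0_left Zl mult.assoc)
      qed
      also have "\<dots> = ennreal l * unit_osc p r \<sigma> g"
        unfolding unit_osc_def by (rule nn_integral_cmult) measurable
      finally have "ennreal l * (ennreal l * unit_osc p r \<sigma> g) \<le> ennreal (l * \<Omega>)"
        using osc by (simp add: Z_def)
      hence "ennreal (1 / (l * l)) * (ennreal l * (ennreal l * unit_osc p r \<sigma> g))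
          \<le> ennreal (1 / (l * l)) * ennreal (l * \<Omega>)"
        by (intro mult_left_mono) auto
      thus ?thesis using l \<Omega> by (simp add: mult.assoc[symmetric] ennreal_mult[symmetric] ennreal_mult'[symmetric])
    qed
    ultimately obtain q where q: "degree q < r" "unit_int p (\<lambda>x. g x - poly q x) \<le> ennreal (C * (\<Omega> / l))"
      using unit[of g "\<Omega> / l"] \<Omega> l by auto
    define q' where "q' = pcompose q [:- a / l, 1 / l:]"
    have q'e: "poly q' (a + l * y) = poly q y" for y
      using l by (simp add: q'_def poly_pcompose add_divide_distrib)
    have [measurable]: "poly q' \<in> borel_measurable borel"
      by (intro borel_measurable_continuous_onI continuous_intros)
    have "lp_int p {a..a + l} (\<lambda>x. f x - poly q' x) = ennreal l * unit_int p (\<lambda>y. g y - poly q y)"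
      by (subst scale_int) (auto simp: q'e)
    also have "\<dots> \<le> ennreal l * ennreal (C * (\<Omega> / l))" by (intro mult_left_mono q) auto
    also have "\<dots> = ennreal (C * \<Omega>)" using l C \<Omega> by (subst ennreal_mult[symmetric]) auto
    finally show "\<exists>q. degree q < r \<and> lp_int p {a..a + l} (\<lambda>x. f x - poly q x) \<le> ennreal (C * \<Omega>)"
      using q l by (intro exI[of _ q']) (auto simp: q'_def degree_pcompose)
  qed
qed

section \<open>A polynomial partition of unity\<close>

lemma sum_inverse_squares_le: "(\<Sum>m<n. 1 / (1 + real m)\<^sup>2) \<le> 2"
proof -
  have "(\<Sum>m<n. 1 / (1 + real m)\<^sup>2) \<le> 2 - 1 / real n" if "1 \<le> n" for n :: nat
    using that
  proof (induction n rule: dec_induct)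
    case (step n)
    have n: "0 < real n" using step by simp
    have "1 / (1 + real n)\<^sup>2 \<le> 1 / (real n * (1 + real n))"
      using n by (intro divide_left_mono mult_pos_pos) (auto simp: power2_eq_square)
    also have "\<dots> = 1 / real n - 1 / real (Suc n)" using n by (simp add: field_simps)
    finally show ?case using step by simp
  qed simp
  from this[of n] show ?thesis by (cases n) (auto intro: order.trans)
qed

lemma sum_inverse_squares_dist_le: "(\<Sum>k<n. 1 / (1 + \<bar>real k - real j\<bar>)\<^sup>2) \<le> 4"
proof -
  define g where "g m = 1 / (1 + real m)\<^sup>2" for m
  have g0: "0 \<le> g m" for m by (simp add: g_def)
  have "(\<Sum>k<n. 1 / (1 + \<bar>real k - real j\<bar>)\<^sup>2) = (\<Sum>k\<in>{..<n} \<inter> {..j}. 1 / (1 + \<bar>real k - real j\<bar>)\<^sup>2)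
      + (\<Sum>k\<in>{..<n} - {..j}. 1 / (1 + \<bar>real k - real j\<bar>)\<^sup>2)"
    by (rule sum.Int_Diff) simp
  also have "(\<Sum>k\<in>{..<n} \<inter> {..j}. 1 / (1 + \<bar>real k - real j\<bar>)\<^sup>2) = (\<Sum>k\<in>{..<n} \<inter> {..j}. g (j - k))"
    by (intro sum.cong refl) (auto simp: g_def of_nat_diff)
  also have "\<dots> = sum g ((\<lambda>k. j - k) ` ({..<n} \<inter> {..j}))"
    by (subst sum.reindex) (auto simp: inj_on_def)
  also have "\<dots> \<le> sum g {..<Suc j}" by (intro sum_mono2) (auto simp: g0)
  also have "\<dots> \<le> 2" unfolding g_def by (rule sum_inverse_squares_le)
  also have "(\<Sum>k\<in>{..<n} - {..j}. 1 / (1 + \<bar>real k - real j\<bar>)\<^sup>2) = (\<Sum>k\<in>{..<n} - {..j}. g (k - j))"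
    by (intro sum.cong refl) (auto simp: g_def of_nat_diff)
  also have "\<dots> = sum g ((\<lambda>k. k - j) ` ({..<n} - {..j}))"
    by (subst sum.reindex) (auto simp: inj_on_def)
  also have "\<dots> \<le> sum g {..<n}" by (intro sum_mono2) (auto simp: g0)
  also have "\<dots> \<le> 2" unfolding g_def by (rule sum_inverse_squares_le)
  finally show ?thesis by simp
qed

section \<open>Cosine polynomials as polynomials in the cosine\<close>

lemma chebyshev_exists: "\<exists>T :: real poly. degree T \<le> k \<and> (\<forall>t. poly T (cos t) = cos (real k * t))"
proof (induction k rule: less_induct)
  case (less k)
  consider "k = 0" | "k = 1" | j where "k = Suc (Suc j)" by (cases k; cases "k - 1") auto
  thus ?case
  proof cases
    case 1
    thus ?thesis by (intro exI[of _ "[:1:]"]) simp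
  next
    case 2
    thus ?thesis by (intro exI[of _ "[:0, 1:]"]) simp
  next
    case 3
    obtain T1 where T1: "degree T1 \<le> Suc j" "\<And>t. poly T1 (cos t) = cos (real (Suc j) * t)"
        using less[of "Suc j"] 3 by auto
    obtain T0 where T0: "degree T0 \<le> j" "\<And>t. poly T0 (cos t) = cos (real j * t)" using less[of j] 3 by auto
    have "degree ([:0, 2:] * T1) \<le> Suc (Suc j)" using degree_mult_le[of "[:0, 2:]" T1] T1 by simp
    hence "degree ([:0, 2:] * T1 - T0) \<le> Suc (Suc j)" using T0 by (intro degree_diff_le) auto
    moreover have "poly ([:0, 2:] * T1 - T0) (cos t) = cos (real (Suc (Suc j)) * t)" for t
    proof -
      have e: "real (Suc (Suc j)) * t = real (Suc j) * t + t" "real j * t = real (Suc j) * t - t"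
          by (simp_all add: algebra_simps)
      have "poly ([:0, 2:] * T1 - T0) (cos t) = 2 * cos t * cos (real (Suc j) * t) - cos (real j * t)"
        by (simp add: T1 T0 del: of_nat_Suc)
      also have "\<dots> = cos (real (Suc (Suc j)) * t)" unfolding e cos_add cos_diff by simp
      finally show ?thesis .
    qed
    ultimately show ?thesis using 3 by blast
  qed
qed

lemma cosine_expansion: "degree p \<le> K \<Longrightarrow> \<exists>d. \<forall>t. poly p (cos t) = (\<Sum>k\<le>K. d k * cos (real k * t))" for p :: "real poly"
proof (induction p arbitrary: K)
  case 0
  show ?case by (rule exI[of _ "\<lambda>_. 0"]) simp
next
  case (pCons a p)
  show ?case
  proof (cases "p = 0")
    case True
    have "(\<Sum>k\<le>K. (if k = 0 then a else 0) * cos (real k * t)) = a" for t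
    proof -
      have "(\<Sum>k\<le>K. (if k = 0 then a else 0) * cos (real k * t)) = (\<Sum>k\<le>K. if k = 0 then a else 0)"
        by (intro sum.cong) auto
      thus ?thesis by simp
    qed
    thus ?thesis using True by (intro exI[of _ "\<lambda>k. if k = 0 then a else 0"]) simp
  next
    case False
    then obtain J where K: "K = Suc J" "degree p \<le> J" using pCons.prems by (cases K) auto
    obtain d where d: "\<And>t. poly p (cos t) = (\<Sum>k\<le>J. d k * cos (real k * t))" using pCons.IH[OF K(2)] by blast
    define d' where "d' k = (if k \<le> J then d k else 0)" for k
    \<comment> \<open>cos t cos(k t) is half the sum of cos((k + 1) t) and cos((k - 1) t). The last
      summand is the case k = 0 of the second cosine, which is cos(-t) and so counts for the index
      1.\<close>
    define c where "c k = (if k = 0 then a else 0) + (if k = 0 then 0 else d' (k - 1) / 2) + (d' (Suc k) / 2)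
        + (if k = 1 then d' 0 / 2 else 0)" for k
    have "poly (pCons a p) (cos t) = (\<Sum>k\<le>K. c k * cos (real k * t))" for t
    proof -
      have s1: "(\<Sum>k\<le>K. (if k = 0 then a else 0) * cos (real k * t)) = a"
      proof -
        have "(\<Sum>k\<le>K. (if k = 0 then a else 0) * cos (real k * t)) = (\<Sum>k\<le>K. if k = 0 then a else 0)"
          by (intro sum.cong) auto
        thus ?thesis by simp
      qed
      have s2: "(\<Sum>k\<le>K. (if k = 0 then 0 else d' (k - 1) / 2) * cos (real k * t))
          = (\<Sum>k\<le>J. d k / 2 * cos (real (Suc k) * t))"
        unfolding K(1) by (subst sum.atMost_Suc_shift) (auto simp: d'_def intro!: sum.cong)
      have s3: "(\<Sum>k\<le>K. d' (Suc k) / 2 * cos (real k * t)) + d' 0 / 2 * cos t = (\<Sum>k\<le>J. d k / 2 * cos (real k * t - t))"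
      proof -
        have "(\<Sum>k\<le>J. d k / 2 * cos (real k * t - t)) = (\<Sum>k\<le>Suc (Suc J). d' k / 2 * cos (real k * t - t))"
          by (simp add: d'_def)
        also have "\<dots> = d' 0 / 2 * cos (- t) + (\<Sum>k\<le>Suc J. d' (Suc k) / 2 * cos (real (Suc k) * t - t))"
          by (subst sum.atMost_Suc_shift) simp
        also have "(\<Sum>k\<le>Suc J. d' (Suc k) / 2 * cos (real (Suc k) * t - t))
            = (\<Sum>k\<le>K. d' (Suc k) / 2 * cos (real k * t))"
          unfolding K(1) by (intro sum.cong refl) (simp add: algebra_simps)
        finally show ?thesis by simp
      qed
      have s4: "(\<Sum>k\<le>K. (if k = 1 then d' 0 / 2 else 0) * cos (real k * t)) = d' 0 / 2 * cos t"
      proof -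
        have "(\<Sum>k\<le>K. (if k = 1 then d' 0 / 2 else 0) * cos (real k * t)) = (\<Sum>k\<le>K. if k
            = 1 then d' 0 / 2 * cos t else 0)"
          by (intro sum.cong) auto
        thus ?thesis using K by simp
      qed
      have "(\<Sum>k\<le>K. c k * cos (real k * t)) = a + (\<Sum>k\<le>J. d k / 2 * cos (real (Suc k) * t))
          + (\<Sum>k\<le>J. d k / 2 * cos (real k * t - t))"
        unfolding c_def distrib_right sum.distrib s1 s2 s4 s3[symmetric] by simp
      also have "\<dots> = a + (\<Sum>k\<le>J. d k * (cos t * cos (real k * t)))"
        unfolding add.assoc sum.distrib[symmetric]
        by (intro arg_cong2[of _ _ _ _ "(+)"] sum.cong refl) (simp add: distrib_right cos_add cos_diff algebra_simps)
      also have "\<dots> = poly (pCons a p) (cos t)"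
        by (simp add: d sum_distrib_left mult_ac)
      finally show ?thesis by simp
    qed
    thus ?thesis by blast
  qed
qed

lemma norm_fejer_real:
  "norm (fejer n (of_real t)) = (\<Sum>k<n. \<Sum>l<n. cos ((real k - real l) * t)) / (real n)\<^sup>2"
proof -
  define A where "A = (\<Sum>k<n. exp (\<i> * complex_of_real t) ^ k)"
  have "(\<Sum>k<n. exp (- (\<i> * complex_of_real t)) ^ k) = cnj A"
    by (simp add: A_def exp_cnj)
  hence "norm (fejer n (of_real t)) = (norm A)\<^sup>2 / (real n)\<^sup>2"
    by (simp add: fejer_def A_def[symmetric] norm_mult norm_divide norm_power power2_eq_square)
  also have "A = (\<Sum>k<n. cis (real k * t))"
    unfolding A_def by (simp add: cis_conv_exp exp_of_nat_mult[symmetric] mult_ac)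
  also have "(norm \<dots>)\<^sup>2 = (\<Sum>k<n. cos (real k * t))\<^sup>2 + (\<Sum>k<n. sin (real k * t))\<^sup>2"
    by (simp add: cmod_power2)
  also have "\<dots> = (\<Sum>k<n. \<Sum>l<n. cos ((real k - real l) * t))"
    unfolding power2_eq_square sum_product sum.distrib[symmetric]
    by (intro sum.cong refl) (simp add: left_diff_distrib cos_diff)
  finally show ?thesis .
qed

lemma fejer_power_poly:
  assumes n: "1 \<le> n"
  shows "\<exists>p :: real poly. degree p \<le> M * (n - 1) \<and> (\<forall>t. poly p (cos t) = norm (fejer n (of_real t)) ^ M)"
proof -
  obtain T :: "nat \<Rightarrow> real poly" where T: "\<And>k. degree (T k) \<le> k" "\<And>k t. poly (T k) (cos t) = cos (real k * t)"
    using chebyshev_exists by metis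
  define D where "D k l = (if k \<le> l then l - k else k - l)" for k l :: nat
  define q where "q = smult (1 / (real n)\<^sup>2) (\<Sum>k<n. \<Sum>l<n. T (D k l))"
  have "degree (\<Sum>k<n. \<Sum>l<n. T (D k l)) \<le> n - 1"
  proof (intro degree_sum_le)
    fix k l assume "k \<in> {..<n}" "l \<in> {..<n}"
    hence "D k l \<le> n - 1" by (auto simp: D_def)
    thus "degree (T (D k l)) \<le> n - 1" using T(1) order.trans by blast
  qed auto
  hence dq: "degree q \<le> n - 1" unfolding q_def by (rule order.trans[OF degree_smult_le])
  have pq: "poly q (cos t) = norm (fejer n (of_real t))" for t
  proof -
    have "poly (T (D k l)) (cos t) = cos ((real k - real l) * t)" for k l
    proof (cases "k \<le> l")
      case True
      hence "poly (T (D k l)) (cos t) = cos (- ((real k - real l) * t))"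
        by (simp add: D_def T(2) of_nat_diff algebra_simps)
      thus ?thesis by (simp only: cos_minus)
    next
      case False
      thus ?thesis by (simp add: D_def T(2) of_nat_diff)
    qed
    thus ?thesis by (simp add: q_def norm_fejer_real poly_sum)
  qed
  have "degree (q ^ M) \<le> M * (n - 1)"
    using mult_le_mono1[OF dq, of M] by (intro order.trans[OF degree_power_le]) (simp add: mult.commute)
  moreover have "poly (q ^ M) (cos t) = norm (fejer n (of_real t)) ^ M" for t by (simp add: poly_power pq)
  ultimately show ?thesis by blast
qed

lemma sum_cos_midpoints:
  assumes k: "k < 2 * N" and N: "1 \<le> N"
  shows "(\<Sum>j<N. cos (real k * ((real j + 1 / 2) * pi / real N))) = (if k = 0 then real N else 0)"
proof (cases "k = 0")
  case False
  define b where "b = real k * pi / (2 * real N)"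
  have b: "0 < b" "b < pi"
  proof -
    show "0 < b" using False N by (simp add: b_def)
    have "real k * pi < (2 * real N) * pi" using k by (intro mult_strict_right_mono) auto
    thus "b < pi" using N by (simp add: b_def field_simps)
  qed
  have sb: "sin b \<noteq> 0" using sin_gt_zero[OF b] by simp
  have "2 * sin b * (\<Sum>j<N. cos (real k * ((real j + 1 / 2) * pi / real N)))
      = (\<Sum>j<N. sin (2 * real (Suc j) * b) - sin (2 * real j * b))"
    unfolding sum_distrib_left
  proof (intro sum.cong refl)
    fix j
    have e: "real k * ((real j + 1 / 2) * pi / real N) = (2 * real j + 1) * b" using N
        by (simp add: b_def field_simps)
    have "sin (2 * real (Suc j) * b) - sin (2 * real j * b) = 2 * sin ((2 * real (Suc j) * b - 2 * real j
        * b) / 2) * cos ((2 * real (Suc j) * b + 2 * real j * b) / 2)"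
      by (rule sin_diff_sin)
    also have "(2 * real (Suc j) * b - 2 * real j * b) / 2 = b" by (simp add: algebra_simps)
    also have "(2 * real (Suc j) * b + 2 * real j * b) / 2 = (2 * real j + 1) * b" by (simp add: field_simps)
    finally show "2 * sin b * cos (real k * ((real j + 1 / 2) * pi / real N))
        = sin (2 * real (Suc j) * b) - sin (2 * real j * b)"
      unfolding e by simp
  qed
  also have "\<dots> = sin (2 * real N * b) - sin (2 * real 0 * b)" by (rule sum_lessThan_telescope)
  also have "2 * real N * b = real k * pi" using N by (simp add: b_def)
  finally have "2 * sin b * (\<Sum>j<N. cos (real k * ((real j + 1 / 2) * pi / real N))) = 0" by (simp add: sin_npi)
  thus ?thesis using sb False by simp
qed simp

text \<open>The members are powers of the Fejer kernel centred at the midpoints and symmetrised. Their sum is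
  constant because the midpoint rule is exact for cosine polynomials of degree below $N$.\<close>

lemma polynomial_partition_of_unity:
  assumes N: "1 \<le> N" and M: "1 \<le> M"
  shows "\<exists>\<alpha> :: nat \<Rightarrow> real poly. (\<forall>j. degree (\<alpha> j) < N) \<and>
    (\<forall>t\<in>{0..pi}. (\<Sum>j<N. poly (\<alpha> j) (cos t)) = 1 \<and>
      (\<forall>j<N. 0 \<le> poly (\<alpha> j) (cos t) \<and>
         poly (\<alpha> j) (cos t) \<le> 2 * (25 * (real M)\<^sup>2) ^ M / (1 + real N * \<bar>t - (real j
             + 1 / 2) * pi / real N\<bar>) ^ (2 * M)))"
proof -
  \<comment> \<open>The largest n with M (n - 1) <= N - 1: the M-th power of the kernel has degree
    below N, and n >= N/M preserves the decay at scale N.\<close>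
  define n where "n = Suc ((N - 1) div M)"
  have n1: "1 \<le> n" by (simp add: n_def)
  have nM: "M * (n - 1) < N"
  proof -
    have "M * ((N - 1) div M) \<le> N - 1" by (rule times_div_less_eq_dividend)
    thus ?thesis using N unfolding n_def diff_Suc_1 by linarith
  qed
  have nN: "real N \<le> real M * real n"
  proof -
    have "N - 1 < M + M * ((N - 1) div M)" using M by (intro dividend_less_times_div) auto
    hence "N \<le> M * n" using N unfolding n_def mult_Suc_right by linarith
    thus ?thesis by (metis of_nat_le_iff of_nat_mult)
  qed
  define D where "D t = norm (fejer n (of_real t)) ^ M" for t
  have D0: "0 \<le> D t" for t by (simp add: D_def)
  obtain p where p: "degree p \<le> M * (n - 1)" "\<And>t. poly p (cos t) = D t"
    using fejer_power_poly[OF n1, of M] unfolding D_def by blast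
  have "degree p \<le> N - 1" using p(1) nM by linarith
  from cosine_expansion[OF this] obtain d where d: "\<And>t. D t = (\<Sum>k\<le>N - 1. d k * cos (real k * t))"
    unfolding p(2) by blast
  have set: "{..N - 1} = {..<N}" using N by auto
  obtain T :: "nat \<Rightarrow> real poly" where T: "\<And>k. degree (T k) \<le> k" "\<And>k t. poly (T k) (cos t) = cos (real k * t)"
    using chebyshev_exists by metis
  define \<tau> where "\<tau> j = (real j + 1 / 2) * pi / real N" for j
  \<comment> \<open>The midpoint sums annihilate the frequencies 1 to N - 1, so only the mean d 0
    survives, counted twice for each j by the symmetrisation.\<close>
  define \<kappa> where "\<kappa> = 2 * real N * d 0"
  have tot: "(\<Sum>j<N. D (t - \<tau> j) + D (t + \<tau> j)) = \<kappa>" for t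
  proof -
    have "(\<Sum>j<N. D (t - \<tau> j) + D (t + \<tau> j)) = (\<Sum>j<N. \<Sum>k<N. 2 * d k * cos (real k * t) * cos (real k * \<tau> j))"
      unfolding d set sum.distrib[symmetric]
      by (intro sum.cong refl) (simp add: distrib_left right_diff_distrib cos_add cos_diff)
    also have "\<dots> = (\<Sum>k<N. 2 * d k * cos (real k * t) * (\<Sum>j<N. cos (real k * \<tau> j)))"
      by (subst sum.swap) (simp add: sum_distrib_left)
    also have "\<dots> = (\<Sum>k<N. if k = 0 then \<kappa> else 0)"
    proof (intro sum.cong refl)
      fix k assume "k \<in> {..<N}"
      hence "(\<Sum>j<N. cos (real k * \<tau> j)) = (if k = 0 then real N else 0)"
        unfolding \<tau>_def using N by (intro sum_cos_midpoints) auto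
      thus "2 * d k * cos (real k * t) * (\<Sum>j<N. cos (real k * \<tau> j)) = (if k = 0 then \<kappa> else 0)"
        by (simp add: \<kappa>_def)
    qed
    also have "\<dots> = \<kappa>" using N by simp
    finally show ?thesis .
  qed
  have "norm (fejer n (of_real 0)) = 1" unfolding norm_fejer_real using n1 by (simp add: power2_eq_square)
  hence "1 = D (\<tau> 0 - \<tau> 0)" by (simp add: D_def)
  also have "\<dots> \<le> D (\<tau> 0 - \<tau> 0) + D (\<tau> 0 + \<tau> 0)" using D0 by simp
  also have "\<dots> \<le> (\<Sum>j<N. D (\<tau> 0 - \<tau> j) + D (\<tau> 0 + \<tau> j))"
    using N D0 by (intro member_le_sum[of 0 "{..<N}" "\<lambda>j. D (\<tau> 0 - \<tau> j) + D (\<tau> 0 + \<tau> j)"]) auto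
  finally have \<kappa>: "1 \<le> \<kappa>" by (simp add: tot)
  \<comment> \<open>The symmetrised translates contain cosines only, so Chebyshev polynomials
    express them in cos t. Division by \<kappa>, which is at least 1 because D is 1 at 0, normalises
    the sum.\<close>
  define \<alpha> where "\<alpha> j = (\<Sum>k<N. smult (2 * d k * cos (real k * \<tau> j) / \<kappa>) (T k))" for j
  have pa: "poly (\<alpha> j) (cos t) = (D (t - \<tau> j) + D (t + \<tau> j)) / \<kappa>" for j t
    unfolding \<alpha>_def d set sum.distrib[symmetric] poly_sum sum_divide_distrib
    by (intro sum.cong refl) (simp add: T distrib_left right_diff_distrib cos_add cos_diff)
  show ?thesis
  proof (intro exI[of _ \<alpha>] conjI allI ballI impI)
    fix j
    show "degree (\<alpha> j) < N" unfolding \<alpha>_def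
    proof (rule degree_sum_less)
      fix k assume "k \<in> {..<N}"
      thus "degree (smult (2 * d k * cos (real k * \<tau> j) / \<kappa>) (T k)) < N"
        using degree_smult_le[of _ "T k"] T(1)[of k] by (meson lessThan_iff le_less_trans)
    qed (use N in auto)
  next
    fix t assume t: "t \<in> {0..pi}"
    show "(\<Sum>j<N. poly (\<alpha> j) (cos t)) = 1"
      unfolding pa sum_divide_distrib[symmetric] tot using \<kappa> by simp
    fix j assume j: "j < N"
    show "0 \<le> poly (\<alpha> j) (cos t)" unfolding pa using D0 \<kappa> by simp
    have \<tau>: "0 \<le> \<tau> j" "\<tau> j \<le> pi"
    proof -
      show "0 \<le> \<tau> j" by (simp add: \<tau>_def)
      have "(real j + 1 / 2) * pi \<le> real N * pi" using j by (intro mult_right_mono) auto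
      thus "\<tau> j \<le> pi" using N by (simp add: \<tau>_def field_simps)
    qed
    define w where "w = 1 + real N * \<bar>t - \<tau> j\<bar>"
    have w: "0 < w" by (auto simp: w_def add_pos_nonneg)
    have dec: "D x \<le> (25 * (real M)\<^sup>2) ^ M / w ^ (2 * M)" if x: "\<bar>sin ((t - \<tau> j) / 2)\<bar> \<le> \<bar>sin (x / 2)\<bar>" for x
    proof -
      define w' where "w' = 1 + real n * \<bar>t - \<tau> j\<bar>"
      have w': "0 < w'" by (auto simp: w'_def add_pos_nonneg)
      have "real N * \<bar>t - \<tau> j\<bar> \<le> real M * real n * \<bar>t - \<tau> j\<bar>" using nN by (intro mult_right_mono) auto
      hence "w \<le> real M * w'" using M by (simp add: w_def w'_def distrib_left mult.assoc)
      hence "w\<^sup>2 \<le> (real M * w')\<^sup>2" using w by (intro power_mono) auto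
      hence "25 / w'\<^sup>2 \<le> 25 * (real M)\<^sup>2 / w\<^sup>2" using w w' by (simp add: field_simps power_mult_distrib)
      hence "norm (fejer n (of_real x)) \<le> 25 * (real M)\<^sup>2 / w\<^sup>2"
        using fejer_decay[OF n1 _ _ \<tau> x] t by (simp add: w'_def)
      hence "D x \<le> (25 * (real M)\<^sup>2 / w\<^sup>2) ^ M" unfolding D_def by (intro power_mono) auto
      thus ?thesis by (simp add: power_divide power_mult)
    qed
    have "D (t - \<tau> j) \<le> (25 * (real M)\<^sup>2) ^ M / w ^ (2 * M)" by (rule dec) simp
    moreover have "D (t + \<tau> j) \<le> (25 * (real M)\<^sup>2) ^ M / w ^ (2 * M)"
      by (rule dec) (use sin_half_sum_bounds(1)[of t "\<tau> j"] t \<tau> in auto)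
    ultimately have "D (t - \<tau> j) + D (t + \<tau> j) \<le> 2 * (25 * (real M)\<^sup>2) ^ M / w ^ (2 * M)" by simp
    moreover have "(D (t - \<tau> j) + D (t + \<tau> j)) / \<kappa> \<le> (D (t - \<tau> j) + D (t + \<tau> j)) / 1"
      using \<kappa> D0 by (intro divide_left_mono) auto
    ultimately show "poly (\<alpha> j) (cos t) \<le> 2 * (25 * (real M)\<^sup>2) ^ M / (1 + real N * \<bar>t - (real j
        + 1 / 2) * pi / real N\<bar>) ^ (2 * M)"
      unfolding pa w_def \<tau>_def by simp
  qed
qed

section \<open>The direct estimate\<close>

text \<open>The nodes decrease from 1 at j = 0 to -1 at j = N, so cell j is {node N (Suc j)..node N
  j}. Enlarged cells use the index j - 1 of the natural numbers; for j = 0 the enlarged cell is thus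
  the cell itself.\<close>

definition node :: "nat \<Rightarrow> nat \<Rightarrow> real" where
  "node N j = cos (real j * pi / real N)"

definition midpt :: "nat \<Rightarrow> nat \<Rightarrow> real" where
  "midpt N j = cos ((real j + 1 / 2) * pi / real N)"

lemma arccos_between:
  assumes "0 \<le> a" "a \<le> b" "b \<le> pi" and x: "x \<in> {cos b..cos a}"
  shows "a \<le> arccos x" "arccos x \<le> b" "x \<in> {-1..1}" "cos (arccos x) = x"
proof -
  show 1: "x \<in> {-1..1}" using x cos_ge_minus_one[of b] cos_le_one[of a] unfolding atLeastAtMost_iff by linarith
  show "cos (arccos x) = x" using 1 by simp
  have "arccos x \<le> arccos (cos b)" using x 1 by (intro arccos_le_arccos) auto
  thus "arccos x \<le> b" using assms by (simp add: arccos_cos)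
  have "arccos (cos a) \<le> arccos x" using x 1 by (intro arccos_le_arccos) auto
  thus "a \<le> arccos x" using assms by (simp add: arccos_cos)
qed

lemma midpt_props:
  assumes "1 \<le> N" "j < N"
  shows "midpt N j \<in> {-1..1}" "arccos (midpt N j) = (real j + 1 / 2) * pi / real N"
    "0 \<le> (real j + 1 / 2) * pi / real N" "(real j + 1 / 2) * pi / real N \<le> pi"
proof -
  show "midpt N j \<in> {-1..1}" by (simp add: midpt_def)
  show 1: "0 \<le> (real j + 1 / 2) * pi / real N" by simp
  have "(real j + 1 / 2) * pi \<le> real N * pi" using assms by (intro mult_right_mono) auto
  thus 2: "(real j + 1 / 2) * pi / real N \<le> pi" using assms by (simp add: field_simps)
  show "arccos (midpt N j) = (real j + 1 / 2) * pi / real N" using 1 2 by (simp add: midpt_def arccos_cos)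
qed

lemma adist_midpt_le:
  assumes N: "1 \<le> N" and i: "i < N" and ab: "0 \<le> a" "a \<le> b" "b \<le> real N"
    and x: "x \<in> {cos (b * pi / real N)..cos (a * pi / real N)}" and D: "\<bar>a - (real i + 1 / 2)\<bar>
        \<le> D" "\<bar>b - (real i + 1 / 2)\<bar> \<le> D"
  shows "adist N (midpt N i) x \<le> 4 * D" "x \<in> {-1..1}"
proof -
  have N0: "0 < real N" using N by simp
  have "b * pi \<le> real N * pi" using ab by (intro mult_right_mono) auto
  hence b: "b * pi / real N \<le> pi" using N0 by (simp add: field_simps)
  have abp: "0 \<le> a * pi / real N" "a * pi / real N \<le> b * pi / real N"
    using ab N0 by (auto intro!: divide_right_mono mult_right_mono)
  note A = arccos_between[OF abp b x]
  show "x \<in> {-1..1}" by (rule A)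
  define t where "t = real N * arccos x / pi"
  have t: "a \<le> t" "t \<le> b" using A(1,2) N0 by (auto simp: t_def field_simps)
  have at: "arccos x = t * pi / real N" using N0 by (simp add: t_def)
  have "adist N (midpt N i) x = real N * \<bar>((real i + 1 / 2) - t) * (pi / real N)\<bar>"
    unfolding adist_def midpt_props(2)[OF N i] at by (simp add: algebra_simps diff_divide_distrib add_divide_distrib)
  also have "\<dots> = pi * \<bar>(real i + 1 / 2) - t\<bar>" using N0 by (simp add: abs_mult)
  also have "\<dots> \<le> 4 * D" using t D pi_less_4 by (intro mult_mono) (auto simp: abs_le_iff)
  finally show "adist N (midpt N i) x \<le> 4 * D" .
qed

lemma cell_props:
  assumes N: "1 \<le> N" and j: "j < N" and x: "x \<in> {node N (Suc j)..node N j}"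
  shows "x \<in> {-1..1}" "real j * pi / real N \<le> arccos x" "arccos x \<le> real (Suc j) * pi / real N"
    and "i < N \<Longrightarrow> adist N (midpt N i) x \<le> 4 * \<bar>real i - real j\<bar> + 2"
proof -
  have N0: "0 < real N" using N by simp
  have "real (Suc j) * pi \<le> real N * pi" using j by (intro mult_right_mono) auto
  hence b: "real (Suc j) * pi / real N \<le> pi" using N0 by (simp add: field_simps)
  have ab: "0 \<le> real j * pi / real N" "real j * pi / real N \<le> real (Suc j) * pi / real N"
    using N0 by (auto intro!: divide_right_mono mult_right_mono)
  show "x \<in> {-1..1}" "real j * pi / real N \<le> arccos x" "arccos x \<le> real (Suc j) * pi / real N"
    using arccos_between[OF ab b] x unfolding node_def by auto
  assume i: "i < N"
  have "adist N (midpt N i) x \<le> 4 * (\<bar>real i - real j\<bar> + 1 / 2)"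
    by (rule adist_midpt_le(1)[OF N i, of "real j" "real (Suc j)"]) (use j x in \<open>auto simp: node_def abs_if\<close>)
  thus "adist N (midpt N i) x \<le> 4 * \<bar>real i - real j\<bar> + 2" by simp
qed

text \<open>The enlarged cell i is the union of the cells i - 1 and i. Consecutive enlarged cells i
  and i + 1 share the whole cell i, where the two local polynomials will be compared.\<close>

lemma big_cell_props:
  assumes N: "1 \<le> N" and i: "i < N" and x: "x \<in> {node N (Suc i)..node N (i - 1)}"
  shows "x \<in> {-1..1}" "adist N (midpt N i) x \<le> 6"
    and "(real i - 1) * pi / real N \<le> arccos x" "arccos x \<le> real (Suc i) * pi / real N"
proof -
  have N0: "0 < real N" using N by simp
  have "adist N (midpt N i) x \<le> 4 * (3 / 2) \<and> x \<in> {-1..1}"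
    using adist_midpt_le[OF N i, of "real (i - 1)" "real (Suc i)" x "3 / 2"] i x
    by (cases i) (auto simp: node_def)
  thus "x \<in> {-1..1}" "adist N (midpt N i) x \<le> 6" by auto
  have "real (Suc i) * pi \<le> real N * pi" using i by (intro mult_right_mono) auto
  hence b: "real (Suc i) * pi / real N \<le> pi" using N0 by (simp add: field_simps)
  have ab: "0 \<le> real (i - 1) * pi / real N" "real (i - 1) * pi / real N \<le> real (Suc i) * pi / real N"
    using N0 by (auto intro!: divide_right_mono mult_right_mono)
  have *: "real (i - 1) * pi / real N \<le> arccos x" "arccos x \<le> real (Suc i) * pi / real N"
    using arccos_between[OF ab b] x unfolding node_def by auto
  have "(real i - 1) * pi / real N \<le> real (i - 1) * pi / real N"
    using N0 by (intro divide_right_mono mult_right_mono) auto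
  thus "(real i - 1) * pi / real N \<le> arccos x" using * by linarith
  show "arccos x \<le> real (Suc i) * pi / real N" by (rule *)
qed

lemma node_mono: "1 \<le> N \<Longrightarrow> i \<le> j \<Longrightarrow> j \<le> N \<Longrightarrow> node N j \<le> node N i"
proof -
  assume *: "1 \<le> N" "i \<le> j" "j \<le> N"
  hence N0: "0 < real N" by simp
  have "real j * pi \<le> real N * pi" using * by (intro mult_right_mono) auto
  hence "real j * pi / real N \<le> pi" using N0 by (simp add: field_simps)
  moreover have "real i * pi / real N \<le> real j * pi / real N" using *
      by (intro divide_right_mono mult_right_mono) auto
  ultimately show ?thesis unfolding node_def by (intro cos_monotone_0_pi_le) auto
qed

text \<open>The length is 2 sin \<tau> sin b with b half the angular width. Jordan's inequality
  bounds both sines below by 1/N; one copy of the product then gives sin \<tau> / N and the other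
  1/N^2.\<close>

lemma cell_length_ge:
  assumes N: "1 \<le> N" and i: "i < N"
  shows "rho N (midpt N i) \<le> node N i - node N (Suc i)"
proof -
  define \<tau> where "\<tau> = (real i + 1 / 2) * pi / real N"
  define b where "b = pi / (2 * real N)"
  have N0: "0 < real N" "1 \<le> real N" using N by simp_all
  have \<tau>: "0 \<le> \<tau>" "\<tau> \<le> pi" using midpt_props[OF N i] by (auto simp: \<tau>_def)
  have b: "0 \<le> b" "b \<le> pi / 2" using N0 by (auto simp: b_def field_simps)
  have sb: "1 / real N \<le> sin b" using sin_ge_two_div_pi[OF b] N0 by (simp add: b_def)
  have b\<tau>: "b \<le> \<tau>" "b \<le> pi - \<tau>"
  proof -
    have "\<tau> - b = real i * pi / real N" using N0 by (simp add: \<tau>_def b_def field_simps)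
    moreover have "0 \<le> real i * pi / real N" by simp
    ultimately show "b \<le> \<tau>" by linarith
    have "real (Suc i) * pi \<le> real N * pi" using i by (intro mult_right_mono) auto
    hence "real (Suc i) * pi / real N \<le> pi" using N0 by (simp add: field_simps)
    moreover have "\<tau> + b = real (Suc i) * pi / real N" using N0 by (simp add: \<tau>_def b_def field_simps)
    ultimately show "b \<le> pi - \<tau>" by linarith
  qed
  have s\<tau>: "1 / real N \<le> sin \<tau>"
  proof (cases "\<tau> \<le> pi / 2")
    case True
    have "1 / real N = 2 / pi * b" using N0 by (simp add: b_def)
    also have "\<dots> \<le> 2 / pi * \<tau>" using b\<tau> by (intro mult_left_mono) auto
    also have "\<dots> \<le> sin \<tau>" using \<tau> True by (intro sin_ge_two_div_pi)
    finally show ?thesis .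
  next
    case False
    have "1 / real N = 2 / pi * b" using N0 by (simp add: b_def)
    also have "\<dots> \<le> 2 / pi * (pi - \<tau>)" using b\<tau> by (intro mult_left_mono) auto
    also have "\<dots> \<le> sin (pi - \<tau>)" using \<tau> False by (intro sin_ge_two_div_pi) auto
    finally show ?thesis by simp
  qed
  have e: "real i * pi / real N = \<tau> - b" "real (Suc i) * pi / real N = \<tau> + b"
    using N0 by (auto simp: \<tau>_def b_def field_simps)
  have "node N i - node N (Suc i) = 2 * sin \<tau> * sin b"
    unfolding node_def e by (simp add: cos_diff cos_add)
  also have "\<dots> \<ge> 2 * sin \<tau> * (1 / real N)"
    using sb \<tau> by (intro mult_left_mono) (auto simp: sin_ge_zero)
  also have "2 * sin \<tau> * (1 / real N) = sin \<tau> / real N + sin \<tau> * (1 / real N)" by simp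
  also have "\<dots> \<ge> sin \<tau> / real N + 1 / real N * (1 / real N)"
    using s\<tau> N0 by (intro add_left_mono mult_right_mono) auto
  finally show ?thesis
    unfolding midpt_def \<tau>_def[symmetric] rho_cos[OF \<tau>] by (simp add: power2_eq_square)
qed

lemma big_cell_length_le:
  assumes N: "1 \<le> N" and i: "i < N"
  shows "node N (i - 1) - node N (Suc i) \<le> 84 * rho N (midpt N i)"
proof -
  have m: "midpt N i \<in> {-1..1}" by (rule midpt_props[OF N i])
  have r: "0 < rho N (midpt N i)" using N m by (rule rho_pos)
  have mono: "node N (Suc i) \<le> node N (i - 1)" using N i by (intro node_mono) auto
  \<comment> \<open>42 is 6 + 6^2, from d <= 6; both ends together give 84.\<close>
  have *: "\<bar>midpt N i - x\<bar> \<le> 42 * rho N (midpt N i)" if x: "x \<in> {node N (Suc i)..node N (i - 1)}" for x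
  proof -
    define d where "d = adist N (midpt N i) x"
    have d: "0 \<le> d" "d \<le> 6" using big_cell_props(2)[OF N i x] by (auto simp: d_def)
    have "\<bar>midpt N i - x\<bar> \<le> (d + d\<^sup>2) * rho N (midpt N i)"
      unfolding d_def by (rule dist_le_adist[OF N m big_cell_props(1)[OF N i x]])
    also have "\<dots> \<le> 42 * rho N (midpt N i)"
    proof (intro mult_right_mono)
      have "d\<^sup>2 \<le> 6\<^sup>2" using d by (intro power_mono)
      thus "d + d\<^sup>2 \<le> 42" using d by simp
    qed (use r in simp)
    finally show ?thesis .
  qed
  have "\<bar>midpt N i - node N (i - 1)\<bar> \<le> 42 * rho N (midpt N i)" "\<bar>midpt N i - node N (Suc i)\<bar> \<le> 42 * rho N (midpt N i)"
    by (rule *, use mono in simp)+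
  thus ?thesis by linarith
qed

lemma cell_cover:
  assumes N: "1 \<le> N" and x: "x \<in> {-1..1}"
  shows "\<exists>j<N. x \<in> {node N (Suc j)..node N j}"
proof -
  have N0: "0 < real N" using N by simp
  define t where "t = real N * arccos x / pi"
  have ax: "0 \<le> arccos x" "arccos x \<le> pi" "cos (arccos x) = x" using x by (auto simp: arccos_lbound arccos_ubound)
  have t: "0 \<le> t" "t \<le> real N" using ax N0 by (auto simp: t_def field_simps mult_left_mono)
  have xt: "x = cos (t * pi / real N)" using N0 ax by (simp add: t_def)
  \<comment> \<open>The point -1 corresponds to t = N and is assigned to the last cell.\<close>
  define j where "j = (if t = real N then N - 1 else nat \<lfloor>t\<rfloor>)"
  have j: "j < N" "real j \<le> t" "t \<le> real (Suc j)"
  proof -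
    have "real (nat \<lfloor>t\<rfloor>) \<le> t" "t \<le> real (Suc (nat \<lfloor>t\<rfloor>))" using t by (simp_all add: le_of_int_ceiling) linarith
    moreover have "nat \<lfloor>t\<rfloor> < N" if "t \<noteq> real N" using t that \<open>real (nat \<lfloor>t\<rfloor>) \<le> t\<close>
        by (metis linorder_not_less of_nat_le_iff order.antisym order.trans)
    ultimately show "j < N" "real j \<le> t" "t \<le> real (Suc j)" using N by (auto simp: j_def)
  qed
  have "real (Suc j) * pi \<le> real N * pi" using j by (intro mult_right_mono) auto
  hence "real (Suc j) * pi / real N \<le> pi" using N0 by (simp add: field_simps)
  moreover have "real j * pi / real N \<le> t * pi / real N" "t * pi / real N \<le> real (Suc j) * pi / real N"
    using j N0 by (auto intro!: divide_right_mono mult_right_mono)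
  moreover have "0 \<le> real j * pi / real N" by simp
  ultimately have "cos (real (Suc j) * pi / real N) \<le> cos (t * pi / real N)" "cos (t * pi / real N)
      \<le> cos (real j * pi / real N)"
    by (intro cos_monotone_0_pi_le; linarith)+
  thus ?thesis using j by (auto simp: node_def xt)
qed

lemma big_cell_overlap:
  assumes N: "1 \<le> N"
  shows "(\<Sum>i<N. indicator {node N (Suc i)..node N (i - 1)} x :: ennreal) \<le> 5"
proof (cases "x \<in> {-1..1}")
  case False
  have "indicator {node N (Suc i)..node N (i - 1)} x = (0 :: ennreal)" if "i < N" for i
    using False big_cell_props(1)[OF N that, of x] by (auto simp: indicator_def)
  thus ?thesis by simp
next
  case True
  then obtain j where j: "j < N" "x \<in> {node N (Suc j)..node N j}" using cell_cover[OF N] by blast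
  have N0: "0 < real N" using N by simp
  define A where "A = {i. i < N \<and> x \<in> {node N (Suc i)..node N (i - 1)}}"
  have "A \<subseteq> {j - 2..j + 2}"
  proof
    fix i assume "i \<in> A"
    hence i: "i < N" "x \<in> {node N (Suc i)..node N (i - 1)}" by (auto simp: A_def)
    have "(real i - 1) * pi / real N \<le> real (Suc j) * pi / real N"
      using big_cell_props(3)[OF N i] cell_props(3)[OF N j] by linarith
    hence "real i - 1 \<le> real (Suc j)" using N0 by (simp add: divide_le_cancel)
    moreover have "real j * pi / real N \<le> real (Suc i) * pi / real N"
      using big_cell_props(4)[OF N i] cell_props(2)[OF N j] by linarith
    hence "real j \<le> real (Suc i)" using N0 by (simp add: divide_le_cancel del: of_nat_Suc)
    ultimately show "i \<in> {j - 2..j + 2}" by auto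
  qed
  hence "card A \<le> card {j - 2..j + 2}" by (intro card_mono) auto
  hence cA: "card A \<le> 5" by simp
  have "(\<Sum>i<N. indicator {node N (Suc i)..node N (i - 1)} x :: ennreal) = (\<Sum>i\<in>{..<N}. if i \<in> A then 1 else 0)"
    by (intro sum.cong refl) (auto simp: A_def indicator_def)
  also have "\<dots> = of_nat (card A)"
    by (subst sum.inter_restrict[symmetric]) (auto simp: A_def Int_def intro!: arg_cong[where f = card])
  also have "\<dots> \<le> of_nat 5" using cA by (intro of_nat_mono)
  finally show ?thesis by simp
qed

section \<open>Oscillation on cells, bounded by symmetric differences\<close>

definition osc :: "real \<Rightarrow> nat \<Rightarrow> real \<Rightarrow> real \<Rightarrow> real \<Rightarrow> (real \<Rightarrow> real) \<Rightarrow> ennreal" where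
  "osc p r \<sigma> a l f = (\<integral>\<^sup>+u. lp_int p {a..a + l - real r * u} (fdiff r u f)
     * indicator {0<..<\<sigma> * l} u \<partial>lborel)"

text \<open>Away from the endpoints rho_N is at most 2 phi(x)/N and the claim is immediate. Near
  them rho_N is of order 1/N^2, and the domain condition supplies u <= 2 phi(x)^2; multiplying it
  with u <= 1/(2 N^2) gives the square of the claim.\<close>

lemma step_le_phi:
  assumes N: "1 \<le> N" and r: "1 \<le> r" and x: "\<bar>x\<bar> < 1" and u: "0 < u"
    and le: "u \<le> 1 / 4 * rho N x" and dom: "x - real r * u / 2 \<in> {-1..1}" "x + real r * u / 2 \<in> {-1..1}"
  shows "u \<le> phi x / real N"
proof -
  have N0: "0 < real N" using N by simp
  have ph: "0 < phi x" using x by (rule phi_pos)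
  have rho: "rho N x = phi x / real N + 1 / (real N)\<^sup>2" by (simp add: rho_def phi_def)
  show ?thesis
  proof (cases "1 / real N \<le> phi x")
    case True
    have "1 / (real N)\<^sup>2 = 1 / real N * (1 / real N)" by (simp add: power2_eq_square)
    also have "\<dots> \<le> phi x * (1 / real N)" using True N0 by (intro mult_right_mono) auto
    finally have "rho N x \<le> 2 * (phi x / real N)" unfolding rho by simp
    moreover have "0 \<le> phi x / real N" using ph by simp
    ultimately show ?thesis using le by linarith
  next
    case False
    have "1 * u \<le> real r * u" using r u by (intro mult_right_mono) auto
    hence "u / 2 \<le> 1 - \<bar>x\<bar>" using dom by (auto simp: abs_if)
    moreover have "(1 - \<bar>x\<bar>) * 1 \<le> (1 - \<bar>x\<bar>) * (1 + \<bar>x\<bar>)" using x by (intro mult_left_mono) auto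
    moreover have "(1 - \<bar>x\<bar>) * (1 + \<bar>x\<bar>) = (phi x)\<^sup>2"
      using abs_square_less_1[of x] x by (simp add: phi_def algebra_simps power2_eq_square)
    ultimately have "1 - \<bar>x\<bar> \<le> (phi x)\<^sup>2" "u / 2 \<le> 1 - \<bar>x\<bar>" by (simp_all only: mult_1_right)
    hence u1: "u \<le> 2 * (phi x)\<^sup>2" by linarith
    have "phi x / real N \<le> 1 / real N * (1 / real N)"
      using False N0 mult_right_mono[of "phi x" "1 / real N" "1 / real N"] by simp
    hence "rho N x \<le> 2 * (1 / (real N)\<^sup>2)" unfolding rho by (simp add: power2_eq_square)
    hence u2: "u \<le> 1 / 2 * (1 / (real N)\<^sup>2)" using le by linarith
    have "u * u \<le> (2 * (phi x)\<^sup>2) * (1 / 2 * (1 / (real N)\<^sup>2))"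
      using u u1 u2 by (intro mult_mono) auto
    also have "\<dots> = (phi x / real N)\<^sup>2" by (simp add: power_divide)
    finally have "u\<^sup>2 \<le> (phi x / real N)\<^sup>2" by (simp add: power2_eq_square)
    thus ?thesis by (rule power2_le_imp_le) (use ph in simp)
  qed
qed

context doubling_measure
begin

lemma aw_big_cell:
  assumes N: "2 \<le> N" and i: "i < N" and x: "x \<in> {node N (Suc i)..node N (i - 1)}"
  shows "aw N (midpt N i) \<le> 3 ^ s * 7 ^ (2 * s + 1) * aw N x" "aw N x \<le> 3 ^ s * 7 ^ (2 * s + 1) * aw N (midpt N i)"
    "rho N (midpt N i) \<le> 7 * rho N x"
proof -
  have N1: "1 \<le> N" using N by simp
  have m: "midpt N i \<in> {-1..1}" by (rule midpt_props[OF N1 i])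
  note x1 = big_cell_props(1)[OF N1 i x]
  have d: "1 + adist N (midpt N i) x \<le> 7" using big_cell_props(2)[OF N1 i x] by simp
  have pw: "(1 + adist N (midpt N i) x) ^ (2 * s + 1) \<le> 7 ^ (2 * s + 1)"
    by (rule power_mono[OF d]) simp
  have "aw N (midpt N i) \<le> 3 ^ s * (1 + adist N x (midpt N i)) ^ (2 * s + 1) * aw N x" by (rule aw_le[OF N x1 m])
  also have "\<dots> \<le> 3 ^ s * 7 ^ (2 * s + 1) * aw N x"
    using pw aw_nonneg[OF N1 x1] by (intro mult_right_mono mult_left_mono) (auto simp: adist_commute)
  finally show "aw N (midpt N i) \<le> 3 ^ s * 7 ^ (2 * s + 1) * aw N x" .
  have "aw N x \<le> 3 ^ s * (1 + adist N (midpt N i) x) ^ (2 * s + 1) * aw N (midpt N i)" by (rule aw_le[OF N m x1])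
  also have "\<dots> \<le> 3 ^ s * 7 ^ (2 * s + 1) * aw N (midpt N i)"
    using pw aw_nonneg[OF N1 m] by (intro mult_right_mono mult_left_mono) auto
  finally show "aw N x \<le> 3 ^ s * 7 ^ (2 * s + 1) * aw N (midpt N i)" .
  have "rho N (midpt N i) \<le> (1 + adist N x (midpt N i)) * rho N x" by (rule rho_le_adist[OF N1 x1 m])
  also have "\<dots> \<le> 7 * rho N x" using d rho_pos[OF N1 x1] by (intro mult_right_mono) (auto simp: adist_commute)
  finally show "rho N (midpt N i) \<le> 7 * rho N x" .
qed

text \<open>A cell of length $l$ satisfies $l \le 84 \cdot 7\,\rho_N(x)$ for each of its points $x$. So steps
  up to $l/2352$ are at most $\rho_N(x)/4$, as needed to write them as $h\varphi(x)$ with $h \le 1/N$.\<close>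

lemma osc_cell_le:
  fixes f :: "real \<Rightarrow> real"
  assumes N: "2 \<le> N" and i: "i < N" and r: "1 \<le> r" and [measurable]: "f \<in> borel_measurable borel"
  defines "a \<equiv> node N (Suc i)" and "l \<equiv> node N (i - 1) - node N (Suc i)"
  shows "ennreal (aw N (midpt N i) / l) * osc p r (1 / 2352) a l f \<le>
     ennreal (7 * real N * (3 ^ s * 7 ^ (2 * s + 1))) *
     (\<integral>\<^sup>+h. (\<integral>\<^sup>+x. ennreal (\<bar>sym_diff r (h * phi x) f x\<bar> powr p * aw N x) * indicator {a..a
         + l} x * indicator {-1..1} x \<partial>lborel) * indicator {0<..1 / real N} h \<partial>lborel)"
proof -
  have N1: "1 \<le> N" and N0: "0 < real N" using N by auto
  have al: "a + l = node N (i - 1)" by (simp add: a_def l_def)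
  have m: "midpt N i \<in> {-1..1}" by (rule midpt_props[OF N1 i])
  have rm: "0 < rho N (midpt N i)" by (rule rho_pos[OF N1 m])
  have "rho N (midpt N i) \<le> node N i - node N (Suc i)" by (rule cell_length_ge[OF N1 i])
  also have "\<dots> \<le> l" unfolding l_def using node_mono[OF N1, of "i - 1" i] i by simp
  finally have l1: "rho N (midpt N i) \<le> l" .
  hence l0: "0 < l" using rm by linarith
  have l2: "l \<le> 84 * rho N (midpt N i)" unfolding l_def by (rule big_cell_length_le[OF N1 i])
  define D where "D = (3::real) ^ s * 7 ^ (2 * s + 1)"
  have D0: "0 \<le> D" by (simp add: D_def)
  \<comment> \<open>The base point is moved by r u / 2, so that x becomes the centre of the
    difference, as in \<open>sym_diff\<close>.\<close>
  define K where "K u x = ennreal (\<bar>fdiff r u f (x - real r * u / 2)\<bar> powr p) * indicator {a..a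
      + l - real r * u} (x - real r * u / 2) * indicator {0<..<1 / 2352 * l} u" for u x
  have K_borel [measurable]: "case_prod K \<in> borel_measurable (borel \<Otimes>\<^sub>M borel)"
    unfolding K_def case_prod_beta' by measurable
  define S where "S h x = ennreal (\<bar>sym_diff r (h * phi x) f x\<bar> powr p * aw N x) * indicator {a..a
      + l} x * indicator {-1..1} x * indicator {0<..1 / real N} h" for h x
  have [measurable]: "case_prod S \<in> borel_measurable (borel \<Otimes>\<^sub>M borel)"
    unfolding S_def case_prod_beta' sym_diff_def by measurable
  have "osc p r (1 / 2352) a l f = (\<integral>\<^sup>+u. (\<integral>\<^sup>+x. K u x \<partial>lborel) \<partial>lborel)"
    unfolding osc_def
  proof (rule nn_integral_cong)
    fix u :: real
    have "lp_int p {a..a + l - real r * u} (fdiff r u f)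
       = (\<integral>\<^sup>+x. ennreal (\<bar>fdiff r u f (x - real r * u / 2)\<bar> powr p) * indicator {a..a
           + l - real r * u} (x - real r * u / 2) \<partial>lborel)"
      by (subst nn_integral_real_affine[where c = 1 and t = "- (real r * u / 2)"]) auto
    thus "lp_int p {a..a + l - real r * u} (fdiff r u f) * indicator {0<..<1 / 2352 * l} u
       = (\<integral>\<^sup>+x. K u x \<partial>lborel)"
      unfolding K_def by (subst nn_integral_multc) auto
  qed
  also have "\<dots> = (\<integral>\<^sup>+x. (\<integral>\<^sup>+u. K u x \<partial>lborel) \<partial>lborel)"
    by (rule lborel_pair.Fubini'[symmetric]) measurable
  finally have "ennreal (aw N (midpt N i) / l) * osc p r (1 / 2352) a l f
      = (\<integral>\<^sup>+x. ennreal (aw N (midpt N i) / l) * (\<integral>\<^sup>+u. K u x \<partial>lborel) \<partial>lborel)"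
    by (subst nn_integral_cmult) auto
  also have "\<dots> \<le> (\<integral>\<^sup>+x. ennreal (7 * real N * D) * (\<integral>\<^sup>+h. S h x \<partial>lborel) \<partial>lborel)"
  proof (rule nn_integral_mono)
    fix x :: real
    have dom: "x - real r * u / 2 \<in> {node N (Suc i)..node N (i - 1)}" "x
        + real r * u / 2 \<in> {node N (Suc i)..node N (i - 1)}"
      if "K u x \<noteq> 0" for u
    proof -
      have "0 < u" "x - real r * u / 2 \<in> {a..a + l - real r * u}"
        using that by (auto simp: K_def indicator_def split: if_splits)
      moreover from this have "0 \<le> real r * u" by simp
      ultimately show "x - real r * u / 2 \<in> {node N (Suc i)..node N (i - 1)}" "x
          + real r * u / 2 \<in> {node N (Suc i)..node N (i - 1)}"
        unfolding al[symmetric] a_def[symmetric] atLeastAtMost_iff by linarith+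
    qed
    have dom1: "x - real r * u / 2 \<in> {-1..1}" "x + real r * u / 2 \<in> {-1..1}" "0 < u" "\<bar>x\<bar> < 1" "x \<in> {node N (Suc
        i)..node N (i - 1)}"
      if K: "K u x \<noteq> 0" for u
    proof -
      show 1: "x - real r * u / 2 \<in> {-1..1}" "x + real r * u / 2 \<in> {-1..1}"
        using big_cell_props(1)[OF N1 i] dom[OF K] by blast+
      show u: "0 < u" using K by (auto simp: K_def indicator_def split: if_splits)
      have "0 < real r * u" using u r by simp
      thus "\<bar>x\<bar> < 1" "x \<in> {node N (Suc i)..node N (i - 1)}" using 1 dom[OF K] unfolding atLeastAtMost_iff by linarith+
    qed
    show "ennreal (aw N (midpt N i) / l) * (\<integral>\<^sup>+u. K u x \<partial>lborel) \<le> ennreal (7 * real N * D) * (\<integral>\<^sup>+h. S h x \<partial>lborel)"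
    proof (cases "\<bar>x\<bar> < 1 \<and> x \<in> {node N (Suc i)..node N (i - 1)}")
      case False
      hence "K u x = 0" for u using dom1[of u] by blast
      thus ?thesis by simp
    next
      case True
      hence x: "\<bar>x\<bar> < 1" and xc: "x \<in> {node N (Suc i)..node N (i - 1)}" by auto
      have x1: "x \<in> {-1..1}" using x by auto
      have ph: "0 < phi x" using x by (rule phi_pos)
      have ax: "0 \<le> aw N x" "0 \<le> aw N (midpt N i)" using aw_nonneg[OF N1] x1 m by auto
      have rx: "rho N x \<le> 7 * rho N (midpt N i)"
      proof -
        have "rho N x \<le> (1 + adist N (midpt N i) x) * rho N (midpt N i)" by (rule rho_le_adist[OF N1 m x1])
        also have "\<dots> \<le> 7 * rho N (midpt N i)"
          using big_cell_props(2)[OF N1 i xc] rm by (intro mult_right_mono) auto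
        finally show ?thesis .
      qed
      \<comment> \<open>Pays for the Jacobian of u = h phi(x): phi(x) <= N rho_N(x) <= 7 N l, so
        division by the cell length l leaves a factor of order N, the reciprocal of the range of
        h.\<close>
      have coef: "aw N (midpt N i) / l * phi x \<le> 7 * real N * D * aw N x"
      proof -
        have "phi x / real N \<le> rho N x" using N1 by (rule phi_le_rho)
        hence "phi x / real N \<le> 7 * l" using rx l1 by linarith
        hence "phi x \<le> 7 * real N * l" using N0 by (simp add: field_simps)
        hence "phi x / l \<le> 7 * real N" using l0 by (simp add: field_simps)
        hence "aw N (midpt N i) * (phi x / l) \<le> (D * aw N x) * (7 * real N)"
          using aw_big_cell(1)[OF N i xc] ax D0 ph l0 unfolding D_def[symmetric] by (intro mult_mono) auto
        thus ?thesis by (simp add: mult_ac)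
      qed
      have Kx: "(\<lambda>u. K u x) \<in> borel_measurable borel"
        unfolding K_def by measurable
      have Sx: "(\<lambda>h. S h x) \<in> borel_measurable borel"
        unfolding S_def sym_diff_def by measurable
      have "(\<integral>\<^sup>+u. K u x \<partial>lborel) = ennreal (phi x) * (\<integral>\<^sup>+h. K (h * phi x) x \<partial>lborel)"
        using nn_integral_real_affine[OF Kx, of "phi x" 0] ph by (simp add: mult.commute)
      moreover have "ennreal (aw N (midpt N i) / l * phi x) = ennreal (aw N (midpt N i) / l) * ennreal (phi x)"
        by (rule ennreal_mult) (use ax l0 ph in auto)
      ultimately have "ennreal (aw N (midpt N i) / l) * (\<integral>\<^sup>+u. K u x \<partial>lborel)
          = ennreal (aw N (midpt N i) / l * phi x) * (\<integral>\<^sup>+h. K (h * phi x) x \<partial>lborel)"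
        by (simp only: mult.assoc)
      also have "\<dots> = (\<integral>\<^sup>+h. ennreal (aw N (midpt N i) / l * phi x) * K (h * phi x) x \<partial>lborel)"
        by (rule nn_integral_cmult[symmetric]) measurable
      also have "\<dots> \<le> (\<integral>\<^sup>+h. ennreal (7 * real N * D) * S h x \<partial>lborel)"
      proof (rule nn_integral_mono)
        fix h :: real
        show "ennreal (aw N (midpt N i) / l * phi x) * K (h * phi x) x \<le> ennreal (7 * real N * D) * S h x"
        proof (cases "K (h * phi x) x = 0")
          case False
          note d = dom1[OF False]
          have "h * phi x < 1 / 2352 * l" using False by (auto simp: K_def indicator_def split: if_splits)
          also have "\<dots> \<le> 1 / 4 * rho N x" using l2 aw_big_cell(3)[OF N i xc] by simp
          finally have "h * phi x \<le> phi x / real N" using d x N1 r by (intro step_le_phi) auto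
          hence h: "0 < h" "h \<le> 1 / real N" using d(3) ph N0 by (auto simp: field_simps zero_less_mult_iff)
          have "K (h * phi x) x \<le> ennreal (\<bar>fdiff r (h * phi x) f (x - real r * (h * phi x) / 2)\<bar> powr p)"
            by (auto simp: K_def indicator_def)
          also have "\<bar>fdiff r (h * phi x) f (x - real r * (h * phi x) / 2)\<bar> = \<bar>sym_diff r (h * phi x) f x\<bar>"
            using d by (intro sym_diff_fdiff[symmetric]) auto
          finally have Kle: "K (h * phi x) x \<le> ennreal (\<bar>sym_diff r (h * phi x) f x\<bar> powr p)" .
          have "ennreal (aw N (midpt N i) / l * phi x) * K (h * phi x) x
              \<le> ennreal (7 * real N * D * aw N x) * ennreal (\<bar>sym_diff r (h * phi x) f x\<bar> powr p)"
            by (rule mult_mono[OF ennreal_leI[OF coef] Kle]) auto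
          also have "\<dots> = ennreal (7 * real N * D) * ennreal (\<bar>sym_diff r (h * phi x) f x\<bar> powr p * aw N x)"
            using ax D0 by (simp add: ennreal_mult[symmetric] mult_ac)
          finally have fin: "ennreal (aw N (midpt N i) / l * phi x) * K (h * phi x) x
              \<le> ennreal (7 * real N * D) * ennreal (\<bar>sym_diff r (h * phi x) f x\<bar> powr p * aw N x)" .
          have "x \<in> {a..a + l}" using xc unfolding al unfolding a_def .
          hence "ennreal (7 * real N * D) * ennreal (\<bar>sym_diff r (h * phi x) f x\<bar> powr p * aw N x)
              = ennreal (7 * real N * D) * S h x"
            using h x1 by (simp add: S_def)
          thus ?thesis using fin by simp
        qed simp
      qed
      also have "\<dots> = ennreal (7 * real N * D) * (\<integral>\<^sup>+h. S h x \<partial>lborel)"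
        by (rule nn_integral_cmult) (use Sx in simp)
      finally show ?thesis .
    qed
  qed
  also have "\<dots> = ennreal (7 * real N * D) * (\<integral>\<^sup>+x. (\<integral>\<^sup>+h. S h x \<partial>lborel) \<partial>lborel)"
    by (rule nn_integral_cmult) measurable
  also have "(\<integral>\<^sup>+x. (\<integral>\<^sup>+h. S h x \<partial>lborel) \<partial>lborel) = (\<integral>\<^sup>+h. (\<integral>\<^sup>+x. S h x \<partial>lborel) \<partial>lborel)"
    by (rule lborel_pair.Fubini') measurable
  also have "\<dots> = (\<integral>\<^sup>+h. (\<integral>\<^sup>+x. ennreal (\<bar>sym_diff r (h * phi x) f x\<bar> powr p * aw N x) * indicator {a..a
      + l} x * indicator {-1..1} x \<partial>lborel) * indicator {0<..1 / real N} h \<partial>lborel)"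
  proof (rule nn_integral_cong)
    fix h :: real
    have [measurable]: "(\<lambda>x. sym_diff r (h * phi x) f x) \<in> borel_measurable borel" by (rule sym_diff_borel) measurable
    show "(\<integral>\<^sup>+x. S h x \<partial>lborel) = (\<integral>\<^sup>+x. ennreal (\<bar>sym_diff r (h * phi x) f x\<bar> powr p * aw N x)
        * indicator {a..a + l} x * indicator {-1..1} x \<partial>lborel) * indicator {0<..1 / real N} h"
      unfolding S_def by (rule nn_integral_multc) measurable
  qed
  finally show ?thesis by (simp add: D_def)
qed

text \<open>The enlarged cells overlap at most five times, and the factor N of
  \<open>osc_cell_le\<close> cancels against the length 1/N of the range of h. Hence 35 = 7 *
  5.\<close>

lemma osc_sum_le:
  fixes f :: "real \<Rightarrow> real"
  assumes N: "2 \<le> N" and r: "1 \<le> r" and f[measurable]: "f \<in> borel_measurable borel"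
    and \<Omega>: "\<And>h. 0 < h \<Longrightarrow> h \<le> 1 / real N \<Longrightarrow> wint p N (\<lambda>x. sym_diff r (h * phi x) f x) \<le> ennreal \<Omega>" "0 \<le> \<Omega>"
  shows "(\<Sum>i<N. ennreal (aw N (midpt N i) / (node N (i - 1) - node N (Suc i))) *
            osc p r (1 / 2352) (node N (Suc i)) (node N (i - 1) - node N (Suc i)) f)
     \<le> ennreal (35 * (3 ^ s * 7 ^ (2 * s + 1)) * \<Omega>)"
proof -
  have N1: "1 \<le> N" and N0: "0 < real N" using N by auto
  define D where "D = (3::real) ^ s * 7 ^ (2 * s + 1)"
  have D0: "0 \<le> D" by (simp add: D_def)
  define g where "g h x = ennreal (\<bar>sym_diff r (h * phi x) f x\<bar> powr p * aw N x)" for h x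
  have gx[measurable]: "(\<lambda>x. g h x) \<in> borel_measurable borel" for h
  proof -
    have [measurable]: "(\<lambda>x. sym_diff r (h * phi x) f x) \<in> borel_measurable borel" by (rule sym_diff_borel) measurable
    show ?thesis unfolding g_def by measurable
  qed
  have [measurable]: "(\<lambda>(h, x). g h x) \<in> borel_measurable (borel \<Otimes>\<^sub>M borel)"
    unfolding g_def case_prod_beta' sym_diff_def by measurable
  define c where "c i = {node N (Suc i)..node N (i - 1)}" for i
  have "(\<Sum>i<N. ennreal (aw N (midpt N i) / (node N (i - 1) - node N (Suc i))) *
            osc p r (1 / 2352) (node N (Suc i)) (node N (i - 1) - node N (Suc i)) f)
    \<le> (\<Sum>i<N. ennreal (7 * real N * D) * (\<integral>\<^sup>+h. (\<integral>\<^sup>+x. g h x * indicator (c i) x * indicator {-1..1} x \<partial>lborel)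
        * indicator {0<..1 / real N} h \<partial>lborel))"
  proof (rule sum_mono)
    fix i assume "i \<in> {..<N}"
    hence "i < N" by simp
    from osc_cell_le[OF N this r f, of p]
    show "ennreal (aw N (midpt N i) / (node N (i - 1) - node N (Suc i))) *
            osc p r (1 / 2352) (node N (Suc i)) (node N (i - 1) - node N (Suc i)) f
      \<le> ennreal (7 * real N * D) * (\<integral>\<^sup>+h. (\<integral>\<^sup>+x. g h x * indicator (c i) x * indicator {-1..1} x \<partial>lborel)
          * indicator {0<..1 / real N} h \<partial>lborel)"
      by (simp add: D_def g_def c_def)
  qed
  also have "\<dots> = ennreal (7 * real N * D) * (\<integral>\<^sup>+h. (\<Sum>i<N. (\<integral>\<^sup>+x.
      g h x * indicator (c i) x * indicator {-1..1} x \<partial>lborel) * indicator {0<..1 / real N} h) \<partial>lborel)"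
    unfolding sum_distrib_left[symmetric] c_def by (subst nn_integral_sum) auto
  also have "\<dots> \<le> ennreal (7 * real N * D) * (\<integral>\<^sup>+h. ennreal (5 * \<Omega>) * indicator {0<..1 / real N} h \<partial>lborel)"
  proof (intro mult_left_mono nn_integral_mono)
    fix h :: real
    show "(\<Sum>i<N. (\<integral>\<^sup>+x. g h x * indicator (c i) x * indicator {-1..1} x \<partial>lborel) * indicator {0<..1 / real N} h)
        \<le> ennreal (5 * \<Omega>) * indicator {0<..1 / real N} h"
    proof (cases "h \<in> {0<..1 / real N}")
      case True
      have "(\<Sum>i<N. (\<integral>\<^sup>+x. g h x * indicator (c i) x * indicator {-1..1} x \<partial>lborel))
          = (\<integral>\<^sup>+x. (\<Sum>i<N. g h x * indicator (c i) x * indicator {-1..1} x) \<partial>lborel)"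
        unfolding c_def by (rule nn_integral_sum[symmetric]) measurable
      also have "\<dots> \<le> (\<integral>\<^sup>+x. 5 * (g h x * indicator {-1..1} x) \<partial>lborel)"
      proof (rule nn_integral_mono)
        fix x :: real
        have "(\<Sum>i<N. g h x * indicator (c i) x * indicator {-1..1} x)
            = (\<Sum>i<N. indicator (c i) x) * (g h x * indicator {-1..1} x)"
          unfolding sum_distrib_right by (intro sum.cong refl) (simp only: mult_ac)
        also have "\<dots> \<le> 5 * (g h x * indicator {-1..1} x)"
          unfolding c_def by (intro mult_right_mono big_cell_overlap[OF N1]) auto
        finally show "(\<Sum>i<N. g h x * indicator (c i) x * indicator {-1..1} x) \<le> 5 * (g h x * indicator {-1..1} x)" .
      qed
      also have "\<dots> = 5 * wint p N (\<lambda>x. sym_diff r (h * phi x) f x)"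
        unfolding wint_def g_def[symmetric] by (rule nn_integral_cmult) measurable
      also have "\<dots> \<le> 5 * ennreal \<Omega>" using True by (intro mult_left_mono \<Omega>) auto
      also have "\<dots> = ennreal (5 * \<Omega>)" using \<Omega> by (simp add: ennreal_mult)
      finally show ?thesis using True by simp
    qed simp
  qed auto
  also have "(\<integral>\<^sup>+h. ennreal (5 * \<Omega>) * indicator {0<..1 / real N} h \<partial>lborel) = ennreal (5 * \<Omega>) * ennreal (1 / real N)"
    by (subst nn_integral_cmult_indicator) auto
  also have "ennreal (7 * real N * D) * (ennreal (5 * \<Omega>) * ennreal (1 / real N))
      = ennreal (7 * real N * D * (5 * \<Omega> * (1 / real N)))"
    using D0 \<Omega> by (simp only: ennreal_mult'[symmetric] mult_nonneg_nonneg of_nat_0_le_iff zero_le_numeral)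
  also have "7 * real N * D * (5 * \<Omega> * (1 / real N)) = 35 * D * \<Omega>" using N0 by simp
  finally show ?thesis by (simp add: D_def)
qed

end

section \<open>Growth, comparison and gluing of local polynomials\<close>

lemma poly_growth:
  fixes q :: "real poly"
  assumes r: "1 \<le> r" and deg: "degree q < r" and p: "1 < p" and l: "0 < l" and A: "0 \<le> A"
    and int: "lp_int p {c..c + l} (poly q) \<le> ennreal (l * A powr p)"
  shows "\<bar>poly q x\<bar> \<le> 2 * (real r)\<^sup>2 * (2 * real r) ^ r * (1 + \<bar>x - c\<bar> / l) ^ r * A"
proof -
  have r0: "0 < real r" "1 \<le> real r" using r by simp_all
  \<comment> \<open>{c..c + l} is cut into 2 r pieces of length d and every second one is used, so
    points of different pieces are at least d apart.\<close>
  define d where "d = l / (2 * real r)"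
  have d: "0 < d" using l r0 by (simp add: d_def)
  define J where "J k = {c + 2 * real k * d..c + (2 * real k + 1) * d}" for k :: nat
  have Jsub: "J k \<subseteq> {c..c + l}" if "k < r" for k
  proof -
    have "(2 * real k + 1) * d \<le> (2 * real r) * d" using that d by (intro mult_right_mono) auto
    also have "\<dots> = l" using r0 by (simp add: d_def)
    finally show ?thesis using d by (auto simp: J_def intro: order.trans[of _ "c + 2 * real k * d"])
  qed
  \<comment> \<open>The minimum of the modulus over the piece obeys the averaged bound: its p-th
    power times d is at most l A^p, where l = 2 r d, and (2 r)^(1/p) <= 2 r.\<close>
  have "\<exists>z\<in>J k. \<bar>poly q z\<bar> \<le> 2 * real r * A" if k: "k < r" for k
  proof -
    have cont: "continuous_on (J k) (\<lambda>x. \<bar>poly q x\<bar>)" by (intro continuous_intros)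
    have ne: "J k \<noteq> {}" using d by (auto simp: J_def)
    have comp: "compact (J k)" by (simp add: J_def)
    obtain z where z: "z \<in> J k" "\<And>y. y \<in> J k \<Longrightarrow> \<bar>poly q z\<bar> \<le> \<bar>poly q y\<bar>"
      using continuous_attains_inf[OF comp ne cont] by blast
    have "ennreal (\<bar>poly q z\<bar> powr p * d) = ennreal (\<bar>poly q z\<bar> powr p) * emeasure lborel (J k)"
      using d by (simp add: J_def ennreal_mult algebra_simps)
    also have "\<dots> = (\<integral>\<^sup>+x. ennreal (\<bar>poly q z\<bar> powr p) * indicator (J k) x \<partial>lborel)"
      by (rule nn_integral_cmult_indicator[symmetric]) (simp add: J_def)
    also have "\<dots> \<le> lp_int p {c..c + l} (poly q)"
    proof (rule nn_integral_mono)
      fix y :: real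
      show "ennreal (\<bar>poly q z\<bar> powr p) * indicator (J k) y \<le> ennreal (\<bar>poly q y\<bar> powr p) * indicator {c..c + l} y"
      proof (cases "y \<in> J k")
        case True
        moreover from this have "y \<in> {c..c + l}" using Jsub[OF k] by blast
        moreover have "\<bar>poly q z\<bar> powr p \<le> \<bar>poly q y\<bar> powr p" using z(2)[OF True] p by (intro powr_mono2) auto
        ultimately show ?thesis by (simp add: ennreal_leI)
      qed simp
    qed
    also note int
    finally have "\<bar>poly q z\<bar> powr p * d \<le> l * A powr p" using l by (subst (asm) ennreal_le_iff) auto
    also have "l = 2 * real r * d" using r0 by (simp add: d_def)
    finally have "\<bar>poly q z\<bar> powr p * d \<le> (2 * real r * A powr p) * d" by (simp add: mult_ac)
    hence "\<bar>poly q z\<bar> powr p \<le> 2 * real r * A powr p" using d by (rule mult_right_le_imp_le)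
    also have "\<dots> \<le> (2 * real r) powr p * A powr p"
    proof (intro mult_right_mono)
      have "(2 * real r) powr 1 \<le> (2 * real r) powr p" using r0 p by (intro powr_mono) auto
      thus "2 * real r \<le> (2 * real r) powr p" using r0 by simp
    qed simp
    also have "\<dots> = (2 * real r * A) powr p" using A r0 by (simp add: powr_mult)
    finally have "\<bar>poly q z\<bar> \<le> 2 * real r * A"
      using p A r0 powr_less_mono2[of p "2 * real r * A" "\<bar>poly q z\<bar>"] by force
    thus ?thesis using z by blast
  qed
  then obtain z where z: "\<And>k. k < r \<Longrightarrow> z k \<in> J k" "\<And>k. k < r \<Longrightarrow> \<bar>poly q (z k)\<bar> \<le> 2 * real r * A" by metis
  have sep1: "d \<le> z j - z i" if "i < j" "i < r" "j < r" for i j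
  proof -
    have "real i + 1 \<le> real j" using that by simp
    hence "(2 * real i + 2) * d \<le> 2 * real j * d" using d by (intro mult_right_mono) auto
    thus ?thesis using z(1)[of i] z(1)[of j] that by (auto simp: J_def algebra_simps)
  qed
  have sep: "d \<le> \<bar>z i - z j\<bar>" if "i < r" "j < r" "i \<noteq> j" for i j
    using sep1[of i j] sep1[of j i] that by (cases "i < j") auto
  define y where "y = 1 + \<bar>x - c\<bar> / l"
  have y: "1 \<le> y" using l by (simp add: y_def)
  have fac: "\<bar>x - z j\<bar> / d \<le> 2 * real r * y" if "j < r" for j
  proof -
    have "z j \<in> {c..c + l}" using z(1)[OF that] Jsub[OF that] by blast
    hence "\<bar>x - z j\<bar> \<le> \<bar>x - c\<bar> + l" by auto
    also have "\<dots> = l * y" using l by (simp add: y_def distrib_left)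
    also have "\<dots> = (2 * real r * y) * d" using r0 by (simp add: d_def)
    finally show ?thesis using d by (simp add: pos_divide_le_eq)
  qed
  have "1 \<le> 2 * real r * y"
  proof -
    have "1 * 1 \<le> (2 * real r) * y" using r0 y by (intro mult_mono) auto
    thus ?thesis by simp
  qed
  note ry = this
  have "\<bar>poly q x\<bar> \<le> (\<Sum>i<r. \<bar>poly q (z i)\<bar> * (\<Prod>j\<in>{..<r} - {i}. \<bar>x - z j\<bar> / d))"
    by (rule poly_bound_from_nodes(1)[OF deg sep d])
  also have "\<dots> \<le> (\<Sum>i<r. (2 * real r * A) * (2 * real r * y) ^ r)"
  proof (intro sum_mono mult_mono)
    fix i assume i: "i \<in> {..<r}"
    show "\<bar>poly q (z i)\<bar> \<le> 2 * real r * A" using z(2) i by simp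
    have "(\<Prod>j\<in>{..<r} - {i}. \<bar>x - z j\<bar> / d) \<le> (\<Prod>j\<in>{..<r} - {i}. 2 * real r * y)"
      using fac d by (intro prod_mono) auto
    also have "\<dots> = (2 * real r * y) ^ (r - 1)" using i by simp
    also have "\<dots> \<le> (2 * real r * y) ^ r" using ry by (intro power_increasing) auto
    finally show "(\<Prod>j\<in>{..<r} - {i}. \<bar>x - z j\<bar> / d) \<le> (2 * real r * y) ^ r" .
  qed (use A d in \<open>auto intro!: prod_nonneg\<close>)
  also have "\<dots> = 2 * (real r)\<^sup>2 * (2 * real r) ^ r * y ^ r * A"
    by (simp add: power_mult_distrib power2_eq_square)
  finally show ?thesis by (simp add: y_def)
qed

lemma chain_le:
  fixes v :: "nat \<Rightarrow> real"
  shows "\<bar>v k - v j\<bar> \<le> (\<Sum>i\<in>{min j k..<max j k}. \<bar>v i - v (Suc i)\<bar>)"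
proof -
  have *: "\<bar>v k - v j\<bar> \<le> (\<Sum>i\<in>{j..<k}. \<bar>v i - v (Suc i)\<bar>)" if "j \<le> k" for j k
    using that
  proof (induction k rule: dec_induct)
    case (step k)
    have "\<bar>v (Suc k) - v j\<bar> \<le> \<bar>v k - v j\<bar> + \<bar>v k - v (Suc k)\<bar>" by linarith
    also have "\<dots> \<le> (\<Sum>i\<in>{j..<Suc k}. \<bar>v i - v (Suc i)\<bar>)" using step by simp
    finally show ?case .
  qed simp
  show ?thesis
  proof (cases "j \<le> k")
    case True
    thus ?thesis using *[of j k] by (simp add: min_def max_def)
  next
    case False
    thus ?thesis using *[of k j] by (simp add: min_def max_def abs_minus_commute)
  qed
qed

context doubling_measure
begin

lemma aw_pos:
  assumes \<mu>: "0 < measure \<mu> {-1..1}" and n: "2 \<le> n" and x: "x \<in> {-1..1}"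
  shows "0 < aw n x"
proof -
  have r: "0 < rho n x" using n x by (intro rho_pos) auto
  define a where "a = max (-1) (x - rho n x)"
  define b where "b = min 1 (x + rho n x)"
  have ab: "a < b" "{a..b} \<subseteq> {-1..1}" using r x by (auto simp: a_def b_def)
  have "measure \<mu> {-1..1} \<le> (3 / 2 * (1 - (-1)) / (b - a)) ^ s * measure \<mu> {a..b}"
    by (rule growth[OF ab]) simp
  hence "measure \<mu> {a..b} \<noteq> 0" using \<mu> by auto
  hence "0 < measure \<mu> {a..b}" by (simp add: order_less_le)
  hence "0 < measure \<mu> {x - rho n x..x + rho n x}" by (simp add: a_def b_def measure_clip[of "x - rho n x"])
  thus ?thesis using r by (simp add: aw_def)
qed

text \<open>Weight times length is comparable to the mass of the cell. Estimating this product
  through \<open>aw_rho_le\<close> costs 2 s powers of the index distance, which is the exponent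
  that the decay in \<open>weighted_decay_sum_le\<close> has to absorb.\<close>

lemma aw_cell_length_le:
  assumes N: "2 \<le> N" and i: "i < N" and j: "j < N"
  shows "aw N (midpt N j) * (node N j - node N (Suc j)) \<le> 84 * 48 ^ s * (1
      + \<bar>real i - real j\<bar>) ^ (2 * s) * (aw N (midpt N i) * (node N i - node N (Suc i)))"
    and "aw N (midpt N j) \<le> 3 ^ s * (1 + 4 * \<bar>real i - real j\<bar>) ^ (2 * s + 1) * aw N (midpt N i)"
proof -
  have N1: "1 \<le> N" and N0: "0 < real N" using N by auto
  define D where "D = \<bar>real i - real j\<bar>"
  have mi: "midpt N i \<in> {-1..1}" and mj: "midpt N j \<in> {-1..1}" using midpt_props(1)[OF N1] i j by auto
  note aw0 = aw_nonneg[OF N1 mi] aw_nonneg[OF N1 mj]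
  have ri: "rho N (midpt N i) \<le> node N i - node N (Suc i)" by (rule cell_length_ge[OF N1 i])
  have "node N j - node N (Suc j) \<le> node N (j - 1) - node N (Suc j)" using node_mono[OF N1, of "j - 1" j] j by simp
  also have "\<dots> \<le> 84 * rho N (midpt N j)" by (rule big_cell_length_le[OF N1 j])
  finally have lj: "node N j - node N (Suc j) \<le> 84 * rho N (midpt N j)" .
  have ad: "adist N (midpt N i) (midpt N j) \<le> 4 * D"
  proof -
    have "adist N (midpt N i) (midpt N j) = real N * \<bar>(real i - real j) * (pi / real N)\<bar>"
      unfolding adist_def midpt_props(2)[OF N1 i] midpt_props(2)[OF N1 j]
          by (simp add: algebra_simps diff_divide_distrib add_divide_distrib)
    also have "\<dots> = pi * D" using N0 by (simp add: abs_mult D_def)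
    also have "\<dots> \<le> 4 * D" using pi_less_4 by (intro mult_right_mono) (auto simp: D_def)
    finally show ?thesis .
  qed
  have D0: "0 \<le> D" by (simp add: D_def)
  have "aw N (midpt N j) * (node N j - node N (Suc j)) \<le> aw N (midpt N j) * (84 * rho N (midpt N j))"
    by (intro mult_left_mono lj aw0)
  also have "\<dots> = 84 * (aw N (midpt N j) * rho N (midpt N j))" by simp
  also have "\<dots> \<le> 84 * ((3 * (1 + adist N (midpt N i) (midpt N j))\<^sup>2) ^ s * (aw N (midpt N i) * rho N (midpt N i)))"
    by (intro mult_left_mono aw_rho_le N mi mj) auto
  also have "\<dots> \<le> 84 * ((48 * (1 + D)\<^sup>2) ^ s * (aw N (midpt N i) * (node N i - node N (Suc i))))"
  proof -
    have "(1 + adist N (midpt N i) (midpt N j))\<^sup>2 \<le> (4 * (1 + D))\<^sup>2"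
      using ad D0 by (intro power_mono) auto
    also have "\<dots> = 16 * (1 + D)\<^sup>2" by (simp only: power_mult_distrib) simp
    finally have "(3 * (1 + adist N (midpt N i) (midpt N j))\<^sup>2) ^ s \<le> (48 * (1 + D)\<^sup>2) ^ s"
      by (intro power_mono) auto
    moreover have "aw N (midpt N i) * rho N (midpt N i) \<le> aw N (midpt N i) * (node N i - node N (Suc i))"
      by (rule mult_left_mono[OF ri aw0(1)])
    moreover have "0 \<le> aw N (midpt N i) * rho N (midpt N i)"
      using aw0 rho_pos[OF N1 mi] by (intro mult_nonneg_nonneg) auto
    ultimately have "(3 * (1 + adist N (midpt N i) (midpt N j))\<^sup>2) ^ s * (aw N (midpt N i) * rho N (midpt N i)) \<le>
        (48 * (1 + D)\<^sup>2) ^ s * (aw N (midpt N i) * (node N i - node N (Suc i)))"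
      by - (rule mult_mono, assumption+, simp, assumption)
    thus ?thesis by simp
  qed
  also have "(48 * (1 + D)\<^sup>2) ^ s = 48 ^ s * (1 + D) ^ (2 * s)" by (simp add: power_mult_distrib power_mult)
  finally show "aw N (midpt N j) * (node N j - node N (Suc j))
      \<le> 84 * 48 ^ s * (1 + \<bar>real i - real j\<bar>) ^ (2 * s) * (aw N (midpt N i) * (node N i - node N (Suc i)))"
    by (simp add: D_def mult.assoc)
  have "aw N (midpt N j) \<le> 3 ^ s * (1 + adist N (midpt N i) (midpt N j)) ^ (2 * s + 1) * aw N (midpt N i)"
    by (rule aw_le[OF N mi mj])
  also have "\<dots> \<le> 3 ^ s * (1 + 4 * D) ^ (2 * s + 1) * aw N (midpt N i)"
    using ad by (intro mult_right_mono mult_left_mono power_mono aw0) auto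
  finally show "aw N (midpt N j) \<le> 3 ^ s * (1 + 4 * \<bar>real i - real j\<bar>) ^ (2 * s + 1) * aw N (midpt N i)"
      by (simp add: D_def)
qed

text \<open>The index distance 1 + |k - j| is at most 2 (1 + z), where z is the scaled angular
  distance to the k-th midpoint. The decay exceeds the growth B by two powers, which are
  summable.\<close>

lemma partition_weight_le:
  fixes M B :: nat
  assumes N: "2 \<le> N" and j: "j < N" and x: "x \<in> {node N (Suc j)..node N j}" and B: "2 * M = B + 2"
    and \<alpha>: "\<And>k. k < N \<Longrightarrow> \<alpha> k \<le> CM / (1 + real N * \<bar>arccos x - (real k
        + 1 / 2) * pi / real N\<bar>) ^ (2 * M)" and CM: "0 \<le> CM"
  shows "(\<Sum>k<N. \<alpha> k * (1 + \<bar>real k - real j\<bar>) ^ B) \<le> CM * 2 ^ (2 * M) * 4"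
proof -
  have N1: "1 \<le> N" and N0: "0 < real N" using N by auto
  have "\<alpha> k * (1 + \<bar>real k - real j\<bar>) ^ B \<le> CM * 2 ^ (2 * M) * (1 / (1 + \<bar>real k - real j\<bar>)\<^sup>2)" if k: "k < N" for k
  proof -
    define D where "D = \<bar>real k - real j\<bar>"
    have D: "0 \<le> D" by (simp add: D_def)
    define z where "z = real N * \<bar>arccos x - (real k + 1 / 2) * pi / real N\<bar>"
    define t where "t = real N * arccos x / pi"
    have t: "real j \<le> t" "t \<le> real (Suc j)" using cell_props(2,3)[OF N1 j x] N0 by (auto simp: t_def field_simps)
    have zt: "z = pi * \<bar>t - (real k + 1 / 2)\<bar>"
    proof -
      have "arccos x - (real k + 1 / 2) * pi / real N = (t - (real k + 1 / 2)) * (pi / real N)"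
        using N0 by (simp add: t_def field_simps)
      thus ?thesis using N0 by (simp add: z_def abs_mult)
    qed
    have "(1 + D) / 2 \<le> 1 + z"
    proof (cases "k = j")
      case True
      thus ?thesis by (simp add: D_def zt)
    next
      case False
      hence D1: "1 \<le> D" by (auto simp: D_def)
      have "D - 1 / 2 \<le> \<bar>t - (real k + 1 / 2)\<bar>" using t by (auto simp: D_def abs_if)
      hence "2 * (D - 1 / 2) \<le> pi * \<bar>t - (real k + 1 / 2)\<bar>" using D1 pi_ge_two by (intro mult_mono) auto
      thus ?thesis using D1 by (simp add: zt)
    qed
    note half = this
    have z0: "0 < ((1 + D) / 2) ^ (2 * M)" "0 < (1 + z) ^ (2 * M)"
      using D half by (auto intro!: zero_less_power)
    have "((1 + D) / 2) ^ (2 * M) \<le> (1 + z) ^ (2 * M)" using D half by (intro power_mono) auto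
    hence "CM / (1 + z) ^ (2 * M) \<le> CM / ((1 + D) / 2) ^ (2 * M)"
      using CM z0 by (intro divide_left_mono mult_pos_pos) auto
    hence "\<alpha> k \<le> CM / ((1 + D) / 2) ^ (2 * M)" using \<alpha>[OF k] by (simp add: z_def)
    hence "\<alpha> k * (1 + D) ^ B \<le> CM / ((1 + D) / 2) ^ (2 * M) * (1 + D) ^ B"
      using D by (intro mult_right_mono) auto
    also have "\<dots> = CM * 2 ^ (2 * M) * (1 / (1 + D)\<^sup>2)"
    proof -
      have "(1 + D) ^ (2 * M) = (1 + D) ^ B * (1 + D)\<^sup>2" unfolding B by (rule power_add)
      moreover have "(1 + D) ^ B \<noteq> 0" using D by simp
      ultimately show ?thesis by (simp add: power_divide)
    qed
    finally show ?thesis by (simp add: D_def)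
  qed
  hence "(\<Sum>k<N. \<alpha> k * (1 + \<bar>real k - real j\<bar>) ^ B) \<le> (\<Sum>k<N. CM * 2 ^ (2 * M) * (1 / (1 + \<bar>real k - real j\<bar>)\<^sup>2))"
    by (intro sum_mono) auto
  also have "\<dots> = CM * 2 ^ (2 * M) * (\<Sum>k<N. 1 / (1 + \<bar>real k - real j\<bar>)\<^sup>2)"
    by (simp add: sum_distrib_left)
  also have "\<dots> \<le> CM * 2 ^ (2 * M) * 4"
    using CM by (intro mult_left_mono sum_inverse_squares_dist_le) auto
  finally show ?thesis .
qed

text \<open>A weighted Schur test. Of the decay 2 s + 2, two powers serve as Jensen weights of total
  mass at most 4. After exchanging the sums, 2 s powers absorb the ratio of the masses of cells j
  and i, and two remain for summing over j.\<close>

lemma weighted_decay_sum_le: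
  assumes N: "2 \<le> N" and p: "1 < p" and A: "\<And>i. i < N - 1 \<Longrightarrow> 0 \<le> A i"
  defines "H \<equiv> \<lambda>j. \<Sum>i<N - 1. A i / (1 + \<bar>real i - real j\<bar>) ^ (2 * s + 2)"
  shows "(\<Sum>j<N. aw N (midpt N j) * (node N j - node N (Suc j)) * H j powr p) \<le>
    4 powr (p - 1) * (84 * 48 ^ s) * 4 * (\<Sum>i<N - 1. aw N (midpt N i) * (node N i - node N (Suc i)) * A i powr p)"
proof -
  have N1: "1 \<le> N" using N by simp
  define e where "e = 2 * s + 2"
  define W where "W j = aw N (midpt N j) * (node N j - node N (Suc j))" for j
  have W0: "0 \<le> W j" if "j < N" for j
    unfolding W_def using that node_mono[OF N1, of j "Suc j"] midpt_props(1)[OF N1 that] N1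
    by (intro mult_nonneg_nonneg aw_nonneg) auto
  define K where "K = 84 * (48::real) ^ s"
  have Hp: "H j powr p \<le> 4 powr (p - 1) * (\<Sum>i<N - 1. A i powr p / (1 + \<bar>real i - real j\<bar>) ^ e)" for j
  proof -
    define k where "k i = 1 / (1 + \<bar>real i - real j\<bar>)\<^sup>2" for i
    define h where "h i = A i / (1 + \<bar>real i - real j\<bar>) ^ (2 * s)" for i
    have k0: "0 \<le> k i" for i by (simp add: k_def)
    have h0: "0 \<le> h i" if "i < N - 1" for i using A[OF that] by (simp add: h_def)
    have "H j = (\<Sum>i<N - 1. k i * h i)"
      unfolding H_def k_def h_def by (simp add: power_add power2_eq_square mult_ac)
    also have "\<dots> powr p \<le> 4 powr (p - 1) * (\<Sum>i<N - 1. k i * h i powr p)"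
    proof (rule sum_jensen_powr[OF _ _ _ p])
      show "(\<Sum>i<N - 1. k i) \<le> 4" unfolding k_def by (rule sum_inverse_squares_dist_le)
    qed (use k0 h0 in auto)
    also have "\<dots> \<le> 4 powr (p - 1) * (\<Sum>i<N - 1. A i powr p / (1 + \<bar>real i - real j\<bar>) ^ e)"
    proof (intro mult_left_mono sum_mono)
      fix i assume "i \<in> {..<N - 1}"
      hence Ai: "0 \<le> A i" using A by simp
      define y where "y = 1 / (1 + \<bar>real i - real j\<bar>) ^ (2 * s)"
      have y: "0 \<le> y" "y \<le> 1" by (auto simp: y_def divide_le_eq_1 intro!: one_le_power)
      \<comment> \<open>The other 2 s powers are only weakened here, since y <= 1; one copy of y
        suffices later.\<close>
      have "y powr p \<le> y powr 1" using y p by (intro powr_mono') auto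
      hence yp: "y powr p \<le> y" using y by simp
      have "h i = A i * y" by (simp add: h_def y_def)
      hence "h i powr p = A i powr p * y powr p" using Ai y by (simp add: powr_mult)
      also have "\<dots> \<le> A i powr p * y" using yp by (intro mult_left_mono) auto
      finally have "k i * h i powr p \<le> k i * (A i powr p * y)" using k0 by (intro mult_left_mono) auto
      also have "\<dots> = A i powr p / (1 + \<bar>real i - real j\<bar>) ^ e"
        by (simp add: k_def y_def e_def power_add power2_eq_square mult_ac)
      finally show "k i * h i powr p \<le> A i powr p / (1 + \<bar>real i - real j\<bar>) ^ e" .
    qed auto
    finally show ?thesis .
  qed
  have "(\<Sum>j<N. W j * H j powr p) \<le> (\<Sum>j<N. W j * (4 powr (p - 1) * (\<Sum>i<N - 1. A i powr p / (1
      + \<bar>real i - real j\<bar>) ^ e)))"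
    by (intro sum_mono mult_left_mono Hp W0) auto
  also have "\<dots> = 4 powr (p - 1) * (\<Sum>j<N. \<Sum>i<N - 1. W j * (A i powr p / (1 + \<bar>real i - real j\<bar>) ^ e))"
    by (simp add: sum_distrib_left mult_ac)
  also have "\<dots> \<le> 4 powr (p - 1) * (\<Sum>j<N. \<Sum>i<N - 1. K * (W i * A i powr p) * (1 / (1 + \<bar>real j - real i\<bar>)\<^sup>2))"
  proof (intro mult_left_mono sum_mono)
    fix j i assume "j \<in> {..<N}" "i \<in> {..<N - 1}"
    hence ij: "i < N" "j < N" by auto
    define D where "D = 1 + \<bar>real i - real j\<bar>"
    have D: "0 < D" by (simp add: D_def add_pos_nonneg)
    have "W j * (A i powr p / D ^ e) \<le> K * D ^ (2 * s) * W i * (A i powr p / D ^ e)"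
      unfolding W_def K_def D_def using aw_cell_length_le(1)[OF N ij] by (intro mult_right_mono) auto
    also have "\<dots> = K * (W i * A i powr p) * (1 / D\<^sup>2)"
      using D by (simp add: e_def power_add power2_eq_square)
    finally show "W j * (A i powr p / (1 + \<bar>real i - real j\<bar>) ^ e)
        \<le> K * (W i * A i powr p) * (1 / (1 + \<bar>real j - real i\<bar>)\<^sup>2)"
      by (simp add: D_def abs_minus_commute)
  qed auto
  also have "(\<Sum>j<N. \<Sum>i<N - 1. K * (W i * A i powr p) * (1 / (1 + \<bar>real j - real i\<bar>)\<^sup>2))
      = (\<Sum>i<N - 1. K * (W i * A i powr p) * (\<Sum>j<N. 1 / (1 + \<bar>real j - real i\<bar>)\<^sup>2))"
    by (subst sum.swap) (simp add: sum_distrib_left)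
  also have "\<dots> \<le> (\<Sum>i<N - 1. K * (W i * A i powr p) * 4)"
    using W0 by (intro sum_mono mult_left_mono sum_inverse_squares_dist_le) (auto simp: K_def)
  also have "\<dots> = K * 4 * (\<Sum>i<N - 1. W i * A i powr p)" by (simp add: sum_distrib_left mult_ac)
  finally show ?thesis by (simp add: W_def K_def mult_ac mult_left_mono)
qed

end

lemma cell_distance_le:
  assumes N: "1 \<le> N" and i: "i < N" and j: "j < N" and x: "x \<in> {node N (Suc j)..node N j}"
  shows "0 < node N i - node N (Suc i)"
    and "1 + \<bar>x - node N (Suc i)\<bar> / (node N i - node N (Suc i)) \<le> 16 * (1 + \<bar>real i - real j\<bar>)\<^sup>2"
proof -
  define D where "D = \<bar>real i - real j\<bar>"
  have D: "0 \<le> D" by (simp add: D_def)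
  note m = midpt_props(1)[OF N i]
  have r: "0 < rho N (midpt N i)" by (rule rho_pos[OF N m])
  have l: "rho N (midpt N i) \<le> node N i - node N (Suc i)" by (rule cell_length_ge[OF N i])
  show l0: "0 < node N i - node N (Suc i)" using r l by linarith
  have dist: "\<bar>midpt N i - y\<bar> \<le> (a + a\<^sup>2) * rho N (midpt N i)" if "y \<in> {-1..1}" "adist N (midpt N i) y \<le> a" for y a
  proof -
    have "\<bar>midpt N i - y\<bar> \<le> (adist N (midpt N i) y + (adist N (midpt N i) y)\<^sup>2) * rho N (midpt N i)"
      by (rule dist_le_adist[OF N m that(1)])
    also have "\<dots> \<le> (a + a\<^sup>2) * rho N (midpt N i)"
      using that r by (intro mult_right_mono add_mono power_mono) auto
    finally show ?thesis .
  qed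
  have end_cell: "node N (Suc i) \<in> {node N (Suc i)..node N i}" using l0 by simp
  have "\<bar>midpt N i - x\<bar> \<le> ((4 * D + 2) + (4 * D + 2)\<^sup>2) * rho N (midpt N i)"
    using dist[OF cell_props(1)[OF N j x] cell_props(4)[OF N j x i]] by (simp add: D_def)
  moreover have "\<bar>midpt N i - node N (Suc i)\<bar> \<le> (2 + 2\<^sup>2) * rho N (midpt N i)"
    using cell_props(4)[OF N i end_cell i] by (intro dist[OF cell_props(1)[OF N i end_cell]]) simp
  ultimately have "\<bar>x - node N (Suc i)\<bar> \<le> ((4 * D + 2) + (4 * D + 2)\<^sup>2) * rho N (midpt N i) + (2
      + 2\<^sup>2) * rho N (midpt N i)"
    by linarith
  also have "\<dots> = (12 + 20 * D + 16 * D\<^sup>2) * rho N (midpt N i)"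
    by (simp add: power2_eq_square algebra_simps)
  also have "\<dots> \<le> (12 + 20 * D + 16 * D\<^sup>2) * (node N i - node N (Suc i))"
    using D l by (intro mult_left_mono) auto
  finally have "\<bar>x - node N (Suc i)\<bar> / (node N i - node N (Suc i)) \<le> 12 + 20 * D + 16 * D\<^sup>2"
    using l0 by (simp add: pos_divide_le_eq)
  also have "\<dots> + 1 \<le> 16 * (1 + D)\<^sup>2" using D by (simp add: power2_eq_square algebra_simps)
  finally show "1 + \<bar>x - node N (Suc i)\<bar> / (node N i - node N (Suc i)) \<le> 16 * (1 + \<bar>real i - real j\<bar>)\<^sup>2"
    by (simp add: D_def)
qed

text \<open>q i and q (Suc i) both approximate f on cell i, so their difference is small there; A is
  its L_p mean up to constants. \<open>poly_growth\<close> carries the bound to cell j at the price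
  of a power of the relative distance, which is at most quadratic in the index distance.\<close>

lemma adjacent_difference_le:
  fixes f :: "real \<Rightarrow> real" and q :: "nat \<Rightarrow> real poly"
  assumes N: "1 \<le> N" and r: "1 \<le> r" and p: "1 < p" and [measurable]: "f \<in> borel_measurable borel"
    and q: "\<And>i. i < N \<Longrightarrow> degree (q i) < r" and \<Omega>: "\<And>i. i < N \<Longrightarrow> 0 \<le> \<Omega> i"
      "\<And>i. i < N \<Longrightarrow> lp_int p {node N (Suc i)..node N (i - 1)} (\<lambda>x. f x - poly (q i) x) \<le> ennreal (\<Omega> i)"
    and i: "Suc i < N" and j: "j < N" and x: "x \<in> {node N (Suc j)..node N j}"
  defines "A \<equiv> (2 powr p * (\<Omega> i + \<Omega> (Suc i)) / (node N i - node N (Suc i))) powr (1 / p)"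
  shows "\<bar>poly (q i) x - poly (q (Suc i)) x\<bar> \<le> 2 * (real r)\<^sup>2 * (2 * real r) ^ r * 16 ^ r * (1
      + \<bar>real i - real j\<bar>) ^ (2 * r) * A"
    and "(node N i - node N (Suc i)) * A powr p = 2 powr p * (\<Omega> i + \<Omega> (Suc i))"
proof -
  have iN: "i < N" using i by simp
  define l where "l = node N i - node N (Suc i)"
  have l: "0 < l" unfolding l_def by (rule cell_distance_le(1)[OF N iN j x])
  have O0: "0 \<le> \<Omega> i + \<Omega> (Suc i)" using \<Omega>(1)[OF iN] \<Omega>(1)[OF i] by simp
  show lA: "(node N i - node N (Suc i)) * A powr p = 2 powr p * (\<Omega> i + \<Omega> (Suc i))"
    using l p O0 unfolding A_def l_def[symmetric] by (simp add: powr_powr)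
  have sub: "{node N (Suc i)..node N i} \<subseteq> {node N (Suc i)..node N (i - 1)}"
    "{node N (Suc i)..node N i} \<subseteq> {node N (Suc (Suc i))..node N (Suc i - 1)}"
    using node_mono[OF N, of "i - 1" i] node_mono[OF N, of "Suc i" "Suc (Suc i)"] i by auto
  let ?I = "\<lambda>g. \<integral>\<^sup>+x. ennreal (\<bar>g x\<bar> powr p) * indicator {node N (Suc i)..node N i} x \<partial>lborel"
  have "?I (poly (q i - q (Suc i))) \<le> (\<integral>\<^sup>+x. ennreal (2 powr p) *
      (ennreal (\<bar>f x - poly (q i) x\<bar> powr p) * indicator {node N (Suc i)..node N (i - 1)} x
       + ennreal (\<bar>f x - poly (q (Suc i)) x\<bar> powr p) * indicator {node N (Suc (Suc i))..node N (Suc i - 1)} x)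
           \<partial>lborel)"
  proof (rule nn_integral_mono)
    fix y :: real
    show "ennreal (\<bar>poly (q i - q (Suc i)) y\<bar> powr p) * indicator {node N (Suc i)..node N i} y
      \<le> ennreal (2 powr p) *
        (ennreal (\<bar>f y - poly (q i) y\<bar> powr p) * indicator {node N (Suc i)..node N (i - 1)} y
         + ennreal (\<bar>f y - poly (q (Suc i)) y\<bar> powr p) * indicator {node N (Suc (Suc i))..node N (Suc i - 1)} y)"
    proof (cases "y \<in> {node N (Suc i)..node N i}")
      case True
      have "\<bar>poly (q i - q (Suc i)) y\<bar> powr p \<le> (\<bar>f y - poly (q i) y\<bar> + \<bar>f y - poly (q (Suc i)) y\<bar>) powr p"
        using p by (intro powr_mono2) auto
      also have "\<dots> \<le> 2 powr p * (\<bar>f y - poly (q i) y\<bar> powr p + \<bar>f y - poly (q (Suc i)) y\<bar> powr p)"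
        by (rule powr_add_le) (use p in auto)
      finally have "ennreal (\<bar>poly (q i - q (Suc i)) y\<bar> powr p)
          \<le> ennreal (2 powr p * (\<bar>f y - poly (q i) y\<bar> powr p + \<bar>f y - poly (q (Suc i)) y\<bar> powr p))"
        by (rule ennreal_leI)
      moreover have "y \<in> {node N (Suc i)..node N (i - 1)}" "y \<in> {node N (Suc (Suc i))..node N (Suc i - 1)}"
        using True sub by blast+
      ultimately show ?thesis using True by (simp only: indicator_simps mult_1_right) (simp add: ennreal_mult)
    qed simp
  qed
  also have "\<dots> = ennreal (2 powr p) *
      (lp_int p {node N (Suc i)..node N (i - 1)} (\<lambda>x. f x - poly (q i) x)
       + lp_int p {node N (Suc (Suc i))..node N (Suc i - 1)} (\<lambda>x. f x - poly (q (Suc i)) x))"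
    by (subst nn_integral_cmult) (auto simp: nn_integral_add )
  also have "\<dots> \<le> ennreal (2 powr p) * (ennreal (\<Omega> i) + ennreal (\<Omega> (Suc i)))"
    by (intro mult_left_mono add_mono \<Omega>(2) iN i) auto
  also have "\<dots> = ennreal (l * A powr p)"
    using \<Omega>(1)[OF iN] \<Omega>(1)[OF i] O0 lA by (simp add: l_def ennreal_mult)
  finally have int: "?I (poly (q i - q (Suc i))) \<le> ennreal (l * A powr p)" .
  have deg: "degree (q i - q (Suc i)) < r" using q[OF iN] q[OF i] by (rule degree_diff_less)
  have cl: "node N i = node N (Suc i) + l" by (simp add: l_def)
  have "\<bar>poly (q i - q (Suc i)) x\<bar> \<le> 2 * (real r)\<^sup>2 * (2 * real r) ^ r * (1 + \<bar>x - node N (Suc i)\<bar> / l) ^ r * A"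
    using int unfolding cl by (intro poly_growth[OF r deg p l]) (auto simp: A_def)
  also have "\<dots> \<le> 2 * (real r)\<^sup>2 * (2 * real r) ^ r * (16 * (1 + \<bar>real i - real j\<bar>)\<^sup>2) ^ r * A"
    using cell_distance_le(2)[OF N iN j x] l
    by (intro mult_right_mono mult_left_mono power_mono) (auto simp: l_def A_def)
  also have "(16 * (1 + \<bar>real i - real j\<bar>)\<^sup>2) ^ r = 16 ^ r * (1 + \<bar>real i - real j\<bar>) ^ (2 * r)"
    by (simp add: power_mult_distrib power_mult)
  finally show "\<bar>poly (q i) x - poly (q (Suc i)) x\<bar> \<le> 2 * (real r)\<^sup>2 * (2 * real r) ^ r * 16 ^ r * (1
      + \<bar>real i - real j\<bar>) ^ (2 * r) * A"
    by (simp add: mult.assoc)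
qed

lemma cell_integral_le:
  assumes p: "0 \<le> p" and ab: "a \<le> b" "b \<le> c" and H: "0 \<le> H" and B: "0
      \<le> B" and [measurable]: "u \<in> borel_measurable borel"
    and u: "lp_int p {a..c} u \<le> ennreal B"
    and g: "\<And>x. x \<in> {a..b} \<Longrightarrow> \<bar>g x\<bar> \<le> \<bar>u x\<bar> + H"
  shows "lp_int p {a..b} g \<le> ennreal (2 powr p * (B + (b - a) * H powr p))"
proof -
  have "lp_int p {a..b} g
      \<le> (\<integral>\<^sup>+x. ennreal (2 powr p) * (ennreal (\<bar>u x\<bar> powr p) * indicator {a..c} x
          + ennreal (H powr p) * indicator {a..b} x) \<partial>lborel)"
  proof (rule nn_integral_mono)
    fix x :: real
    show "ennreal (\<bar>g x\<bar> powr p) * indicator {a..b} x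
      \<le> ennreal (2 powr p) * (ennreal (\<bar>u x\<bar> powr p) * indicator {a..c} x + ennreal (H powr p) * indicator {a..b} x)"
    proof (cases "x \<in> {a..b}")
      case True
      have "\<bar>g x\<bar> powr p \<le> (\<bar>u x\<bar> + H) powr p" using g[OF True] p by (intro powr_mono2) auto
      also have "\<dots> \<le> 2 powr p * (\<bar>u x\<bar> powr p + H powr p)" using H p by (intro powr_add_le) auto
      finally have "ennreal (\<bar>g x\<bar> powr p) \<le> ennreal (2 powr p * (\<bar>u x\<bar> powr p + H powr p))" by (rule ennreal_leI)
      thus ?thesis using True ab by (simp add: ennreal_mult)
    qed simp
  qed
  also have "\<dots> = ennreal (2 powr p) * (lp_int p {a..c} u
      + (\<integral>\<^sup>+x. ennreal (H powr p) * indicator {a..b} x \<partial>lborel))"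
    by (subst nn_integral_cmult) (auto simp: nn_integral_add)
  also have "(\<integral>\<^sup>+x. ennreal (H powr p) * indicator {a..b} x \<partial>lborel) = ennreal ((b - a) * H powr p)"
    using ab by (subst nn_integral_cmult_indicator) (auto simp: ennreal_mult mult.commute)
  also have "ennreal (2 powr p) * (lp_int p {a..c} u + ennreal ((b - a) * H powr p))
      \<le> ennreal (2 powr p) * (ennreal B + ennreal ((b - a) * H powr p))"
    by (intro mult_left_mono add_right_mono u) auto
  also have "\<dots> = ennreal (2 powr p * (B + (b - a) * H powr p))"
    using B ab by (simp add: ennreal_mult)
  finally show ?thesis .
qed

text \<open>v k stands for the value at a point of cell j of the k-th local polynomial. As the
  weights sum to 1, the error is an average of v j - v k, and each of these is split along the chain
  of cells from j to k.\<close>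

lemma glued_difference_le:
  fixes v \<alpha> A :: "nat \<Rightarrow> real"
  assumes j: "j < N" and K: "0 \<le> K" and A: "\<And>i. i < N - 1 \<Longrightarrow> 0 \<le> A i"
    and adj: "\<And>i. Suc i < N \<Longrightarrow> \<bar>v i - v (Suc i)\<bar> \<le> K * (1 + \<bar>real i - real j\<bar>) ^ m * A i"
    and \<alpha>: "(\<Sum>k<N. \<alpha> k) = 1" "\<And>k. k < N \<Longrightarrow> 0 \<le> \<alpha> k"
    and S: "(\<Sum>k<N. \<alpha> k * (1 + \<bar>real k - real j\<bar>) ^ (m + e)) \<le> S"
  defines "H \<equiv> (\<Sum>i<N - 1. A i / (1 + \<bar>real i - real j\<bar>) ^ e)"
  shows "\<bar>v j - (\<Sum>k<N. \<alpha> k * v k)\<bar> \<le> S * K * H"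
proof -
  have H0: "0 \<le> H" unfolding H_def using A by (intro sum_nonneg divide_nonneg_nonneg) auto
  have vk: "\<bar>v k - v j\<bar> \<le> (1 + \<bar>real k - real j\<bar>) ^ (m + e) * (K * H)" if k: "k < N" for k
  proof -
    have "\<bar>v k - v j\<bar> \<le> (\<Sum>i\<in>{min j k..<max j k}. \<bar>v i - v (Suc i)\<bar>)" by (rule chain_le)
    also have "\<dots> \<le> (\<Sum>i\<in>{min j k..<max j k}. (1 + \<bar>real k - real j\<bar>) ^ (m + e) * K * (A i / (1
        + \<bar>real i - real j\<bar>) ^ e))"
    proof (rule sum_mono)
      fix i assume i: "i \<in> {min j k..<max j k}"
      hence iN: "Suc i < N" using j k by auto
      \<comment> \<open>Every i on the chain has |i - j| <= |k - j|. So growth m is traded for decay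
        e in i, and the excess m + e in k is left to the partition of unity.\<close>
      have "(1 + \<bar>real i - real j\<bar>) ^ m = (1 + \<bar>real i - real j\<bar>) ^ (m + e) / (1 + \<bar>real i - real j\<bar>) ^ e"
        by (simp add: power_add add_nonneg_eq_0_iff)
      also have "\<dots> \<le> (1 + \<bar>real k - real j\<bar>) ^ (m + e) / (1 + \<bar>real i - real j\<bar>) ^ e"
        using i by (intro divide_right_mono power_mono) auto
      finally have "K * (1 + \<bar>real i - real j\<bar>) ^ m * A i \<le> K * ((1 + \<bar>real k - real j\<bar>) ^ (m + e) / (1
          + \<bar>real i - real j\<bar>) ^ e) * A i"
        using K A[of i] iN by (intro mult_right_mono mult_left_mono) auto
      with adj[OF iN] show "\<bar>v i - v (Suc i)\<bar> \<le> (1 + \<bar>real k - real j\<bar>) ^ (m + e) * K * (A i / (1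
          + \<bar>real i - real j\<bar>) ^ e)"
        by (simp add: mult_ac)
    qed
    also have "\<dots> \<le> (\<Sum>i<N - 1. (1 + \<bar>real k - real j\<bar>) ^ (m + e) * K * (A i / (1 + \<bar>real i - real j\<bar>) ^ e))"
      using j k K A by (intro sum_mono2) auto
    also have "\<dots> = (1 + \<bar>real k - real j\<bar>) ^ (m + e) * (K * H)"
      unfolding H_def sum_distrib_left by (simp add: mult_ac)
    finally show ?thesis .
  qed
  have "v j = (\<Sum>k<N. \<alpha> k) * v j" using \<alpha> by simp
  hence "v j - (\<Sum>k<N. \<alpha> k * v k) = (\<Sum>k<N. \<alpha> k * (v j - v k))"
    by (simp add: sum_distrib_right sum_subtractf right_diff_distrib)
  hence "\<bar>v j - (\<Sum>k<N. \<alpha> k * v k)\<bar> \<le> (\<Sum>k<N. \<bar>\<alpha> k * (v j - v k)\<bar>)" by simp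
  also have "\<dots> \<le> (\<Sum>k<N. \<alpha> k * ((1 + \<bar>real k - real j\<bar>) ^ (m + e) * (K * H)))"
  proof (rule sum_mono)
    fix k assume "k \<in> {..<N}"
    hence k: "k < N" by simp
    have "\<bar>\<alpha> k * (v j - v k)\<bar> = \<alpha> k * \<bar>v k - v j\<bar>" using \<alpha>(2)[OF k] by (simp add: abs_mult abs_minus_commute)
    also have "\<dots> \<le> \<alpha> k * ((1 + \<bar>real k - real j\<bar>) ^ (m + e) * (K * H))"
      using vk[OF k] \<alpha>(2)[OF k] by (intro mult_left_mono)
    finally show "\<bar>\<alpha> k * (v j - v k)\<bar> \<le> \<alpha> k * ((1 + \<bar>real k - real j\<bar>) ^ (m + e) * (K * H))" .
  qed
  also have "\<dots> = (\<Sum>k<N. \<alpha> k * (1 + \<bar>real k - real j\<bar>) ^ (m + e)) * (K * H)"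
    by (simp only: sum_distrib_right mult.assoc)
  also have "\<dots> \<le> S * (K * H)" using S K H0 by (intro mult_right_mono) auto
  finally show ?thesis by (simp add: mult.assoc)
qed

context doubling_measure
begin

text \<open>Whitney's inequality on each enlarged cell, with the oscillation of that cell as data.
  The weighted sum of these data is what \<open>osc_sum_le\<close> controls.\<close>

lemma local_approximation:
  assumes \<mu>: "0 < measure \<mu> {-1..1}" and r: "1 \<le> r" and p: "1 < p"
  shows "\<exists>C\<ge>0. \<forall>N f \<Omega>. 2 \<le> N \<longrightarrow> f \<in> borel_measurable borel \<longrightarrow>
    lp_int p {-1..1} f < \<infinity> \<longrightarrow> 0 < \<Omega> \<longrightarrow>
    smooth_bound p r N f \<Omega> \<longrightarrow>
    (\<exists>q b. (\<forall>i<N. degree (q i) < r \<and> 0 \<le> b i \<and>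
        lp_int p {node N (Suc i)..node N (i - 1)} (\<lambda>x. f x - poly (q i) x) \<le> ennreal (b i)) \<and>
      (\<Sum>i<N. aw N (midpt N i) * b i) \<le> C * \<Omega>)"
proof -
  have \<sigma>: "0 < (1 / 2352 :: real)" by simp
  obtain C where C: "0 \<le> C" and W: "\<forall>f a l \<Omega>. f \<in> borel_measurable borel \<longrightarrow> 0 < l \<longrightarrow>
    lp_int p {a..a + l} f < \<infinity> \<longrightarrow> 0 < \<Omega> \<longrightarrow>
    osc p r (1 / 2352) a l f \<le> ennreal (l * \<Omega>) \<longrightarrow>
    (\<exists>q. degree q < r \<and> lp_int p {a..a + l} (\<lambda>x. f x - poly q x) \<le> ennreal (C * \<Omega>))"
    using whitney_interval[OF r p \<sigma>, folded osc_def] by (elim exE conjE) (rule that)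
  note whitney = W[rule_format]
  define K where "K = 35 * ((3::real) ^ s * 7 ^ (2 * s + 1))"
  have K0: "0 \<le> K" by (simp add: K_def)
  show ?thesis
  proof (intro exI[of _ "C * (K + 1)"] conjI allI impI)
    show "0 \<le> C * (K + 1)" using C K0 by simp
    fix N and f :: "real \<Rightarrow> real" and \<Omega> :: real
    assume N: "2 \<le> N" and f[measurable]: "f \<in> borel_measurable borel"
      and fin: "lp_int p {-1..1} f < \<infinity>" and \<Omega>: "0 < \<Omega>"
      and wb: "smooth_bound p r N f \<Omega>"
    have N1: "1 \<le> N" and N0: "0 < real N" using N by auto
    define l where "l i = node N (i - 1) - node N (Suc i)" for i
    define w where "w i = aw N (midpt N i)" for i
    have w: "0 < w i" if "i < N" for i
      unfolding w_def by (rule aw_pos[OF \<mu> N midpt_props(1)[OF N1 that]])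
    have l: "0 < l i" if "i < N" for i
    proof -
      have "node N (Suc i) \<in> {node N (Suc i)..node N i}" using node_mono[OF N1, of i "Suc i"] that by simp
      hence "0 < node N i - node N (Suc i)" by (rule cell_distance_le(1)[OF N1 that that])
      moreover have "node N i \<le> node N (i - 1)" using that by (intro node_mono N1) auto
      ultimately show ?thesis by (simp add: l_def)
    qed
    define O' where "O' i = osc p r (1 / 2352) (node N (Suc i)) (l i) f" for i
    have sumO: "(\<Sum>i<N. ennreal (w i / l i) * O' i) \<le> ennreal (K * \<Omega>)"
      unfolding w_def l_def O'_def K_def using wb \<Omega> by (intro osc_sum_le[OF N r f]) auto
    have Ofin: "O' i < \<infinity>" if "i < N" for i
    proof -
      have "ennreal (w i / l i) * O' i \<le> (\<Sum>i<N. ennreal (w i / l i) * O' i)"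
        using that by (intro member_le_sum) auto
      also note sumO
      finally have "ennreal (w i / l i) * O' i < \<infinity>" by (simp add: le_less_trans)
      thus ?thesis using w[OF that] l[OF that] by (auto simp: ennreal_mult_less_top)
    qed
    define R where "R i = enn2real (O' i)" for i
    have R: "O' i = ennreal (R i)" "0 \<le> R i" if "i < N" for i
      using Ofin[OF that] by (simp_all add: R_def)
    \<comment> \<open>Whitney's inequality asks for a positive bound, and the oscillation of a cell
      may be 0. The second summand repairs this; weighted by w i and summed over the N cells it adds
      only \<Omega>. Positivity of the weight is used for the division.\<close>
    define b where "b i = R i / l i + \<Omega> / (real N * w i)" for i
    have b: "0 < b i" if "i < N" for i
      using R(2)[OF that] w[OF that] l[OF that] \<Omega> N0 by (auto simp: b_def intro!: add_nonneg_pos)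
    have "\<exists>q. degree q < r \<and> lp_int p {node N (Suc i)..node N (i - 1)} (\<lambda>x. f x - poly q x) \<le> ennreal (C * b i)"
      if i: "i < N" for i
    proof -
      have sub: "{node N (Suc i)..node N (i - 1)} \<subseteq> {-1..1}" using big_cell_props(1)[OF N1 i] by blast
      have e: "node N (i - 1) = node N (Suc i) + l i" by (simp add: l_def)
      have "lp_int p {node N (Suc i)..node N (i - 1)} f
          \<le> lp_int p {-1..1} f"
        using sub by (intro nn_integral_mono mult_left_mono) (auto simp: indicator_def)
      hence fin': "lp_int p {node N (Suc i)..node N (Suc i) + l i} f < \<infinity>"
        using fin unfolding e by (rule le_less_trans)
      have "R i \<le> l i * b i"
      proof -
        have "R i = l i * (R i / l i)" using l[OF i] by simp
        also have "\<dots> \<le> l i * b i" using l[OF i] w[OF i] \<Omega> N0 by (intro mult_left_mono) (auto simp: b_def)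
        finally show ?thesis .
      qed
      hence "O' i \<le> ennreal (l i * b i)" using R(1)[OF i] by (simp add: ennreal_leI)
      from whitney[OF f l[OF i] fin' b[OF i] this[unfolded O'_def]] show ?thesis unfolding e .
    qed
    hence "\<forall>i. \<exists>q. i < N \<longrightarrow> degree q < r \<and> lp_int p {node N (Suc i)..node N (i - 1)} (\<lambda>x. f x - poly q x)
        \<le> ennreal (C * b i)"
      by simp
    from choice[OF this] obtain q where "\<forall>i. i < N \<longrightarrow> degree (q i) < r
        \<and> lp_int p {node N (Suc i)..node N (i - 1)} (\<lambda>x. f x - poly (q i) x) \<le> ennreal (C * b i)" ..
    note q = conjunct1[OF this[rule_format]] conjunct2[OF this[rule_format]]
    have "ennreal (\<Sum>i<N. w i * (R i / l i)) = (\<Sum>i<N. ennreal (w i / l i) * O' i)"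
    proof (subst sum_ennreal[symmetric])
      fix i assume "i \<in> {..<N}"
      thus "0 \<le> w i * (R i / l i)" using R(2)[of i] w[of i] l[of i] by simp
    next
      show "(\<Sum>i<N. ennreal (w i * (R i / l i))) = (\<Sum>i<N. ennreal (w i / l i) * O' i)"
      proof (rule sum.cong)
        fix i assume "i \<in> {..<N}"
        hence i: "i < N" by simp
        have "ennreal (w i / l i) * ennreal (R i) = ennreal (w i / l i * R i)"
          using R(2)[OF i] w[OF i] l[OF i] by (subst ennreal_mult) auto
        thus "ennreal (w i * (R i / l i)) = ennreal (w i / l i) * O' i" using R(1)[OF i] by simp
      qed simp
    qed
    also note sumO
    finally have "(\<Sum>i<N. w i * (R i / l i)) \<le> K * \<Omega>" using K0 \<Omega> by (subst (asm) ennreal_le_iff) auto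
    moreover have "(\<Sum>i<N. w i * b i) = (\<Sum>i<N. w i * (R i / l i)) + (\<Sum>i<N. \<Omega> / real N)"
      unfolding sum.distrib[symmetric]
    proof (rule sum.cong)
      fix i assume "i \<in> {..<N}"
      hence "w i \<noteq> 0" using w by force
      thus "w i * b i = w i * (R i / l i) + \<Omega> / real N" by (simp add: b_def distrib_left)
    qed simp
    moreover have "(\<Sum>i<N. \<Omega> / real N) = \<Omega>" using N0 by simp
    ultimately have "(\<Sum>i<N. w i * b i) \<le> (K + 1) * \<Omega>" by (simp add: algebra_simps)
    hence "C * (\<Sum>i<N. w i * b i) \<le> C * ((K + 1) * \<Omega>)" using C by (intro mult_left_mono)
    hence "(\<Sum>i<N. aw N (midpt N i) * (C * b i)) \<le> C * (K + 1) * \<Omega>"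
      by (simp add: w_def sum_distrib_left mult_ac)
    moreover have "0 \<le> C * b i" if "i < N" for i using b[OF that] C by simp
    ultimately show "\<exists>q b. (\<forall>i<N. degree (q i) < r \<and> 0 \<le> b i \<and>
        lp_int p {node N (Suc i)..node N (i - 1)} (\<lambda>x. f x - poly (q i) x) \<le> ennreal (b i)) \<and>
      (\<Sum>i<N. aw N (midpt N i) * b i) \<le> C * (K + 1) * \<Omega>"
      by (rule_tac x = q in exI, rule_tac x = "\<lambda>i. C * b i" in exI) (use q in simp)
  qed
qed

lemma wint_le_cell_sum:
  assumes N: "2 \<le> N" and [measurable]: "g \<in> borel_measurable borel"
  shows "wint p N g \<le> (\<Sum>j<N. ennreal (3 ^ s * 7 ^ (2 * s + 1) * aw N (midpt N j)) *
      lp_int p {node N (Suc j)..node N j} g)"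
proof -
  have N1: "1 \<le> N" using N by simp
  define D where "D = (3::real) ^ s * 7 ^ (2 * s + 1)"
  have "wint p N g \<le> (\<integral>\<^sup>+x. (\<Sum>j<N. ennreal (D * aw N (midpt N j)) * (ennreal (\<bar>g x\<bar> powr p)
      * indicator {node N (Suc j)..node N j} x)) \<partial>lborel)"
    unfolding wint_def
  proof (rule nn_integral_mono)
    fix x :: real
    show "ennreal (\<bar>g x\<bar> powr p * aw N x) * indicator {-1..1} x
      \<le> (\<Sum>j<N. ennreal (D * aw N (midpt N j)) * (ennreal (\<bar>g x\<bar> powr p) * indicator {node N (Suc j)..node N j} x))"
    proof (cases "x \<in> {-1..1}")
      case True
      obtain j where j: "j < N" "x \<in> {node N (Suc j)..node N j}" using cell_cover[OF N1 True] by blast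
      have "node N j \<le> node N (j - 1)" using j by (intro node_mono N1) auto
      hence "x \<in> {node N (Suc j)..node N (j - 1)}" using j by auto
      from aw_big_cell(2)[OF N j(1) this] have "aw N x \<le> D * aw N (midpt N j)" by (simp only: D_def)
      hence "\<bar>g x\<bar> powr p * aw N x \<le> (D * aw N (midpt N j)) * \<bar>g x\<bar> powr p"
        by (subst mult.commute) (intro mult_right_mono, auto)
      hence "ennreal (\<bar>g x\<bar> powr p * aw N x) \<le> ennreal (D * aw N (midpt N j) * \<bar>g x\<bar> powr p)"
        by (rule ennreal_leI)
      also have "\<dots> = ennreal (D * aw N (midpt N j)) * (ennreal (\<bar>g x\<bar> powr p)
          * indicator {node N (Suc j)..node N j} x)"
        using j by (simp add: ennreal_mult'')
      also have "\<dots> \<le> (\<Sum>j<N. ennreal (D * aw N (midpt N j)) * (ennreal (\<bar>g x\<bar> powr p)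
          * indicator {node N (Suc j)..node N j} x))"
        using j(1) by (intro member_le_sum) auto
      finally show ?thesis using True by simp
    qed simp
  qed
  also have "\<dots> = (\<Sum>j<N. ennreal (D * aw N (midpt N j)) *
      lp_int p {node N (Suc j)..node N j} g)"
    by (subst nn_integral_sum) (auto simp: nn_integral_cmult)
  finally show ?thesis by (simp add: D_def)
qed

lemma direct_estimate_pos:
  assumes \<mu>: "0 < measure \<mu> {-1..1}" and r: "1 \<le> r" and p: "1 < p"
  shows "\<exists>C\<ge>0. \<forall>N f \<Omega>. 2 \<le> N \<longrightarrow> f \<in> borel_measurable borel \<longrightarrow>
    lp_int p {-1..1} f < \<infinity> \<longrightarrow> 0 < \<Omega> \<longrightarrow>
    smooth_bound p r N f \<Omega> \<longrightarrow>
    (\<exists>P. degree P < N + r \<and> wint p N (\<lambda>x. f x - poly P x) \<le> ennreal (C * \<Omega>))"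
proof -
  from local_approximation[OF \<mu> r p] obtain C where C: "0 \<le> C" and L: "\<forall>N f \<Omega>. 2 \<le> N \<longrightarrow> f \<in> borel_measurable borel \<longrightarrow>
    lp_int p {-1..1} f < \<infinity> \<longrightarrow> 0 < \<Omega> \<longrightarrow>
    smooth_bound p r N f \<Omega> \<longrightarrow>
    (\<exists>q b. (\<forall>i<N. degree (q i) < r \<and> 0 \<le> b i \<and>
        lp_int p {node N (Suc i)..node N (i - 1)} (\<lambda>x. f x - poly (q i) x) \<le> ennreal (b i)) \<and>
      (\<Sum>i<N. aw N (midpt N i) * b i) \<le> C * \<Omega>)"
    by (elim exE conjE) (rule that)
  \<comment> \<open>2 M = 2 r + (2 s + 2) + 2: growth of local polynomials, decay demanded by
    \<open>weighted_decay_sum_le\<close>, and two powers for summability.\<close>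
  define M where "M = r + s + 2"
  define S where "S = 2 * (25 * (real M)\<^sup>2) ^ M * 2 ^ (2 * M) * 4"
  define K where "K = 2 * (real r)\<^sup>2 * (2 * real r) ^ r * 16 ^ r"
  define D where "D = (3::real) ^ s * 7 ^ (2 * s + 1)"
  \<comment> \<open>The ratio of the weights of neighbouring cells, where 1 + 4 |i - j| = 5.\<close>
  define G where "G = (3::real) ^ s * 5 ^ (2 * s + 1)"
  define T where "T = 4 powr (p - 1) * (84 * 48 ^ s) * 4"
  have nn: "0 \<le> S" "0 \<le> K" "0 \<le> D" "0 \<le> G" "0 \<le> T" by (simp_all add: S_def K_def D_def G_def T_def)
  define E where "E = D * 2 powr p * (C + (S * K) powr p * (T * (2 powr p * ((1 + G) * C))))"
  show ?thesis
  proof (intro exI[of _ E] conjI allI impI)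
    show "0 \<le> E" using nn C by (simp add: E_def)
    fix N and f :: "real \<Rightarrow> real" and \<Omega> :: real
    assume N: "2 \<le> N" and f[measurable]: "f \<in> borel_measurable borel"
      and fin: "lp_int p {-1..1} f < \<infinity>" and \<Omega>: "0 < \<Omega>"
      and wb: "smooth_bound p r N f \<Omega>"
    have N1: "1 \<le> N" using N by auto
    from L[THEN spec, THEN spec, THEN spec, THEN mp, OF N, THEN mp, OF f, THEN mp, OF fin, THEN mp, OF \<Omega>, THEN
        mp, OF wb] obtain q b where
      qb: "\<forall>i<N. degree (q i) < r \<and> 0 \<le> b i \<and>
        lp_int p {node N (Suc i)..node N (i - 1)} (\<lambda>x. f x - poly (q i) x) \<le> ennreal (b i)"
      and sum_b: "(\<Sum>i<N. aw N (midpt N i) * b i) \<le> C * \<Omega>" by (elim exE conjE) (rule that)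
    have q: "\<And>i. i < N \<Longrightarrow> degree (q i) < r" and b: "\<And>i. i < N \<Longrightarrow> 0 \<le> b i"
      and fq: "\<And>i. i < N \<Longrightarrow> lp_int p {node N (Suc i)..node N (i - 1)} (\<lambda>x. f x - poly (q i) x) \<le> ennreal (b i)"
      using qb[rule_format] by blast+
    have "1 \<le> M" by (simp add: M_def)
    from polynomial_partition_of_unity[OF N1 this] obtain \<alpha> :: "nat \<Rightarrow> real poly" where deg\<alpha>: "\<And>j. degree (\<alpha> j) < N"
      and \<alpha>: "\<forall>t\<in>{0..pi}. (\<Sum>j<N. poly (\<alpha> j) (cos t)) = 1 \<and>
      (\<forall>j<N. 0 \<le> poly (\<alpha> j) (cos t) \<and>
         poly (\<alpha> j) (cos t) \<le> 2 * (25 * (real M)\<^sup>2) ^ M / (1 + real N * \<bar>t - (real j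
             + 1 / 2) * pi / real N\<bar>) ^ (2 * M))"
      by (elim exE conjE) (rule that, blast)
    define P where "P = (\<Sum>k<N. \<alpha> k * q k)"
    have degP: "degree P < N + r" unfolding P_def
    proof (rule degree_sum_less)
      fix k assume "k \<in> {..<N}"
      hence "degree (\<alpha> k) + degree (q k) < N + r" using deg\<alpha>[of k] q[of k] by simp
      thus "degree (\<alpha> k * q k) < N + r" using degree_mult_le[of "\<alpha> k" "q k"] by linarith
    qed (use N in simp)
    define w where "w i = aw N (midpt N i)" for i
    have w: "0 \<le> w i" if "i < N" for i
      unfolding w_def by (rule aw_nonneg[OF N1 midpt_props(1)[OF N1 that]])
    define l where "l i = node N i - node N (Suc i)" for i
    define A where "A i = (2 powr p * (b i + b (Suc i)) / l i) powr (1 / p)" for i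
    have A0: "0 \<le> A i" for i by (simp add: A_def)
    define H where "H j = (\<Sum>i<N - 1. A i / (1 + \<bar>real i - real j\<bar>) ^ (2 * s + 2))" for j
    have H0: "0 \<le> H j" for j unfolding H_def using A0 by (intro sum_nonneg divide_nonneg_nonneg) auto
    have lA: "l i * A i powr p = 2 powr p * (b i + b (Suc i))" if "i < N - 1" for i
      unfolding A_def l_def
      using that node_mono[OF N1, of i "Suc i"]
      by (intro adjacent_difference_le(2)[OF N1 r p f q b fq, of i i "node N i"]) auto
    have main: "\<bar>f x - poly P x\<bar> \<le> \<bar>f x - poly (q j) x\<bar> + S * K
        * H j" if j: "j < N" and x: "x \<in> {node N (Suc j)..node N j}" for j x
    proof -
      have x1: "x \<in> {-1..1}" by (rule cell_props(1)[OF N1 j x])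
      define t where "t = arccos x"
      have t: "t \<in> {0..pi}" "cos t = x" using x1 by (auto simp: t_def arccos_lbound arccos_ubound)
      note \<alpha>t = \<alpha>[rule_format, OF t(1), unfolded t(2)]
      have "\<bar>poly (q j) x - (\<Sum>k<N. poly (\<alpha> k) x * poly (q k) x)\<bar> \<le> S * K * H j"
        unfolding H_def
      proof (rule glued_difference_le[OF j nn(2), where m = "2 * r"])
        fix i assume i: "Suc i < N"
        show "\<bar>poly (q i) x - poly (q (Suc i)) x\<bar> \<le> K * (1 + \<bar>real i - real j\<bar>) ^ (2 * r) * A i"
          using adjacent_difference_le(1)[OF N1 r p f q b fq i j x] by (simp add: K_def A_def l_def)
      next
        have "(\<Sum>k<N. poly (\<alpha> k) x * (1 + \<bar>real k - real j\<bar>) ^ (2 * r + (2 * s + 2)))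
          \<le> 2 * (25 * (real M)\<^sup>2) ^ M * 2 ^ (2 * M) * 4"
        proof (rule partition_weight_le[OF N j x])
          fix k assume "k < N"
          thus "poly (\<alpha> k) x \<le> 2 * (25 * (real M)\<^sup>2) ^ M / (1 + real N * \<bar>arccos x - (real k
              + 1 / 2) * pi / real N\<bar>) ^ (2 * M)"
            using \<alpha>t by (simp add: t_def)
        qed (simp_all add: M_def)
        thus "(\<Sum>k<N. poly (\<alpha> k) x * (1 + \<bar>real k - real j\<bar>) ^ (2 * r + (2 * s + 2))) \<le> S"
          by (simp only: S_def)
      qed (use \<alpha>t A0 in auto)
      also have "(\<Sum>k<N. poly (\<alpha> k) x * poly (q k) x) = poly P x" by (simp add: P_def poly_sum)
      finally show ?thesis by linarith
    qed
    have [measurable]: "poly Q \<in> borel_measurable borel" for Q :: "real poly" by (rule poly_borel)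
    have "wint p N (\<lambda>x. f x - poly P x) \<le> (\<Sum>j<N. ennreal (D * w j) *
      lp_int p {node N (Suc j)..node N j} (\<lambda>x. f x - poly P x))"
      unfolding D_def w_def by (rule wint_le_cell_sum[OF N]) measurable
    also have "\<dots> \<le> (\<Sum>j<N. ennreal (D * w j) * ennreal (2 powr p * (b j + l j * (S * K * H j) powr p)))"
    proof (intro sum_mono mult_left_mono)
      fix j assume "j \<in> {..<N}"
      hence j: "j < N" by simp
      show "lp_int p {node N (Suc j)..node N j} (\<lambda>x. f x - poly P x)
          \<le> ennreal (2 powr p * (b j + l j * (S * K * H j) powr p))"
        unfolding l_def
      proof (rule cell_integral_le[OF _ _ _ _ b[OF j] _ fq[OF j] main[OF j]])
        show "0 \<le> p" "0 \<le> S * K * H j" using p nn H0 by simp_all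
        show "node N (Suc j) \<le> node N j" "node N j \<le> node N (j - 1)" using j by (auto intro!: node_mono N1)
      qed simp_all
    qed auto
    also have "\<dots> = (\<Sum>j<N. ennreal (D * w j * (2 powr p * (b j + l j * (S * K * H j) powr p))))"
      by (intro sum.cong refl ennreal_mult'[symmetric]) (use nn w in auto)
    also have "\<dots> = ennreal (\<Sum>j<N. D * w j * (2 powr p * (b j + l j * (S * K * H j) powr p)))"
      using nn w b node_mono[OF N1] by (intro sum_ennreal) (auto simp: l_def)
    also have "(\<Sum>j<N. D * w j * (2 powr p * (b j + l j * (S * K * H j) powr p)))
        = D * 2 powr p * ((\<Sum>j<N. w j * b j) + (S * K) powr p * (\<Sum>j<N. w j * l j * H j powr p))"
    proof -
      have "D * w j * (2 powr p * (b j + l j * (S * K * H j) powr p))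
          = D * 2 powr p * (w j * b j + (S * K) powr p * (w j * l j * H j powr p))" for j
        using nn H0[of j] by (simp add: powr_mult algebra_simps)
      thus ?thesis by (simp only: sum_distrib_left[symmetric] sum.distrib)
    qed
    also have "\<dots> \<le> D * 2 powr p * (C * \<Omega> + (S * K) powr p * (T * (2 powr p * ((1 + G) * (C * \<Omega>)))))"
    proof (intro mult_left_mono add_mono)
      show "(\<Sum>j<N. w j * b j) \<le> C * \<Omega>" using sum_b by (simp add: w_def)
      have "(\<Sum>j<N. w j * l j * H j powr p) \<le> T * (\<Sum>i<N - 1. w i * l i * A i powr p)"
        unfolding w_def l_def H_def T_def by (rule weighted_decay_sum_le[OF N p A0])
      also have "(\<Sum>i<N - 1. w i * l i * A i powr p) = 2 powr p * (\<Sum>i<N - 1. w i * (b i + b (Suc i)))"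
        unfolding sum_distrib_left
      proof (rule sum.cong)
        fix i assume "i \<in> {..<N - 1}"
        thus "w i * l i * A i powr p = 2 powr p * (w i * (b i + b (Suc i)))"
          using lA[of i] by (simp add: mult.assoc)
      qed simp
      also have "(\<Sum>i<N - 1. w i * (b i + b (Suc i))) \<le> (\<Sum>i<N - 1. w i * b i + G * (w (Suc i) * b (Suc i)))"
      proof (rule sum_mono)
        fix i assume "i \<in> {..<N - 1}"
        hence i: "i < N" "Suc i < N" by auto
        have "w i \<le> G * w (Suc i)"
          using aw_cell_length_le(2)[OF N i(2,1)] by (simp add: w_def G_def)
        hence "w i * b (Suc i) \<le> G * w (Suc i) * b (Suc i)" using b[OF i(2)] by (intro mult_right_mono)
        thus "w i * (b i + b (Suc i)) \<le> w i * b i + G * (w (Suc i) * b (Suc i))" by (simp add: algebra_simps)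
      qed
      also have "\<dots> = (\<Sum>i<N - 1. w i * b i) + G * (\<Sum>i<N - 1. w (Suc i) * b (Suc i))"
        by (simp add: sum.distrib sum_distrib_left)
      also have "\<dots> \<le> (\<Sum>i<N. w i * b i) + G * (\<Sum>i<N. w i * b i)"
      proof (intro add_mono mult_left_mono nn)
        show "(\<Sum>i<N - 1. w i * b i) \<le> (\<Sum>i<N. w i * b i)" using w b by (intro sum_mono2) auto
        have "(\<Sum>i<N - 1. w (Suc i) * b (Suc i)) = (\<Sum>i\<in>Suc ` {..<N - 1}. w i * b i)"
          by (simp add: sum.reindex)
        also have "\<dots> \<le> (\<Sum>i<N. w i * b i)" using w b by (intro sum_mono2) auto
        finally show "(\<Sum>i<N - 1. w (Suc i) * b (Suc i)) \<le> (\<Sum>i<N. w i * b i)" .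
      qed
      also have "\<dots> = (1 + G) * (\<Sum>i<N. w i * b i)" by (simp add: algebra_simps)
      also have "\<dots> \<le> (1 + G) * (C * \<Omega>)" using sum_b nn by (intro mult_left_mono) (auto simp: w_def)
      finally show "(\<Sum>j<N. w j * l j * H j powr p) \<le> T * (2 powr p * ((1 + G) * (C * \<Omega>)))"
        using nn by (simp add: mult_left_mono)
    qed (use nn in auto)
    also have "\<dots> = E * \<Omega>" by (simp add: E_def algebra_simps)
    finally have "wint p N (\<lambda>x. f x - poly P x) \<le> ennreal (E * \<Omega>)" by (simp add: ennreal_leI)
    with degP show "\<exists>P. degree P < N + r \<and> wint p N (\<lambda>x. f x - poly P x) \<le> ennreal (E * \<Omega>)" by blast
  qed
qed

theorem direct_estimate:
  assumes r: "1 \<le> r" and p: "1 < p"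
  shows "\<exists>C\<ge>0. \<forall>N f \<Omega>. 2 \<le> N \<longrightarrow> f \<in> borel_measurable borel \<longrightarrow>
    lp_int p {-1..1} f < \<infinity> \<longrightarrow> 0 < \<Omega> \<longrightarrow>
    smooth_bound p r N f \<Omega> \<longrightarrow>
    (\<exists>P. degree P < N + r \<and> wint p N (\<lambda>x. f x - poly P x) \<le> ennreal (C * \<Omega>))"
proof (cases "measure \<mu> {-1..1} = 0")
  case False
  hence "0 < measure \<mu> {-1..1}" by (simp add: order_less_le)
  thus ?thesis by (rule direct_estimate_pos[OF _ r p])
next
  case True
  \<comment> \<open>Without mass the weights vanish, so the division by them in
    \<open>local_approximation\<close> is impossible, but all weighted norms are 0.\<close>
  have "measure \<mu> {a..b} = 0" for a b
  proof -
    have "measure \<mu> {a..b} = measure \<mu> {max (-1) a..min 1 b}" by (rule measure_clip)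
    also have "\<dots> \<le> measure \<mu> {-1..1}" by (rule finite_measure_mono) (auto simp: sets_mu)
    finally show ?thesis using True by (simp add: measure_le_0_iff)
  qed
  hence "wint p N g = 0" for N g by (simp add: wint_def aw_def)
  thus ?thesis using r by (auto intro!: exI[of _ 0])
qed

end

section \<open>Weights and representatives\<close>

text \<open>The zero extension makes the mass outside [-1,1] vanish, so doubled intervals may stick
  out. The doubling constant is raised to at least 1, since it is iterated.\<close>

lemma doubling_weight_measure:
  assumes w: "doubling_weight w"
  obtains \<mu> s where "doubling_measure \<mu> s"
    "\<And>a b. measure \<mu> {a..b} = (LINT u:{a..b}|lebesgue. zero_ext w u)"
proof -
  define g where "g = zero_ext w"
  have g0: "0 \<le> g x" for x using w by (auto simp: g_def zero_ext_def doubling_weight_def)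
  have "g = (\<lambda>x. indicator {-1..1} x *\<^sub>R w x)" by (auto simp: g_def zero_ext_def fun_eq_iff)
  hence int: "integrable lebesgue g" using w by (simp add: doubling_weight_def set_integrable_def)
  hence [measurable]: "g \<in> borel_measurable lebesgue" by auto
  \<comment> \<open>The identity pushes the density forward from the Lebesgue to the Borel sets, on
    which the locale is based.\<close>
  define \<mu> where "\<mu> = distr (density lebesgue (\<lambda>x. ennreal (g x))) borel (\<lambda>x. x)"
  have sets: "sets \<mu> = sets borel" by (simp add: \<mu>_def)
  have id: "(\<lambda>x::real. x) \<in> density lebesgue (\<lambda>x. ennreal (g x)) \<rightarrow>\<^sub>M borel"
    by (simp add: measurable_completion)
  have em: "emeasure \<mu> A = (\<integral>\<^sup>+x. ennreal (g x) * indicator A x \<partial>lebesgue)" if A: "A \<in> sets borel" for A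
  proof -
    have Al: "A \<in> sets lebesgue" using A by (simp add: sets_completionI_sets)
    have "emeasure \<mu> A = emeasure (density lebesgue (\<lambda>x. ennreal (g x))) A"
      unfolding \<mu>_def using A by (subst emeasure_distr[OF id]) (auto simp: space_density)
    also have "\<dots> = (\<integral>\<^sup>+x. ennreal (g x) * indicator A x \<partial>lebesgue)"
      using Al by (intro emeasure_density) auto
    finally show ?thesis .
  qed
  have fin: "finite_measure \<mu>"
  proof
    have "emeasure \<mu> UNIV = (\<integral>\<^sup>+x. ennreal (g x) \<partial>lebesgue)" by (simp add: em)
    also have "\<dots> = ennreal (integral\<^sup>L lebesgue g)" using int g0 by (intro nn_integral_eq_integral) auto
    finally show "emeasure \<mu> (space \<mu>) \<noteq> \<infinity>" by (simp add: \<mu>_def)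
  qed
  have meas: "measure \<mu> {a..b} = (LINT u:{a..b}|lebesgue. zero_ext w u)" for a b
  proof -
    have i: "integrable lebesgue (\<lambda>x. indicator {a..b} x *\<^sub>R g x)" by (rule integrable_mult_indicator[OF _ int]) simp
    have "emeasure \<mu> {a..b} = (\<integral>\<^sup>+x. ennreal (indicator {a..b} x *\<^sub>R g x) \<partial>lebesgue)"
      by (subst em) (auto intro!: nn_integral_cong simp: indicator_def)
    also have "\<dots> = ennreal (LINT u:{a..b}|lebesgue. g u)"
      unfolding set_lebesgue_integral_def using i g0 by (intro nn_integral_eq_integral) auto
    finally show ?thesis
      unfolding measure_def g_def[symmetric] set_lebesgue_integral_def using g0 by simp
  qed
  have emfin: "emeasure \<mu> {a..b} < \<infinity>" for a b
    using finite_measure.emeasure_finite[OF fin] by (simp add: top.not_eq_extremum)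
  obtain L where L: "\<And>m l. 0 < l \<Longrightarrow> {m - l..m + l} \<subseteq> {-1..1} \<Longrightarrow>
      measure \<mu> {m - 2 * l..m + 2 * l} \<le> L * measure \<mu> {m - l..m + l}"
    using w unfolding doubling_weight_def meas by blast
  define L' where "L' = max L 1"
  have L': "1 \<le> L'" "0 < l \<Longrightarrow> {m - l..m + l} \<subseteq> {-1..1} \<Longrightarrow>
      measure \<mu> {m - 2 * l..m + 2 * l} \<le> L' * measure \<mu> {m - l..m + l}" for m l
  proof -
    show "1 \<le> L'" by (simp add: L'_def)
    assume "0 < l" "{m - l..m + l} \<subseteq> {-1..1}"
    hence "measure \<mu> {m - 2 * l..m + 2 * l} \<le> L * measure \<mu> {m - l..m + l}" by (rule L)
    also have "\<dots> \<le> L' * measure \<mu> {m - l..m + l}" by (intro mult_right_mono) (auto simp: L'_def)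
    finally show "measure \<mu> {m - 2 * l..m + 2 * l} \<le> L' * measure \<mu> {m - l..m + l}" .
  qed
  obtain s where s: "L' < (3 / 2) ^ s" using real_arch_pow[of "3 / 2" L'] by auto
  have "doubling_measure \<mu> s"
  proof (rule doubling_measure.intro)
    show "sets \<mu> = sets borel" by (rule sets)
    show "finite_measure \<mu>" by (rule fin)
    have "emeasure \<mu> (- {-1..1}) = (\<integral>\<^sup>+x. ennreal (g x) * indicator (- {-1..1}) x \<partial>lebesgue)" by (rule em) simp
    also have "\<dots> = (\<integral>\<^sup>+x. 0 \<partial>(lebesgue :: real measure))"
      by (intro nn_integral_cong) (auto simp: g_def zero_ext_def indicator_def)
    finally show "emeasure \<mu> (- {-1..1}) = 0" by simp
    fix a b c d :: real
    assume "a < b" "{a..b} \<subseteq> {c..d}" "{c..d} \<subseteq> {-1..1}"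
    thus "measure \<mu> {c..d} \<le> (3 / 2 * (d - c) / (b - a)) ^ s * measure \<mu> {a..b}"
      by - (rule interval_growth_power[OF emfin sets L'(1) _ less_imp_le[OF s]], rule L'(2), assumption+)
  qed
  from this meas show thesis by (rule that)
qed

text \<open>The exceptional set is returned as a Borel null set with equality off it, and not as an
  almost-everywhere statement, because differences evaluate f at shifted points and the set has to
  be pulled back along the shifts.\<close>

lemma in_Lp_borel_representative:
  assumes f: "in_Lp p f" and p: "0 < p"
  obtains g N where "g \<in> borel_measurable borel" "N \<in> null_sets lborel" "\<And>x. x \<in> {-1..1} \<Longrightarrow> x \<notin> N \<Longrightarrow> f x = g x"
    "lp_int p {-1..1} g < \<infinity>"
proof -
  have "(\<lambda>x. if x \<in> {-1..1} then f x else 0) \<in> borel_measurable lebesgue"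
    using f by (intro borel_measurable_if_I) (auto simp: in_Lp_def)
  from completion_ex_borel_measurable_real[OF this] obtain g where g: "g \<in> borel_measurable lborel"
    and ae: "AE x in lborel. (if x \<in> {-1..1} then f x else 0) = g x" by blast
  from ae obtain N where N: "{x \<in> space lborel. \<not> (if x \<in> {-1..1} then f x else 0) = g x} \<subseteq> N"
    "emeasure lborel N = 0" "N \<in> sets lborel" by (rule AE_E)
  have eq: "f x = g x" if "x \<in> {-1..1}" "x \<notin> N" for x using subsetD[OF N(1), of x] that by auto
  have "integrable (lebesgue_on {-1..1}) (\<lambda>x. \<bar>f x\<bar> powr p)" using f by (simp add: in_Lp_def)
  hence "(\<integral>\<^sup>+x. ennreal (norm (\<bar>f x\<bar> powr p)) \<partial>lebesgue_on {-1..1}) < \<infinity>"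
    by (simp add: integrable_iff_bounded)
  also have "(\<integral>\<^sup>+x. ennreal (norm (\<bar>f x\<bar> powr p)) \<partial>lebesgue_on {-1..1}) = lp_int p {-1..1} f"
    by (subst nn_integral_restrict_space) (simp_all add: nn_integral_completion)
  also have "\<dots> = lp_int p {-1..1} g"
    using ae by (intro nn_integral_cong_AE) (auto simp: indicator_def elim!: eventually_mono)
  finally show thesis using g N eq by (intro that[of g N]) (auto simp: null_sets_def)
qed

section \<open>From norms in [0,infinity] to integrals, and the equivalence\<close>

lemma ennpowr_le_iff:
  assumes "0 < p" "0 \<le> c"
  shows "ennpowr a (1 / p) \<le> ennreal c \<longleftrightarrow> a \<le> ennreal (c powr p)"
proof (cases a)
  case (real y)
  have "y powr (1 / p) \<le> c \<longleftrightarrow> y \<le> c powr p"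
  proof
    assume "y powr (1 / p) \<le> c"
    hence "(y powr (1 / p)) powr p \<le> c powr p" using assms by (intro powr_mono2) auto
    thus "y \<le> c powr p" using real assms by (simp add: powr_powr)
  next
    assume "y \<le> c powr p"
    hence "y powr (1 / p) \<le> (c powr p) powr (1 / p)" using assms real by (intro powr_mono2) auto
    thus "y powr (1 / p) \<le> c" using assms by (simp add: powr_powr)
  qed
  thus ?thesis using real assms by (simp add: ennpowr_def)
qed (use assms in \<open>simp add: ennpowr_def top_unique\<close>)

lemma enn_bigo_pos:
  assumes "enn_bigo a b" "\<And>n. 0 \<le> b n"
  obtains C n0 where "0 < C" "\<And>n. n0 \<le> n \<Longrightarrow> a n \<le> ennreal (C * b n)"
proof -
  obtain C n0 where C: "\<And>n. n0 \<le> n \<Longrightarrow> a n \<le> ennreal (C * b n)"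
    using assms(1) unfolding enn_bigo_def eventually_sequentially by blast
  have "a n \<le> ennreal (max C 1 * b n)" if "n0 \<le> n" for n
    using C[OF that] by (rule order_trans) (intro ennreal_leI mult_right_mono assms, simp)
  thus thesis by (intro that[of "max C 1" n0]) auto
qed

theorem corollary7p7:
  fixes w f :: "real \<Rightarrow> real" and r :: nat and p \<alpha> :: real
  assumes "doubling_weight w"
    and "1 \<le> r"
    and "1 < p"
    and "in_Lp p f"
    and "0 < \<alpha>"
    and "\<alpha> < real r - 1 / p"
  shows "enn_bigo (\<lambda>n. best_approx n f p (averaged_weight w n)) (\<lambda>n. real n powr (- \<alpha>))
     \<longleftrightarrow> enn_bigo (\<lambda>n. modulus r f (1 / real n) p (averaged_weight w n)) (\<lambda>n. real n powr (- \<alpha>))"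
proof -
  note r = assms(2) and p = assms(3)
  have p0: "0 < p" using p by simp
  have "0 < 1 / p" using p by simp
  hence \<alpha>: "0 < \<alpha>" "\<alpha> < real r" using assms(5,6) by linarith+
  obtain \<mu> s where "doubling_measure \<mu> s" and \<mu>: "\<And>a b. measure \<mu> {a..b} = (LINT u:{a..b}|lebesgue. zero_ext w u)"
    by (rule doubling_weight_measure[OF assms(1)]) blast
  then interpret doubling_measure \<mu> s by simp
  have aw: "averaged_weight w n = aw n" for n
    by (simp add: fun_eq_iff averaged_weight_def aw_def \<mu>)
  obtain g N where g[measurable]: "g \<in> borel_measurable borel" and N: "N \<in> null_sets lborel"
    and eq: "\<And>x. x \<in> {-1..1} \<Longrightarrow> x \<notin> N \<Longrightarrow> f x = g x"
    and fin: "lp_int p {-1..1} g < \<infinity>"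
    by (rule in_Lp_borel_representative[OF assms(4) p0]) blast
  \<comment> \<open>Comparing a norm with a real bound is comparing p-th powers, also when the norm
    is infinite. This is the only passage between the norms of f and the integrals of g.\<close>
  have norm_le: "wnorm p (averaged_weight w n) u \<le> ennreal c \<longleftrightarrow> wint p n v \<le> ennreal (c powr p)"
    if "AE x in lborel. x \<in> {-1..1} \<longrightarrow> u x = v x" "0 \<le> c" for n u v c
  proof -
    have "wint p n v = (\<integral>\<^sup>+x. ennreal (\<bar>u x\<bar> powr p * aw n x) * indicator {-1..1} x \<partial>lborel)"
      unfolding wint_def using that(1) by (intro nn_integral_cong_AE) (auto simp: indicator_def elim!:
          eventually_mono)
    thus ?thesis
      unfolding wnorm_def aw nn_integral_completion using ennpowr_le_iff[OF p0 that(2)] by simp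
  qed
  have approx_le: "wnorm p (averaged_weight w n) (\<lambda>x. f x - poly P x)
      \<le> ennreal c \<longleftrightarrow> wint p n (\<lambda>x. g x - poly P x) \<le> ennreal (c powr p)"
    if "0 \<le> c" for n P c
    using eq that AE_not_in[OF N] by (intro norm_le) (auto elim!: eventually_mono)
  have diff_le: "wnorm p (averaged_weight w n) (\<lambda>x. sym_diff r (h * phi x) f x)
      \<le> ennreal c \<longleftrightarrow> wint p n (\<lambda>x. sym_diff r (h * phi x) g x) \<le> ennreal (c powr p)"
    if "0 < h" "0 \<le> c" for n h c
    using that by (intro norm_le AE_sym_diff_eq[OF N eq _ r])
  have pw: "(C * real n powr - \<alpha>) powr p = C powr p * real n powr (- (\<alpha> * p))" if "0 \<le> C" for C n
    using that by (simp add: powr_mult powr_powr)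
  show ?thesis
  proof
    assume "enn_bigo (\<lambda>n. best_approx n f p (averaged_weight w n)) (\<lambda>n. real n powr (- \<alpha>))"
    then obtain C n0 where C: "0 < C" "\<And>n. n0 \<le> n \<Longrightarrow> best_approx n f p (averaged_weight w n)
        \<le> ennreal (C * real n powr (- \<alpha>))"
      by (rule enn_bigo_pos) auto
    have "\<exists>P. degree P < m \<and> wint p m (\<lambda>x. g x - poly P x) \<le> ennreal ((2 * C) powr p * real m powr (- (\<alpha> * p)))"
      if m: "max 1 n0 \<le> m" for m
    proof -
      have "best_approx m f p (averaged_weight w m) \<le> ennreal (C * real m powr (- \<alpha>))" using m by (intro C) simp
      \<comment> \<open>The infimum need not be attained; doubling the positive bound makes it
        strict, so that some polynomial lies below it. This uses m >= 1, as 0 has the power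
        0.\<close>
      also have "\<dots> < ennreal (2 * C * real m powr (- \<alpha>))" using C(1) m by (intro ennreal_lessI) auto
      finally obtain P where P: "degree P < m" "wnorm p (averaged_weight w m) (\<lambda>x.
          f x - poly P x) < ennreal (2 * C * real m powr (- \<alpha>))"
        unfolding best_approx_def INF_less_iff by blast
      have "wint p m (\<lambda>x. g x - poly P x) \<le> ennreal ((2 * C * real m powr (- \<alpha>)) powr p)"
        using approx_le[THEN iffD1, OF _ less_imp_le[OF P(2)]] C(1) by simp
      thus ?thesis using P(1) pw[of "2 * C" m] C(1) by auto
    qed
    hence "\<exists>D\<ge>0. \<exists>n1. \<forall>n\<ge>n1. \<forall>h. 0 < h \<longrightarrow> h \<le> 1 / real n \<longrightarrow>
        wint p n (\<lambda>x. sym_diff r (h * phi x) g x) \<le> ennreal (D * real n powr (- (\<alpha> * p)))"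
      using C(1) by (intro inverse_estimate[OF p r \<alpha> g, of "(2 * C) powr p" "max 1 n0"]) auto
    then obtain D n1 where D: "0 \<le> D" "\<forall>n\<ge>n1. \<forall>h. 0 < h \<longrightarrow> h \<le> 1 / real n \<longrightarrow>
        wint p n (\<lambda>x. sym_diff r (h * phi x) g x) \<le> ennreal (D * real n powr (- (\<alpha> * p)))"
      by (elim exE conjE) (rule that)
    have "modulus r f (1 / real n) p (averaged_weight w n) \<le> ennreal (D powr (1 / p)
        * real n powr (- \<alpha>))" if n: "n1 \<le> n" for n
      unfolding modulus_def
    proof (rule SUP_least)
      fix h assume "h \<in> {0<..1 / real n}"
      hence h: "0 < h" "h \<le> 1 / real n" by auto
      have "(D powr (1 / p) * real n powr (- \<alpha>)) powr p = D * real n powr (- (\<alpha> * p))"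
        using pw[of "D powr (1 / p)" n] D(1) p0 by (simp add: powr_powr)
      thus "wnorm p (averaged_weight w n) (\<lambda>x. sym_diff r (h * phi x) f x)
          \<le> ennreal (D powr (1 / p) * real n powr (- \<alpha>))"
        using D(2) n h by (subst diff_le) auto
    qed
    thus "enn_bigo (\<lambda>n. modulus r f (1 / real n) p (averaged_weight w n)) (\<lambda>n. real n powr (- \<alpha>))"
      unfolding enn_bigo_def eventually_sequentially by blast
  next
    assume "enn_bigo (\<lambda>n. modulus r f (1 / real n) p (averaged_weight w n)) (\<lambda>n. real n powr (- \<alpha>))"
    then obtain C n0 where C: "0 < C" "\<And>n. n0 \<le> n \<Longrightarrow> modulus r f (1 / real n) p (averaged_weight w n)
        \<le> ennreal (C * real n powr (- \<alpha>))"
      by (rule enn_bigo_pos) auto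
    from direct_estimate[OF r p] obtain E where E: "0 \<le> E" and direct: "\<forall>N f \<Omega>. 2 \<le> N \<longrightarrow> f \<in> borel_measurable borel \<longrightarrow>
      lp_int p {-1..1} f < \<infinity> \<longrightarrow> 0 < \<Omega> \<longrightarrow>
      smooth_bound p r N f \<Omega> \<longrightarrow>
      (\<exists>P. degree P < N + r \<and> wint p N (\<lambda>x. f x - poly P x) \<le> ennreal (E * \<Omega>))"
      by (elim exE conjE) (rule that)
    \<comment> \<open>The approximant built at scale N has degree below N + r, so n = N + r is used.
      As n <= (1 + r) N, the changes of weight and of rate are bounded factors.\<close>
    define A where "A = 1 + real r"
    define B where "B = (A\<^sup>2 * (E * C powr p)) powr (1 / p) * A powr \<alpha>"
    have A: "1 \<le> A" by (simp add: A_def)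
    have "best_approx n f p (averaged_weight w n) \<le> ennreal (B * real n powr (- \<alpha>))" if n: "max 2 n0 + r \<le> n" for n
    proof -
      define N where "N = n - r"
      have N: "2 \<le> N" "n0 \<le> N" "n = N + r" using n by (auto simp: N_def)
      have nA: "real n \<le> A * real N"
      proof -
        have "real r * 1 \<le> real r * real N" using N(1) by (intro mult_left_mono) auto
        thus ?thesis by (simp add: N(3) A_def distrib_right)
      qed
      define \<Omega> where "\<Omega> = C powr p * real N powr (- (\<alpha> * p))"
      have \<Omega>: "0 < \<Omega>" using C(1) N(1) by (simp add: \<Omega>_def)
      have wb: "smooth_bound p r N g \<Omega>"
      proof (intro allI impI)
        fix h :: real assume h: "0 < h" "h \<le> 1 / real N"
        have "wnorm p (averaged_weight w N) (\<lambda>x. sym_diff r (h * phi x) f x)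
            \<le> modulus r f (1 / real N) p (averaged_weight w N)"
          unfolding modulus_def using h by (intro SUP_upper) auto
        also have "\<dots> \<le> ennreal (C * real N powr (- \<alpha>))" by (rule C(2)[OF N(2)])
        finally show "wint p N (\<lambda>x. sym_diff r (h * phi x) g x) \<le> ennreal \<Omega>"
          using h C(1) pw[of C N] by (subst (asm) diff_le) (auto simp: \<Omega>_def)
      qed
      from direct[THEN spec, THEN spec, THEN spec, THEN mp, OF N(1), THEN mp, OF g, THEN mp, OF fin, THEN mp, OF
          \<Omega>, THEN mp, OF wb]
      obtain P where P: "degree P < N + r" "wint p N (\<lambda>x. g x - poly P x) \<le> ennreal (E * \<Omega>)" by blast
      have [measurable]: "poly P \<in> borel_measurable borel" by (rule poly_borel)
      have "wint p n (\<lambda>x. g x - poly P x) \<le> ennreal (A\<^sup>2) * wint p N (\<lambda>x. g x - poly P x)"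
        using N nA A by (intro wint_scale) auto
      also have "\<dots> \<le> ennreal (A\<^sup>2) * ennreal (E * \<Omega>)" by (intro mult_left_mono P) auto
      also have "\<dots> = ennreal (A\<^sup>2 * (E * C powr p) * real N powr (- (\<alpha> * p)))"
        using E \<Omega> by (simp add: \<Omega>_def ennreal_mult[symmetric] mult_ac)
      also have "\<dots> \<le> ennreal (A\<^sup>2 * (E * C powr p) * (A powr (\<alpha> * p) * real n powr (- (\<alpha> * p))))"
      proof (intro ennreal_leI mult_left_mono)
        have "real n powr (\<alpha> * p) \<le> (A * real N) powr (\<alpha> * p)"
          using nA \<alpha> p0 by (intro powr_mono2) auto
        also have "\<dots> = A powr (\<alpha> * p) * real N powr (\<alpha> * p)" using A by (simp add: powr_mult)
        finally show "real N powr (- (\<alpha> * p)) \<le> A powr (\<alpha> * p) * real n powr (- (\<alpha> * p))"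
          using N by (simp add: powr_minus field_simps)
      qed (use E in simp)
      also have "A\<^sup>2 * (E * C powr p) * (A powr (\<alpha> * p) * real n powr (- (\<alpha> * p))) = (B * real n powr (- \<alpha>)) powr p"
        using A E C(1) p0 by (simp add: B_def powr_mult powr_powr)
      finally have "wnorm p (averaged_weight w n) (\<lambda>x. f x - poly P x) \<le> ennreal (B * real n powr (- \<alpha>))"
        by (subst approx_le) (auto simp: B_def)
      moreover have "best_approx n f p (averaged_weight w n) \<le> wnorm p (averaged_weight w n) (\<lambda>x. f x - poly P x)"
        unfolding best_approx_def using P(1) N(3) by (intro INF_lower) simp
      ultimately show ?thesis by (rule order_trans[rotated])
    qed
    thus "enn_bigo (\<lambda>n. best_approx n f p (averaged_weight w n)) (\<lambda>n. real n powr (- \<alpha>))"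
      unfolding enn_bigo_def eventually_sequentially by blast
  qed
qed

end
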